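(* Let $(M,F)$ be a forward complete Finsler manifold and let $p\in(1,\infty)$. Given $(\mu_t)\in\mathsf{AC}^p([0,1];\mathscr{P}_p(M))$, there exist two vector fields $\mathbf{v}^+\in L^p(\bar\mu;TM_+)$ and $\mathbf{v}^-\in L^p(\bar\mu;TM_-)$ such that both $(\mu_t,\mathbf{v}^+)$ and $(\mu_t,\mathbf{v}^-)$ satisfy the continuity equation $\partial_t\mu_t+\mathrm{div}(\mathbf{v}_t\mu_t)=0$, and $$\|\mathbf{v}^+_t\|_{L^p(\mu_t;M_+)}\le|\mu'_+|_p(t),\qquad \|\mathbf{v}^-_t\|_{L^p(\mu_t;M_-)}\le|\mu'_-|_p(t)$$ for $\mathscr{L}^1$-a.e. $t\in(0,1)$.
   Context: A Finsler manifold $(M,F)$ is a connected smooth manifold $M$ without boundary of dimension $n\ge 2$ with a continuous function $F:TM\to[0,\infty)$ such that (a) $F\in C^\infty(TM\setminus\{0\})$; (b) $F(x,\lambda y)=\lambda F(x,y)$ for all $\lambda\ge 0$; (c) the matrix $g_{ij}(x,y)=[\frac12F^2]_{y^iy^j}(x,y)$ is positive definite for $y\neq 0$. $F(x,-y)=F(x,y)$ is not assumed. The (generally non-symmetric) distance is $d_F(p,q)=\inf\int_0^1F(\gamma'(t))\,dt$ over piecewise smooth curves from $p$ to $q$; $\hat d_F(x,y)=\frac12[d_F(x,y)+d_F(y,x)]$. $(M,F)$ is forward complete if every forward Cauchy sequence (for each $\epsilon>0$ there is $N$ with $d_F(x_m,x_n)<\epsilon$ whenever $n\ge m>N$) converges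 in $M$. $\mathscr{P}(X)$ denotes Borel probability measures on $X$. With $\star\in M$ any fixed point, $\mathscr{P}_p(M)=\{\mu\in\mathscr{P}(M):\int_M\hat d_F(\star,x)^p\,d\mu(x)<\infty\}$ and $W_p(\mu,\nu)=\inf_\pi(\int_{M\times M}d_F(x,y)^p\,d\pi(x,y))^{1/p}$, the infimum over $\pi\in\mathscr{P}(M\times M)$ with first marginal $\mu$ and second marginal $\nu$. $\mathsf{AC}^p([0,1];\mathscr{P}_p(M))$ is the class of maps $t\mapsto\mu_t$ for which there is a nonnegative $f\in L^p([0,1])$ with $W_p(\mu_{t_1},\mu_{t_2})\le\int_{t_1}^{t_2}f$ and $W_p(\mu_{t_2},\mu_{t_1})\le\int_{t_1}^{t_2}f$ for all $0\le t_1\le t_2\le1$. Such curves are narrowly continuous, and the metric derivatives $|\mu'_+|_p(t)=\lim_{s\to t}\frac{W_p(\mu_{\min\{s,t\}},\mu_{\max\{s,t\}})}{|t-s|}$, $|\mu'_-|_p(t)=\lim_{s\to t}\frac{W_p(\mu_{\max\{s,t\}},\mu_{\min\{s,t\}})}{|t-s|}$ exist for $\mathscr{L}^1$-a.e. $t\in(0,1)$ ($\mathscr{L}^1$ is Lebesgue measure). $\bar\mu\in\mathscr{P}([0,1]\times M)$ is the measure associated to $(\mu_t)$: $\int\varphi\,d\bar\mu=\int_0^1\int_M\varphi(t,x)\,d\mu_t(x)\,dt$ for all bounded Borel $\varphi:[0,1]\times M\to\mathbb{R}$. A time-dependent Borel vector field $\mathbf{v}:[0,1]\times M\to TM$ belongs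 to $L^p(\bar\mu;TM_+)$ (resp. $L^p(\bar\mu;TM_-)$) if $\mathbf{v}_t(x)\in T_xM$ for $\bar\mu$-a.e. $(t,x)$ and $\int F^p(\mathbf{v}_t(x))\,d\bar\mu<\infty$ (resp. $\int F^p(-\mathbf{v}_t(x))\,d\bar\mu<\infty$). Also $\|\mathbf{w}\|_{L^p(\mu_t;M_+)}=(\int_MF^p(\mathbf{w})\,d\mu_t)^{1/p}$ and $\|\mathbf{w}\|_{L^p(\mu_t;M_-)}=(\int_MF^p(-\mathbf{w})\,d\mu_t)^{1/p}$. $(\mu_t,\mathbf{v})$ satisfies the continuity equation $\partial_t\mu_t+\mathrm{div}(\mathbf{v}_t\mu_t)=0$ if for every $\phi\in C^1_0(M)$ ($C^1$-functions with compact support) one has $\frac{d}{dt}\int_M\phi\,d\mu_t=\int_M\langle\mathbf{v}_t,d\phi\rangle\,d\mu_t$ in the sense of distributions on $(0,1)$. *)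

theory Defs
  imports "HOL-Probability.Probability"
begin

section \<open>Smooth manifolds\<close>

text \<open>On an open subset of a finite-dimensional space this is the usual class \<open>C\<^sup>k\<close>: the iterated
  directional derivatives of order less than \<open>k\<close> are differentiable, and those of order \<open>k\<close> are
  continuous.\<close>

primrec Ck_on ::
  "nat \<Rightarrow> 'a::real_normed_vector set \<Rightarrow> ('a \<Rightarrow> 'b::real_normed_vector) \<Rightarrow> bool" where
  "Ck_on 0 S f \<longleftrightarrow> continuous_on S f"
| "Ck_on (Suc k) S f \<longleftrightarrow>
     (\<forall>x\<in>S. f differentiable (at x)) \<and> (\<forall>v. Ck_on k S (\<lambda>x. frechet_derivative f (at x) v))"

definition smooth_on :: "'a::real_normed_vector set \<Rightarrow> ('a \<Rightarrow> 'b::real_normed_vector) \<Rightarrow> bool" where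
  "smooth_on S f \<longleftrightarrow> (\<forall>k. Ck_on k S f)"

text \<open>A chart is its domain together with its coordinate map, whose values off the domain are
  irrelevant. The manifold is the whole type \<open>'a\<close>; an atlas need not be maximal.\<close>

type_synonym ('a, 'n) chart = "'a set \<times> ('a \<Rightarrow> real ^ 'n)"

definition chart_inv :: "('a, 'n::finite) chart \<Rightarrow> real ^ 'n \<Rightarrow> 'a" where
  "chart_inv c = inv_into (fst c) (snd c)"

definition is_chart :: "('a::topological_space, 'n::finite) chart \<Rightarrow> bool" where
  "is_chart c \<longleftrightarrow> open (fst c) \<and> open (snd c ` fst c) \<and>
     homeomorphism (fst c) (snd c ` fst c) (snd c) (chart_inv c)"

definition charts_at :: "('a, 'n::finite) chart set \<Rightarrow> 'a \<Rightarrow> ('a, 'n) chart set" where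
  "charts_at A x = {c \<in> A. x \<in> fst c}"

definition smooth_atlas :: "('a::topological_space, 'n::finite) chart set \<Rightarrow> bool" where
  "smooth_atlas A \<longleftrightarrow>
     (\<forall>c\<in>A. is_chart c) \<and>
     (\<forall>x. charts_at A x \<noteq> {}) \<and>
     (\<forall>c\<in>A. \<forall>c'\<in>A. smooth_on (snd c ` (fst c \<inter> fst c')) (snd c' \<circ> chart_inv c))"

definition Ck_function ::
  "nat \<Rightarrow> ('a, 'n::finite) chart set \<Rightarrow> ('a \<Rightarrow> real) \<Rightarrow> bool" where
  "Ck_function k A \<phi> \<longleftrightarrow> (\<forall>c\<in>A. Ck_on k (snd c ` fst c) (\<phi> \<circ> chart_inv c))"


section \<open>The tangent bundle\<close>

text \<open>A tangent vector at \<open>x\<close> is a pair \<open>(x, w)\<close>, where \<open>w\<close> assigns to each chart around \<open>x\<close> the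
  components of the vector in that chart, subject to the contravariant transformation rule; \<open>w\<close> is
  normalised to \<open>0\<close> at all other arguments, so that equality of tangent vectors is equality of
  pairs.\<close>

type_synonym ('a, 'n) tvec = "'a \<times> (('a, 'n) chart \<Rightarrow> real ^ 'n)"

definition transition_deriv ::
  "('a, 'n::finite) chart \<Rightarrow> ('a, 'n) chart \<Rightarrow> 'a \<Rightarrow> real ^ 'n \<Rightarrow> real ^ 'n" where
  "transition_deriv c c' x = frechet_derivative (snd c' \<circ> chart_inv c) (at (snd c x))"

definition tangent_bundle :: "('a, 'n::finite) chart set \<Rightarrow> ('a, 'n) tvec set" where
  "tangent_bundle A = {(x, w).
     (\<forall>c. c \<notin> charts_at A x \<longrightarrow> w c = 0) \<and>
     (\<forall>c\<in>charts_at A x. \<forall>c'\<in>charts_at A x. w c' = transition_deriv c c' x (w c))}"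

definition tangent_space :: "('a, 'n::finite) chart set \<Rightarrow> 'a \<Rightarrow> ('a, 'n) tvec set" where
  "tangent_space A x = {w \<in> tangent_bundle A. fst w = x}"

definition tscale :: "real \<Rightarrow> ('a, 'n::finite) tvec \<Rightarrow> ('a, 'n) tvec" where
  "tscale r w = (fst w, \<lambda>c. r *\<^sub>R snd w c)"

definition tneg :: "('a, 'n::finite) tvec \<Rightarrow> ('a, 'n) tvec" where
  "tneg w = (fst w, \<lambda>c. - snd w c)"

text \<open>The tangent vector at \<open>x\<close> whose components in the chart \<open>c\<close> are \<open>y\<close>.\<close>

definition tangent_of ::
  "('a, 'n::finite) chart set \<Rightarrow> ('a, 'n) chart \<Rightarrow> 'a \<Rightarrow> real ^ 'n \<Rightarrow> ('a, 'n) tvec" where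
  "tangent_of A c x y = (x, \<lambda>c'. if c' \<in> charts_at A x then transition_deriv c c' x y else 0)"

lemma tangent_of_coordinates:
  assumes "w \<in> tangent_bundle A" "c \<in> charts_at A (fst w)"
  shows "tangent_of A c (fst w) (snd w c) = w"
proof (rule prod_eqI)
  show "snd (tangent_of A c (fst w) (snd w c)) = snd w"
  proof
    fix c'
    show "snd (tangent_of A c (fst w) (snd w c)) c' = snd w c'"
    proof (cases "c' \<in> charts_at A (fst w)")
      case True
      then have "snd w c' = transition_deriv c c' (fst w) (snd w c)"
        using assms unfolding tangent_bundle_def mem_Collect_eq case_prod_beta by blast
      with True show ?thesis unfolding tangent_of_def snd_conv by (simp only: if_True)
    next
      case False
      then have "snd w c' = 0"
        using assms(1) unfolding tangent_bundle_def mem_Collect_eq case_prod_beta by blast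
      with False show ?thesis unfolding tangent_of_def snd_conv by (simp only: if_False)
    qed
  qed
qed (simp add: tangent_of_def)

text \<open>The bundle topology: for a smooth atlas \<open>A\<close> and \<open>c \<in> A\<close>, the maps \<open>(z, y) \<mapsto> tangent_of A c (chart_inv c z) y\<close>
  are homeomorphisms from \<open>snd c ` fst c \<times> \<real>\<^sup>n\<close> onto open sets.\<close>

definition tangent_topology ::
  "('a, 'n::finite) chart set \<Rightarrow> ('a, 'n) tvec topology" where
  "tangent_topology A = topology (\<lambda>S. S \<subseteq> tangent_bundle A \<and>
     (\<forall>c\<in>A. open {(z, y). z \<in> snd c ` fst c \<and> tangent_of A c (chart_inv c z) y \<in> S}))"

lemma openin_tangent_topology:
  "openin (tangent_topology A) S \<longleftrightarrow> S \<subseteq> tangent_bundle A \<and>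
     (\<forall>c\<in>A. open {(z, y). z \<in> snd c ` fst c \<and> tangent_of A c (chart_inv c z) y \<in> S})"
proof -
  let ?P = "\<lambda>c S. {(z, y). z \<in> snd c ` fst c \<and> tangent_of A c (chart_inv c z) y \<in> S}"
  let ?L = "\<lambda>S. S \<subseteq> tangent_bundle A \<and> (\<forall>c\<in>A. open (?P c S))"
  have "istopology ?L"
    unfolding istopology_def
  proof (intro conjI allI impI)
    fix S T assume S: "?L S" and T: "?L T"
    show "S \<inter> T \<subseteq> tangent_bundle A" using S by blast
    show "\<forall>c\<in>A. open (?P c (S \<inter> T))"
    proof
      fix c assume c: "c \<in> A"
      have "?P c (S \<inter> T) = ?P c S \<inter> ?P c T" by blast
      moreover have "open (?P c S \<inter> ?P c T)"
      proof (rule open_Int)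
        show "open (?P c S)" using S c by blast
        show "open (?P c T)" using T c by blast
      qed
      ultimately show "open (?P c (S \<inter> T))" by (rule ssubst)
    qed
  next
    fix K assume K: "\<forall>S\<in>K. ?L S"
    show "\<Union>K \<subseteq> tangent_bundle A" using K by blast
    show "\<forall>c\<in>A. open (?P c (\<Union>K))"
    proof
      fix c assume c: "c \<in> A"
      have "?P c (\<Union>K) = (\<Union>S\<in>K. ?P c S)" by blast
      moreover have "open (\<Union>S\<in>K. ?P c S)"
      proof (rule open_UN, rule ballI)
        fix S assume "S \<in> K"
        then show "open (?P c S)" using K c by blast
      qed
      ultimately show "open (?P c (\<Union>K))" by (rule ssubst)
    qed
  qed
  then have "openin (topology ?L) = ?L" by (rule topology_inverse')
  then show ?thesis
    unfolding tangent_topology_def by (rule fun_cong)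
qed

definition tangent_borel :: "('a, 'n::finite) chart set \<Rightarrow> ('a, 'n) tvec measure" where
  "tangent_borel A = sigma (tangent_bundle A) {S. openin (tangent_topology A) S}"

text \<open>\<open>\<langle>w, d\<phi>\<rangle>\<close>; the value does not depend on the chart.\<close>

definition pairing ::
  "('a, 'n::finite) chart set \<Rightarrow> ('a, 'n) tvec \<Rightarrow> ('a \<Rightarrow> real) \<Rightarrow> real" where
  "pairing A w \<phi> = (let c = (SOME c. c \<in> charts_at A (fst w)) in
     frechet_derivative (\<phi> \<circ> chart_inv c) (at (snd c (fst w))) (snd w c))"


section \<open>Finsler manifolds\<close>

definition fundamental_tensor ::
  "('a, 'n::finite) chart set \<Rightarrow> (('a, 'n) tvec \<Rightarrow> real) \<Rightarrow> ('a, 'n) chart \<Rightarrow> 'a \<Rightarrow> real ^ 'n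
    \<Rightarrow> real ^ 'n ^ 'n" where
  "fundamental_tensor A F c x y =
     (let E = (\<lambda>u. (F (tangent_of A c x u))\<^sup>2 / 2) in
      \<chi> i j. frechet_derivative (\<lambda>u. frechet_derivative E (at u) (axis i 1)) (at y) (axis j 1))"

text \<open>Hausdorff and second countable are part of the type of points; the values of \<open>F\<close> outside
  \<open>tangent_bundle A\<close> are irrelevant.\<close>

definition finsler_manifold ::
  "('a::{t2_space, second_countable_topology}, 'n::finite) chart set
    \<Rightarrow> (('a, 'n) tvec \<Rightarrow> real) \<Rightarrow> bool" where
  "finsler_manifold A F \<longleftrightarrow>
     smooth_atlas A \<and> connected (UNIV :: 'a set) \<and> 2 \<le> CARD('n) \<and>
     (\<forall>w\<in>tangent_bundle A. 0 \<le> F w) \<and>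
     continuous_map (tangent_topology A) euclideanreal F \<and>
     (\<forall>c\<in>A. smooth_on (snd c ` fst c \<times> (UNIV - {0}))
        (\<lambda>(z, y). F (tangent_of A c (chart_inv c z) y))) \<and>
     (\<forall>w\<in>tangent_bundle A. \<forall>r\<ge>0. F (tscale r w) = r * F w) \<and>
     (\<forall>c\<in>A. \<forall>x\<in>fst c. \<forall>y. y \<noteq> 0 \<longrightarrow>
        (\<forall>u. u \<noteq> 0 \<longrightarrow> 0 < u \<bullet> (fundamental_tensor A F c x y *v u)))"

text \<open>Smoothness on a closed interval, up to and including the end points: locally the
  coordinate representation extends to a smooth map on an open interval.\<close>

definition smooth_curve_on ::
  "('a, 'n::finite) chart set \<Rightarrow> real set \<Rightarrow> (real \<Rightarrow> 'a) \<Rightarrow> bool" where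
  "smooth_curve_on A I \<gamma> \<longleftrightarrow> (\<forall>t\<in>I. \<forall>c\<in>charts_at A (\<gamma> t). \<exists>e>0. \<exists>h. smooth_on {t - e<..<t + e} h \<and>
     (\<forall>s\<in>I \<inter> {t - e<..<t + e}. \<gamma> s \<in> fst c \<and> snd c (\<gamma> s) = h s))"

definition piecewise_smooth_curve ::
  "('a::topological_space, 'n::finite) chart set \<Rightarrow> (real \<Rightarrow> 'a) \<Rightarrow> bool" where
  "piecewise_smooth_curve A \<gamma> \<longleftrightarrow> continuous_on {0..1} \<gamma> \<and>
     (\<exists>(N::nat) \<tau>. \<tau> 0 = 0 \<and> \<tau> N = 1 \<and>
        (\<forall>i<N. \<tau> i < \<tau> (Suc i) \<and> smooth_curve_on A {\<tau> i..\<tau> (Suc i)} \<gamma>))"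

text \<open>At the finitely many break points (and at \<open>0\<close>, \<open>1\<close>) the value is irrelevant.\<close>

definition velocity ::
  "('a, 'n::finite) chart set \<Rightarrow> (real \<Rightarrow> 'a) \<Rightarrow> real \<Rightarrow> ('a, 'n) tvec" where
  "velocity A \<gamma> t = (\<gamma> t, \<lambda>c. if c \<in> charts_at A (\<gamma> t)
     then vector_derivative (\<lambda>s. snd c (\<gamma> s)) (at t) else 0)"

definition finsler_dist ::
  "('a::topological_space, 'n::finite) chart set \<Rightarrow> (('a, 'n) tvec \<Rightarrow> real) \<Rightarrow> 'a \<Rightarrow> 'a \<Rightarrow> real" where
  "finsler_dist A F x y = Inf {integral {0..1} (\<lambda>t. F (velocity A \<gamma> t)) | \<gamma>.
     piecewise_smooth_curve A \<gamma> \<and> \<gamma> 0 = x \<and> \<gamma> 1 = y}"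

definition sym_dist ::
  "('a::topological_space, 'n::finite) chart set \<Rightarrow> (('a, 'n) tvec \<Rightarrow> real) \<Rightarrow> 'a \<Rightarrow> 'a \<Rightarrow> real" where
  "sym_dist A F x y = (finsler_dist A F x y + finsler_dist A F y x) / 2"

definition forward_complete ::
  "('a::topological_space, 'n::finite) chart set \<Rightarrow> (('a, 'n) tvec \<Rightarrow> real) \<Rightarrow> bool" where
  "forward_complete A F \<longleftrightarrow> (\<forall>\<sigma> :: nat \<Rightarrow> 'a.
     (\<forall>e>0. \<exists>N. \<forall>m n. N < m \<and> m \<le> n \<longrightarrow> finsler_dist A F (\<sigma> m) (\<sigma> n) < e) \<longrightarrow>
     (\<exists>x. \<sigma> \<longlonglongrightarrow> x))"


section \<open>Wasserstein spaces and absolutely continuous curves\<close>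

definition ennreal_powr :: "ennreal \<Rightarrow> real \<Rightarrow> ennreal" where
  "ennreal_powr a r = (if a = \<infinity> then \<infinity> else ennreal (enn2real a powr r))"

definition borel_probs :: "'a::topological_space measure set" where
  "borel_probs = {\<mu>. prob_space \<mu> \<and> sets \<mu> = sets borel}"

definition wasserstein_space ::
  "('a::topological_space, 'n::finite) chart set \<Rightarrow> (('a, 'n) tvec \<Rightarrow> real) \<Rightarrow> real \<Rightarrow> 'a
    \<Rightarrow> 'a measure set" where
  "wasserstein_space A F p star =
     {\<mu> \<in> borel_probs. (\<integral>\<^sup>+ x. ennreal (sym_dist A F star x powr p) \<partial>\<mu>) < \<infinity>}"

definition couplings ::
  "'a::topological_space measure \<Rightarrow> 'a measure \<Rightarrow> ('a \<times> 'a) measure set" where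
  "couplings \<mu> \<nu> = {\<pi> \<in> borel_probs. distr \<pi> borel fst = \<mu> \<and> distr \<pi> borel snd = \<nu>}"

definition wasserstein ::
  "('a::topological_space, 'n::finite) chart set \<Rightarrow> (('a, 'n) tvec \<Rightarrow> real) \<Rightarrow> real
    \<Rightarrow> 'a measure \<Rightarrow> 'a measure \<Rightarrow> ennreal" where
  "wasserstein A F p \<mu> \<nu> = (INF \<pi>\<in>couplings \<mu> \<nu>.
     ennreal_powr (\<integral>\<^sup>+ (x, y). ennreal (finsler_dist A F x y powr p) \<partial>\<pi>) (1 / p))"

text \<open>Curves are functions on \<open>real\<close>, of which only the restriction to \<open>[0, 1]\<close> matters.\<close>

definition AC_curves ::
  "('a::topological_space, 'n::finite) chart set \<Rightarrow> (('a, 'n) tvec \<Rightarrow> real) \<Rightarrow> real \<Rightarrow> 'a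
    \<Rightarrow> (real \<Rightarrow> 'a measure) set" where
  "AC_curves A F p star = {\<mu>.
     (\<forall>t\<in>{0..1}. \<mu> t \<in> wasserstein_space A F p star) \<and>
     (\<exists>f. f \<in> borel_measurable (lebesgue_on {0..1}) \<and> (\<forall>t\<in>{0..1}. 0 \<le> f t) \<and>
        (\<integral>\<^sup>+ t\<in>{0..1}. ennreal (f t powr p) \<partial>lebesgue) < \<infinity> \<and>
        (\<forall>t1 t2. 0 \<le> t1 \<and> t1 \<le> t2 \<and> t2 \<le> 1 \<longrightarrow>
           wasserstein A F p (\<mu> t1) (\<mu> t2) \<le> (\<integral>\<^sup>+ t\<in>{t1..t2}. ennreal (f t) \<partial>lebesgue) \<and>
           wasserstein A F p (\<mu> t2) (\<mu> t1) \<le> (\<integral>\<^sup>+ t\<in>{t1..t2}. ennreal (f t) \<partial>lebesgue)))}"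

definition metric_deriv_plus ::
  "('a::topological_space, 'n::finite) chart set \<Rightarrow> (('a, 'n) tvec \<Rightarrow> real) \<Rightarrow> real
    \<Rightarrow> (real \<Rightarrow> 'a measure) \<Rightarrow> real \<Rightarrow> ennreal" where
  "metric_deriv_plus A F p \<mu> t =
     Lim (at t) (\<lambda>s. wasserstein A F p (\<mu> (min s t)) (\<mu> (max s t)) / ennreal \<bar>t - s\<bar>)"

definition metric_deriv_minus ::
  "('a::topological_space, 'n::finite) chart set \<Rightarrow> (('a, 'n) tvec \<Rightarrow> real) \<Rightarrow> real
    \<Rightarrow> (real \<Rightarrow> 'a measure) \<Rightarrow> real \<Rightarrow> ennreal" where
  "metric_deriv_minus A F p \<mu> t =
     Lim (at t) (\<lambda>s. wasserstein A F p (\<mu> (max s t)) (\<mu> (min s t)) / ennreal \<bar>t - s\<bar>)"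


section \<open>Vector fields along a curve and the continuity equation\<close>

definition time_space_borel :: "(real \<times> 'a::topological_space) measure" where
  "time_space_borel = restrict_space borel ({0..1} \<times> UNIV)"

definition associated_measure ::
  "(real \<Rightarrow> 'a::topological_space measure) \<Rightarrow> (real \<times> 'a) measure" where
  "associated_measure \<mu> = (THE m. prob_space m \<and> sets m = sets time_space_borel \<and>
     (\<forall>\<phi> \<in> borel_measurable time_space_borel. bounded (\<phi> ` ({0..1} \<times> UNIV)) \<longrightarrow>
        (LINT z|m. \<phi> z) = (LINT t:{0..1}|lborel. (LINT x|\<mu> t. \<phi> (t, x) :: real))))"

definition vector_fields_along ::
  "('a::topological_space, 'n::finite) chart set \<Rightarrow> (real \<Rightarrow> 'a measure)
    \<Rightarrow> (real \<times> 'a \<Rightarrow> ('a, 'n) tvec) set" where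
  "vector_fields_along A \<mu> = {v \<in> measurable time_space_borel (tangent_borel A).
     AE (t, x) in associated_measure \<mu>. v (t, x) \<in> tangent_space A x}"

definition Lp_fields_plus ::
  "('a::topological_space, 'n::finite) chart set \<Rightarrow> (('a, 'n) tvec \<Rightarrow> real) \<Rightarrow> real
    \<Rightarrow> (real \<Rightarrow> 'a measure) \<Rightarrow> (real \<times> 'a \<Rightarrow> ('a, 'n) tvec) set" where
  "Lp_fields_plus A F p \<mu> = {v \<in> vector_fields_along A \<mu>.
     (\<integral>\<^sup>+ z. ennreal (F (v z) powr p) \<partial>associated_measure \<mu>) < \<infinity>}"

definition Lp_fields_minus ::
  "('a::topological_space, 'n::finite) chart set \<Rightarrow> (('a, 'n) tvec \<Rightarrow> real) \<Rightarrow> real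
    \<Rightarrow> (real \<Rightarrow> 'a measure) \<Rightarrow> (real \<times> 'a \<Rightarrow> ('a, 'n) tvec) set" where
  "Lp_fields_minus A F p \<mu> = {v \<in> vector_fields_along A \<mu>.
     (\<integral>\<^sup>+ z. ennreal (F (tneg (v z)) powr p) \<partial>associated_measure \<mu>) < \<infinity>}"

definition Lp_norm_plus ::
  "(('a, 'n::finite) tvec \<Rightarrow> real) \<Rightarrow> real \<Rightarrow> 'a measure \<Rightarrow> ('a \<Rightarrow> ('a, 'n) tvec) \<Rightarrow> ennreal" where
  "Lp_norm_plus F p \<mu> w = ennreal_powr (\<integral>\<^sup>+ x. ennreal (F (w x) powr p) \<partial>\<mu>) (1 / p)"

definition Lp_norm_minus ::
  "(('a, 'n::finite) tvec \<Rightarrow> real) \<Rightarrow> real \<Rightarrow> 'a measure \<Rightarrow> ('a \<Rightarrow> ('a, 'n) tvec) \<Rightarrow> ennreal" where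
  "Lp_norm_minus F p \<mu> w = ennreal_powr (\<integral>\<^sup>+ x. ennreal (F (tneg (w x)) powr p) \<partial>\<mu>) (1 / p)"

definition test_functions :: "('a::topological_space, 'n::finite) chart set \<Rightarrow> ('a \<Rightarrow> real) set" where
  "test_functions A = {\<phi>. Ck_function 1 A \<phi> \<and> compact (closure {x. \<phi> x \<noteq> 0})}"

text \<open>The first three conjuncts say that both \<open>t \<mapsto> \<integral>\<phi> d\<mu>\<^sub>t\<close> and the right-hand side of the equation are
  well defined and locally integrable on \<open>(0, 1)\<close>, that is, distributions. They are spelled out because the Bochner
  integral of a non-integrable function is \<open>0\<close> by convention.\<close>

definition continuity_equation ::
  "('a::topological_space, 'n::finite) chart set \<Rightarrow> (real \<Rightarrow> 'a measure)
    \<Rightarrow> (real \<times> 'a \<Rightarrow> ('a, 'n) tvec) \<Rightarrow> bool" where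
  "continuity_equation A \<mu> v \<longleftrightarrow> (\<forall>\<phi>\<in>test_functions A.
     (AE t in lborel. 0 < t \<and> t < 1 \<longrightarrow> integrable (\<mu> t) (\<lambda>x. pairing A (v (t, x)) \<phi>)) \<and>
     (\<forall>a b. 0 < a \<and> b < 1 \<longrightarrow> set_integrable lborel {a..b} (\<lambda>t. LINT x|\<mu> t. \<phi> x)) \<and>
     (\<forall>a b. 0 < a \<and> b < 1 \<longrightarrow>
        set_integrable lborel {a..b} (\<lambda>t. LINT x|\<mu> t. pairing A (v (t, x)) \<phi>)) \<and>
     (\<forall>\<eta> :: real \<Rightarrow> real. smooth_on UNIV \<eta> \<and> (\<exists>a b. 0 < a \<and> b < 1 \<and> {t. \<eta> t \<noteq> 0} \<subseteq> {a..b}) \<longrightarrow>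
        - (LINT t:{0<..<1}|lborel. deriv \<eta> t * (LINT x|\<mu> t. \<phi> x)) =
          (LINT t:{0<..<1}|lborel. \<eta> t * (LINT x|\<mu> t. pairing A (v (t, x)) \<phi>))))"

end

theory Submission imports Defs begin

text \<open>Moving along the curve from time \<open>t\<close> for a time \<open>h\<close> changes the integral of a test function \<open>\<phi>\<close> by at most \<open>h\<close> times the
 metric derivative times the \<open>L\<^sup>q(\<mu>\<^sub>t)\<close>-norm of the slope of \<open>\<phi>\<close>, up to \<open>o(h)\<close>; the slope is the dual Finsler norm of \<open>d\<phi>\<close>.
 In a measurable frame of the tangent bundle, \<open>\<eta> d\<phi> \<mapsto> \<integral>\<eta>(t) (\<integral>\<phi> d\<mu>\<^sub>t)' dt\<close> is therefore a linear functional dominated by the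
 sublinear functional \<open>h \<mapsto> \<integral>m(t) \<parallel>h\<^sub>t\<parallel>\<^sub>q dt\<close>, where \<open>m\<close> is the metric derivative. Its Hahn-Banach extension to all bounded
 covector fields is absolutely continuous with respect to the space-time measure, hence is the pairing with a vector
 field by Radon-Nikodym, and testing it against the Legendre transform of that field gives the pointwise norm bound. The
 backward case is the same argument for curves run backwards in time, with the opposite field.\<close>

section \<open>Absolutely continuous functions of a real variable\<close>

text \<open>\<open>F\<close> is not reversible and its dual norm comes from no inner product, so the
  field is not sought as a limit of gradients; domination by a sublinear functional respects the
  asymmetry. That functional is L^1 in time with weight \<open>m\<close> and L^q in space, rather
  than L^q in space-time. This makes the domination local in time: a test field may be multiplied by
  the indicator of any time set, so the final inequality holds at almost every single t, with m(t)
  itself as the bound. The extension acts on all bounded measurable covector fields, whose fibres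
  vary with x; a countable choice of charts gives one measurable frame, rescaled so that the Finsler
  norm dominates the Euclidean one, and covector fields become functions with values in
  \<open>real ^ 'n\<close>. The slope of \<phi> may enter the estimate only at the starting point of
  a displacement, because the L^q norm is taken against \<open>\<mu> t\<close>; what permits this is
  that the slope is upper semicontinuous, uniformly by compactness of the support.\<close>

abbreviation short_interval :: "real => real => real => real => bool" where
 "short_interval x d s t \<equiv> 0 <= s \<and> s <= x \<and> x <= t \<and> t <= 1 \<and> t - s < d"

lemma set_integral_Icc_combine:
 fixes f :: "real => real"
 assumes "set_integrable lborel {a..b} f" "a <= c" "c <= b"
 shows "(LINT t:{a..b}|lborel. f t) = (LINT t:{a..c}|lborel. f t) + (LINT t:{c..b}|lborel. f t)"
proof -
 have 1: "set_integrable lborel {a..c} f" "set_integrable lborel {c..b} f"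
  using assms by (auto intro: set_integrable_subset[OF assms(1)])
 have f: "f integrable_on {a..b}" using assms set_borel_integral_eq_integral(1) by blast
 show ?thesis
  using set_borel_integral_eq_integral(2)[OF assms(1)] set_borel_integral_eq_integral(2)[OF 1(1)]
   set_borel_integral_eq_integral(2)[OF 1(2)]
   Henstock_Kurzweil_Integration.integral_combine[OF assms(2,3) f] by simp
qed

lemma set_integral_small:
 fixes f :: "real => real"
 assumes f: "set_integrable lborel {a..b} f" and c: "c \<in> {a..b}" and e: "0 < e"
 obtains d where "0 < d" "!!x. x \<in> {a..b} ==> \<bar>x - c\<bar> < d ==>
   \<bar>(LINT t:{min x c..max x c}|lborel. f t)\<bar> < e"
proof -
 have f': "f integrable_on {a..b}" using f set_borel_integral_eq_integral(1) by blast
 have "continuous_on {a..b} (\<lambda>x. integral {a..x} f)" by (rule indefinite_integral_continuous_1[OF f'])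
 then obtain d where d: "0 < d" "!!x. x \<in> {a..b} ==> dist x c < d ==> dist (integral {a..x} f) (integral {a..c} f) < e"
  using c e unfolding continuous_on_iff by metis
 show ?thesis
 proof (rule that[OF d(1)])
  fix x assume x: "x \<in> {a..b}" "\<bar>x - c\<bar> < d"
  have I: "integral {a..y} f + integral {y..z} f = integral {a..z} f" if "a <= y" "y <= z" "z <= b" for y z
   using that f' by (intro Henstock_Kurzweil_Integration.integral_combine)
    (auto intro: integrable_on_subinterval)
  have "integral {a..min x c} f + integral {min x c..max x c} f = integral {a..max x c} f"
   using x c by (intro I) auto
  moreover have "set_integrable lborel {min x c..max x c} f"
   using f by (rule set_integrable_subset) (use x c in auto)
  then have "(LINT t:{min x c..max x c}|lborel. f t) = integral {min x c..max x c} f"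
   by (rule set_borel_integral_eq_integral(2))
  moreover have "dist (integral {a..x} f) (integral {a..c} f) < e" using d(2) x by (auto simp: dist_real_def)
  ultimately show "\<bar>(LINT t:{min x c..max x c}|lborel. f t)\<bar> < e"
   by (auto simp: dist_real_def min_def max_def split: if_splits)
 qed
qed

section \<open>Lebesgue differentiation by a covering argument\<close>

lemma negligible_AE_lborel:
 assumes "negligible (S :: real set)"
 shows "AE x in lborel. x \<notin> S"
proof -
 have "AE x in lebesgue. x \<notin> S" using assms by (simp add: negligible_iff_null_sets AE_not_in)
 then show ?thesis by (simp add: AE_completion_iff)
qed

text \<open>The covering lemma delivers a countable family without an enumeration, so subadditivity
  is phrased as an integral over \<open>count_space C\<close>.\<close>

lemma emeasure_UN_countable_le:
 assumes "countable C" and X[measurable]: "!!i. i \<in> C ==> X i \<in> sets M"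
 shows "emeasure M (\<Union>i\<in>C. X i) <= (\<integral>\<^sup>+ i. emeasure M (X i) \<partial>count_space C)"
proof -
 have U: "(\<Union>i\<in>C. X i) \<in> sets M" using assms by (intro sets.countable_UN'') auto
 have "emeasure M (\<Union>i\<in>C. X i) = (\<integral>\<^sup>+ x. indicator (\<Union>i\<in>C. X i) x \<partial>M)"
  using U by simp
 also have "\<dots> <= (\<integral>\<^sup>+ x. (\<integral>\<^sup>+ i. indicator (X i) x \<partial>count_space C) \<partial>M)"
 proof (rule nn_integral_mono)
  fix x
  show "indicator (\<Union>i\<in>C. X i) x <= (\<integral>\<^sup>+ i. indicator (X i) x \<partial>count_space C)"
  proof (cases "x \<in> (\<Union>i\<in>C. X i)")
   case True
   then obtain i where i: "i \<in> C" "x \<in> X i" by blast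
   have "(indicator (X i) x :: ennreal) <= (\<integral>\<^sup>+ i. indicator (X i) x \<partial>count_space C)"
    by (rule nn_integral_ge_point[OF i(1)])
   then show ?thesis using True i by simp
  qed simp
 qed
 also have "\<dots> = (\<integral>\<^sup>+ i. (\<integral>\<^sup>+ x. indicator (X i) x \<partial>M) \<partial>count_space C)"
  by (rule nn_integral_count_space_nn_integral) (use assms in auto)
 also have "\<dots> = (\<integral>\<^sup>+ i. emeasure M (X i) \<partial>count_space C)"
  by (intro nn_integral_cong) simp
 finally show ?thesis .
qed

text \<open>Covering argument. The exceptional points for the rate 1 / (k + 1) form
  \<open>N k\<close>; each is the centre of small balls inside an open \<open>U\<close> around
  \<open>E\<close> whose \<nu>-mass exceeds a fixed multiple of their radius. A disjoint subfamily
  has total mass at most that of \<open>U\<close>, which outer regularity makes as small as desired,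
  and its fivefold enlargements still cover \<open>N k\<close>.\<close>

lemma zero_density_on_null_set:
 fixes \<nu> :: "real measure"
 assumes fin: "finite_measure \<nu>" and sets: "sets \<nu> = sets borel"
  and E: "E \<in> sets borel" "emeasure \<nu> E = 0"
 shows "AE x in lborel. x \<in> E -->
  (\<forall>e>0. \<exists>d>0. \<forall>h. 0 < h \<and> h < d --> measure \<nu> (cball x h) <= e * h)"
proof -
 interpret finite_measure \<nu> by fact
 define N where "N k = {x\<in>E. \<forall>d>0. \<exists>h. 0 < h \<and> h < d \<and> measure \<nu> (cball x h) > h / real (Suc k)}" for k
 have "negligible (N k)" for k
 proof (rule negligible_outer_le[THEN iffD2, rule_format])
  fix e :: real assume e: "0 < e"
  \<comment> \<open>A ball of radius 5 h has length 10 h, and h is less than k + 1 times the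
    \<nu>-mass of the ball of radius h. The resulting factor 10 (k + 1) is compensated here.\<close>
  define \<eta> where "\<eta> = e / (10 * real (Suc k))"
  have \<eta>: "0 < \<eta>" using e by (simp add: \<eta>_def)
  have "(INF U\<in>{U. E \<subseteq> U \<and> open U}. emeasure \<nu> U) = 0"
   using outer_regular[of \<nu> E] E sets by simp
  then have "(INF U\<in>{U. E \<subseteq> U \<and> open U}. emeasure \<nu> U) < ennreal \<eta>" using \<eta> by simp
  then obtain U where U: "E \<subseteq> U" "open U" "emeasure \<nu> U < ennreal \<eta>"
   unfolding INF_less_iff by auto
  have U': "measure \<nu> U <= \<eta>" using U(3) \<eta> by (simp add: emeasure_eq_measure ennreal_less_iff)
  define K where "K = {(x, h). x \<in> N k \<and> 0 < h \<and> h <= 1 \<and> cball x h \<subseteq> U \<and> measure \<nu> (cball x h) > h / real (Suc k)}"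
  have K: "0 < snd i \<and> snd i <= 1" if "i \<in> K" for i using that by (auto simp: K_def)
  obtain C where C: "countable C" "C \<subseteq> K"
   "pairwise (\<lambda>i j. disjnt (cball (fst i) (snd i)) (cball (fst j) (snd j))) C"
   "!!i. i \<in> K ==> \<exists>j. j \<in> C \<and>
            \<not> disjnt (cball (fst i) (snd i)) (cball (fst j) (snd j)) \<and>
            cball (fst i) (snd i) \<subseteq> ball (fst j) (5 * snd j)"
   by (rule Vitali_covering_lemma_cballs_balls[of K snd 1 fst, OF K]) (assumption, rule that)
  let ?T = "\<Union>j\<in>C. ball (fst j) (5 * snd j)"
  have sub: "N k \<subseteq> ?T"
  proof
   fix x assume x: "x \<in> N k"
   then have "x \<in> U" using U by (auto simp: N_def)
   then obtain r where r: "0 < r" "ball x r \<subseteq> U" using U(2) openE by blast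
   obtain h where h: "0 < h" "h < min r 1" "measure \<nu> (cball x h) > h / real (Suc k)"
    using x r(1) unfolding N_def by (auto dest!: spec[of _ "min r 1"])
   have "cball x h \<subseteq> U" using h r by (auto simp: subset_iff)
   then have "(x, h) \<in> K" using x h by (auto simp: K_def)
   from C(4)[OF this] obtain j where "j \<in> C" "cball x h \<subseteq> ball (fst j) (5 * snd j)" by auto
   moreover have "x \<in> cball x h" using h by simp
   ultimately show "x \<in> ?T" by blast
  qed
  have "emeasure lborel ?T <= (\<integral>\<^sup>+ j. emeasure lborel (ball (fst j) (5 * snd j)) \<partial>count_space C)"
   by (rule emeasure_UN_countable_le) (use C in auto)
  also have "\<dots> <= (\<integral>\<^sup>+ j. ennreal (10 * real (Suc k)) * emeasure \<nu> (cball (fst j) (snd j)) \<partial>count_space C)"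
  proof (rule nn_integral_mono)
   fix j assume "j \<in> space (count_space C)"
   then have "j \<in> K" using C by auto
   then have j: "0 < snd j" "measure \<nu> (cball (fst j) (snd j)) > snd j / real (Suc k)"
    by (auto simp: K_def)
   have "emeasure lborel (ball (fst j) (5 * snd j)) = ennreal (10 * snd j)"
    using j by (simp add: ball_eq_greaterThanLessThan)
   also have "10 * snd j <= 10 * real (Suc k) * measure \<nu> (cball (fst j) (snd j))"
    using j by (simp add: field_simps)
   finally show "emeasure lborel (ball (fst j) (5 * snd j)) <= ennreal (10 * real (Suc k)) * emeasure \<nu> (cball (fst j) (snd j))"
    by (simp add: emeasure_eq_measure ennreal_mult' ennreal_leI del: of_nat_Suc)
  qed
  also have "\<dots> = ennreal (10 * real (Suc k)) * (\<integral>\<^sup>+ j. emeasure \<nu> (cball (fst j) (snd j)) \<partial>count_space C)"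
   by (rule nn_integral_cmult) simp
  also have "(\<integral>\<^sup>+ j. emeasure \<nu> (cball (fst j) (snd j)) \<partial>count_space C) = emeasure \<nu> (\<Union>j\<in>C. cball (fst j) (snd j))"
   by (rule emeasure_UN_countable[symmetric])
    (use C sets in \<open>auto simp: disjoint_family_on_def pairwise_def disjnt_def\<close>)
  also have "\<dots> <= emeasure \<nu> U"
  proof (rule emeasure_mono)
   have "cball (fst j) (snd j) \<subseteq> U" if "j \<in> C" for j
    using subsetD[OF C(2) that] unfolding K_def by (simp add: case_prod_beta)
   then show "(\<Union>j\<in>C. cball (fst j) (snd j)) \<subseteq> U" by (rule UN_least)
   show "U \<in> sets \<nu>" using U sets by simp
  qed
  also have "\<dots> <= ennreal \<eta>" using U by simp
  also have "ennreal (10 * real (Suc k)) * ennreal \<eta> = ennreal (10 * real (Suc k) * \<eta>)"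
   by (rule ennreal_mult'[symmetric]) simp
  also have "10 * real (Suc k) * \<eta> = e" by (simp add: \<eta>_def)
  finally have m: "emeasure lborel ?T <= ennreal e" by (simp add: mult_left_mono)
  have T: "?T \<in> sets borel" by (intro borel_open open_UN) auto
  have "?T \<in> lmeasurable"
   using m T by (intro fmeasurableI) (auto simp: order.strict_trans1[of _ "ennreal e"])
  moreover have "measure lebesgue ?T <= e"
   using m T e by (simp add: measure_def enn2real_leI)
  ultimately show "\<exists>T. N k \<subseteq> T \<and> T \<in> lmeasurable \<and> Sigma_Algebra.measure lebesgue T <= e"
   using sub by blast
 qed
 then have "AE x in lborel. \<forall>k. x \<notin> N k" by (simp add: AE_all_countable negligible_AE_lborel)
 then show ?thesis
 proof eventually_elim
  case (elim x)
  show ?case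
  proof (intro impI allI)
   fix e :: real assume x: "x \<in> E" and e: "0 < e"
   obtain k where k: "1 / real (Suc k) < e" using e nat_approx_posE by blast
   have "\<not> (\<forall>d>0. \<exists>h. 0 < h \<and> h < d \<and> measure \<nu> (cball x h) > h / real (Suc k))"
    using spec[OF elim, of k] x unfolding N_def by blast
   then obtain d where d0: "d > 0" "\<not> (\<exists>h. 0 < h \<and> h < d \<and> measure \<nu> (cball x h) > h / real (Suc k))"
    by blast
   then have d: "d > 0" "!!h. 0 < h ==> h < d ==> measure \<nu> (cball x h) <= h / real (Suc k)"
    by (meson not_less)+
   have "h / real (Suc k) <= e * h" if "0 < h" for h
    using mult_left_mono[of "1 / real (Suc k)" e h] k that by (simp add: mult.commute)
   then show "\<exists>d>0. \<forall>h. 0 < h \<and> h < d --> measure \<nu> (cball x h) <= e * h"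
    using d by (meson order_trans)
  qed
 qed
qed

text \<open>For a rational \<open>a\<close> just above f x, the measure with density (f - a)^+ on
  [0, 1] has no mass on the set where f <= a, hence zero density at almost every point of that set:
  near x the excess of f over \<open>a\<close> is negligible. Restricting to rationals keeps the
  number of exceptional null sets countable.\<close>

lemma lebesgue_differentiation_upper:
 fixes f :: "real => real"
 assumes f[measurable]: "f \<in> borel_measurable borel" and i: "set_integrable lborel {0..1} f"
 shows "AE x in lborel. 0 < x \<and> x < 1 --> (\<forall>e>0. \<exists>d>0. \<forall>s t. short_interval x d s t -->
   (LINT y:{s..t}|lborel. f y) <= (f x + e) * (t - s))"
proof -
 define g where "g a y = max 0 (f y - a) * indicator {0..1} y" for a y :: real
 have g[measurable]: "g a \<in> borel_measurable borel" for a unfolding g_def by measurable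
 have gi: "integrable lborel (g a)" for a
 proof (rule Bochner_Integration.integrable_bound)
  show "integrable lborel (\<lambda>y. \<bar>indicator {0..1} y * f y\<bar> + \<bar>a\<bar> * indicator {0..1} y)"
   using i by (intro Bochner_Integration.integrable_add integrable_abs) (auto simp: set_integrable_def)
  show "AE y in lborel. norm (g a y) <= norm (\<bar>indicator {0..1} y * f y\<bar> + \<bar>a\<bar> * indicator {0..1} y)"
   by (intro AE_I2) (auto simp: g_def indicator_def max_def)
 qed simp
 define \<nu> where "\<nu> a = density lborel (\<lambda>y. ennreal (g a y))" for a
 have g0: "0 <= g a y" for a y by (simp add: g_def)
 have em: "emeasure (\<nu> a) B = ennreal (LINT y:B|lborel. g a y)" if "B \<in> sets borel" for a B
 proof -
  have "integrable lborel (\<lambda>y. indicator B y *\<^sub>R g a y)"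
   using integrable_mult_indicator[OF _ gi, of B a] that by simp
  then show ?thesis using that g0
   by (simp add: \<nu>_def emeasure_density nn_integral_eq_integral[symmetric] set_lebesgue_integral_def)
    (auto intro!: nn_integral_cong simp: indicator_def)
 qed
 have fin: "finite_measure (\<nu> a)" for a
  by (rule finite_measureI) (use em[of UNIV a] in \<open>auto simp: \<nu>_def\<close>)
 have "AE x in lborel. x \<in> {y. f y <= a} -->
  (\<forall>e>0. \<exists>d>0. \<forall>h. 0 < h \<and> h < d --> measure (\<nu> a) (cball x h) <= e * h)" for a
 proof (rule zero_density_on_null_set[OF fin])
  show "emeasure (\<nu> a) {y. f y <= a} = 0"
  proof -
   have "(\<lambda>y. indicator {y. f y <= a} y *\<^sub>R g a y) = (\<lambda>_. 0)"
    by (auto simp: g_def indicator_def max_def fun_eq_iff)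
   then have "(LINT y:{y. f y <= a}|lborel. g a y) = 0"
    by (simp add: set_lebesgue_integral_def)
   then show ?thesis by (simp add: em)
  qed
 qed (auto simp: \<nu>_def)
 then have "AE x in lborel. \<forall>a\<in>\<rat>. x \<in> {y. f y <= a} -->
  (\<forall>e>0. \<exists>d>0. \<forall>h. 0 < h \<and> h < d --> measure (\<nu> a) (cball x h) <= e * h)"
  by (simp add: AE_ball_countable countable_rat)
 then show ?thesis
 proof eventually_elim
  case (elim x)
  show ?case
  proof (intro impI allI)
   fix e :: real assume x: "0 < x \<and> x < 1" and e: "0 < e"
   obtain a where a: "a \<in> \<rat>" "f x < a" "a < f x + e/2" using Rats_dense_in_real[of "f x" "f x + e/2"] e by auto
   have "e/2 > 0" using e by simp
   then obtain d where d: "d > 0" "!!h. 0 < h ==> h < d ==> measure (\<nu> a) (cball x h) <= e/2 * h"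
    using elim[rule_format, OF a(1) _ \<open>e/2 > 0\<close>] a(2) by auto
   show "\<exists>d>0. \<forall>s t. short_interval x d s t -->
     (LINT y:{s..t}|lborel. f y) <= (f x + e) * (t - s)"
   proof (intro exI[of _ d] conjI d(1) allI impI)
    fix s t assume st: "short_interval x d s t"
    have if': "set_integrable lborel {s..t} f" using i by (rule set_integrable_subset) (use st in auto)
    have ig: "set_integrable lborel {s..t} (g a)"
     unfolding set_integrable_def by (rule integrable_mult_indicator[OF _ gi]) simp
    have ic: "set_integrable lborel {s..t} (\<lambda>_. a)" by (intro borel_integrable_atLeastAtMost' continuous_on_const)
    show "(LINT y:{s..t}|lborel. f y) <= (f x + e) * (t - s)"
    proof (cases "s = t")
     case True
     then have "{s..t} = {s}" by auto
     then show ?thesis using set_borel_integral_eq_integral(2)[OF if'] True by simp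
    next
     case False
     have "(LINT y:{s..t}|lborel. f y) <= (LINT y:{s..t}|lborel. a + g a y)"
      by (intro set_integral_mono if' set_integral_add ic ig) (use st in \<open>auto simp: g_def\<close>)
     also have "\<dots> = a * (t - s) + (LINT y:{s..t}|lborel. g a y)"
      using set_integral_add(2)[OF ic ig] st by (simp add: set_lebesgue_integral_def)
     also have "(LINT y:{s..t}|lborel. g a y) = measure (\<nu> a) {s..t}"
     proof -
      have "0 <= (LINT y:{s..t}|lborel. g a y)"
       unfolding set_lebesgue_integral_def by (intro Bochner_Integration.integral_nonneg) (simp add: g0)
      then show ?thesis using em[of "{s..t}" a] by (simp add: measure_def)
     qed
     also have "\<dots> <= measure (\<nu> a) (cball x (t - s))"
      by (intro finite_measure.finite_measure_mono[OF fin]) (use st in \<open>auto simp: dist_real_def \<nu>_def\<close>)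
     also have "\<dots> <= e/2 * (t - s)" using d(2)[rule_format, of "t - s"] st False by simp
     also have "a * (t - s) + e/2 * (t - s) <= (f x + e) * (t - s)"
      using mult_right_mono[of "a + e/2" "f x + e" "t - s"] a st by (simp add: algebra_simps)
     finally show ?thesis by simp
    qed
   qed
  qed
 qed
qed

lemma lebesgue_differentiation:
 fixes f :: "real => real"
 assumes f[measurable]: "f \<in> borel_measurable borel" and i: "set_integrable lborel {0..1} f"
 shows "AE x in lborel. 0 < x \<and> x < 1 --> (\<forall>e>0. \<exists>d>0. \<forall>s t. short_interval x d s t -->
   \<bar>(LINT y:{s..t}|lborel. f y) - f x * (t - s)\<bar> <= e * (t - s))"
proof -
 have i': "set_integrable lborel {0..1} (\<lambda>x. - f x)" using i by (simp add: set_integrable_def)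
 have mf: "(\<lambda>x. - f x) \<in> borel_measurable borel" by measurable
 show ?thesis
  using lebesgue_differentiation_upper[OF f i] lebesgue_differentiation_upper[OF mf i']
 proof eventually_elim
  case (elim x)
  show ?case
  proof (intro impI allI)
   fix e :: real assume x: "0 < x \<and> x < 1" and e: "0 < e"
   obtain d1 where d1: "d1 > 0" "\<forall>s t. short_interval x d1 s t -->
     (LINT y:{s..t}|lborel. f y) <= (f x + e) * (t - s)"
    using mp[OF spec[OF mp[OF elim(1) x], of e] e] by (elim exE conjE)
   obtain d2 where d2: "d2 > 0" "\<forall>s t. short_interval x d2 s t -->
     (LINT y:{s..t}|lborel. - f y) <= (- f x + e) * (t - s)"
    using mp[OF spec[OF mp[OF elim(2) x], of e] e] by (elim exE conjE)
   show "\<exists>d>0. \<forall>s t. short_interval x d s t -->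
     \<bar>(LINT y:{s..t}|lborel. f y) - f x * (t - s)\<bar> <= e * (t - s)"
   proof (intro exI[of _ "min d1 d2"] conjI allI impI)
    fix s t assume st: "short_interval x (min d1 d2) s t"
    have "(LINT y:{s..t}|lborel. - f y) = - (LINT y:{s..t}|lborel. f y)"
     by (simp add: set_lebesgue_integral_def)
    moreover have "(LINT y:{s..t}|lborel. f y) <= (f x + e) * (t - s)" using d1(2) st by simp
    moreover have "(LINT y:{s..t}|lborel. - f y) <= (- f x + e) * (t - s)" using d2(2) st by simp
    ultimately show "\<bar>(LINT y:{s..t}|lborel. f y) - f x * (t - s)\<bar> <= e * (t - s)"
     by (simp add: algebra_simps abs_le_iff)
   qed (use d1(1) d2(1) in simp)
  qed
 qed
qed

section \<open>Absolutely continuous functions have densities\<close>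

lemma sum_of_measures:
 assumes "sets N = sets M"
 obtains S where "sets S = sets M" "!!A. A \<in> sets M ==> emeasure S A = emeasure M A + emeasure N A"
proof -
 let ?f = "\<lambda>A. emeasure M A + emeasure N A"
 let ?S = "measure_of (space M) (sets M) ?f"
 have sp: "space N = space M" using sets_eq_imp_space_eq[OF assms] .
 have "emeasure ?S A = ?f A" if "A \<in> sets M" for A
 proof (rule emeasure_measure_of_sigma)
  show "sigma_algebra (space M) (sets M)" by (rule sets.sigma_algebra_axioms)
  show "positive (sets M) ?f" by (simp add: positive_def)
  show "countably_additive (sets M) ?f"
  proof (rule countably_additiveI)
   fix B :: "nat => 'a set" assume B: "range B \<subseteq> sets M" "disjoint_family B" "(\<Union>i. B i) \<in> sets M"
   have "(\<Sum>i. emeasure M (B i) + emeasure N (B i)) = (\<Sum>i. emeasure M (B i)) + (\<Sum>i. emeasure N (B i))"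
    by (rule suminf_add[symmetric]) auto
   then show "(\<Sum>i. ?f (B i)) = ?f (\<Union>i. B i)"
    using B assms by (simp add: suminf_emeasure)
  qed
 qed fact
 then show ?thesis by (intro that[of ?S]) auto
qed

text \<open>Borel measures finite on half-lines are determined by their values there; that
  \<open>F\<close> is constant from 1 on makes these values finite and explicit.\<close>

lemma emeasure_interval_measure_Ioi:
 assumes m: "!!x y. x <= y ==> F x <= F y" and c: "!!a. continuous (at_right a) F"
  and k: "!!x. 1 <= x ==> F x = F 1"
 shows "emeasure (interval_measure F) {x<..} = ennreal (F (max 1 x) - F x)"
proof -
 let ?A = "\<lambda>n::nat. {x<..max 1 x + real n}"
 have e: "emeasure (interval_measure F) (?A n) = ennreal (F (max 1 x) - F x)" for n
 proof -
  have "F (max 1 x + real n) = F (max 1 x)" using k[of "max 1 x + real n"] k[of "max 1 x"] by simp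
  then show ?thesis by (subst emeasure_interval_measure_Ioc[OF _ m c]) auto
 qed
 have "(SUP n. emeasure (interval_measure F) (?A n)) = emeasure (interval_measure F) (\<Union>n. ?A n)"
  by (rule SUP_emeasure_incseq) (auto simp: incseq_def)
 moreover have "(\<Union>n. ?A n) = {x<..}"
 proof (intro set_eqI iffI)
  fix y assume "y \<in> {x<..}"
  moreover obtain n :: nat where "y <= real n" using real_arch_simple by blast
  ultimately have "y \<in> ?A n" by auto
  then show "y \<in> (\<Union>n. ?A n)" by blast
 qed auto
 ultimately show ?thesis using e by simp
qed

lemma set_integral_nonneg_Icc:
 fixes f :: "real => real"
 assumes "!!x. x \<in> A ==> 0 <= f x"
 shows "0 <= (LINT x:A|M. f x)"
 unfolding set_lebesgue_integral_def
 by (intro Bochner_Integration.integral_nonneg) (auto simp: indicator_def assms)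

text \<open>The Lebesgue-Stieltjes measures of \<open>\<integral>f + \<phi>\<close> and \<open>\<integral>f - \<phi>\<close> add up to the measure with
 density \<open>2f\<close>, so the first one has a density by Radon-Nikodym.\<close>

lemma absolutely_continuous_real:
 fixes f \<phi> :: "real => real"
 assumes f[measurable]: "f \<in> borel_measurable borel" and f0: "!!t. 0 <= f t"
  and i: "set_integrable lborel {0..1} f"
  and \<phi>: "!!s t. 0 <= s ==> s <= t ==> t <= 1 ==> \<bar>\<phi> t - \<phi> s\<bar> <= (LINT y:{s..t}|lborel. f y)"
 obtains u where "u \<in> borel_measurable borel" "set_integrable lborel {0..1} u"
  "!!s t. 0 <= s ==> s <= t ==> t <= 1 ==> \<phi> t - \<phi> s = (LINT y:{s..t}|lborel. u y)"
proof -
 \<comment> \<open>Clamping to [0, 1] extends the functions constantly beyond the interval, so that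
   they define Stieltjes measures on the whole line.\<close>
 define c where "c t = max 0 (min 1 t)" for t :: real
 have c01: "0 <= c t" "c t <= 1" for t by (auto simp: c_def)
 have cm: "c s <= c t" if "s <= t" for s t using that by (auto simp: c_def)
 define I where "I t = (LINT y:{0..c t}|lborel. f y)" for t
 have ist: "set_integrable lborel {s..t} f" if "0 <= s" "t <= 1" for s t
  using i by (rule set_integrable_subset) (use that in auto)
 have Id: "I t - I s = (LINT y:{c s..c t}|lborel. f y)" if "s <= t" for s t
  unfolding I_def using set_integral_Icc_combine[OF ist[of 0 "c t"], of "c s"] c01 cm[OF that] by simp
 have \<phi>d: "\<bar>\<phi> (c t) - \<phi> (c s)\<bar> <= I t - I s" if "s <= t" for s t
  using \<phi>[of "c s" "c t"] c01 cm[OF that] Id[OF that] by simp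
 have cont: "continuous (at a) I" for a
 proof -
  have "continuous_on {0..1} (\<lambda>x. integral {0..x} f)"
   by (rule indefinite_integral_continuous_1) (use i set_borel_integral_eq_integral(1) in blast)
  then have "continuous_on {0..1} (\<lambda>x. LINT y:{0..x}|lborel. f y)"
   by (rule continuous_on_eq) (use ist set_borel_integral_eq_integral(2)[symmetric] in auto)
  then have "continuous_on UNIV (\<lambda>t. (LINT y:{0..c t}|lborel. f y))"
   by (rule continuous_on_compose2) (auto simp: c_def intro!: continuous_intros)
  then show ?thesis unfolding I_def by (simp add: continuous_on_eq_continuous_at)
 qed
 have cont\<phi>: "continuous (at a) (\<lambda>t. \<phi> (c t))" for a
 proof -
  have "((\<lambda>t. \<phi> (c t) - \<phi> (c a)) \<longlongrightarrow> 0) (at a)"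
  proof (rule Lim_null_comparison)
   show "\<forall>\<^sub>F t in at a. norm (\<phi> (c t) - \<phi> (c a)) <= \<bar>I t - I a\<bar>"
    using \<phi>d by (intro always_eventually allI) (metis abs_ge_self abs_minus_commute le_cases order_trans real_norm_def)
   show "((\<lambda>t. \<bar>I t - I a\<bar>) \<longlongrightarrow> 0) (at a)"
    using cont[of a] by (intro tendsto_rabs_zero) (auto simp: continuous_at LIM_zero_iff)
  qed
  then show ?thesis by (simp add: continuous_at LIM_zero_iff)
 qed
 define G where "G t = I t + \<phi> (c t)" for t
 define H where "H t = I t - \<phi> (c t)" for t
 have Gm: "G s <= G t" and Hm: "H s <= H t" if "s <= t" for s t
  using \<phi>d[OF that] by (auto simp: G_def H_def abs_le_iff)
 have Gc: "continuous (at_right a) G" and Hc: "continuous (at_right a) H" for a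
  unfolding G_def H_def by (auto intro!: continuous_intros continuous_at_imp_continuous_at_within[OF cont] continuous_at_imp_continuous_at_within[OF cont\<phi>])
 have G1: "G x = G 1" and H1: "H x = H 1" if "1 <= x" for x
  using that by (auto simp: G_def H_def I_def c_def)
 define M where "M = interval_measure G"
 define N where "N = interval_measure H"
 obtain S where S: "sets S = sets M" "!!A. A \<in> sets M ==> emeasure S A = emeasure M A + emeasure N A"
  by (rule sum_of_measures[of N M]) (auto simp: M_def N_def)
 define D where "D = density lborel (\<lambda>y. ennreal (2 * (indicator {0..1} y * f y)))"
 have "S = D"
 proof (rule measure_eqI_lessThan)
  show "sets S = sets borel" "sets D = sets borel" using S by (auto simp: M_def D_def)
  fix x
  have Sx: "emeasure S {x<..} = ennreal (2 * (I (max 1 x) - I x))"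
  proof -
   have "emeasure S {x<..} = ennreal (G (max 1 x) - G x) + ennreal (H (max 1 x) - H x)"
    using S(2)[of "{x<..}"] emeasure_interval_measure_Ioi[OF Gm Gc G1, of x] emeasure_interval_measure_Ioi[OF Hm Hc H1, of x]
    by (simp add: M_def N_def)
   also have "\<dots> = ennreal ((G (max 1 x) - G x) + (H (max 1 x) - H x))"
    by (rule ennreal_plus[symmetric]) (use Gm Hm in auto)
   finally show ?thesis by (simp add: G_def H_def)
  qed
  show "emeasure S {x<..} < \<infinity>" by (simp add: Sx)
  have "emeasure D {x<..} = (\<integral>\<^sup>+ y. ennreal (2 * (indicator {0..1} y * f y)) * indicator {x<..} y \<partial>lborel)"
   unfolding D_def by (rule emeasure_density) auto
  also have "\<dots> = (\<integral>\<^sup>+ y. ennreal (2 * (indicator {c x..1} y *\<^sub>R f y)) \<partial>lborel)"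
  proof (rule nn_integral_cong_AE, use AE_lborel_singleton[of x] AE_lborel_singleton[of 1] in eventually_elim)
   fix y :: real assume "y \<noteq> x" "y \<noteq> 1"
   then have "y \<in> {c x..1} \<longleftrightarrow> y \<in> {0..1} \<and> y \<in> {x<..}" by (auto simp: c_def)
   then have "(indicator {c x..1} y :: real) = indicator {0..1} y * indicator {x<..} y"
    by (simp only: indicator_def) simp
   then show "ennreal (2 * (indicator {0..1} y * f y)) * indicator {x<..} y = ennreal (2 * (indicator {c x..1} y *\<^sub>R f y))"
    by (cases "y \<in> {x<..}") (simp_all add: indicator_simps)
  qed
  also have "\<dots> = ennreal (2 * (LINT y:{c x..1}|lborel. f y))"
   using ist[of "c x" 1] c01 f0 unfolding set_lebesgue_integral_def set_integrable_def
   by (subst nn_integral_eq_integral) (auto simp: indicator_def)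
  also have "(LINT y:{c x..1}|lborel. f y) = I (max 1 x) - I x"
   using Id[of x "max 1 x"] by (simp add: c_def)
  finally show "emeasure S {x<..} = emeasure D {x<..}" using Sx by simp
 qed
 \<comment> \<open>\<open>M\<close> is bounded by \<open>S\<close>, and \<open>S\<close> equals
   \<open>D\<close>, which has a Lebesgue density.\<close>
 have ac: "absolutely_continuous lborel M"
  unfolding absolutely_continuous_def
 proof
  fix A :: "real set" assume A: "A \<in> null_sets lborel"
  then have A': "A \<in> sets borel" by auto
  have "A \<in> null_sets D"
   using A unfolding D_def by (subst null_sets_density_iff) (auto simp: AE_not_in dest: AE_not_in)
  then have "emeasure S A = 0" using \<open>S = D\<close> by auto
  then show "A \<in> null_sets M" using S(2)[of A] A' by (auto simp: M_def null_sets_def)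
 qed
 have finM: "finite_measure M"
 proof (rule finite_measureI)
  have "emeasure S UNIV = \<integral>\<^sup>+ y. ennreal (2 * (indicator {0..1} y *\<^sub>R f y)) \<partial>lborel"
   unfolding \<open>S = D\<close> D_def by (subst emeasure_density) auto
  also have "\<dots> < \<infinity>"
   using i f0 unfolding set_integrable_def by (subst nn_integral_eq_integral) auto
  finally show "emeasure M (space M) \<noteq> \<infinity>" using S(2)[of UNIV] by (auto simp: M_def)
 qed
 obtain g where g[measurable]: "g \<in> borel_measurable lborel"
  and gRN: "AE x in lborel. RN_deriv lborel M x = ennreal (g x)" and g0: "!!x. 0 <= g x"
  using sigma_finite_measure.real_RN_deriv[OF sigma_finite_lborel finM ac] by (auto simp: M_def)
 have Mg: "M = density lborel (\<lambda>x. ennreal (g x))"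
 proof -
  have "M = density lborel (RN_deriv lborel M)"
   using sigma_finite_measure.density_RN_deriv[OF sigma_finite_lborel ac] by (simp add: M_def)
  also have "\<dots> = density lborel (\<lambda>x. ennreal (g x))"
   by (rule density_cong) (use gRN in auto)
  finally show ?thesis .
 qed
 have gi: "integrable lborel g"
 proof (rule integrableI_nonneg)
  have "(\<integral>\<^sup>+ x. ennreal (g x) \<partial>lborel) = emeasure M UNIV"
   unfolding Mg by (subst emeasure_density) auto
  also have "\<dots> < \<infinity>" using finite_measure.emeasure_finite[OF finM, of UNIV] by (simp add: top.not_eq_extremum)
  finally show "(\<integral>\<^sup>+ x. ennreal (g x) \<partial>lborel) < \<infinity>" .
 qed (use g0 in auto)
 have gs: "set_integrable lborel B g" if "B \<in> sets borel" for B
  unfolding set_integrable_def using gi that by (intro integrable_mult_indicator) auto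
 show ?thesis
 \<comment> \<open>\<open>G\<close> is the sum of the indefinite integral of \<open>f\<close> and of
   \<phi>, so subtracting \<open>f\<close> from its density leaves the density of \<phi>.\<close>
 proof (rule that[of "\<lambda>x. g x - f x"])
  show "(\<lambda>x. g x - f x) \<in> borel_measurable borel" using g by simp
  show "set_integrable lborel {0..1} (\<lambda>x. g x - f x)"
   by (intro set_integral_diff(1) gs i) auto
  fix s t :: real assume st: "0 <= s" "s <= t" "t <= 1"
  have "ennreal (G t - G s) = emeasure M {s<..t}"
   unfolding M_def by (rule emeasure_interval_measure_Ioc[symmetric, OF st(2) Gm Gc])
  also have "\<dots> = (\<integral>\<^sup>+ y. ennreal (g y) * indicator {s<..t} y \<partial>lborel)"
   unfolding Mg by (rule emeasure_density) auto
  also have "\<dots> = (\<integral>\<^sup>+ y. ennreal (indicator {s..t} y *\<^sub>R g y) \<partial>lborel)"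
  proof (rule nn_integral_cong_AE, use AE_lborel_singleton[of s] in eventually_elim)
   fix y assume "y \<noteq> s"
   then show "ennreal (g y) * indicator {s<..t} y = ennreal (indicator {s..t} y *\<^sub>R g y)"
    by (simp add: indicator_def)
  qed
  also have "\<dots> = ennreal (LINT y:{s..t}|lborel. g y)"
   using gs[of "{s..t}"] g0 unfolding set_lebesgue_integral_def set_integrable_def
   by (subst nn_integral_eq_integral) auto
  finally have "G t - G s = (LINT y:{s..t}|lborel. g y)"
   using Gm[OF st(2)] set_integral_nonneg_Icc[of "{s..t}" g lborel] g0 by simp
  moreover have "I t - I s = (LINT y:{s..t}|lborel. f y)" using Id[of s t] st by (simp add: c_def)
  moreover have "c s = s" "c t = t" using st by (auto simp: c_def)
  moreover have "(LINT y:{s..t}|lborel. g y - f y) = (LINT y:{s..t}|lborel. g y) - (LINT y:{s..t}|lborel. f y)"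
   by (intro set_integral_diff(2) gs ist) (use st in auto)
  ultimately show "\<phi> t - \<phi> s = (LINT y:{s..t}|lborel. g y - f y)" by (simp add: G_def)
 qed
qed

text \<open>For each rational r the function t \<mapsto> d r t is absolutely continuous, and the
  metric derivative is the supremum over r of the derivatives \<open>U r\<close>. By the triangle
  inequality d s t bounds the increment of d r over {s..t}, which gives the lower estimate. For the
  upper one, d s t is at most the integral of \<open>m\<close>, by letting r approach s. Only the
  second argument of \<open>d\<close> moves, in keeping with its asymmetry.\<close>

lemma metric_derivative:
 fixes f :: "real => real" and d :: "real => real => real"
 assumes f[measurable]: "f \<in> borel_measurable borel" and f0: "!!t. 0 <= f t"
  and i: "set_integrable lborel {0..1} f"
  and d0: "!!s t. s \<in> {0..1} ==> t \<in> {0..1} ==> 0 <= d s t"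
  and tri: "!!r s t. r \<in> {0..1} ==> s \<in> {0..1} ==> t \<in> {0..1} ==> d r t <= d r s + d s t"
  and fwd: "!!s t. 0 <= s ==> s <= t ==> t <= 1 ==> d s t <= (LINT y:{s..t}|lborel. f y)"
  and bwd: "!!s t. 0 <= s ==> s <= t ==> t <= 1 ==> d t s <= (LINT y:{s..t}|lborel. f y)"
 obtains m where "m \<in> borel_measurable borel" "!!t. 0 <= m t" "!!t. m t <= f t"
  "AE t in lborel. 0 < t \<and> t < 1 --> (\<forall>e>0. \<exists>\<delta>>0. \<forall>s s'. short_interval t \<delta> s s' -->
    \<bar>d s s' - m t * (s' - s)\<bar> <= e * (s' - s))"
proof -
 define Q where "Q = \<rat> \<inter> {0..1::real}"
 have Q: "countable Q" "0 \<in> Q" "Q \<subseteq> {0..1}" by (auto simp: Q_def countable_rat)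
 have "\<exists>u. u \<in> borel_measurable borel \<and> set_integrable lborel {0..1} u \<and>
   (\<forall>s t. 0 <= s --> s <= t --> t <= 1 --> d r t - d r s = (LINT y:{s..t}|lborel. u y))" if r: "r \<in> Q" for r
 proof -
  have "\<bar>d r t - d r s\<bar> <= (LINT y:{s..t}|lborel. f y)" if st: "0 <= s" "s <= t" "t <= 1" for s t
   using tri[of r s t] tri[of r t s] fwd[OF st] bwd[OF st] st r Q(3) by (auto simp: abs_le_iff)
  note D = this
  show ?thesis
  proof (rule absolutely_continuous_real[where f=f and \<phi>="d r", OF f f0 i])
   show "\<bar>d r t - d r s\<bar> <= (LINT y:{s..t}|lborel. f y)" if "0 <= s" "s <= t" "t <= 1" for s t
    by (rule D[OF that])
  next
   fix u assume "u \<in> borel_measurable borel" "set_integrable lborel {0..1} u"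
    "!!s t. 0 <= s ==> s <= t ==> t <= 1 ==> d r t - d r s = (LINT y:{s..t}|lborel. u y)"
   then show ?thesis by (intro exI[of _ u]) simp
  qed
 qed
 then obtain U where U[measurable]: "!!r. r \<in> Q ==> U r \<in> borel_measurable borel"
  and Ui: "!!r. r \<in> Q ==> set_integrable lborel {0..1} (U r)"
  and Ud: "!!r s t. r \<in> Q ==> 0 <= s ==> s <= t ==> t <= 1 ==> d r t - d r s = (LINT y:{s..t}|lborel. U r y)"
  by metis
 \<comment> \<open>The clipping makes the supremum finite and bounds \<open>m\<close> by
   \<open>f\<close> at every t instead of almost every t. The upper cut changes nothing almost
   everywhere, since there \<open>U r <= f\<close>.\<close>
 define h where "h r t = max 0 (min (U r t) (f t))" for r t
 define m where "m t = (SUP r\<in>Q. h r t)" for t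
 have h0: "0 <= h r t" "h r t <= f t" for r t using f0 by (auto simp: h_def)
 have bdd: "bdd_above ((\<lambda>r. h r t) ` Q)" for t using h0(2) by (rule bdd_aboveI2)
 have hm: "h r t <= m t" if "r \<in> Q" for r t unfolding m_def by (rule cSUP_upper[OF that bdd])
 have m0: "0 <= m t" for t using h0(1)[of 0 t] hm[OF Q(2), of t] by simp
 have mf: "m t <= f t" for t unfolding m_def by (rule cSUP_least) (use Q h0 in auto)
 have mm[measurable]: "m \<in> borel_measurable borel"
 proof -
  have "(\<lambda>t. SUP r\<in>Q. h r t) \<in> borel_measurable borel"
   by (rule borel_measurable_cSUP[OF Q(1)]) (auto simp: h_def intro!: bdd[unfolded h_def])
  then show ?thesis by (simp add: m_def[abs_def])
 qed
 have mi: "set_integrable lborel {0..1} m"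
  using i unfolding set_integrable_def
  by (rule Bochner_Integration.integrable_bound) (use m0 mf in \<open>auto simp: indicator_def f0\<close>)
 have sub: "set_integrable lborel {s..t} g" if "set_integrable lborel {0..1} g" "0 <= s" "t <= 1" for s t and g :: "real => real"
  using that(1) by (rule set_integrable_subset) (use that in auto)
 have "AE y in lborel. \<forall>r\<in>Q. 0 < y \<and> y < 1 --> (\<forall>e>0. \<exists>d>0. \<forall>s t. short_interval y d s t -->
   \<bar>(LINT z:{s..t}|lborel. U r z) - U r y * (t - s)\<bar> <= e * (t - s))"
  by (subst AE_ball_countable[OF Q(1)]) (intro ballI lebesgue_differentiation U Ui)
 note AEU = this
 have "AE y in lborel. 0 < y \<and> y < 1 --> (\<forall>r\<in>Q. U r y <= f y)"
  using AEU lebesgue_differentiation[OF f i]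
 proof eventually_elim
  case (elim y)
  show ?case
  proof (intro impI ballI)
   fix r assume y: "0 < y \<and> y < 1" and r: "r \<in> Q"
   show "U r y <= f y"
   proof (rule field_le_epsilon)
    fix e :: real assume "0 < e"
    then have e: "0 < e / 2" by simp
    obtain d1 where d1: "d1 > 0" "\<forall>s t. short_interval y d1 s t -->
      \<bar>(LINT z:{s..t}|lborel. U r z) - U r y * (t - s)\<bar> <= e / 2 * (t - s)"
     using mp[OF spec[OF mp[OF bspec[OF elim(1) r] y], of "e/2"] e] by (elim exE conjE)
    obtain d2 where d2: "d2 > 0" "\<forall>s t. short_interval y d2 s t -->
      \<bar>(LINT z:{s..t}|lborel. f z) - f y * (t - s)\<bar> <= e / 2 * (t - s)"
     using mp[OF spec[OF mp[OF elim(2) y], of "e/2"] e] by (elim exE conjE)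
    define t where "t = y + min (1 - y) (min d1 d2) / 2"
    have t: "y < t" "t <= 1" "t - y < d1" "t - y < d2"
    proof -
     have "min (1 - y) (min d1 d2) <= 1 - y" "min (1 - y) (min d1 d2) <= d1" "min (1 - y) (min d1 d2) <= d2"
      "0 < min (1 - y) (min d1 d2)" using y d1(1) d2(1) by auto
     then show "y < t" "t <= 1" "t - y < d1" "t - y < d2" unfolding t_def by linarith+
    qed
    have "\<bar>(LINT z:{y..t}|lborel. U r z) - U r y * (t - y)\<bar> <= e / 2 * (t - y)"
     "\<bar>(LINT z:{y..t}|lborel. f z) - f y * (t - y)\<bar> <= e / 2 * (t - y)"
     using d1(2) d2(2) t y by simp_all
    moreover have "(LINT z:{y..t}|lborel. U r z) <= (LINT z:{y..t}|lborel. f z)"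
     using Ud[of r y t] tri[of r y t] fwd[of y t] t y r Q(3) by auto
    moreover have "(f y + e) * (t - y) = f y * (t - y) + e / 2 * (t - y) + e / 2 * (t - y)"
     by (simp add: field_simps)
    ultimately have "U r y * (t - y) <= (f y + e) * (t - y)" by linarith
    then show "U r y <= f y + e" using t by simp
   qed
  qed
 qed
 then have Um: "AE y in lborel. 0 < y \<and> y < 1 --> (\<forall>r\<in>Q. U r y <= m y)"
 proof eventually_elim
  case (elim y)
  then show ?case using hm[of _ y] by (fastforce simp: h_def)
 qed
 have upper: "d s t <= (LINT y:{s..t}|lborel. m y)" if st: "0 <= s" "s <= t" "t <= 1" for s t
 proof (rule field_le_epsilon)
  fix e :: real assume e: "0 < e"
  have s01: "s \<in> {0..1}" and "e / 2 > 0" using st e by auto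
  \<comment> \<open>A rational r within \<delta> of s makes d s r and d r s small in both orders;
    the increment of d r over {s..t} is then d s t up to e.\<close>
  from set_integral_small[OF i this] obtain \<delta> where \<delta>: "\<delta> > 0"
   "!!x. x \<in> {0..1} ==> \<bar>x - s\<bar> < \<delta> ==> \<bar>LINT t:{min x s..max x s}|lborel. f t\<bar> < e / 2" by metis
  have "max 0 (s - \<delta>) < min 1 (s + \<delta>)" using s01 \<delta> by auto
  from Rats_dense_in_real[OF this] obtain r where r: "r \<in> \<rat>" "max 0 (s - \<delta>) < r" "r < min 1 (s + \<delta>)" by blast
  have rQ: "r \<in> Q" "r \<in> {0..1}" using r by (auto simp: Q_def)
  have "\<bar>r - s\<bar> < \<delta>" using r by auto
  from \<delta>(2)[OF rQ(2) this] have I: "(LINT t:{min r s..max r s}|lborel. f t) < e / 2" by simp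
  have "d s r <= e / 2 \<and> d r s <= e / 2"
  proof (cases "s <= r")
   case True
   then have "(LINT t:{s..r}|lborel. f t) < e / 2" using I by (simp add: min.absorb2 max.absorb1)
   then show ?thesis using fwd[of s r] bwd[of s r] s01 rQ(2) True by simp
  next
   case False
   then have "(LINT t:{r..s}|lborel. f t) < e / 2" using I by (simp add: min.absorb1 max.absorb2)
   then show ?thesis using fwd[of r s] bwd[of r s] s01 rQ(2) False by simp
  qed
  then have "d s r <= e / 2" "d r s <= e / 2" by auto
  moreover have "d s t <= d s r + d r t" using tri[OF s01 rQ(2)] st by simp
  moreover have "d r t - d r s = (LINT y:{s..t}|lborel. U r y)" by (rule Ud[OF rQ(1) st])
  moreover have "(LINT y:{s..t}|lborel. U r y) <= (LINT y:{s..t}|lborel. m y)"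
  proof (rule set_integral_mono_AE)
   show "set_integrable lborel {s..t} (U r)" "set_integrable lborel {s..t} m"
    using sub[OF Ui[OF rQ(1)]] sub[OF mi] st by auto
   show "AE x\<in>{s..t} in lborel. U r x <= m x"
    using Um AE_lborel_singleton[of 0] AE_lborel_singleton[of 1]
    by eventually_elim (use st rQ in force)
  qed
  ultimately show "d s t <= (LINT y:{s..t}|lborel. m y) + e" by linarith
 qed
 have lower: "(LINT y:{s..t}|lborel. U r y) <= d s t" if "r \<in> Q" "0 <= s" "s <= t" "t <= 1" for r s t
  using Ud[OF that] tri[of r s t] that Q(3) by auto
 show ?thesis
 proof (rule that[OF mm m0 mf])
  show "AE t in lborel. 0 < t \<and> t < 1 --> (\<forall>e>0. \<exists>\<delta>>0. \<forall>s s'. short_interval t \<delta> s s' -->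
    \<bar>d s s' - m t * (s' - s)\<bar> <= e * (s' - s))"
   using AEU lebesgue_differentiation[OF mm mi]
  proof eventually_elim
   case (elim y)
   show ?case
   proof (intro impI allI)
    fix e :: real assume y: "0 < y \<and> y < 1" and e': "0 < e"
    then have e: "0 < e / 2" by simp
    have "\<exists>r\<in>Q. m y - e / 2 < h r y"
     using less_cSUP_iff[OF _ bdd, of "m y - e/2" y] Q(2) e unfolding m_def by auto
    then obtain r where r: "r \<in> Q" "m y - e / 2 < h r y" by blast
    obtain d1 where d1: "d1 > 0" "\<forall>s t. short_interval y d1 s t -->
      \<bar>(LINT z:{s..t}|lborel. U r z) - U r y * (t - s)\<bar> <= e / 2 * (t - s)"
     using mp[OF spec[OF mp[OF bspec[OF elim(1) r(1)] y], of "e/2"] e] by (elim exE conjE)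
    obtain d2 where d2: "d2 > 0" "\<forall>s t. short_interval y d2 s t -->
      \<bar>(LINT z:{s..t}|lborel. m z) - m y * (t - s)\<bar> <= e / 2 * (t - s)"
     using mp[OF spec[OF mp[OF elim(2) y], of "e/2"] e] by (elim exE conjE)
    show "\<exists>\<delta>>0. \<forall>s s'. short_interval y \<delta> s s' -->
     \<bar>d s s' - m y * (s' - s)\<bar> <= e * (s' - s)"
    proof (intro exI[of _ "min d1 d2"] conjI allI impI)
     fix s s' assume s: "short_interval y (min d1 d2) s s'"
     have "d s s' <= (LINT z:{s..s'}|lborel. m z)" using upper s by simp
     moreover have "\<bar>(LINT z:{s..s'}|lborel. m z) - m y * (s' - s)\<bar> <= e / 2 * (s' - s)"
      using d2(2) s by simp
     moreover have "e / 2 * (s' - s) <= e * (s' - s)"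
      using e' s by (intro mult_right_mono) auto
     ultimately have 1: "d s s' - m y * (s' - s) <= e * (s' - s)" by linarith
     have 2: "(m y - e) * (s' - s) <= d s s'"
     \<comment> \<open>If \<open>m y - e / 2\<close> is negative, \<open>h r y\<close> may be the
       clipped value 0 and says nothing about \<open>U r y\<close>; then nonnegativity of
       \<open>d\<close> is enough. Otherwise \<open>h r y\<close> is positive and
       \<open>U r y\<close> lies above it.\<close>
     proof (cases "m y - e / 2 < 0")
      case True
      then have "(m y - e) * (s' - s) <= 0" using s e' by (intro mult_nonpos_nonneg) auto
      also have "0 <= d s s'" using d0 s by simp
      finally show ?thesis .
     next
      case False
      then have "m y - e / 2 < U r y" using r(2) by (auto simp: h_def)
      then have "(m y - e) * (s' - s) <= (U r y - e / 2) * (s' - s)"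
       using s by (intro mult_right_mono) auto
      also have "\<dots> <= (LINT z:{s..s'}|lborel. U r z)"
      proof -
       have "\<bar>(LINT z:{s..s'}|lborel. U r z) - U r y * (s' - s)\<bar> <= e / 2 * (s' - s)"
        using d1(2) s by simp
       moreover have "(U r y - e / 2) * (s' - s) = U r y * (s' - s) - e / 2 * (s' - s)"
        by (rule left_diff_distrib)
       ultimately show ?thesis by linarith
      qed
      also have "\<dots> <= d s s'" using lower[OF r(1), of s s'] s by simp
      finally show ?thesis .
     qed
     show "\<bar>d s s' - m y * (s' - s)\<bar> <= e * (s' - s)"
     proof -
      have "(m y - e) * (s' - s) = m y * (s' - s) - e * (s' - s)" by (rule left_diff_distrib)
      then show ?thesis using 1 2 by linarith
     qed
    qed (use d1 d2 in simp)
   qed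
  qed
 qed
qed

section \<open>The inequalities of Hoelder and Minkowski\<close>

lemma nn_integral_combination_le:
 assumes [measurable]: "u \<in> borel_measurable M" "v \<in> borel_measurable M"
  and nn: "!!x. 0 <= u x" "!!x. 0 <= v x" "0 <= \<alpha>" "0 <= \<beta>" "0 <= A" "0 <= B"
  and u: "(\<integral>\<^sup>+ x. ennreal (u x) \<partial>M) <= ennreal A" and v: "(\<integral>\<^sup>+ x. ennreal (v x) \<partial>M) <= ennreal B"
 shows "(\<integral>\<^sup>+ x. ennreal (\<alpha> * u x + \<beta> * v x) \<partial>M) <= ennreal (\<alpha> * A + \<beta> * B)"
proof -
 have "(\<integral>\<^sup>+ x. ennreal (\<alpha> * u x + \<beta> * v x) \<partial>M) = (\<integral>\<^sup>+ x. ennreal \<alpha> * ennreal (u x) + ennreal \<beta> * ennreal (v x) \<partial>M)"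
  by (intro nn_integral_cong) (simp add: nn ennreal_mult' ennreal_plus)
 also have "\<dots> = ennreal \<alpha> * (\<integral>\<^sup>+ x. ennreal (u x) \<partial>M) + ennreal \<beta> * (\<integral>\<^sup>+ x. ennreal (v x) \<partial>M)"
  by (simp add: nn_integral_add nn_integral_cmult)
 also have "\<dots> <= ennreal \<alpha> * ennreal A + ennreal \<beta> * ennreal B"
  by (intro add_mono mult_left_mono u v) auto
 also have "\<dots> = ennreal (\<alpha> * A + \<beta> * B)" using nn by (simp add: ennreal_mult' ennreal_plus)
 finally show ?thesis .
qed

text \<open>Young's inequality for f / a and g / b, multiplied by a b and integrated. The numbers a
  and b are positive upper bounds for the norms and not the norms themselves, so that a vanishing
  norm needs no case of its own.\<close>

lemma nn_integral_Holder:
 assumes [measurable]: "f \<in> borel_measurable M" "g \<in> borel_measurable M"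
  and nn: "!!x. 0 <= f x" "!!x. 0 <= g x" and a: "0 < a" and b: "0 < b"
  and pq: "1 < p" "1 < q" "1 / p + 1 / q = 1"
  and f: "(\<integral>\<^sup>+ x. ennreal (f x powr p) \<partial>M) <= ennreal (a powr p)"
  and g: "(\<integral>\<^sup>+ x. ennreal (g x powr q) \<partial>M) <= ennreal (b powr q)"
 shows "(\<integral>\<^sup>+ x. ennreal (f x * g x) \<partial>M) <= ennreal (a * b)"
proof -
 let ?\<alpha> = "a * b / (p * a powr p)" and ?\<beta> = "a * b / (q * b powr q)"
 have le: "f x * g x <= ?\<alpha> * f x powr p + ?\<beta> * g x powr q" for x
 proof -
  have "f x / a * (g x / b) <= (f x / a) powr p / p + (g x / b) powr q / q"
   using Youngs_inequality[of p q "f x / a" "g x / b"] pq nn a b by simp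
  then have "a * b * (f x / a * (g x / b)) <= a * b * ((f x / a) powr p / p + (g x / b) powr q / q)"
   using a b by (intro mult_left_mono) auto
  then show ?thesis using a b nn by (simp add: powr_divide field_simps)
 qed
 have "(\<integral>\<^sup>+ x. ennreal (f x * g x) \<partial>M) <= (\<integral>\<^sup>+ x. ennreal (?\<alpha> * f x powr p + ?\<beta> * g x powr q) \<partial>M)"
  by (intro nn_integral_mono ennreal_leI le)
 also have "\<dots> <= ennreal (?\<alpha> * a powr p + ?\<beta> * b powr q)"
  by (rule nn_integral_combination_le) (use a b pq f g in auto)
 also have "?\<alpha> * a powr p + ?\<beta> * b powr q = a * b * (1 / p + 1 / q)"
  using a b pq by (simp add: field_simps)
 finally show ?thesis by (simp add: pq)
qed

text \<open>If x or y is 0 the claim reduces to \<open>w powr p <= w\<close> for w in [0, 1];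
  positive arguments fall under the convexity of the power.\<close>

lemma powr_convex_nonneg:
 fixes x y :: real
 assumes p: "1 <= p" and xy: "0 <= x" "0 <= y" and t: "0 <= t" "t <= 1"
 shows "((1 - t) * x + t * y) powr p <= (1 - t) * x powr p + t * y powr p"
proof -
 have less: "w powr p <= w" if "0 <= w" "w <= 1" for w :: real
  using powr_mono'[of 1 p w] p that by simp
 consider "x = 0" | "y = 0" | "0 < x" "0 < y" using xy by fastforce
 then show ?thesis
 proof cases
  case 1
  then show ?thesis using mult_right_mono[OF less[OF t], of "y powr p"] xy t by (simp add: powr_mult)
 next
  case 2
  then show ?thesis using mult_right_mono[OF less[of "1 - t"], of "x powr p"] xy t by (simp add: powr_mult)
 next
  case 3
  then show ?thesis using convex_onD[OF powr_convex[OF p], of t x y] t by simp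
 qed
qed

text \<open>Convexity of the p-th power with the weights a / (a + b) and b / (a + b), applied to f /
  a and g / b.\<close>

lemma nn_integral_Minkowski:
 assumes [measurable]: "f \<in> borel_measurable M" "g \<in> borel_measurable M"
  and nn: "!!x. 0 <= f x" "!!x. 0 <= g x" and a: "0 < a" and b: "0 < b"
  and p: "1 <= p"
  and f: "(\<integral>\<^sup>+ x. ennreal (f x powr p) \<partial>M) <= ennreal (a powr p)"
  and g: "(\<integral>\<^sup>+ x. ennreal (g x powr p) \<partial>M) <= ennreal (b powr p)"
 shows "(\<integral>\<^sup>+ x. ennreal ((f x + g x) powr p) \<partial>M) <= ennreal ((a + b) powr p)"
proof -
 let ?c = "(a + b) powr p"
 let ?\<alpha> = "?c * (a / (a + b)) / a powr p" and ?\<beta> = "?c * (b / (a + b)) / b powr p"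
 have le: "(f x + g x) powr p <= ?\<alpha> * f x powr p + ?\<beta> * g x powr p" for x
 proof -
  have e: "1 - b / (a + b) = a / (a + b)" using a b by (simp add: field_simps)
  have conv: "(a / (a + b) * (f x / a) + b / (a + b) * (g x / b)) powr p
    <= a / (a + b) * (f x / a) powr p + b / (a + b) * (g x / b) powr p"
   using powr_convex_nonneg[of p "f x / a" "g x / b" "b / (a + b)"] p a b nn by (simp add: e)
  have "(a + b) * (a / (a + b) * (f x / a) + b / (a + b) * (g x / b)) = f x + g x"
   using a b by (simp add: distrib_left)
  then have "(f x + g x) powr p = ((a + b) * (a / (a + b) * (f x / a) + b / (a + b) * (g x / b))) powr p"
   by simp
  also have "\<dots> = ?c * (a / (a + b) * (f x / a) + b / (a + b) * (g x / b)) powr p"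
   by (rule powr_mult)
  also have "\<dots> <= ?c * (a / (a + b) * (f x / a) powr p + b / (a + b) * (g x / b) powr p)"
   by (rule mult_left_mono[OF conv]) simp
  also have "\<dots> = ?\<alpha> * f x powr p + ?\<beta> * g x powr p"
   using a b nn by (simp add: powr_divide field_simps)
  finally show ?thesis .
 qed
 have "(\<integral>\<^sup>+ x. ennreal ((f x + g x) powr p) \<partial>M) <= (\<integral>\<^sup>+ x. ennreal (?\<alpha> * f x powr p + ?\<beta> * g x powr p) \<partial>M)"
  by (intro nn_integral_mono ennreal_leI le)
 also have "\<dots> <= ennreal (?\<alpha> * a powr p + ?\<beta> * b powr p)"
  by (rule nn_integral_combination_le) (use a b f g in auto)
 also have "?\<alpha> * a powr p + ?\<beta> * b powr p = ?c"
 proof -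
  have "?\<alpha> * a powr p + ?\<beta> * b powr p = ?c * (a / (a + b) + b / (a + b))"
   using a b by (simp only: distrib_left) simp
  also have "a / (a + b) + b / (a + b) = 1" using a b by (simp add: add_divide_distrib[symmetric])
  finally show ?thesis by simp
 qed
 finally show ?thesis .
qed

section \<open>Sublinear functionals and signed densities\<close>

text \<open>Homogeneity is only asked as an inequality for positive factors; applying it to the
  inverse factor as well gives equality in \<open>sublinear_on_scale\<close>. Nothing ties N (- g)
  to N g, since the Finsler norm is not reversible.\<close>

definition sublinear_on :: "('z => 'v::real_vector) set => (('z => 'v) => real) => bool" where
 "sublinear_on X N \<longleftrightarrow>
   (\<forall>g\<in>X. \<forall>h\<in>X. N (\<lambda>z. g z + h z) <= N g + N h) \<and>
   (\<forall>g\<in>X. \<forall>c>0. N (\<lambda>z. c *\<^sub>R g z) <= c * N g)"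

locale function_space =
 fixes X :: "('z => 'v::real_vector) set"
 assumes zero: "(\<lambda>_. 0) \<in> X"
  and add: "!!g h. g \<in> X ==> h \<in> X ==> (\<lambda>z. g z + h z) \<in> X"
  and scale: "!!c g. g \<in> X ==> (\<lambda>z. c *\<^sub>R g z) \<in> X"
begin

lemma neg: "g \<in> X ==> (\<lambda>z. - g z) \<in> X"
 using scale[of g "-1"] by simp

lemma sublinear_on_scale:
 assumes N: "sublinear_on X N" and g: "g \<in> X" and c: "0 <= c"
 shows "N (\<lambda>z. c *\<^sub>R g z) = c * N g"
proof (cases "c = 0")
 case True
 have "N (\<lambda>_. 0) <= 1/2 * N (\<lambda>_. 0)" "N (\<lambda>_. 0) <= 2 * N (\<lambda>_. 0)"
  using N zero unfolding sublinear_on_def by (force dest!: bspec[of X _ "\<lambda>_. 0"] spec[of _ "1/2"], force)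
 then show ?thesis using True by simp
next
 case False
 then have c: "0 < c" using c by simp
 have "N (\<lambda>z. c *\<^sub>R g z) <= c * N g" using N g c by (simp add: sublinear_on_def)
 moreover have "N (\<lambda>z. inverse c *\<^sub>R (c *\<^sub>R g z)) <= inverse c * N (\<lambda>z. c *\<^sub>R g z)"
  using N scale[OF g, of c] c by (simp add: sublinear_on_def del: scaleR_scaleR)
 ultimately show ?thesis using c by (simp add: field_simps)
qed

lemma sublinear_on_zero: "sublinear_on X N ==> N (\<lambda>_. 0) = 0"
 using sublinear_on_scale[OF _ zero, of N 0] by simp

lemma sublinear_on_add:
 "sublinear_on X N ==> g \<in> X ==> h \<in> X ==> N (\<lambda>z. g z + h z) <= N g + N h"
 by (simp add: sublinear_on_def)

lemma sublinear_on_neg: "sublinear_on X N ==> g \<in> X ==> - N (\<lambda>z. - g z) <= N g"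
 using sublinear_on_add[of N g "\<lambda>z. - g z"] neg[of g] sublinear_on_zero[of N] by simp

text \<open>The lowered functional of the Hahn-Banach argument: a linear functional below it takes
  at least the value a at r for every pair (r, a) of \<open>R\<close>, as the choice g = - r shows.
  It is set to 0 off \<open>X\<close> so that functionals agreeing on \<open>X\<close> are
  equal.\<close>

definition lower_by :: "(('z => 'v) \<times> real) set => (('z => 'v) => real) => ('z => 'v) => real" where
 "lower_by R N g = (if g \<in> X then INF (r, a)\<in>R. N (\<lambda>z. g z + r z) - a else 0)"

text \<open>Prescribed values, kept as pairs. Asking only for a cone lets the same lowering serve a
  single ray in \<open>minimal_sublinear\<close> and a set closed under negation in
  \<open>hahn_banach\<close>.\<close>

definition dominated_cone :: "(('z => 'v) \<times> real) set => (('z => 'v) => real) => bool" where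
 "dominated_cone R N \<longleftrightarrow> ((\<lambda>_. 0), 0) \<in> R \<and> (\<forall>g a. (g, a) \<in> R --> g \<in> X \<and> a <= N g) \<and>
   (\<forall>g a h b. (g, a) \<in> R --> (h, b) \<in> R --> ((\<lambda>z. g z + h z), a + b) \<in> R) \<and>
   (\<forall>g a c. (g, a) \<in> R --> 0 < c --> ((\<lambda>z. c *\<^sub>R g z), c * a) \<in> R)"

text \<open>The infimum is finite because a <= N r <= N (g + r) + N (- g), so that - N (- g) is a
  lower bound. Subadditivity adds two elements of the cone, homogeneity scales one.\<close>

lemma lower_by:
 assumes N: "sublinear_on X N" and R: "dominated_cone R N"
 shows "sublinear_on X (lower_by R N)"
  and "g \<in> X ==> lower_by R N g <= N g"
  and "g \<in> X ==> (r, a) \<in> R ==> lower_by R N g <= N (\<lambda>z. g z + r z) - a"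
proof -
 have RX: "r \<in> X" "a <= N r" if "(r, a) \<in> R" for r a
  using R that unfolding dominated_cone_def by blast+
 have R0: "((\<lambda>_. 0), 0) \<in> R" using R unfolding dominated_cone_def by blast
 have Radd: "((\<lambda>z. g z + h z), a + b) \<in> R" if "(g, a) \<in> R" "(h, b) \<in> R" for g h a b
  using R that unfolding dominated_cone_def by blast
 have Rsc: "((\<lambda>z. c *\<^sub>R g z), c * a) \<in> R" if "(g, a) \<in> R" "0 < c" for g a c
  using R that unfolding dominated_cone_def by blast
 have bdd: "bdd_below ((\<lambda>(r, a). N (\<lambda>z. g z + r z) - a) ` R)" if g: "g \<in> X" for g
 proof (rule bdd_belowI2[of _ "- N (\<lambda>z. - g z)"], clarify)
  fix r a assume ra: "(r, a) \<in> R"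
  have "N (\<lambda>z. (g z + r z) + - g z) <= N (\<lambda>z. g z + r z) + N (\<lambda>z. - g z)"
   by (intro sublinear_on_add[OF N] add neg g RX[OF ra])
  then show "- N (\<lambda>z. - g z) <= N (\<lambda>z. g z + r z) - a" using RX(2)[OF ra] by simp
 qed
 show le: "lower_by R N g <= N (\<lambda>z. g z + r z) - a" if "g \<in> X" "(r, a) \<in> R" for g r a
  using cINF_lower[OF bdd[OF that(1)] that(2)] that by (simp add: lower_by_def)
 show "lower_by R N g <= N g" if "g \<in> X" using le[OF that R0] by simp
 have ge: "b <= lower_by R N g" if "g \<in> X" "!!r a. (r, a) \<in> R ==> b <= N (\<lambda>z. g z + r z) - a" for b g
  unfolding lower_by_def using that R0 by (auto intro!: cINF_greatest)
 show "sublinear_on X (lower_by R N)"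
  unfolding sublinear_on_def
 proof (intro conjI ballI allI impI)
  fix g h assume gh: "g \<in> X" "h \<in> X"
  have "lower_by R N (\<lambda>z. g z + h z) - lower_by R N g <= lower_by R N h"
  proof (rule ge[OF gh(2)])
   fix r a assume ra: "(r, a) \<in> R"
   have "lower_by R N (\<lambda>z. g z + h z) - (N (\<lambda>z. h z + r z) - a) <= lower_by R N g"
   proof (rule ge[OF gh(1)])
    fix s b assume sb: "(s, b) \<in> R"
    have "lower_by R N (\<lambda>z. g z + h z) <= N (\<lambda>z. (g z + h z) + (s z + r z)) - (b + a)"
     by (rule le[OF add[OF gh] Radd[OF sb ra]])
    moreover have "N (\<lambda>z. (g z + s z) + (h z + r z)) <= N (\<lambda>z. g z + s z) + N (\<lambda>z. h z + r z)"
     by (intro sublinear_on_add[OF N] add gh RX[OF ra] RX[OF sb])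
    moreover have "(\<lambda>z. (g z + s z) + (h z + r z)) = (\<lambda>z. (g z + h z) + (s z + r z))"
     by (simp add: algebra_simps)
    ultimately show "lower_by R N (\<lambda>z. g z + h z) - (N (\<lambda>z. h z + r z) - a) <= N (\<lambda>z. g z + s z) - b"
     by simp
   qed
   then show "lower_by R N (\<lambda>z. g z + h z) - lower_by R N g <= N (\<lambda>z. h z + r z) - a" by simp
  qed
  then show "lower_by R N (\<lambda>z. g z + h z) <= lower_by R N g + lower_by R N h" by simp
 next
  fix g and c :: real assume g: "g \<in> X" and c: "0 < c"
  have "lower_by R N (\<lambda>z. c *\<^sub>R g z) / c <= lower_by R N g"
  proof (rule ge[OF g])
   fix r a assume ra: "(r, a) \<in> R"
   have "lower_by R N (\<lambda>z. c *\<^sub>R g z) <= N (\<lambda>z. c *\<^sub>R g z + c *\<^sub>R r z) - c * a"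
    by (rule le[OF scale[OF g] Rsc[OF ra c]])
   also have "(\<lambda>z. c *\<^sub>R g z + c *\<^sub>R r z) = (\<lambda>z. c *\<^sub>R (g z + r z))" by (simp add: scaleR_add_right)
   also have "N \<dots> = c * N (\<lambda>z. g z + r z)"
    using c by (intro sublinear_on_scale[OF N] add g RX[OF ra]) simp
   finally show "lower_by R N (\<lambda>z. c *\<^sub>R g z) / c <= N (\<lambda>z. g z + r z) - a"
    using c by (simp add: field_simps)
  qed
  then show "lower_by R N (\<lambda>z. c *\<^sub>R g z) <= c * lower_by R N g"
   using c by (simp add: field_simps)
 qed
qed

text \<open>A minimal sublinear functional is linear, because lowering it along the ray through \<open>h\<close>
 cannot change it.\<close>

lemma minimal_sublinear:
 assumes N: "sublinear_on X N"
 obtains L where "!!g. g \<in> X ==> L g <= N g"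
  "!!g h. g \<in> X ==> h \<in> X ==> L (\<lambda>z. g z + h z) = L g + L h"
  "!!c g. g \<in> X ==> L (\<lambda>z. c *\<^sub>R g z) = c * L g"
proof -
 \<comment> \<open>Fixing the value 0 off \<open>X\<close> makes functionals that agree on
   \<open>X\<close> equal, as a minimal element in the sense of Zorn's lemma demands.\<close>
 define S where "S = {p. sublinear_on X p \<and> (\<forall>g\<in>X. p g <= N g) \<and> (\<forall>g. g \<notin> X --> p g = 0)}"
 define P where "P p q \<longleftrightarrow> (\<forall>g. q g <= p g)" for p q :: "('z => 'v) => real"
 have "\<exists>L\<in>S. \<forall>q\<in>S. P L q --> q = L"
 proof (rule predicate_Zorn)
  show "partial_order_on S (relation_of P S)"
   by (rule partial_order_on_relation_ofI) (auto simp: P_def fun_eq_iff intro: order_trans antisym)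
  fix C assume C: "C \<in> Chains (relation_of P S)"
  have CS: "C \<subseteq> S" using C by (auto simp: Chains_def relation_of_def)
  have CC: "P p q \<or> P q p" if "p \<in> C" "q \<in> C" for p q
   using C that by (auto simp: Chains_def relation_of_def)
  show "\<exists>u\<in>S. \<forall>a\<in>C. P a u"
  proof (cases "C = {}")
   case True
   have "(\<lambda>g. if g \<in> X then N g else 0) \<in> S"
    using N by (auto simp: S_def sublinear_on_def add scale)
   then show ?thesis using True by blast
  next
   case False
   define u where "u g = (INF p\<in>C. p g)" for g
   have bdd: "bdd_below ((\<lambda>p. p g) ` C)" for g
   proof (rule bdd_belowI2[of _ "if g \<in> X then - N (\<lambda>z. - g z) else 0"])
    fix p assume "p \<in> C"
    then have p: "p \<in> S" using CS by blast
    then show "(if g \<in> X then - N (\<lambda>z. - g z) else 0) <= p g"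
     using sublinear_on_neg[of p g] neg[of g] by (force simp: S_def)
   qed
   have lo: "u g <= p g" if "p \<in> C" for p g unfolding u_def by (rule cINF_lower[OF bdd that])
   have gr: "b <= u g" if "!!p. p \<in> C ==> b <= p g" for b g
    unfolding u_def by (rule cINF_greatest[OF False that])
   obtain p0 where p0: "p0 \<in> C" using False by blast
   have "sublinear_on X u"
    unfolding sublinear_on_def
   proof (intro conjI ballI allI impI)
    fix g h assume gh: "g \<in> X" "h \<in> X"
    have *: "u (\<lambda>z. g z + h z) <= p g + q h" if pq: "p \<in> C" "q \<in> C" for p q
    proof -
     obtain r where r: "r \<in> C" "P p r" "P q r"
      using CC[OF pq] pq by (auto simp: P_def)
     have "u (\<lambda>z. g z + h z) <= r (\<lambda>z. g z + h z)" by (rule lo[OF r(1)])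
     also have "\<dots> <= r g + r h" using CS r(1) gh by (auto simp: S_def intro!: sublinear_on_add)
     also have "\<dots> <= p g + q h" using r by (intro add_mono) (auto simp: P_def)
     finally show ?thesis .
    qed
    have "u (\<lambda>z. g z + h z) - u g <= u h"
    proof (rule gr)
     fix q assume q: "q \<in> C"
     have "u (\<lambda>z. g z + h z) - q h <= u g" by (rule gr) (use *[OF _ q] in force)
     then show "u (\<lambda>z. g z + h z) - u g <= q h" by simp
    qed
    then show "u (\<lambda>z. g z + h z) <= u g + u h" by simp
   next
    fix g and c :: real assume g: "g \<in> X" and c: "0 < c"
    have "u (\<lambda>z. c *\<^sub>R g z) / c <= u g"
    proof (rule gr)
     fix p assume p: "p \<in> C"
     have "u (\<lambda>z. c *\<^sub>R g z) <= p (\<lambda>z. c *\<^sub>R g z)" by (rule lo[OF p])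
     also have "\<dots> = c * p g" using CS p g c by (intro sublinear_on_scale) (auto simp: S_def)
     finally show "u (\<lambda>z. c *\<^sub>R g z) / c <= p g" using c by (simp add: field_simps)
    qed
    then show "u (\<lambda>z. c *\<^sub>R g z) <= c * u g" using c by (simp add: field_simps)
   qed
   moreover have "\<forall>g\<in>X. u g <= N g"
   proof
    fix g assume "g \<in> X"
    then have "p0 g <= N g" using CS p0 by (auto simp: S_def)
    then show "u g <= N g" using lo[OF p0, of g] by simp
   qed
   moreover have "u g = 0" if "g \<notin> X" for g
   proof -
    have "p g = 0" if "p \<in> C" for p using CS that \<open>g \<notin> X\<close> by (auto simp: S_def)
    then have "(INF p\<in>C. p g) = (INF p\<in>C. 0)" by (intro INF_cong) auto
    then show ?thesis using False by (simp add: u_def)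
   qed
   ultimately have "u \<in> S" by (simp add: S_def)
   then show ?thesis using lo by (auto simp: P_def)
  qed
 qed
 then obtain L where L: "L \<in> S" "!!q. q \<in> S ==> P L q ==> q = L" by blast
 have Ls: "sublinear_on X L" and LN: "!!g. g \<in> X ==> L g <= N g" and L0: "!!g. g \<notin> X ==> L g = 0"
  using L(1) by (auto simp: S_def)
 have ge: "L g + L h <= L (\<lambda>z. g z + h z)" if gh: "g \<in> X" "h \<in> X" for g h
 proof -
  define R where "R = {((\<lambda>z. t *\<^sub>R h z), t * L h) | t. 0 <= t}"
  have "dominated_cone R L"
   unfolding dominated_cone_def
  proof (intro conjI)
   show "((\<lambda>_. 0), 0) \<in> R" by (auto simp: R_def intro!: exI[of _ 0])
   show "\<forall>g a. (g, a) \<in> R --> g \<in> X \<and> a <= L g"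
    using gh sublinear_on_scale[OF Ls gh(2)] by (auto simp: R_def scale)
   show "\<forall>g a k b. (g, a) \<in> R --> (k, b) \<in> R --> ((\<lambda>z. g z + k z), a + b) \<in> R"
   proof (intro allI impI)
    fix g a k b assume "(g, a) \<in> R" "(k, b) \<in> R"
    then obtain t s where "g = (\<lambda>z. t *\<^sub>R h z)" "a = t * L h" "0 <= t" "k = (\<lambda>z. s *\<^sub>R h z)" "b = s * L h" "0 <= s"
     unfolding R_def by blast
    then have "(\<lambda>z. g z + k z) = (\<lambda>z. (t + s) *\<^sub>R h z)" "a + b = (t + s) * L h" "0 <= t + s"
     by (simp_all add: scaleR_add_left distrib_right)
    then show "((\<lambda>z. g z + k z), a + b) \<in> R" unfolding R_def by blast
   qed
   show "\<forall>g a c. (g, a) \<in> R --> 0 < c --> ((\<lambda>z. c *\<^sub>R g z), c * a) \<in> R"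
   proof (intro allI impI)
    fix g a and c :: real assume "(g, a) \<in> R" "0 < c"
    then obtain t where "g = (\<lambda>z. t *\<^sub>R h z)" "a = t * L h" "0 <= t"
     unfolding R_def by blast
    then have "(\<lambda>z. c *\<^sub>R g z) = (\<lambda>z. (c * t) *\<^sub>R h z)" "c * a = (c * t) * L h" "0 <= c * t"
     using \<open>0 < c\<close> by simp_all
    then show "((\<lambda>z. c *\<^sub>R g z), c * a) \<in> R" unfolding R_def by blast
   qed
  qed
  note lb = lower_by[OF Ls this]
  have "lower_by R L \<in> S"
   using lb(1) order_trans[OF lb(2) LN] by (auto simp: S_def lower_by_def[of _ _ g for g])
  moreover have "P L (lower_by R L)"
   unfolding P_def using lb(2) L0 by (auto simp: lower_by_def[of _ _ g for g])
  ultimately have eq: "lower_by R L = L" using L(2) by blast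
  \<comment> \<open>With t = 1 on the ray, the lowered functional at g is at most L (g + h) - L h;
    by minimality it is still L g, and this is superadditivity.\<close>
  have "(h, L h) \<in> R" by (auto simp: R_def intro!: exI[of _ 1])
  from lb(3)[OF gh(1) this] eq show ?thesis by simp
 qed
 have Ladd: "L (\<lambda>z. g z + h z) = L g + L h" if "g \<in> X" "h \<in> X" for g h
  using ge[OF that] sublinear_on_add[OF Ls that] by simp
 have Lneg: "L (\<lambda>z. - g z) = - L g" if "g \<in> X" for g
  using Ladd[OF that neg[OF that]] sublinear_on_zero[OF Ls] by simp
 have Lsc: "L (\<lambda>z. c *\<^sub>R g z) = c * L g" if "g \<in> X" for c g
 proof (cases "0 <= c")
  case True
  then show ?thesis by (rule sublinear_on_scale[OF Ls that])
 next
  case False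
  then have "L (\<lambda>z. (- c) *\<^sub>R g z) = - c * L g" by (intro sublinear_on_scale[OF Ls that]) simp
  moreover have "L (\<lambda>z. - (c *\<^sub>R g z)) = - L (\<lambda>z. c *\<^sub>R g z)" by (rule Lneg[OF scale[OF that]])
  ultimately show ?thesis by simp
 qed
 show ?thesis by (rule that[OF LN Ladd Lsc])
qed

text \<open>Take a linear functional below the lowered one. A pair (g, a) of \<open>R\<close> gives
  L (- g) <= N 0 - a = - a, that is a <= L g; the same for (- g, - a) gives equality.\<close>

lemma hahn_banach:
 assumes N: "sublinear_on X N" and R: "dominated_cone R N"
  and Rneg: "!!g a. (g, a) \<in> R ==> ((\<lambda>z. - g z), - a) \<in> R"
 obtains L where "!!g. g \<in> X ==> L g <= N g"
  "!!g h. g \<in> X ==> h \<in> X ==> L (\<lambda>z. g z + h z) = L g + L h"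
  "!!c g. g \<in> X ==> L (\<lambda>z. c *\<^sub>R g z) = c * L g"
  "!!g a. (g, a) \<in> R ==> L g = a"
proof -
 note lb = lower_by[OF N R]
 obtain L where L: "!!g. g \<in> X ==> L g <= lower_by R N g"
  "!!g h. g \<in> X ==> h \<in> X ==> L (\<lambda>z. g z + h z) = L g + L h"
  "!!c g. g \<in> X ==> L (\<lambda>z. c *\<^sub>R g z) = c * L g"
  by (rule minimal_sublinear[OF lb(1)]) (rule that)
 have RX: "g \<in> X" if "(g, a) \<in> R" for g a using R that unfolding dominated_cone_def by blast
 have ge: "a <= L g" if ga: "(g, a) \<in> R" for g a
 proof -
  have "L (\<lambda>z. - g z) <= lower_by R N (\<lambda>z. - g z)" by (rule L(1)[OF neg[OF RX[OF ga]]])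
  also have "\<dots> <= N (\<lambda>z. - g z + g z) - a" by (rule lb(3)[OF neg[OF RX[OF ga]] ga])
  also have "\<dots> = - a" using sublinear_on_zero[OF N] by simp
  finally show ?thesis using L(3)[OF RX[OF ga], of "-1"] by simp
 qed
 have La: "L g = a" if ga: "(g, a) \<in> R" for g a
 proof -
  have "- a <= L (\<lambda>z. - g z)" by (rule ge[OF Rneg[OF ga]])
  then show ?thesis using ge[OF ga] L(3)[OF RX[OF ga], of "-1"] by simp
 qed
 show ?thesis by (rule that[OF order_trans[OF L(1) lb(2)] L(2,3) La])
qed

end

section \<open>Densities of real-valued set functions\<close>

lemma Radon_Nikodym_real_nonneg:
 assumes fin: "finite_measure M" and P0: "!!A. A \<in> sets M ==> 0 <= P A"
  and cadd: "!!A::nat => 'z set. range A \<subseteq> sets M ==> disjoint_family A ==> (\<lambda>i. P (A i)) sums P (\<Union>i. A i)"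
  and null: "!!A. A \<in> null_sets M ==> P A = (0::real)"
 obtains v :: "'z => real" where "integrable M v" "!!A. A \<in> sets M ==> P A = (LINT z:A|M. v z)"
proof -
 interpret finite_measure M by fact
 let ?N = "measure_of (space M) (sets M) (\<lambda>A. ennreal (P A))"
 have N: "emeasure ?N A = ennreal (P A)" if "A \<in> sets M" for A
 proof (rule emeasure_measure_of_sigma)
  show "sigma_algebra (space M) (sets M)" by (rule sets.sigma_algebra_axioms)
  show "positive (sets M) (\<lambda>A. ennreal (P A))" using null[of "{}"] by (simp add: positive_def)
  show "countably_additive (sets M) (\<lambda>A. ennreal (P A))"
  proof (rule countably_additiveI)
   fix A :: "nat => 'z set" assume A: "range A \<subseteq> sets M" "disjoint_family A" "(\<Union>i. A i) \<in> sets M"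
   then show "(\<Sum>i. ennreal (P (A i))) = ennreal (P (\<Union>i. A i))"
    using cadd[OF A(1,2)] P0 by (intro suminf_ennreal_eq) auto
  qed
 qed fact
 have sN: "sets ?N = sets M" by simp
 have finN: "finite_measure ?N" by (rule finite_measureI) (simp add: N)
 have ac: "absolutely_continuous M ?N"
  unfolding absolutely_continuous_def by (auto simp: null_sets_def N null)
 obtain g where g[measurable]: "g \<in> borel_measurable M"
  and gRN: "AE x in M. RN_deriv M ?N x = ennreal (g x)" and g0: "!!x. 0 <= g x"
  using real_RN_deriv[OF finN ac sN] by auto
 have Ng: "?N = density M (\<lambda>x. ennreal (g x))"
 proof -
  have "?N = density M (RN_deriv M ?N)" using density_RN_deriv[OF ac sN] by simp
  also have "\<dots> = density M (\<lambda>x. ennreal (g x))" by (rule density_cong) (use gRN in auto)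
  finally show ?thesis .
 qed
 have PI: "ennreal (P A) = (\<integral>\<^sup>+ x. ennreal (indicator A x *\<^sub>R g x) \<partial>M)" if A: "A \<in> sets M" for A
 proof -
  have "ennreal (P A) = emeasure (density M (\<lambda>x. ennreal (g x))) A" using N[OF A] Ng by simp
  also have "\<dots> = (\<integral>\<^sup>+ x. ennreal (g x) * indicator A x \<partial>M)" by (rule emeasure_density) (use A in auto)
  finally show ?thesis by (auto intro!: nn_integral_cong simp: indicator_def)
 qed
 have gi: "integrable M g"
 proof (rule integrableI_nonneg)
  have "(\<integral>\<^sup>+ x. ennreal (g x) \<partial>M) = ennreal (P (space M))"
   by (subst PI) (auto intro!: nn_integral_cong simp: indicator_def)
  then show "(\<integral>\<^sup>+ x. ennreal (g x) \<partial>M) < \<infinity>" by simp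
 qed (use g0 in auto)
 have "P A = (LINT z:A|M. g z)" if A: "A \<in> sets M" for A
 proof -
  have "integrable M (\<lambda>x. indicator A x *\<^sub>R g x)" by (rule integrable_mult_indicator[OF A gi])
  then have "ennreal (P A) = ennreal (LINT z:A|M. g z)"
   unfolding PI[OF A] set_lebesgue_integral_def by (intro nn_integral_eq_integral) (auto simp: g0)
  moreover have "0 <= (LINT z:A|M. g z)"
   unfolding set_lebesgue_integral_def by (intro Bochner_Integration.integral_nonneg) (simp add: g0)
  ultimately show ?thesis using P0[OF A] by simp
 qed
 then show ?thesis by (rule that[OF gi])
qed

text \<open>The positive part \<open>A \<mapsto> sup {\<nu> B | B \<subseteq> A}\<close> of the Jordan decomposition reduces the signed case
 to the nonnegative one.\<close>

lemma Radon_Nikodym_signed: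
 assumes fin: "finite_measure M" and bnd: "!!A. A \<in> sets M ==> \<bar>\<nu> A\<bar> <= (K::real)"
  and cadd: "!!A::nat => 'z set. range A \<subseteq> sets M ==> disjoint_family A ==> (\<lambda>i. \<nu> (A i)) sums \<nu> (\<Union>i. A i)"
  and add: "!!A B. A \<in> sets M ==> B \<in> sets M ==> A \<inter> B = {} ==> \<nu> (A \<union> B) = \<nu> A + \<nu> B"
  and null: "!!A. A \<in> null_sets M ==> \<nu> A = 0"
 obtains v :: "'z => real" where "integrable M v" "!!A. A \<in> sets M ==> \<nu> A = (LINT z:A|M. v z)"
proof -
 define sub where "sub A = {B \<in> sets M. B \<subseteq> A}" for A
 define P where "P A = (SUP B\<in>sub A. \<nu> B)" for A
 have bdd: "bdd_above (\<nu> ` sub A)" for A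
  by (rule bdd_aboveI2[of _ _ K]) (use bnd in \<open>force simp: sub_def abs_le_iff\<close>)
 have up: "\<nu> B <= P A" if "B \<in> sub A" for A B unfolding P_def by (rule cSUP_upper[OF that bdd])
 have emp: "{} \<in> sub A" for A by (simp add: sub_def)
 have lst: "P A <= b" if "!!B. B \<in> sub A ==> \<nu> B <= b" for A b
  unfolding P_def by (rule cSUP_least) (use emp that in auto)
 have n0: "\<nu> {} = 0" by (rule null) simp
 have P0: "0 <= P A" for A using up[OF emp, of A] n0 by simp
 have Pmono: "P A <= P B" if "A \<subseteq> B" for A B
  by (rule lst, rule up) (use that in \<open>auto simp: sub_def\<close>)
 have Padd: "P (A \<union> B) = P A + P B" if AB: "A \<in> sets M" "B \<in> sets M" "A \<inter> B = {}" for A B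
 proof (rule antisym)
  show "P (A \<union> B) <= P A + P B"
  proof (rule lst)
   fix C assume C: "C \<in> sub (A \<union> B)"
   then have "C = (C \<inter> A) \<union> (C \<inter> B)" by (auto simp: sub_def)
   then have "\<nu> C = \<nu> (C \<inter> A) + \<nu> (C \<inter> B)"
    using add[of "C \<inter> A" "C \<inter> B"] C AB by (auto simp: sub_def)
   also have "\<dots> <= P A + P B" by (intro add_mono up) (use C AB in \<open>auto simp: sub_def\<close>)
   finally show "\<nu> C <= P A + P B" .
  qed
  have "P A <= P (A \<union> B) - P B"
  proof (rule lst)
   fix C assume C: "C \<in> sub A"
   have "P B <= P (A \<union> B) - \<nu> C"
   proof (rule lst)
    fix D assume D: "D \<in> sub B"
    have "\<nu> C + \<nu> D = \<nu> (C \<union> D)"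
     by (rule add[symmetric]) (use C D AB in \<open>auto simp: sub_def\<close>)
    also have "\<dots> <= P (A \<union> B)" by (rule up) (use C D in \<open>auto simp: sub_def\<close>)
    finally show "\<nu> D <= P (A \<union> B) - \<nu> C" by simp
   qed
   then show "\<nu> C <= P (A \<union> B) - P B" by simp
  qed
  then show "P A + P B <= P (A \<union> B)" by simp
 qed
 have Psums: "(\<lambda>i. P (A i)) sums P (\<Union>i. A i)"
  if A: "range A \<subseteq> sets M" "disjoint_family A" for A :: "nat => 'z set"
 proof -
  have fs: "(\<Sum>i<n. P (A i)) = P (\<Union>i<n. A i)" for n
  proof (induction n)
   case 0
   have "P {} <= 0" by (rule lst) (auto simp: sub_def n0)
   then show ?case using P0[of "{}"] by simp
  next
   case (Suc n)
   have "A i \<inter> A n = {}" if "i < n" for i using A(2) that by (simp add: disjoint_family_on_def)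
   then have "(\<Union>i<n. A i) \<inter> A n = {}" by blast
   then have "P ((\<Union>i<n. A i) \<union> A n) = P (\<Union>i<n. A i) + P (A n)"
    using A(1) by (intro Padd sets.finite_UN) auto
   moreover have "(\<Union>i<Suc n. A i) = (\<Union>i<n. A i) \<union> A n" by (auto simp: less_Suc_eq)
   ultimately show ?case using Suc by simp
  qed
  have le: "(\<Sum>i<n. P (A i)) <= P (\<Union>i. A i)" for n
   unfolding fs by (rule Pmono) auto
  have sm: "summable (\<lambda>i. P (A i))"
   by (rule summableI_nonneg_bounded[OF P0 le])
  have "P (\<Union>i. A i) <= (\<Sum>i. P (A i))"
  proof (rule lst)
   fix B assume B: "B \<in> sub (\<Union>i. A i)"
   then have "(\<Union>i. B \<inter> A i) = B" by (auto simp: sub_def)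
   moreover have "(\<lambda>i. \<nu> (B \<inter> A i)) sums \<nu> (\<Union>i. B \<inter> A i)"
    by (rule cadd) (use A B in \<open>auto simp: sub_def disjoint_family_on_def\<close>)
   ultimately have s: "(\<lambda>i. \<nu> (B \<inter> A i)) sums \<nu> B" by simp
   have "(\<Sum>i. \<nu> (B \<inter> A i)) <= (\<Sum>i. P (A i))"
    by (rule suminf_le[OF _ sums_summable[OF s] sm]) (use A B in \<open>auto intro!: up simp: sub_def\<close>)
   then show "\<nu> B <= (\<Sum>i. P (A i))" using sums_unique[OF s] by simp
  qed
  moreover have "(\<Sum>i. P (A i)) <= P (\<Union>i. A i)" by (rule suminf_le_const[OF sm le])
  ultimately have "(\<Sum>i. P (A i)) = P (\<Union>i. A i)" by (rule antisym[rotated])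
  then show ?thesis using summable_sums[OF sm] by simp
 qed
 have Pnull: "P A = 0" if A: "A \<in> null_sets M" for A
 proof -
  have "P A <= 0"
  proof (rule lst)
   fix B assume "B \<in> sub A"
   then have "B \<in> null_sets M" using null_sets_subset[OF A, of B] by (simp add: sub_def)
   then show "\<nu> B <= 0" using null by simp
  qed
  then show ?thesis using P0[of A] by simp
 qed
 obtain v1 :: "'z => real" where v1: "integrable M v1" "!!A. A \<in> sets M ==> P A = (LINT z:A|M. v1 z)"
  by (rule Radon_Nikodym_real_nonneg[OF fin P0 Psums Pnull]) (assumption | rule that)+
 \<comment> \<open>P - \<nu> is the negative part: it is nonnegative since A is one of its own
   subsets.\<close>
 obtain v2 :: "'z => real" where v2: "integrable M v2" "!!A. A \<in> sets M ==> P A - \<nu> A = (LINT z:A|M. v2 z)"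
 proof (rule Radon_Nikodym_real_nonneg[OF fin, of "\<lambda>A. P A - \<nu> A"])
  show "0 <= P A - \<nu> A" if "A \<in> sets M" for A using up[of A A] that by (simp add: sub_def)
  show "(\<lambda>i. P (A i) - \<nu> (A i)) sums (P (\<Union>i. A i) - \<nu> (\<Union>i. A i))"
   if "range A \<subseteq> sets M" "disjoint_family A" for A :: "nat => 'z set"
   by (intro sums_diff Psums cadd that)
  show "P A - \<nu> A = 0" if "A \<in> null_sets M" for A using Pnull null that by simp
 qed (rule that)
 show ?thesis
 proof (rule that[of "\<lambda>z. v1 z - v2 z"])
  show "integrable M (\<lambda>z. v1 z - v2 z)" using v1 v2 by simp
  fix A assume A: "A \<in> sets M"
  have "(LINT z:A|M. v1 z - v2 z) = (LINT z:A|M. v1 z) - (LINT z:A|M. v2 z)"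
   by (rule set_integral_diff(2)) (unfold set_integrable_def, (rule integrable_mult_indicator[OF A v1(1)] integrable_mult_indicator[OF A v2(1)])+)
  then show "\<nu> A = (LINT z:A|M. v1 z - v2 z)" using v1(2)[OF A] v2(2)[OF A] by simp
 qed
qed

section \<open>Kernels and duality\<close>

locale prob_kernel =
 fixes T :: "'t measure" and S :: "'s measure" and K :: "'t => 's measure"
 assumes T: "prob_space T" and K[measurable]: "K \<in> T \<rightarrow>\<^sub>M prob_algebra S"
begin

lemma K_space: "t \<in> space T ==> prob_space (K t)" "t \<in> space T ==> sets (K t) = sets S"
 using measurable_space[OF K] by (auto simp: space_prob_algebra)

lemma K_section:
 assumes "f \<in> measurable (T \<Otimes>\<^sub>M S) N" "t \<in> space T"
 shows "(\<lambda>x. f (t, x)) \<in> measurable (K t) N"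
proof -
 have "(\<lambda>x. f (t, x)) \<in> measurable S N"
  using measurable_compose[OF measurable_Pair1'[OF assms(2)] assms(1)] .
 then show ?thesis using measurable_cong_sets[OF K_space(2)[OF assms(2)] refl] by blast
qed

text \<open>The product of the point mass at t with \<open>K t\<close>, so that binding along
  \<open>T\<close> does not lose the time coordinate.\<close>

definition graph_kernel :: "'t => ('t \<times> 's) measure" where
 "graph_kernel t = distr (K t) (T \<Otimes>\<^sub>M S) (Pair t)"

definition joint :: "('t \<times> 's) measure" where "joint = T \<bind> graph_kernel"

lemma graph_kernel_measurable: "graph_kernel \<in> T \<rightarrow>\<^sub>M prob_algebra (T \<Otimes>\<^sub>M S)"
 unfolding graph_kernel_def[abs_def] by (rule measurable_distr_prob_space2[OF K]) simp

lemma Pair_K: "t \<in> space T ==> Pair t \<in> measurable (K t) (T \<Otimes>\<^sub>M S)"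
 using K_section[of "\<lambda>z. z" "T \<Otimes>\<^sub>M S" t] by simp

lemma sets_joint[simp]: "sets joint = sets (T \<Otimes>\<^sub>M S)"
 unfolding joint_def
 by (rule sets_bind) (auto simp: graph_kernel_def prob_space.not_empty[OF T])

lemma space_joint[simp]: "space joint = space (T \<Otimes>\<^sub>M S)"
 by (rule sets_eq_imp_space_eq[OF sets_joint])

lemma measurable_joint[simp]: "measurable joint N = measurable (T \<Otimes>\<^sub>M S) N"
 by (rule measurable_cong_sets) simp_all

lemma prob_space_joint: "prob_space joint"
 unfolding joint_def
 by (rule prob_space_bind'[OF _ graph_kernel_measurable]) (simp add: space_prob_algebra T)

lemma nn_integral_joint:
 assumes f: "f \<in> borel_measurable (T \<Otimes>\<^sub>M S)"
 shows "(\<integral>\<^sup>+ z. f z \<partial>joint) = (\<integral>\<^sup>+ t. \<integral>\<^sup>+ x. f (t, x) \<partial>K t \<partial>T)"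
 unfolding joint_def
 by (subst nn_integral_bind[OF f measurable_prob_algebraD[OF graph_kernel_measurable]])
  (auto intro!: nn_integral_cong nn_integral_distr simp: graph_kernel_def f Pair_K)

lemma nn_integral_section_measurable:
 assumes f[measurable]: "f \<in> borel_measurable (T \<Otimes>\<^sub>M S)"
 shows "(\<lambda>t. \<integral>\<^sup>+ x. f (t, x) \<partial>K t) \<in> borel_measurable T"
 by (rule nn_integral_measurable_subprob_algebra2[OF _ measurable_prob_algebraD[OF K]]) simp

lemma integral_section_measurable:
 fixes f :: "'t \<times> 's => real"
 assumes f[measurable]: "f \<in> borel_measurable (T \<Otimes>\<^sub>M S)"
 shows "(\<lambda>t. LINT x|K t. f (t, x)) \<in> borel_measurable T"
proof -
 have "(\<lambda>t. LINT z|graph_kernel t. f z) \<in> borel_measurable T"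
  by (rule measurable_compose[OF measurable_prob_algebraD[OF graph_kernel_measurable] integral_measurable_subprob_algebra]) fact
 moreover have "(LINT z|graph_kernel t. f z) = (LINT x|K t. f (t, x))" if "t \<in> space T" for t
  unfolding graph_kernel_def by (rule integral_distr[OF Pair_K[OF that] f])
 ultimately show ?thesis by (simp cong: measurable_cong)
qed

lemma AE_joint:
 assumes P: "Measurable.pred (T \<Otimes>\<^sub>M S) P"
 shows "(AE z in joint. P z) \<longleftrightarrow> (AE t in T. AE x in K t. P (t, x))"
proof -
 have "(AE z in joint. P z) \<longleftrightarrow> (AE t in T. AE z in graph_kernel t. P z)"
  unfolding joint_def by (rule AE_bind[OF measurable_prob_algebraD[OF graph_kernel_measurable] P])
 also have "\<dots> \<longleftrightarrow> (AE t in T. AE x in K t. P (t, x))"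
  unfolding graph_kernel_def
  by (intro AE_cong AE_distr_iff[OF Pair_K]) (use P in \<open>auto simp: pred_def\<close>)
 finally show ?thesis .
qed

lemma integral_joint_nonneg:
 fixes f :: "'t \<times> 's => real"
 assumes f: "integrable joint f" and f0: "!!z. 0 <= f z"
 shows "AE t in T. integrable (K t) (\<lambda>x. f (t, x))"
  "integrable T (\<lambda>t. LINT x|K t. f (t, x))"
  "(LINT z|joint. f z) = (LINT t|T. LINT x|K t. f (t, x))"
proof -
 have fm[measurable]: "f \<in> borel_measurable (T \<Otimes>\<^sub>M S)" using borel_measurable_integrable[OF f] by simp
 have nn: "(\<integral>\<^sup>+ t. \<integral>\<^sup>+ x. ennreal (f (t, x)) \<partial>K t \<partial>T) = ennreal (LINT z|joint. f z)"
  using nn_integral_eq_integral[OF f] f0 nn_integral_joint[of "\<lambda>z. ennreal (f z)"] by simp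
 have "AE t in T. (\<integral>\<^sup>+ x. ennreal (f (t, x)) \<partial>K t) \<noteq> \<infinity>"
  by (rule nn_integral_PInf_AE) (use nn in \<open>auto intro!: nn_integral_section_measurable[of "\<lambda>z. ennreal (f z)", simplified]\<close>)
 then show AEi: "AE t in T. integrable (K t) (\<lambda>x. f (t, x))"
 proof (rule AE_mp, intro AE_I2 impI)
  fix t assume t: "t \<in> space T" and fin: "(\<integral>\<^sup>+ x. ennreal (f (t, x)) \<partial>K t) \<noteq> \<infinity>"
  show "integrable (K t) (\<lambda>x. f (t, x))"
   by (rule integrableI_nonneg) (use K_section[OF fm t] f0 fin in \<open>auto simp: top.not_eq_extremum\<close>)
 qed
 then have eq: "AE t in T. (\<integral>\<^sup>+ x. ennreal (f (t, x)) \<partial>K t) = ennreal (LINT x|K t. f (t, x))"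
  by eventually_elim (rule nn_integral_eq_integral, auto simp: f0)
 have I0: "0 <= (LINT x|K t. f (t, x))" for t by (simp add: f0)
 have nn2: "(\<integral>\<^sup>+ t. ennreal (LINT x|K t. f (t, x)) \<partial>T) = ennreal (LINT z|joint. f z)"
  using nn_integral_cong_AE[OF eq] nn by simp
 show I: "integrable T (\<lambda>t. LINT x|K t. f (t, x))"
  by (rule integrableI_nonneg) (use nn2 I0 integral_section_measurable[OF fm] in auto)
 have "ennreal (LINT t|T. LINT x|K t. f (t, x)) = ennreal (LINT z|joint. f z)"
  using nn_integral_eq_integral[OF I] I0 nn2 by simp
 then show "(LINT z|joint. f z) = (LINT t|T. LINT x|K t. f (t, x))"
  using I0 f0 by (subst (asm) ennreal_inj) (auto intro!: Bochner_Integration.integral_nonneg)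
qed

text \<open>The nonnegative case is applied to the positive and the negative part, and the sections
  are recombined for almost every t.\<close>

lemma integral_joint:
 fixes f :: "'t \<times> 's => real"
 assumes f: "integrable joint f"
 shows "AE t in T. integrable (K t) (\<lambda>x. f (t, x))"
  "integrable T (\<lambda>t. LINT x|K t. f (t, x))"
  "(LINT z|joint. f z) = (LINT t|T. LINT x|K t. f (t, x))"
proof -
 have p: "integrable joint (\<lambda>z. max 0 (f z))" and n: "integrable joint (\<lambda>z. max 0 (- f z))"
  using f by (auto intro!: integrable_max)
 note P = integral_joint_nonneg[OF p, simplified] and N = integral_joint_nonneg[OF n, simplified]
 have d: "max 0 a - max 0 (- a) = a" for a :: real by auto
 show "AE t in T. integrable (K t) (\<lambda>x. f (t, x))"
  using P(1) N(1)
 proof eventually_elim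
  case (elim t)
  have "integrable (K t) (\<lambda>x. max 0 (f (t, x)) - max 0 (- f (t, x)))"
   by (rule Bochner_Integration.integrable_diff[OF elim])
  then show ?case by (simp only: d)
 qed
 have eq: "AE t in T. (LINT x|K t. max 0 (f (t, x))) - (LINT x|K t. max 0 (- f (t, x))) = (LINT x|K t. f (t, x))"
  using P(1) N(1)
 proof eventually_elim
  case (elim t)
  show ?case using Bochner_Integration.integral_diff[OF elim] by (simp only: d)
 qed
 have fm[measurable]: "f \<in> borel_measurable (T \<Otimes>\<^sub>M S)" using borel_measurable_integrable[OF f] by simp
 have I: "integrable T (\<lambda>t. (LINT x|K t. max 0 (f (t, x))) - (LINT x|K t. max 0 (- f (t, x))))"
  by (rule Bochner_Integration.integrable_diff[OF P(2) N(2)])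
 show "integrable T (\<lambda>t. LINT x|K t. f (t, x))"
  by (rule integrable_cong_AE_imp[OF I]) (use eq in \<open>auto intro: integral_section_measurable\<close>)
 have "(LINT z|joint. f z) = (LINT z|joint. max 0 (f z) - max 0 (- f z))" by (simp only: d)
 also have "\<dots> = (LINT t|T. (LINT x|K t. max 0 (f (t, x))) - (LINT x|K t. max 0 (- f (t, x))))"
  by (simp add: Bochner_Integration.integral_diff[OF p n] Bochner_Integration.integral_diff[OF P(2) N(2)] P(3) N(3))
 also have "\<dots> = (LINT t|T. LINT x|K t. f (t, x))"
  by (rule integral_cong_AE) (use eq in \<open>auto intro!: integral_section_measurable borel_measurable_diff borel_measurable_integrable[OF P(2)] borel_measurable_integrable[OF N(2)]\<close>)
 finally show "(LINT z|joint. f z) = (LINT t|T. LINT x|K t. f (t, x))" .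
qed

end

text \<open>A Bochner integral reads 0 on a non-integrable function, so the monotonicity and
  triangle statements below carry a uniform bound on the functions.\<close>

definition Lnorm :: "real => 's measure => ('s => real) => real" where
 "Lnorm q M u = (LINT x|M. u x powr q) powr (1 / q)"

context
 fixes M :: "'s measure" and q :: real
 assumes M: "prob_space M" and q: "1 <= q"
begin

lemma integrable_bounded_powr:
 assumes "u \<in> borel_measurable M" "!!x. 0 <= u x" "!!x. u x <= C"
 shows "integrable M (\<lambda>x. u x powr q)"
proof (rule finite_measure.integrable_const_bound[where B="C powr q"])
 show "finite_measure M" using M by (rule prob_space.finite_measure)
 show "AE x in M. norm (u x powr q) <= C powr q" using assms q by (auto intro!: powr_mono2)
qed (use assms in measurable)

lemma Lnorm_nonneg: "0 <= Lnorm q M u" by (simp add: Lnorm_def)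

lemma Lnorm_powr:
 assumes "!!x. 0 <= u x" shows "Lnorm q M u powr q = (LINT x|M. u x powr q)"
 using q by (simp add: Lnorm_def powr_powr)

lemma Lnorm_mono:
 assumes "u \<in> borel_measurable M" "v \<in> borel_measurable M" "!!x. 0 <= u x" "!!x. u x <= v x" "!!x. v x <= C"
 shows "Lnorm q M u <= Lnorm q M v"
 unfolding Lnorm_def
proof (rule powr_mono2)
 have v0: "0 <= v x" for x using assms(3,4) by (rule order_trans)
 have uC: "u x <= C" for x using assms(4,5) by (rule order_trans)
 show "(LINT x|M. u x powr q) <= (LINT x|M. v x powr q)"
  by (intro integral_mono integrable_bounded_powr[where C=C] powr_mono2) (use assms v0 uC q in auto)
qed (use q in auto)

lemma Lnorm_scale:
 assumes "0 <= c" "!!x. 0 <= u x"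
 shows "Lnorm q M (\<lambda>x. c * u x) = c * Lnorm q M u"
proof -
 have "(LINT x|M. (c * u x) powr q) = c powr q * (LINT x|M. u x powr q)"
  by (simp add: powr_mult)
 then show ?thesis using assms q by (simp add: Lnorm_def powr_mult powr_powr)
qed

lemma Lnorm_const: "0 <= c ==> Lnorm q M (\<lambda>x. c) = c"
 using q prob_space.prob_space[OF M] by (simp add: Lnorm_def powr_powr)

lemma Lnorm_le_const:
 assumes "u \<in> borel_measurable M" "!!x. 0 <= u x" "!!x. u x <= C"
 shows "Lnorm q M u <= C"
 using Lnorm_mono[of u "\<lambda>_. C" C] Lnorm_const[of C] assms order_trans[OF assms(2,3)] by simp

lemma Lnorm_add:
 assumes [measurable]: "u \<in> borel_measurable M" "v \<in> borel_measurable M"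
  and u: "!!x. 0 <= u x" "!!x. u x <= C" and v: "!!x. 0 <= v x" "!!x. v x <= C"
 shows "Lnorm q M (\<lambda>x. u x + v x) <= Lnorm q M u + Lnorm q M v"
proof (rule field_le_epsilon)
 fix e :: real assume e: "0 < e"
 \<comment> \<open>\<open>nn_integral_Minkowski\<close> wants positive bounds for the two norms; the
   norms themselves may vanish.\<close>
 define a b where "a = Lnorm q M u + e / 2" and "b = Lnorm q M v + e / 2"
 have ab: "0 < a" "0 < b" using e Lnorm_nonneg[of u] Lnorm_nonneg[of v] by (auto simp: a_def b_def)
 have le: "(\<integral>\<^sup>+ x. ennreal (w x powr q) \<partial>M) <= ennreal ((Lnorm q M w + e / 2) powr q)"
  if "w \<in> borel_measurable M" "!!x. 0 <= w x" "!!x. w x <= C" for w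
 proof -
  have "(\<integral>\<^sup>+ x. ennreal (w x powr q) \<partial>M) = ennreal (LINT x|M. w x powr q)"
   by (rule nn_integral_eq_integral[OF integrable_bounded_powr]) (use that in auto)
  also have "\<dots> = ennreal (Lnorm q M w powr q)" using Lnorm_powr[of w] that by simp
  also have "\<dots> <= ennreal ((Lnorm q M w + e / 2) powr q)"
   using e q by (intro ennreal_leI powr_mono2) (auto simp: Lnorm_nonneg)
  finally show ?thesis .
 qed
 have "(\<integral>\<^sup>+ x. ennreal ((u x + v x) powr q) \<partial>M) <= ennreal ((a + b) powr q)"
  by (rule nn_integral_Minkowski) (use ab u v q le in \<open>auto simp: a_def b_def\<close>)
 moreover have "(\<integral>\<^sup>+ x. ennreal ((u x + v x) powr q) \<partial>M) = ennreal (LINT x|M. (u x + v x) powr q)"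
  by (rule nn_integral_eq_integral[OF integrable_bounded_powr[where C="C + C"]])
   (use u v add_mono[OF u(2) v(2)] in auto)
 ultimately have "(LINT x|M. (u x + v x) powr q) <= (a + b) powr q" by simp
 then have "Lnorm q M (\<lambda>x. u x + v x) <= ((a + b) powr q) powr (1 / q)"
  unfolding Lnorm_def by (intro powr_mono2) (use q in auto)
 also have "\<dots> = a + b" using ab q by (simp add: powr_powr)
 finally show "Lnorm q M (\<lambda>x. u x + v x) <= Lnorm q M u + Lnorm q M v + e" by (simp add: a_def b_def)
qed

end

text \<open>Tested on the set where g < f, the inequality forces a nonnegative function to have
  integral 0.\<close>

lemma AE_le_of_set_integral_le:
 fixes f g :: "'t => real"
 assumes f: "integrable M f" and g: "integrable M g"
  and le: "!!A. A \<in> sets M ==> (LINT x|M. indicator A x * f x) <= (LINT x|M. indicator A x * g x)"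
 shows "AE x in M. f x <= g x"
proof -
 have [measurable]: "f \<in> borel_measurable M" "g \<in> borel_measurable M" using f g by auto
 define A where "A = {x \<in> space M. g x < f x}"
 have A[measurable]: "A \<in> sets M" unfolding A_def by measurable
 have i: "integrable M (\<lambda>x. indicator A x * h x)" if "integrable M h" for h :: "'t => real"
  using integrable_mult_indicator[OF A that] by simp
 have nn: "0 <= indicator A x * f x - indicator A x * g x" for x by (auto simp: A_def indicator_def)
 have "(LINT x|M. indicator A x * f x - indicator A x * g x) <= 0"
  using le[OF A] by (simp add: Bochner_Integration.integral_diff[OF i[OF f] i[OF g]])
 moreover have "0 <= (LINT x|M. indicator A x * f x - indicator A x * g x)"
  using nn by (rule Bochner_Integration.integral_nonneg)
 ultimately have "(LINT x|M. indicator A x * f x - indicator A x * g x) = 0" by simp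
 then have "AE x in M. indicator A x * f x - indicator A x * g x = 0"
  by (subst (asm) integral_nonneg_eq_0_iff_AE) (use nn i f g in \<open>auto intro!: Bochner_Integration.integrable_diff\<close>)
 with AE_space show ?thesis by eventually_elim (auto simp: A_def indicator_def split: if_splits)
qed

text \<open>The problem in a measurable frame: \<open>G x\<close> is the Finsler norm of the vector
  with components y, \<open>J x\<close> its Legendre transform, \<open>m\<close> the metric
  derivative, q the conjugate exponent. \<open>J_self\<close> and \<open>J_le\<close> say that
  \<open>J x y\<close> is a covector of dual norm at most \<open>G x y\<close> whose pairing with y
  is the square of \<open>G x y\<close>. \<open>G_ge\<close> bounds dual norms by Euclidean norms,
  uniformly in x, so bounded fields have bounded dual norm.\<close>

locale dual_setting = prob_kernel T S K
 for T :: "'t measure" and S :: "'s measure" and K +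
 fixes G :: "'s => 'e::euclidean_space => real" and J :: "'s => 'e => 'e"
  and m :: "'t => real" and p q :: real
 assumes pq: "1 < p" "1 < q" "1 / p + 1 / q = 1"
  and space_S[simp]: "space S = UNIV"
  and G_meas[measurable]: "(\<lambda>z. G (fst z) (snd z)) \<in> borel_measurable (S \<Otimes>\<^sub>M borel)"
  and J_meas[measurable]: "(\<lambda>z. J (fst z) (snd z)) \<in> borel_measurable (S \<Otimes>\<^sub>M borel)"
  and G_ge: "norm y <= G x y" and G_cont: "continuous_on UNIV (G x)" and G_0: "G x 0 = 0"
  and J_self: "J x y \<bullet> y = (G x y)\<^sup>2" and J_le: "J x y \<bullet> u <= G x y * G x u"
  and m_meas[measurable]: "m \<in> borel_measurable T" and m_nonneg: "0 <= m t" and m_int: "integrable T m"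
begin

lemma G_nonneg: "0 <= G x y" using order_trans[OF norm_ge_zero G_ge] .

lemma G_pos: "y \<noteq> 0 ==> 0 < G x y" using G_ge[of y x] zero_less_norm_iff[of y] by linarith

text \<open>A countable index set keeps the supremum in \<open>polar\<close> measurable in x;
  inserting 0 makes that supremum nonnegative.\<close>

definition dense_set :: "'e set" where
 "dense_set = insert 0 (SOME D. countable D \<and> (\<forall>X. open X --> X \<noteq> {} --> (\<exists>d\<in>D. d \<in> X)))"

lemma dense_set: "countable dense_set" "0 \<in> dense_set" "closure dense_set = UNIV"
proof -
 let ?P = "\<lambda>D::'e set. countable D \<and> (\<forall>X. open X --> X \<noteq> {} --> (\<exists>d\<in>D. d \<in> X))"
 have P: "?P (SOME D. ?P D)" by (rule someI_ex) (rule countable_dense_exists)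
 then show "countable dense_set" "0 \<in> dense_set" by (auto simp: dense_set_def)
 show "closure dense_set = UNIV"
 proof (rule ccontr)
  assume "closure dense_set \<noteq> UNIV"
  then have "open (- closure dense_set)" "- closure dense_set \<noteq> {}" by auto
  then obtain d where "d \<in> (SOME D. ?P D)" "d \<in> - closure dense_set" using P by meson
  then show False using closure_subset[of dense_set] by (auto simp: dense_set_def)
 qed
qed

text \<open>The dual norm of h with respect to \<open>G x\<close>. At y = 0 the quotient is 0 / 0 =
  0, which does no harm.\<close>

definition polar :: "'s => 'e => real" where
 "polar x h = (SUP y\<in>dense_set. (h \<bullet> y) / G x y)"

lemma quot_le_norm: "(h \<bullet> y) / G x y <= norm h"
proof (cases "y = 0")
 case False
 have "h \<bullet> y <= norm h * norm y" by (rule norm_cauchy_schwarz)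
 also have "\<dots> <= norm h * G x y" by (intro mult_left_mono G_ge) simp
 finally show ?thesis using G_pos[OF False] by (simp add: field_simps)
qed simp

lemma polar_bdd: "bdd_above ((\<lambda>y. (h \<bullet> y) / G x y) ` dense_set)"
 by (rule bdd_aboveI2[OF quot_le_norm])

lemma polar_le_norm: "polar x h <= norm h"
 unfolding polar_def by (rule cSUP_least) (use dense_set quot_le_norm in auto)

lemma polar_nonneg: "0 <= polar x h"
 unfolding polar_def using cSUP_upper[OF dense_set(2) polar_bdd, of h x] by simp

text \<open>Clear for y in \<open>dense_set\<close>; both sides are continuous in y, so the
  inequality passes to the closure.\<close>

lemma polar_pairing: "h \<bullet> y <= polar x h * G x y"
proof -
 have "closed {y. h \<bullet> y <= polar x h * G x y}"
  by (intro closed_Collect_le continuous_intros G_cont)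
 moreover have "dense_set \<subseteq> {y. h \<bullet> y <= polar x h * G x y}"
 proof
  fix y assume y: "y \<in> dense_set"
  show "y \<in> {y. h \<bullet> y <= polar x h * G x y}"
  proof (cases "y = 0")
   case False
   have "(h \<bullet> y) / G x y <= polar x h" unfolding polar_def by (rule cSUP_upper[OF y polar_bdd])
   then show ?thesis using G_pos[OF False, of x] by (simp add: field_simps)
  qed (simp add: G_0)
 qed
 ultimately have "closure dense_set \<subseteq> {y. h \<bullet> y <= polar x h * G x y}" by (rule closure_minimal[rotated])
 then show ?thesis using dense_set(3) by auto
qed

lemma polar_least:
 assumes "!!y. h \<bullet> y <= c * G x y" "0 <= c" shows "polar x h <= c"
 unfolding polar_def
proof (rule cSUP_least)
 fix y assume "y \<in> dense_set"
 show "(h \<bullet> y) / G x y <= c"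
  using assms(1)[of y] assms(2) G_pos[of y x] by (cases "y = 0") (auto simp: field_simps)
qed (use dense_set in auto)

lemma polar_add: "polar x (g + h) <= polar x g + polar x h"
 by (rule polar_least)
  (use polar_pairing in \<open>auto simp: inner_add_left distrib_right polar_nonneg intro!: add_mono add_nonneg_nonneg\<close>)

lemma polar_scale_le: "0 <= c ==> polar x (c *\<^sub>R h) <= c * polar x h"
 by (rule polar_least)
  (use polar_pairing[of h _ x] in \<open>auto simp: polar_nonneg mult.assoc intro!: mult_left_mono\<close>)

lemma polar_J: "polar x (c *\<^sub>R J x y) <= c * G x y" if "0 <= c"
 by (rule polar_least) (use that J_le in \<open>auto simp: G_nonneg mult.assoc intro!: mult_left_mono\<close>)

lemma polar_meas[measurable]: "(\<lambda>z. polar (fst z) (snd z)) \<in> borel_measurable (S \<Otimes>\<^sub>M borel)"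
 unfolding polar_def
proof (rule borel_measurable_cSUP[OF dense_set(1)])
 fix y
 have "(\<lambda>z. (fst z, y)) \<in> S \<Otimes>\<^sub>M (borel :: 'e measure) \<rightarrow>\<^sub>M S \<Otimes>\<^sub>M (borel :: 'e measure)" by measurable
 from measurable_compose[OF this G_meas]
 have [measurable]: "(\<lambda>z. G (fst z) y) \<in> borel_measurable (S \<Otimes>\<^sub>M (borel :: 'e measure))" by simp
 show "(\<lambda>z. (snd z \<bullet> y) / G (fst z) y) \<in> borel_measurable (S \<Otimes>\<^sub>M (borel :: 'e measure))" by measurable
qed (rule polar_bdd)

lemma polar_comp_meas:
 assumes [measurable]: "h \<in> borel_measurable (T \<Otimes>\<^sub>M S)"
 shows "(\<lambda>z. polar (snd z) (h z)) \<in> borel_measurable (T \<Otimes>\<^sub>M S)"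
proof -
 have "(\<lambda>z. (snd z, h z)) \<in> T \<Otimes>\<^sub>M S \<rightarrow>\<^sub>M S \<Otimes>\<^sub>M borel" by measurable
 from measurable_compose[OF this polar_meas] show ?thesis by simp
qed

definition bounded_fields :: "('t \<times> 's => 'e) set" where
 "bounded_fields = {h \<in> borel_measurable (T \<Otimes>\<^sub>M S). \<exists>C. \<forall>z\<in>space (T \<Otimes>\<^sub>M S). norm (h z) <= C}"

definition dual_norm :: "('t \<times> 's => 'e) => real" where
 "dual_norm h = (LINT t|T. m t * Lnorm q (K t) (\<lambda>x. polar x (h (t, x))))"

lemma space_TS: "z \<in> space (T \<Otimes>\<^sub>M S) \<longleftrightarrow> fst z \<in> space T"
 by (cases z) (simp add: space_pair_measure)

lemma polar_section:
 assumes "h \<in> borel_measurable (T \<Otimes>\<^sub>M S)" "t \<in> space T"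
 shows "(\<lambda>x. polar x (h (t, x))) \<in> borel_measurable (K t)"
 using K_section[OF polar_comp_meas[OF assms(1)] assms(2)] by simp

lemma Lnorm_section_meas:
 assumes f: "f \<in> borel_measurable (T \<Otimes>\<^sub>M S)"
 shows "(\<lambda>t. Lnorm q (K t) (\<lambda>x. f (t, x))) \<in> borel_measurable T"
proof -
 have "(\<lambda>z. f z powr q) \<in> borel_measurable (T \<Otimes>\<^sub>M S)" using f by measurable
 from integral_section_measurable[OF this] show ?thesis unfolding Lnorm_def by measurable
qed

lemma dual_norm_integrable:
 assumes f: "f \<in> borel_measurable (T \<Otimes>\<^sub>M S)" and b: "!!t x. t \<in> space T ==> 0 <= f (t, x)" "!!t x. t \<in> space T ==> f (t, x) <= C"
 shows "integrable T (\<lambda>t. m t * Lnorm q (K t) (\<lambda>x. f (t, x)))"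
proof (rule Bochner_Integration.integrable_bound)
 show "integrable T (\<lambda>t. m t * C)" using m_int by simp
 show "(\<lambda>t. m t * Lnorm q (K t) (\<lambda>x. f (t, x))) \<in> borel_measurable T"
  using Lnorm_section_meas[OF f] by measurable
 show "AE t in T. norm (m t * Lnorm q (K t) (\<lambda>x. f (t, x))) <= norm (m t * C)"
 proof (rule AE_I2)
  fix t assume t: "t \<in> space T"
  have "0 <= Lnorm q (K t) (\<lambda>x. f (t, x))" by (simp add: Lnorm_def)
  moreover have "Lnorm q (K t) (\<lambda>x. f (t, x)) <= C"
   using pq by (intro Lnorm_le_const[OF K_space(1)[OF t]] K_section[OF f t] b t) simp
  ultimately show "norm (m t * Lnorm q (K t) (\<lambda>x. f (t, x))) <= norm (m t * C)"
   using m_nonneg[of t] by (auto simp: abs_mult intro!: mult_left_mono)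
 qed
qed

sublocale function_space bounded_fields
proof
 show "(\<lambda>_. 0) \<in> bounded_fields" by (auto simp: bounded_fields_def)
 fix g h assume "g \<in> bounded_fields" "h \<in> bounded_fields"
 then obtain C D where [measurable]: "g \<in> borel_measurable (T \<Otimes>\<^sub>M S)" "h \<in> borel_measurable (T \<Otimes>\<^sub>M S)"
  and "!!z. z \<in> space (T \<Otimes>\<^sub>M S) ==> norm (g z) <= C" "!!z. z \<in> space (T \<Otimes>\<^sub>M S) ==> norm (h z) <= D"
  unfolding bounded_fields_def by blast
 then show "(\<lambda>z. g z + h z) \<in> bounded_fields"
  unfolding bounded_fields_def by (auto intro!: exI[of _ "C + D"] norm_triangle_mono)
next
 fix g and c :: real assume "g \<in> bounded_fields"
 then obtain C where [measurable]: "g \<in> borel_measurable (T \<Otimes>\<^sub>M S)"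
  and "!!z. z \<in> space (T \<Otimes>\<^sub>M S) ==> norm (g z) <= C"
  unfolding bounded_fields_def by blast
 then show "(\<lambda>z. c *\<^sub>R g z) \<in> bounded_fields"
  unfolding bounded_fields_def by (auto intro!: exI[of _ "\<bar>c\<bar> * C"] mult_left_mono)
qed

lemma bounded_fieldsE:
 assumes "h \<in> bounded_fields"
 obtains C where "h \<in> borel_measurable (T \<Otimes>\<^sub>M S)" "!!t x. t \<in> space T ==> norm (h (t, x)) <= C"
proof -
 obtain C where C: "h \<in> borel_measurable (T \<Otimes>\<^sub>M S)" "\<forall>z\<in>space (T \<Otimes>\<^sub>M S). norm (h z) <= C"
  using assms unfolding bounded_fields_def by blast
 show ?thesis by (rule that[of C]) (use C in \<open>auto simp: space_TS\<close>)
qed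

lemma dual_norm_summand_integrable:
 assumes "h \<in> bounded_fields"
 shows "integrable T (\<lambda>t. m t * Lnorm q (K t) (\<lambda>x. polar x (h (t, x))))"
proof -
 obtain C where h: "h \<in> borel_measurable (T \<Otimes>\<^sub>M S)" "!!t x. t \<in> space T ==> norm (h (t, x)) <= C"
  using bounded_fieldsE[OF assms] by blast
 show ?thesis
  using dual_norm_integrable[OF polar_comp_meas[OF h(1)], of C] polar_nonneg order_trans[OF polar_le_norm h(2)] by simp
qed

lemma dual_norm_le:
 assumes h: "h \<in> bounded_fields" and f: "f \<in> borel_measurable (T \<Otimes>\<^sub>M S)"
  and le: "!!t x. t \<in> space T ==> polar x (h (t, x)) <= f (t, x)"
  and b: "!!t x. t \<in> space T ==> f (t, x) <= C"
 shows "dual_norm h <= (LINT t|T. m t * Lnorm q (K t) (\<lambda>x. f (t, x)))"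
 unfolding dual_norm_def
proof (rule integral_mono)
 have hm: "h \<in> borel_measurable (T \<Otimes>\<^sub>M S)" using h by (simp add: bounded_fields_def)
 show "integrable T (\<lambda>t. m t * Lnorm q (K t) (\<lambda>x. polar x (h (t, x))))"
  by (rule dual_norm_summand_integrable[OF h])
 show "integrable T (\<lambda>t. m t * Lnorm q (K t) (\<lambda>x. f (t, x)))"
  by (rule dual_norm_integrable[OF f order_trans[OF polar_nonneg le] b])
 fix t assume t: "t \<in> space T"
 show "m t * Lnorm q (K t) (\<lambda>x. polar x (h (t, x))) <= m t * Lnorm q (K t) (\<lambda>x. f (t, x))"
  using pq by (intro mult_left_mono m_nonneg Lnorm_mono[OF K_space(1)[OF t], where C=C] polar_section[OF hm t] K_section[OF f t] polar_nonneg le b t) simp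
qed

lemma sublinear_dual_norm: "sublinear_on bounded_fields dual_norm"
 unfolding sublinear_on_def
proof (intro conjI ballI allI impI)
 fix g h assume gh: "g \<in> bounded_fields" "h \<in> bounded_fields"
 obtain C where g: "g \<in> borel_measurable (T \<Otimes>\<^sub>M S)" "!!t x. t \<in> space T ==> norm (g (t, x)) <= C"
  using bounded_fieldsE[OF gh(1)] by blast
 obtain D where h: "h \<in> borel_measurable (T \<Otimes>\<^sub>M S)" "!!t x. t \<in> space T ==> norm (h (t, x)) <= D"
  using bounded_fieldsE[OF gh(2)] by blast
 have gC: "polar x (g (t, x)) <= max C D" if "t \<in> space T" for t x
  by (rule order_trans[OF order_trans[OF polar_le_norm g(2)[OF that]] max.cobounded1])
 have hD: "polar x (h (t, x)) <= max C D" if "t \<in> space T" for t x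
  by (rule order_trans[OF order_trans[OF polar_le_norm h(2)[OF that]] max.cobounded2])
 have "dual_norm (\<lambda>z. g z + h z) <= (LINT t|T. m t * Lnorm q (K t) (\<lambda>x. polar x (g (t, x)) + polar x (h (t, x))))"
  using dual_norm_le[OF add[OF gh], of "\<lambda>z. polar (snd z) (g z) + polar (snd z) (h z)" "max C D + max C D"]
   polar_comp_meas[OF g(1)] polar_comp_meas[OF h(1)] polar_add add_mono[OF gC hD] by simp
 also have "\<dots> <= (LINT t|T. m t * Lnorm q (K t) (\<lambda>x. polar x (g (t, x))) + m t * Lnorm q (K t) (\<lambda>x. polar x (h (t, x))))"
 proof (rule integral_mono)
  show "integrable T (\<lambda>t. m t * Lnorm q (K t) (\<lambda>x. polar x (g (t, x)) + polar x (h (t, x))))"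
   using dual_norm_integrable[of "\<lambda>z. polar (snd z) (g z) + polar (snd z) (h z)" "max C D + max C D"]
    polar_comp_meas[OF g(1)] polar_comp_meas[OF h(1)] add_mono[OF gC hD] polar_nonneg by (simp add: add_nonneg_nonneg)
  show "integrable T (\<lambda>t. m t * Lnorm q (K t) (\<lambda>x. polar x (g (t, x))) + m t * Lnorm q (K t) (\<lambda>x. polar x (h (t, x))))"
   by (intro Bochner_Integration.integrable_add dual_norm_summand_integrable gh)
  fix t assume t: "t \<in> space T"
  have "Lnorm q (K t) (\<lambda>x. polar x (g (t, x)) + polar x (h (t, x))) <= Lnorm q (K t) (\<lambda>x. polar x (g (t, x))) + Lnorm q (K t) (\<lambda>x. polar x (h (t, x)))"
   using pq by (intro Lnorm_add[OF K_space(1)[OF t], where C="max C D"] polar_section g h t polar_nonneg gC hD) simp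
  from mult_left_mono[OF this m_nonneg[of t]]
  show "m t * Lnorm q (K t) (\<lambda>x. polar x (g (t, x)) + polar x (h (t, x))) <= m t * Lnorm q (K t) (\<lambda>x. polar x (g (t, x))) + m t * Lnorm q (K t) (\<lambda>x. polar x (h (t, x)))"
   by (simp add: distrib_left)
 qed
 also have "\<dots> = dual_norm g + dual_norm h"
  unfolding dual_norm_def by (intro Bochner_Integration.integral_add dual_norm_summand_integrable gh)
 finally show "dual_norm (\<lambda>z. g z + h z) <= dual_norm g + dual_norm h" .
next
 fix g and c :: real assume g': "g \<in> bounded_fields" and c: "0 < c"
 obtain C where g: "g \<in> borel_measurable (T \<Otimes>\<^sub>M S)" "!!t x. t \<in> space T ==> norm (g (t, x)) <= C"
  using bounded_fieldsE[OF g'] by blast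
 have gC: "c * polar x (g (t, x)) <= c * C" if "t \<in> space T" for t x
  using order_trans[OF polar_le_norm g(2)[OF that], of x] c by simp
 have "dual_norm (\<lambda>z. c *\<^sub>R g z) <= (LINT t|T. m t * Lnorm q (K t) (\<lambda>x. c * polar x (g (t, x))))"
  using dual_norm_le[OF scale[OF g'], of "\<lambda>z. c * polar (snd z) (g z)" c "c * C"]
   polar_comp_meas[OF g(1)] polar_scale_le[of c] gC c by simp
 also have "\<dots> = (LINT t|T. c * (m t * Lnorm q (K t) (\<lambda>x. polar x (g (t, x)))))"
 proof (rule Bochner_Integration.integral_cong[OF refl])
  fix t assume t: "t \<in> space T"
  have "Lnorm q (K t) (\<lambda>x. c * polar x (g (t, x))) = c * Lnorm q (K t) (\<lambda>x. polar x (g (t, x)))"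
   using pq c by (intro Lnorm_scale[OF K_space(1)[OF t]] polar_nonneg) auto
  then show "m t * Lnorm q (K t) (\<lambda>x. c * polar x (g (t, x))) = c * (m t * Lnorm q (K t) (\<lambda>x. polar x (g (t, x))))"
   by simp
 qed
 also have "\<dots> = c * dual_norm g" unfolding dual_norm_def by (rule integral_mult_right_zero)
 finally show "dual_norm (\<lambda>z. c *\<^sub>R g z) <= c * dual_norm g" .
qed

end

section \<open>A dominated linear functional has a density\<close>

context dual_setting
begin

text \<open>The norm of the indicator of E, in L^1 with weight \<open>m\<close> in time and L^q in
  space. It is not itself a measure, but it bounds the functional on fields of norm at most 1
  carried by E, and so transmits continuity from above and null sets.\<close>

definition weight :: "('t \<times> 's) set => real" where
 "weight E = (LINT t|T. m t * Lnorm q (K t) (\<lambda>x. indicator E (t, x)))"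

lemma weight_integrable:
 assumes "E \<in> sets (T \<Otimes>\<^sub>M S)"
 shows "integrable T (\<lambda>t. m t * Lnorm q (K t) (\<lambda>x. indicator E (t, x)))"
 by (rule dual_norm_integrable[of "indicator E" 1]) (use assms in \<open>auto simp: indicator_def\<close>)

lemma dual_norm_le_weight:
 assumes h: "h \<in> bounded_fields" and E[measurable]: "E \<in> sets (T \<Otimes>\<^sub>M S)" and c: "0 <= c"
  and le: "!!t x. t \<in> space T ==> norm (h (t, x)) <= c * indicator E (t, x)"
 shows "dual_norm h <= c * weight E"
proof -
 have "dual_norm h <= (LINT t|T. m t * Lnorm q (K t) (\<lambda>x. c * indicator E (t, x)))"
  by (rule dual_norm_le[OF h, of "\<lambda>z. c * indicator E z" c])
   (use order_trans[OF polar_le_norm le] c in \<open>auto simp: indicator_def\<close>)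
 also have "\<dots> = (LINT t|T. c * (m t * Lnorm q (K t) (\<lambda>x. indicator E (t, x))))"
 proof (rule Bochner_Integration.integral_cong[OF refl])
  fix t assume t: "t \<in> space T"
  have "Lnorm q (K t) (\<lambda>x. c * indicator E (t, x)) = c * Lnorm q (K t) (\<lambda>x. indicator E (t, x))"
   using pq c by (intro Lnorm_scale[OF K_space(1)[OF t]]) auto
  then show "m t * Lnorm q (K t) (\<lambda>x. c * indicator E (t, x)) = c * (m t * Lnorm q (K t) (\<lambda>x. indicator E (t, x)))"
   by simp
 qed
 also have "\<dots> = c * weight E" unfolding weight_def by (rule integral_mult_right_zero)
 finally show ?thesis .
qed

lemma Lnorm_indicator:
 "Lnorm q (K t) (\<lambda>x. indicator E (t, x)) = (LINT x|K t. indicator E (t, x)) powr (1 / q)"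
 unfolding Lnorm_def using pq
 by (intro arg_cong2[where f="(powr)"] refl Bochner_Integration.integral_cong) (auto simp: indicator_def)

text \<open>Dominated convergence twice: in space with the constant 1, then in time with
  \<open>m\<close>. The hypothesis \<open>dec\<close> says that every point leaves the sets
  eventually.\<close>

lemma weight_decreasing:
 assumes B[measurable]: "!!n::nat. B n \<in> sets (T \<Otimes>\<^sub>M S)" and dec: "!!z. \<exists>N. \<forall>n\<ge>N. z \<notin> B n"
 shows "(\<lambda>n. weight (B n)) \<longlonglongrightarrow> 0"
proof -
 have "(\<lambda>n. LINT t|T. m t * Lnorm q (K t) (\<lambda>x. indicator (B n) (t, x))) \<longlonglongrightarrow> (LINT t|T. 0)"
 proof (rule integral_dominated_convergence[where w=m])
  show "AE t in T. (\<lambda>n. m t * Lnorm q (K t) (\<lambda>x. indicator (B n) (t, x))) \<longlonglongrightarrow> 0"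
  proof (rule AE_I2)
   fix t assume t: "t \<in> space T"
   have "(\<lambda>n. LINT x|K t. indicator (B n) (t, x) :: real) \<longlonglongrightarrow> (LINT x|K t. 0)"
   proof (rule integral_dominated_convergence[where w="\<lambda>_. 1"])
    interpret prob_space "K t" by (rule K_space(1)[OF t])
    show "integrable (K t) (\<lambda>_. 1 :: real)" by simp
    show "(\<lambda>x. indicator (B n) (t, x) :: real) \<in> borel_measurable (K t)" for n
     by (rule K_section[OF _ t]) measurable
    show "AE x in K t. (\<lambda>n. indicator (B n) (t, x) :: real) \<longlonglongrightarrow> 0"
    proof (rule AE_I2)
     fix x
     obtain N where "\<forall>n\<ge>N. (t, x) \<notin> B n" using dec by blast
     then have "\<forall>\<^sub>F n in sequentially. (indicator (B n) (t, x) :: real) = 0"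
      by (auto simp: eventually_sequentially indicator_def)
     then show "(\<lambda>n. indicator (B n) (t, x) :: real) \<longlonglongrightarrow> 0" by (rule tendsto_eventually)
    qed
   qed (auto simp: indicator_def)
   then have "(\<lambda>n. (LINT x|K t. indicator (B n) (t, x) :: real) powr (1 / q)) \<longlonglongrightarrow> 0"
    by (intro tendsto_zero_powrI[where b="1/q"]) (use pq in auto)
   from tendsto_mult_left[OF this, of "m t"]
   show "(\<lambda>n. m t * Lnorm q (K t) (\<lambda>x. indicator (B n) (t, x))) \<longlonglongrightarrow> 0"
    by (simp add: Lnorm_indicator)
  qed
  show "AE t in T. norm (m t * Lnorm q (K t) (\<lambda>x. indicator (B n) (t, x))) <= m t" for n
  proof (rule AE_I2)
   fix t assume t: "t \<in> space T"
   have "Lnorm q (K t) (\<lambda>x. indicator (B n) (t, x)) <= 1"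
    using pq by (intro Lnorm_le_const[OF K_space(1)[OF t]] K_section[OF _ t]) (auto simp: indicator_def)
   moreover have "0 <= Lnorm q (K t) (\<lambda>x. indicator (B n) (t, x))" by (simp add: Lnorm_def)
   ultimately show "norm (m t * Lnorm q (K t) (\<lambda>x. indicator (B n) (t, x))) <= m t"
    using m_nonneg[of t] by (simp add: abs_mult mult_left_le)
  qed
 qed (use m_int borel_measurable_integrable[OF weight_integrable[OF B]] in auto)
 then show ?thesis by (simp add: weight_def)
qed

lemma weight_null:
 assumes "E \<in> null_sets joint" shows "weight E = 0"
proof -
 have E: "E \<in> sets (T \<Otimes>\<^sub>M S)" using assms by auto
 have "AE z in joint. z \<notin> E" using assms by (rule AE_not_in)
 then have "AE t in T. AE x in K t. (t, x) \<notin> E"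
  by (subst (asm) AE_joint) (use E in auto)
 then have "AE t in T. m t * Lnorm q (K t) (\<lambda>x. indicator E (t, x)) = 0"
 proof eventually_elim
  case (elim t)
  then have "(LINT x|K t. indicator E (t, x) :: real) = (LINT x|K t. 0)"
   by (intro integral_eq_zero_AE[THEN trans]) (auto simp: indicator_def elim: eventually_mono)
  then show ?case by (simp add: Lnorm_indicator)
 qed
 then show ?thesis unfolding weight_def by (rule integral_eq_zero_AE)
qed

lemma weight_le: "E \<in> sets (T \<Otimes>\<^sub>M S) ==> weight E <= (LINT t|T. m t)"
 unfolding weight_def
proof (rule integral_mono)
 assume E[measurable]: "E \<in> sets (T \<Otimes>\<^sub>M S)"
 show "integrable T (\<lambda>t. m t * Lnorm q (K t) (\<lambda>x. indicator E (t, x)))" by (rule weight_integrable[OF E])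
 fix t assume t: "t \<in> space T"
 have "Lnorm q (K t) (\<lambda>x. indicator E (t, x)) <= 1"
  using pq by (intro Lnorm_le_const[OF K_space(1)[OF t]] K_section[OF _ t]) (auto simp: indicator_def)
 then show "m t * Lnorm q (K t) (\<lambda>x. indicator E (t, x)) <= m t"
  using m_nonneg[of t] by (simp add: mult_left_le)
qed (rule m_int)

lemma bounded_fieldsI:
 assumes "h \<in> borel_measurable (T \<Otimes>\<^sub>M S)" "!!t x. t \<in> space T ==> norm (h (t, x)) <= C"
 shows "h \<in> bounded_fields"
 using assms by (auto simp: bounded_fields_def space_TS intro!: exI[of _ C])

text \<open>For each basis vector b, the set function E \<mapsto> L (indicator E b) is finitely
  additive and bounded by \<open>weight\<close>, hence countably additive and absolutely continuous;
  its density is the b-component of v. Uniform approximation by step functions extends the formula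
  from indicators to bounded coefficients, and summation over the basis to fields.\<close>

lemma linear_functional_density:
 assumes Lle: "!!h. h \<in> bounded_fields ==> L h <= dual_norm h"
  and Ladd: "!!g h. g \<in> bounded_fields ==> h \<in> bounded_fields ==> L (\<lambda>z. g z + h z) = L g + L h"
  and Lsc: "!!c g. g \<in> bounded_fields ==> L (\<lambda>z. c *\<^sub>R g z) = c * L g"
 obtains v where "v \<in> borel_measurable (T \<Otimes>\<^sub>M S)"
  "!!h. h \<in> bounded_fields ==> integrable joint (\<lambda>z. h z \<bullet> v z)"
  "!!h. h \<in> bounded_fields ==> L h = (LINT z|joint. h z \<bullet> v z)"
proof -
 interpret joint: prob_space joint by (rule prob_space_joint)
 \<comment> \<open>The one-sided domination is applied to h and to - h; the bound by
   \<open>weight\<close> depends only on the Euclidean norm and is the same for both.\<close>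
 have Labs: "\<bar>L h\<bar> <= c * weight E"
  if "h \<in> bounded_fields" "E \<in> sets (T \<Otimes>\<^sub>M S)" "0 <= c"
   "!!t x. t \<in> space T ==> norm (h (t, x)) <= c * indicator E (t, x)" for h c E
 proof -
  have "L h <= c * weight E" using Lle[OF that(1)] dual_norm_le_weight[OF that] by simp
  moreover have "L (\<lambda>z. (-1) *\<^sub>R h z) <= c * weight E"
   by (rule order_trans[OF Lle[OF scale[OF that(1)]] dual_norm_le_weight[OF scale[OF that(1)] that(2,3)]])
    (use that in simp)
  ultimately show ?thesis using Lsc[OF that(1), of "-1"] by (simp add: abs_le_iff)
 qed
 have gb: "(\<lambda>z. g z *\<^sub>R b) \<in> bounded_fields"
  if [measurable]: "g \<in> borel_measurable (T \<Otimes>\<^sub>M S)" and "!!t x. t \<in> space T ==> \<bar>g (t, x)\<bar> <= C" "b \<in> Basis" for g b C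
  by (rule bounded_fieldsI[of _ C]) (use that in auto)
 have ib: "(\<lambda>z. indicator E z *\<^sub>R b) \<in> bounded_fields" if "E \<in> sets (T \<Otimes>\<^sub>M S)" "b \<in> Basis" for E b
  by (rule gb[of _ 1]) (use that in \<open>auto simp: indicator_def\<close>)
 have "\<exists>v. integrable joint v \<and> (\<forall>E\<in>sets (T \<Otimes>\<^sub>M S). L (\<lambda>z. indicator E z *\<^sub>R b) = (LINT z:E|joint. v z))"
  if b: "b \<in> Basis" for b
 proof -
  define \<nu> where "\<nu> E = L (\<lambda>z. indicator E z *\<^sub>R b)" for E
  have bnd: "\<bar>\<nu> E\<bar> <= weight E" if "E \<in> sets (T \<Otimes>\<^sub>M S)" for E
   using Labs[OF ib[OF that b] that, of 1] b by (simp add: \<nu>_def)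
  have add\<nu>: "\<nu> (A \<union> B) = \<nu> A + \<nu> B"
   if "A \<in> sets (T \<Otimes>\<^sub>M S)" "B \<in> sets (T \<Otimes>\<^sub>M S)" "A \<inter> B = {}" for A B
  proof -
   have "(\<lambda>z. indicator (A \<union> B) z *\<^sub>R b) = (\<lambda>z. indicator A z *\<^sub>R b + indicator B z *\<^sub>R b)"
    using that(3) by (auto simp: fun_eq_iff indicator_def)
   then show ?thesis unfolding \<nu>_def using Ladd[OF ib[OF that(1) b] ib[OF that(2) b]] by simp
  qed
  have n0: "\<nu> {} = 0" using bnd[of "{}"] weight_null[of "{}"] by simp
  have cadd: "(\<lambda>i. \<nu> (A i)) sums \<nu> (\<Union>i. A i)"
   if A: "range A \<subseteq> sets (T \<Otimes>\<^sub>M S)" "disjoint_family A" for A :: "nat => ('t \<times> 's) set"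
  proof -
   have Am[measurable]: "A i \<in> sets (T \<Otimes>\<^sub>M S)" for i using A by auto
   have fs: "(\<Sum>i<n. \<nu> (A i)) = \<nu> (\<Union>i<n. A i)" for n
   proof (induction n)
    case (Suc n)
    have "A i \<inter> A n = {}" if "i < n" for i using A(2) that by (simp add: disjoint_family_on_def)
    then have "(\<Union>i<n. A i) \<inter> A n = {}" by blast
    then have "\<nu> ((\<Union>i<n. A i) \<union> A n) = \<nu> (\<Union>i<n. A i) + \<nu> (A n)"
     by (intro add\<nu> sets.finite_UN) auto
    moreover have "(\<Union>i<Suc n. A i) = (\<Union>i<n. A i) \<union> A n" by (auto simp: less_Suc_eq)
    ultimately show ?case using Suc by simp
   qed (simp add: n0)
   \<comment> \<open>Given finite additivity, countable additivity means that \<nu> tends to 0 along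
     these tails.\<close>
   define B where "B n = (\<Union>i. A i) - (\<Union>i<n. A i)" for n
   have B[measurable]: "B n \<in> sets (T \<Otimes>\<^sub>M S)" for n unfolding B_def by measurable
   have "(\<lambda>n. weight (B n)) \<longlonglongrightarrow> 0"
   proof (rule weight_decreasing[OF B])
    fix z show "\<exists>N. \<forall>n\<ge>N. z \<notin> B n"
    proof (cases "\<exists>i. z \<in> A i")
     case True
     then obtain i where "z \<in> A i" by blast
     then have "\<forall>n\<ge>Suc i. z \<notin> B n" by (auto simp: B_def Suc_le_eq)
     then show ?thesis by blast
    qed (simp add: B_def)
   qed
   then have "(\<lambda>n. \<nu> (B n)) \<longlonglongrightarrow> 0"
    by (rule Lim_null_comparison[rotated]) (use bnd[OF B] in auto)
   moreover have "\<nu> (\<Union>i. A i) = \<nu> (\<Union>i<n. A i) + \<nu> (B n)" for n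
   proof -
    have "(\<Union>i. A i) = (\<Union>i<n. A i) \<union> B n" "(\<Union>i<n. A i) \<inter> B n = {}" by (auto simp: B_def)
    then show ?thesis using add\<nu>[of "\<Union>i<n. A i" "B n"] by (simp add: sets.finite_UN)
   qed
   then have "\<nu> (B n) = \<nu> (\<Union>i. A i) - (\<Sum>i<n. \<nu> (A i))" for n
    unfolding fs by (metis add_diff_cancel_left')
   ultimately have "(\<lambda>n. \<nu> (\<Union>i. A i) - (\<Sum>i<n. \<nu> (A i))) \<longlonglongrightarrow> 0" by simp
   from tendsto_diff[OF tendsto_const[of "\<nu> (\<Union>i. A i)"] this]
   show ?thesis by (simp add: sums_def)
  qed
  have bnd': "\<bar>\<nu> A\<bar> <= (LINT t|T. m t)" if "A \<in> sets joint" for A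
   using bnd[of A] weight_le[of A] that by simp
  have null': "\<nu> A = 0" if "A \<in> null_sets joint" for A
   using bnd[of A] weight_null[OF that] that by (auto simp: null_sets_def)
  obtain v where v: "integrable joint v" "!!A. A \<in> sets joint ==> \<nu> A = (LINT z:A|joint. v z)"
  proof (rule Radon_Nikodym_signed[OF joint.finite_measure_axioms bnd' _ _ null'])
   show "(\<lambda>i. \<nu> (A i)) sums \<nu> (\<Union>i. A i)" if "range A \<subseteq> sets joint" "disjoint_family A" for A :: "nat => ('t \<times> 's) set"
    using cadd that by simp
   show "\<nu> (A \<union> B) = \<nu> A + \<nu> B" if "A \<in> sets joint" "B \<in> sets joint" "A \<inter> B = {}" for A B
    using add\<nu> that by simp
  qed (assumption | rule that)+
  then show ?thesis unfolding \<nu>_def by (intro exI[of _ v]) simp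
 qed
 then obtain w where wi: "!!b. b \<in> Basis ==> integrable joint (w b)"
  and w: "!!b E. b \<in> Basis ==> E \<in> sets (T \<Otimes>\<^sub>M S) ==> L (\<lambda>z. indicator E z *\<^sub>R b) = (LINT z:E|joint. w b z)"
  by metis
 have wm: "w b \<in> borel_measurable (T \<Otimes>\<^sub>M S)" if "b \<in> Basis" for b
  using borel_measurable_integrable[OF wi[OF that]] by simp
 have gwi: "integrable joint (\<lambda>z. g z * w b z)"
  if g: "g \<in> borel_measurable (T \<Otimes>\<^sub>M S)" "!!t x. t \<in> space T ==> \<bar>g (t, x)\<bar> <= C" and b: "b \<in> Basis" for g b C
 proof (rule Bochner_Integration.integrable_bound[OF integrable_mult_right[OF wi[OF b], of C]])
  show "(\<lambda>z. g z * w b z) \<in> borel_measurable joint" using g(1) wm[OF b] by simp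
  show "AE z in joint. norm (g z * w b z) <= norm (C * w b z)"
  proof (rule AE_I2)
   fix z assume "z \<in> space joint"
   then have "\<bar>g z\<bar> <= C" using g(2)[of "fst z" "snd z"] by (simp add: space_TS)
   then show "norm (g z * w b z) <= norm (C * w b z)"
    by (simp add: abs_mult mult_right_mono)
  qed
 qed
 have Lfin: "L (\<lambda>z. (\<Sum>k\<in>F. c k * indicator (E k) z) *\<^sub>R b) = (\<Sum>k\<in>F. c k * (LINT z:E k|joint. w b z))"
  if "finite F" "!!k. E k \<in> sets (T \<Otimes>\<^sub>M S)" and b: "b \<in> Basis" for F :: "int set" and c :: "int => real" and E b
  using that(1)
 proof (induction F)
  case empty
  then show ?case using Lsc[OF zero, of 0] by simp
 next
  case (insert k F)
  have s: "(\<lambda>z. (\<Sum>k\<in>F. c k * indicator (E k) z) *\<^sub>R b) \<in> bounded_fields"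
  proof (rule gb[of _ "\<Sum>k\<in>F. \<bar>c k\<bar>"])
   show "(\<lambda>z. \<Sum>k\<in>F. c k * indicator (E k) z) \<in> borel_measurable (T \<Otimes>\<^sub>M S)" using that(2) by measurable
   show "\<bar>\<Sum>k\<in>F. c k * indicator (E k) (t, x)\<bar> <= (\<Sum>k\<in>F. \<bar>c k\<bar>)" for t x
    by (rule order_trans[OF sum_abs]) (intro sum_mono, simp add: indicator_def)
  qed (rule b)
  have "L (\<lambda>z. c k *\<^sub>R (indicator (E k) z *\<^sub>R b) + (\<Sum>k\<in>F. c k * indicator (E k) z) *\<^sub>R b)
    = c k * (LINT z:E k|joint. w b z) + (\<Sum>k\<in>F. c k * (LINT z:E k|joint. w b z))"
   using Ladd[OF scale[OF ib[OF that(2) b]] s, of "c k" k] Lsc[OF ib[OF that(2) b]] w[OF b that(2)] insert.IH by simp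
  then show ?case by (simp only: sum.insert[OF insert.hyps] scaleR_add_left scaleR_scaleR)
 qed
 have Lg: "L (\<lambda>z. g z *\<^sub>R b) = (LINT z|joint. g z * w b z)"
  if g[measurable]: "g \<in> borel_measurable (T \<Otimes>\<^sub>M S)" and gC: "!!t x. t \<in> space T ==> \<bar>g (t, x)\<bar> <= C" and b: "b \<in> Basis" for g b C
 proof -
  \<comment> \<open>Replacing \<open>g\<close> by a function at uniform distance at most 1 / (n + 1)
    costs that distance times the integral of \<open>m\<close> in \<open>L\<close>, and times the
    integral of |w b| in the integral; \<open>A\<close> is the sum of the two factors.\<close>
  define A where "A = (LINT t|T. m t) + (LINT z|joint. \<bar>w b z\<bar>)"
  have "\<bar>L (\<lambda>z. g z *\<^sub>R b) - (LINT z|joint. g z * w b z)\<bar> <= A / real (Suc n)" for n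
  proof -
   define N where "N = real (Suc n)"
   have N: "1 <= N" "0 < N" by (auto simp: N_def)
   define E where "E k = {z \<in> space (T \<Otimes>\<^sub>M S). \<lfloor>N * g z\<rfloor> = k}" for k :: int
   \<comment> \<open>Since |g| <= C, rounding N g down yields only these finitely many
     integers.\<close>
   define F where "F = {\<lfloor>- (N * C)\<rfloor>..\<lfloor>N * C\<rfloor>}"
   define s where "s z = (\<Sum>k\<in>F. (of_int k / N) * indicator (E k) z)" for z
   have E[measurable]: "E k \<in> sets (T \<Otimes>\<^sub>M S)" for k unfolding E_def by measurable
   have s_eq: "s z = of_int \<lfloor>N * g z\<rfloor> / N" if z: "z \<in> space (T \<Otimes>\<^sub>M S)" for z
   proof -
    have "\<bar>g z\<bar> <= C" using gC[of "fst z" "snd z"] z by (simp add: space_TS)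
    then have "- (N * C) <= N * g z" "N * g z <= N * C"
     using mult_left_mono[of "g z" C N] mult_left_mono[of "- C" "g z" N] N by (auto simp: abs_le_iff)
    then have F: "\<lfloor>N * g z\<rfloor> \<in> F" unfolding F_def by (auto intro!: floor_mono)
    have "s z = (\<Sum>k\<in>F. if k = \<lfloor>N * g z\<rfloor> then of_int k / N else 0)"
     unfolding s_def by (intro sum.cong refl) (use z in \<open>simp add: E_def\<close>)
    also have "\<dots> = of_int \<lfloor>N * g z\<rfloor> / N" using F by (subst sum.delta) (auto simp: F_def)
    finally show ?thesis .
   qed
   have close: "\<bar>g z - s z\<bar> <= 1 / N" if z: "z \<in> space (T \<Otimes>\<^sub>M S)" for z
   proof -
    have "\<bar>N * g z - of_int \<lfloor>N * g z\<rfloor>\<bar> <= 1" by linarith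
    then have "\<bar>N * (g z - s z)\<bar> <= 1" unfolding s_eq[OF z] using N by (simp add: right_diff_distrib)
    then have "N * \<bar>g z - s z\<bar> <= 1" using N by (simp add: abs_mult)
    then show ?thesis using N by (simp add: field_simps)
   qed
   have sm[measurable]: "s \<in> borel_measurable (T \<Otimes>\<^sub>M S)" unfolding s_def by measurable
   have sC: "\<bar>s (t, x)\<bar> <= C + 1" if "t \<in> space T" for t x
   proof -
    have "1 / N <= 1" using N by simp
    moreover have "\<bar>g (t, x) - s (t, x)\<bar> <= 1 / N" using close[of "(t, x)"] that by (simp add: space_TS)
    ultimately show ?thesis using gC[OF that, of x] by linarith
   qed
   have Ls: "L (\<lambda>z. s z *\<^sub>R b) = (LINT z|joint. s z * w b z)"
   proof -
    have "L (\<lambda>z. s z *\<^sub>R b) = (\<Sum>k\<in>F. (of_int k / N) * (LINT z:E k|joint. w b z))"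
     unfolding s_def by (rule Lfin[OF _ E b]) (simp add: F_def)
    also have "\<dots> = (\<Sum>k\<in>F. LINT z|joint. (of_int k / N) * (indicator (E k) z * w b z))"
     by (simp add: set_lebesgue_integral_def)
    also have "\<dots> = (LINT z|joint. (\<Sum>k\<in>F. (of_int k / N) * (indicator (E k) z * w b z)))"
    proof (rule Bochner_Integration.integral_sum[symmetric])
     fix k
     have "integrable joint (\<lambda>z. indicator (E k) z * w b z)"
      by (rule gwi[of _ 1]) (auto simp: indicator_def b)
     then show "integrable joint (\<lambda>z. (of_int k / N) * (indicator (E k) z * w b z))"
      by (rule integrable_mult_right)
    qed
    also have "\<dots> = (LINT z|joint. s z * w b z)"
     by (simp add: s_def sum_distrib_right mult.assoc)
    finally show ?thesis .
   qed
   have d: "(\<lambda>z. (g z - s z) *\<^sub>R b) \<in> bounded_fields"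
    by (rule gb[of _ "1 / N"]) (use close b N in \<open>auto simp: space_TS\<close>)
   have "L (\<lambda>z. (g z - s z) *\<^sub>R b + s z *\<^sub>R b) = L (\<lambda>z. (g z - s z) *\<^sub>R b) + L (\<lambda>z. s z *\<^sub>R b)"
    by (rule Ladd[OF d gb[OF sm sC b]])
   then have 1: "L (\<lambda>z. g z *\<^sub>R b) = L (\<lambda>z. (g z - s z) *\<^sub>R b) + (LINT z|joint. s z * w b z)"
    by (simp add: Ls scaleR_diff_left)
   have sp: "space (T \<Otimes>\<^sub>M S) \<in> sets (T \<Otimes>\<^sub>M S)" by simp
   have "\<bar>L (\<lambda>z. (g z - s z) *\<^sub>R b)\<bar> <= 1 / N * weight (space (T \<Otimes>\<^sub>M S))"
    by (rule Labs[OF d sp]) (use close b N in \<open>auto simp: space_TS\<close>)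
   also have "\<dots> <= 1 / N * (LINT t|T. m t)" using N by (intro mult_left_mono weight_le sp) simp
   finally have 2: "\<bar>L (\<lambda>z. (g z - s z) *\<^sub>R b)\<bar> <= 1 / N * (LINT t|T. m t)" .
   have "\<bar>(LINT z|joint. s z * w b z) - (LINT z|joint. g z * w b z)\<bar> = \<bar>LINT z|joint. (s z - g z) * w b z\<bar>"
    using Bochner_Integration.integral_diff[OF gwi[OF sm sC b] gwi[OF g gC b]] by (simp add: left_diff_distrib)
   also have "\<dots> <= (LINT z|joint. \<bar>(s z - g z) * w b z\<bar>)" by (rule integral_abs_bound)
   also have "\<dots> <= (LINT z|joint. 1 / N * \<bar>w b z\<bar>)"
   proof (rule integral_mono)
    show "integrable joint (\<lambda>z. \<bar>(s z - g z) * w b z\<bar>)"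
     using Bochner_Integration.integrable_diff[OF gwi[OF sm sC b] gwi[OF g gC b]]
     by (intro integrable_abs) (simp add: left_diff_distrib)
    show "integrable joint (\<lambda>z. 1 / N * \<bar>w b z\<bar>)"
     by (intro integrable_mult_right integrable_abs wi b)
    fix z assume "z \<in> space joint"
    then have "\<bar>s z - g z\<bar> <= 1 / N" using close[of z] by (simp add: abs_minus_commute)
    then show "\<bar>(s z - g z) * w b z\<bar> <= 1 / N * \<bar>w b z\<bar>"
     unfolding abs_mult by (rule mult_right_mono) simp
   qed
   also have "\<dots> = 1 / N * (LINT z|joint. \<bar>w b z\<bar>)" by (rule integral_mult_right_zero)
   finally have 3: "\<bar>(LINT z|joint. s z * w b z) - (LINT z|joint. g z * w b z)\<bar> <= 1 / N * (LINT z|joint. \<bar>w b z\<bar>)" .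
   have "A / N = 1 / N * (LINT t|T. m t) + 1 / N * (LINT z|joint. \<bar>w b z\<bar>)"
    by (simp add: A_def add_divide_distrib)
   then show ?thesis using 1 2 3 unfolding N_def[symmetric] by linarith
  qed
  then have "(\<lambda>n. A / real (Suc n)) \<longlonglongrightarrow> 0 ==> \<bar>L (\<lambda>z. g z *\<^sub>R b) - (LINT z|joint. g z * w b z)\<bar> <= 0"
   by (intro LIMSEQ_le_const) auto
  moreover have "(\<lambda>n. A / real (Suc n)) \<longlonglongrightarrow> 0"
   by (rule LIMSEQ_Suc[OF lim_const_over_n])
  ultimately show ?thesis by simp
 qed
 define v where "v z = (\<Sum>b\<in>Basis. w b z *\<^sub>R b)" for z
 have hb: "(\<lambda>z. h z \<bullet> b) \<in> borel_measurable (T \<Otimes>\<^sub>M S)" "\<exists>C. \<forall>t x. t \<in> space T --> \<bar>h (t, x) \<bullet> b\<bar> <= C"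
  if h: "h \<in> bounded_fields" and b: "b \<in> Basis" for h b
 proof -
  obtain C where C: "h \<in> borel_measurable (T \<Otimes>\<^sub>M S)" "!!t x. t \<in> space T ==> norm (h (t, x)) <= C"
   using bounded_fieldsE[OF h] by blast
  show "(\<lambda>z. h z \<bullet> b) \<in> borel_measurable (T \<Otimes>\<^sub>M S)" using C(1) by measurable
  show "\<exists>C. \<forall>t x. t \<in> space T --> \<bar>h (t, x) \<bullet> b\<bar> <= C"
   using order_trans[OF Basis_le_norm[OF b] C(2)] by blast
 qed
 have hv: "h z \<bullet> v z = (\<Sum>b\<in>Basis. (h z \<bullet> b) * w b z)" for h z
  by (simp add: v_def inner_sum_right mult.commute)
 have hwi: "integrable joint (\<lambda>z. (h z \<bullet> b) * w b z)" if "h \<in> bounded_fields" "b \<in> Basis" for h b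
  using hb[OF that] gwi[of "\<lambda>z. h z \<bullet> b"] that(2) by metis
 show ?thesis
 proof (rule that[of v])
  show "v \<in> borel_measurable (T \<Otimes>\<^sub>M S)" unfolding v_def using wm by measurable
  fix h assume h: "h \<in> bounded_fields"
  show "integrable joint (\<lambda>z. h z \<bullet> v z)"
   unfolding hv by (intro Bochner_Integration.integrable_sum hwi[OF h])
  have Lsum: "(\<lambda>z. \<Sum>b\<in>B. (h z \<bullet> b) *\<^sub>R b) \<in> bounded_fields \<and>
    L (\<lambda>z. \<Sum>b\<in>B. (h z \<bullet> b) *\<^sub>R b) = (\<Sum>b\<in>B. LINT z|joint. (h z \<bullet> b) * w b z)"
   if "finite B" "B \<subseteq> Basis" for B
   using that
  proof (induction B)
   case empty
   then show ?case using Lsc[OF zero, of 0] zero by simp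
  next
   case (insert b B)
   then have b: "b \<in> Basis" by simp
   obtain C where C: "!!t x. t \<in> space T ==> \<bar>h (t, x) \<bullet> b\<bar> <= C" using hb(2)[OF h b] by blast
   note f = gb[OF hb(1)[OF h b] C b]
   show ?case
    using insert add[OF f, of "\<lambda>z. \<Sum>b\<in>B. (h z \<bullet> b) *\<^sub>R b"] Ladd[OF f, of "\<lambda>z. \<Sum>b\<in>B. (h z \<bullet> b) *\<^sub>R b"]
     Lg[OF hb(1)[OF h b] C b] by simp
  qed
  have "L h = L (\<lambda>z. \<Sum>b\<in>Basis. (h z \<bullet> b) *\<^sub>R b)" by (simp add: euclidean_representation)
  also have "\<dots> = (\<Sum>b\<in>Basis. LINT z|joint. (h z \<bullet> b) * w b z)" using Lsum[of Basis] by simp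
  also have "\<dots> = (LINT z|joint. h z \<bullet> v z)"
   unfolding hv by (rule Bochner_Integration.integral_sum[symmetric]) (rule hwi[OF h])
  finally show "L h = (LINT z|joint. h z \<bullet> v z)" .
 qed
qed

end

section \<open>The pointwise norm bound and the representation theorem\<close>

context dual_setting
begin

lemma G_comp_meas:
 assumes [measurable]: "v \<in> borel_measurable (T \<Otimes>\<^sub>M S)"
 shows "(\<lambda>z. G (snd z) (v z)) \<in> borel_measurable (T \<Otimes>\<^sub>M S)"
proof -
 have "(\<lambda>z. (snd z, v z)) \<in> T \<Otimes>\<^sub>M S \<rightarrow>\<^sub>M S \<Otimes>\<^sub>M borel" by measurable
 from measurable_compose[OF this G_meas] show ?thesis by simp
qed

lemma J_comp_meas:
 assumes [measurable]: "v \<in> borel_measurable (T \<Otimes>\<^sub>M S)"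
 shows "(\<lambda>z. J (snd z) (v z)) \<in> borel_measurable (T \<Otimes>\<^sub>M S)"
proof -
 have "(\<lambda>z. (snd z, v z)) \<in> T \<Otimes>\<^sub>M S \<rightarrow>\<^sub>M S \<Otimes>\<^sub>M borel" by measurable
 from measurable_compose[OF this J_meas] show ?thesis by simp
qed

text \<open>Testing the functional against \<open>G(v)\<^sup>p\<^sup>-\<^sup>2 J(v)\<close>, truncated so as to be bounded and localised in
 time, turns the domination by the dual norm into the pointwise bound.\<close>

lemma density_Lp_bound:
 assumes v[measurable]: "v \<in> borel_measurable (T \<Otimes>\<^sub>M S)"
  and le: "!!h. h \<in> bounded_fields ==> (LINT z|joint. h z \<bullet> v z) <= dual_norm h"
 shows "AE t in T. (\<integral>\<^sup>+ x. ennreal (G x (v (t, x)) powr p) \<partial>K t) <= ennreal (m t powr p)"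
proof -
 interpret joint: prob_space joint by (rule prob_space_joint)
 define g where "g z = G (snd z) (v z)" for z
 have g[measurable]: "g \<in> borel_measurable (T \<Otimes>\<^sub>M S)" unfolding g_def by (rule G_comp_meas[OF v])
 have g0: "0 <= g z" for z by (simp add: g_def G_nonneg)
 have Jm[measurable]: "(\<lambda>z. J (snd z) (v z)) \<in> borel_measurable (T \<Otimes>\<^sub>M S)" by (rule J_comp_meas[OF v])
 \<comment> \<open>The extremal covector for v in the duality of L^p and L^q: it pairs with v to g^p
   and has dual norm at most g^(p - 1), whose q-th power is again g^p. Where g vanishes,
   \<open>0 powr (p - 2) = 0\<close> keeps these identities, even for p < 2.\<close>
 define h0 where "h0 z = (g z powr (p - 2)) *\<^sub>R J (snd z) (v z)" for z
 have h0[measurable]: "h0 \<in> borel_measurable (T \<Otimes>\<^sub>M S)" unfolding h0_def by measurable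
 have gp: "g z powr (p - 2) * (g z)\<^sup>2 = g z powr p" "g z powr (p - 2) * g z = g z powr (p - 1)" for z
 proof -
  consider "g z = 0" | "0 < g z" using g0[of z] by linarith
  then have "g z powr (p - 2) * (g z)\<^sup>2 = g z powr p \<and> g z powr (p - 2) * g z = g z powr (p - 1)"
  proof cases
   case 2
   have "g z powr (p - 2) * g z powr 2 = g z powr p" "g z powr (p - 2) * g z powr 1 = g z powr (p - 1)"
    by (simp_all only: powr_add[symmetric]) simp_all
   then show ?thesis using 2 by simp
  qed simp
  then show "g z powr (p - 2) * (g z)\<^sup>2 = g z powr p" "g z powr (p - 2) * g z = g z powr (p - 1)" by auto
 qed
 have hv: "h0 z \<bullet> v z = g z powr p" for z
  by (simp add: h0_def J_self g_def[symmetric] gp)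
 have ph: "polar (snd z) (h0 z) <= g z powr (p - 1)" for z
  using polar_J[of "g z powr (p - 2)" "snd z" "v z"] gp(2)[of z] by (simp add: h0_def g_def)
 \<comment> \<open>Both bounds matter: that on \<open>h0\<close> makes the test field admissible,
   that on \<open>g\<close> makes \<open>a k t\<close> an integral of a bounded function.\<close>
 define B where "B k = {z \<in> space (T \<Otimes>\<^sub>M S). g z <= real k \<and> norm (h0 z) <= real k}" for k :: nat
 have B[measurable]: "B k \<in> sets (T \<Otimes>\<^sub>M S)" for k unfolding B_def by measurable
 define a where "a k t = (LINT x|K t. indicator (B k) (t, x) * g (t, x) powr p)" for k t
 have bd: "indicator (B k) z * g z powr r <= real k powr r" if "0 <= r" for k z r
  using that g0[of z] by (auto simp: B_def indicator_def intro!: powr_mono2)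
 have [measurable]: "(\<lambda>z. indicator (B k) z * g z powr r) \<in> borel_measurable (T \<Otimes>\<^sub>M S)" for k r by measurable
 note Bg = this
 have p: "1 <= p" "0 <= p - 1" "(p - 1) * q = p" "1 <= q" using pq by (auto simp: field_simps)
 have Lnorm_a: "Lnorm q (K t) (\<lambda>x. indicator (B k) (t, x) * g (t, x) powr (p - 1)) = a k t powr (1 / q)" for k t
  unfolding Lnorm_def a_def
  by (intro arg_cong2[where f="(powr)"] refl Bochner_Integration.integral_cong)
   (use p pq in \<open>auto simp: indicator_def powr_powr\<close>)
 have ai: "integrable T (a k)" for k
 proof -
  have "integrable joint (\<lambda>z. indicator (B k) z * g z powr p)"
   by (rule joint.integrable_const_bound[where B="real k powr p"]) (use bd[of p k] p Bg in auto)
  from integral_joint(2)[OF this] show ?thesis unfolding a_def .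
 qed
 have a_nonneg: "0 <= a k t" for k t unfolding a_def by (rule Bochner_Integration.integral_nonneg) simp
 have ari: "integrable T (\<lambda>t. m t * a k t powr (1 / q))" for k
  using dual_norm_integrable[OF Bg[of k "p - 1"], of "real k powr (p - 1)"] bd[of "p - 1" k] p
  by (simp add: Lnorm_a)
 \<comment> \<open>The truncated field is tested on an arbitrary time set A; as the dual norm is an
   integral over time, A restricts both sides alike and the inequality becomes pointwise in
   t.\<close>
 have key: "AE t in T. a k t <= m t * a k t powr (1 / q)" for k
 proof (rule AE_le_of_set_integral_le[OF ai ari])
  fix A assume A[measurable]: "A \<in> sets T"
  define h where "h z = indicator A (fst z) *\<^sub>R (indicator (B k) z *\<^sub>R h0 z)" for z
  have hm: "h \<in> borel_measurable (T \<Otimes>\<^sub>M S)" unfolding h_def by measurable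
  have hb: "h \<in> bounded_fields"
   by (rule bounded_fieldsI[OF hm, of "real k"]) (auto simp: h_def indicator_def B_def)
  have i: "integrable joint (\<lambda>z. indicator A (fst z) * (indicator (B k) z * g z powr p))"
   by (rule joint.integrable_const_bound[where B="real k powr p"])
    (use bd[of p k] p Bg in \<open>auto simp: indicator_def\<close>)
  have "(LINT t|T. indicator A t * a k t) = (LINT z|joint. indicator A (fst z) * (indicator (B k) z * g z powr p))"
   by (subst integral_joint(3)[OF i]) (simp add: a_def)
  also have "\<dots> = (LINT z|joint. h z \<bullet> v z)" by (simp add: h_def hv mult.assoc)
  also have "\<dots> <= dual_norm h" by (rule le[OF hb])
  also have "dual_norm h <= (LINT t|T. m t * Lnorm q (K t) (\<lambda>x. indicator A (fst (t, x)) * (indicator (B k) (t, x) * g (t, x) powr (p - 1))))"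
  proof (rule dual_norm_le[OF hb])
   show "(\<lambda>z. indicator A (fst z) * (indicator (B k) z * g z powr (p - 1))) \<in> borel_measurable (T \<Otimes>\<^sub>M S)" by measurable
   fix t x assume "t \<in> space T"
   show "polar x (h (t, x)) <= indicator A (fst (t, x)) * (indicator (B k) (t, x) * g (t, x) powr (p - 1))"
    using ph[of "(t, x)"] polar_le_norm[of x 0] by (auto simp: h_def indicator_def)
   show "indicator A (fst (t, x)) * (indicator (B k) (t, x) * g (t, x) powr (p - 1)) <= real k powr (p - 1)"
    using bd[of "p - 1" k "(t, x)"] p by (auto simp: indicator_def)
  qed
  also have "\<dots> = (LINT t|T. m t * Lnorm q (K t) (\<lambda>x. indicator A t * (indicator (B k) (t, x) * g (t, x) powr (p - 1))))"
   by simp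
  also have "\<dots> = (LINT t|T. indicator A t * (m t * a k t powr (1 / q)))"
  proof (rule Bochner_Integration.integral_cong[OF refl])
   fix t assume t: "t \<in> space T"
   have "Lnorm q (K t) (\<lambda>x. indicator A t * (indicator (B k) (t, x) * g (t, x) powr (p - 1)))
     = indicator A t * Lnorm q (K t) (\<lambda>x. indicator (B k) (t, x) * g (t, x) powr (p - 1))"
    using p by (intro Lnorm_scale[OF K_space(1)[OF t]]) auto
   then show "m t * Lnorm q (K t) (\<lambda>x. indicator A t * (indicator (B k) (t, x) * g (t, x) powr (p - 1))) = indicator A t * (m t * a k t powr (1 / q))"
    by (simp add: Lnorm_a)
  qed
  finally show "(LINT t|T. indicator A t * a k t) <= (LINT t|T. indicator A t * (m t * a k t powr (1 / q)))" .
 qed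
 have "AE t in T. \<forall>k. a k t <= m t * a k t powr (1 / q)" using key by (simp add: AE_all_countable)
 with AE_space show ?thesis
 proof eventually_elim
  case (elim t)
  then have t: "t \<in> space T" by simp
  \<comment> \<open>The truncation keeps \<open>a k t\<close> finite, so its power 1 / q can be
    cancelled, which leaves the power 1 / p bounded by \<open>m t\<close>.\<close>
  have am: "a k t <= m t powr p" for k
  proof (cases "a k t = 0")
   case False
   then have a: "0 < a k t" using a_nonneg[of k t] by simp
   have "a k t powr (1 / p) * a k t powr (1 / q) = a k t" using a pq by (simp add: powr_add[symmetric])
   then have "a k t powr (1 / p) * a k t powr (1 / q) <= m t * a k t powr (1 / q)" using elim by simp
   then have "a k t powr (1 / p) <= m t" using a by simp
   then have "(a k t powr (1 / p)) powr p <= m t powr p" using p by (intro powr_mono2) auto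
   then show ?thesis using a p by (simp add: powr_powr)
  qed simp
  have sec: "(\<lambda>x. indicator (B k) (t, x) * g (t, x) powr p) \<in> borel_measurable (K t)" for k
   using K_section[OF Bg[of k p] t] by simp
  have le: "(\<integral>\<^sup>+ x. ennreal (indicator (B k) (t, x) * g (t, x) powr p) \<partial>K t) <= ennreal (m t powr p)" for k
  proof -
   have "integrable (K t) (\<lambda>x. indicator (B k) (t, x) * g (t, x) powr p)"
    by (rule finite_measure.integrable_const_bound[OF prob_space.finite_measure[OF K_space(1)[OF t]], where B="real k powr p"])
     (use bd[of p k] p sec in auto)
   then have "(\<integral>\<^sup>+ x. ennreal (indicator (B k) (t, x) * g (t, x) powr p) \<partial>K t) = ennreal (a k t)"
    unfolding a_def by (rule nn_integral_eq_integral) simp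
   then show ?thesis using am by (simp add: ennreal_leI)
  qed
  have "(\<integral>\<^sup>+ x. ennreal (g (t, x) powr p) \<partial>K t) = (\<integral>\<^sup>+ x. (SUP k. ennreal (indicator (B k) (t, x) * g (t, x) powr p)) \<partial>K t)"
  proof (rule nn_integral_cong)
   fix x
   obtain k :: nat where k: "max (g (t, x)) (norm (h0 (t, x))) <= real k" using real_arch_simple by blast
   have "(SUP k. ennreal (indicator (B k) (t, x) * g (t, x) powr p)) = ennreal (g (t, x) powr p)"
   proof (rule antisym)
    show "(SUP k. ennreal (indicator (B k) (t, x) * g (t, x) powr p)) <= ennreal (g (t, x) powr p)"
     by (rule SUP_least) (auto simp: indicator_def)
    have "(t, x) \<in> B k" using k t by (simp add: B_def space_TS)
    then show "ennreal (g (t, x) powr p) <= (SUP k. ennreal (indicator (B k) (t, x) * g (t, x) powr p))"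
     by (intro SUP_upper2[of k]) auto
   qed
   then show "ennreal (g (t, x) powr p) = (SUP k. ennreal (indicator (B k) (t, x) * g (t, x) powr p))" by simp
  qed
  also have "\<dots> = (SUP k. \<integral>\<^sup>+ x. ennreal (indicator (B k) (t, x) * g (t, x) powr p) \<partial>K t)"
  proof (rule nn_integral_monotone_convergence_SUP)
   show "incseq (\<lambda>k x. ennreal (indicator (B k) (t, x) * g (t, x) powr p))"
    by (auto simp: incseq_def le_fun_def indicator_def B_def intro: order_trans)
  qed (use sec in measurable)
  also have "\<dots> <= ennreal (m t powr p)" by (rule SUP_least) (rule le)
  finally show ?case by (simp add: g_def)
 qed
qed

text \<open>\<open>R\<close> is the graph of the functional prescribed on test fields. It is a
  relation because only the domination shows that equal fields receive equal values. A cone closed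
  under negation carries a dominated linear extension, whose density v then obeys
  \<open>density_Lp_bound\<close>.\<close>

theorem representation:
 assumes R0: "((\<lambda>_. 0), 0) \<in> R" and RX: "!!h a. (h, a) \<in> R ==> h \<in> bounded_fields"
  and Rle: "!!h a. (h, a) \<in> R ==> a <= dual_norm h"
  and Radd: "!!g a h b. (g, a) \<in> R ==> (h, b) \<in> R ==> ((\<lambda>z. g z + h z), a + b) \<in> R"
  and Rscale: "!!g a c. (g, a) \<in> R ==> ((\<lambda>z. c *\<^sub>R g z), c * a) \<in> R"
 obtains v where "v \<in> borel_measurable (T \<Otimes>\<^sub>M S)"
  "!!h a. (h, a) \<in> R ==> integrable joint (\<lambda>z. h z \<bullet> v z)"
  "!!h a. (h, a) \<in> R ==> a = (LINT z|joint. h z \<bullet> v z)"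
  "AE t in T. (\<integral>\<^sup>+ x. ennreal (G x (v (t, x)) powr p) \<partial>K t) <= ennreal (m t powr p)"
proof -
 have R: "dominated_cone R dual_norm"
  unfolding dominated_cone_def using R0 RX Rle Radd Rscale by blast
 have Rneg: "((\<lambda>z. - g z), - a) \<in> R" if "(g, a) \<in> R" for g a using Rscale[OF that, of "-1"] by simp
 obtain L where L: "!!g. g \<in> bounded_fields ==> L g <= dual_norm g"
  "!!g h. g \<in> bounded_fields ==> h \<in> bounded_fields ==> L (\<lambda>z. g z + h z) = L g + L h"
  "!!c g. g \<in> bounded_fields ==> L (\<lambda>z. c *\<^sub>R g z) = c * L g"
  "!!g a. (g, a) \<in> R ==> L g = a"
  by (rule hahn_banach[OF sublinear_dual_norm R Rneg]) (assumption | rule that)+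
 obtain v where v: "v \<in> borel_measurable (T \<Otimes>\<^sub>M S)"
  "!!h. h \<in> bounded_fields ==> integrable joint (\<lambda>z. h z \<bullet> v z)"
  "!!h. h \<in> bounded_fields ==> L h = (LINT z|joint. h z \<bullet> v z)"
  by (rule linear_functional_density[of L, OF L(1) L(2) L(3)]) (assumption | rule that)+
 show ?thesis
 proof (rule that[OF v(1)])
  show "AE t in T. (\<integral>\<^sup>+ x. ennreal (G x (v (t, x)) powr p) \<partial>K t) <= ennreal (m t powr p)"
   by (rule density_Lp_bound[OF v(1)]) (use L(1) v(3) in simp)
 qed (use RX v L(4) in force)+
qed

end

section \<open>Manifolds and Finsler metrics\<close>

lemma Ck_on_continuous: "Ck_on k S f ==> continuous_on S f"
 by (cases k) (auto intro!: continuous_at_imp_continuous_on differentiable_imp_continuous_within)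

lemma frechet_derivative_cong_open:
 assumes "open S" "x \<in> S" "!!y. y \<in> S ==> f y = g y"
 shows "f differentiable (at x) \<longleftrightarrow> g differentiable (at x)"
  "frechet_derivative f (at x) = frechet_derivative g (at x)"
proof -
 have e: "(f has_derivative f') (at x) \<longleftrightarrow> (g has_derivative f') (at x)" for f'
  using has_derivative_transform_within_open[OF _ assms(1,2), of f f' UNIV g]
   has_derivative_transform_within_open[OF _ assms(1,2), of g f' UNIV f] assms(3) by auto
 show "f differentiable (at x) \<longleftrightarrow> g differentiable (at x)" by (simp add: differentiable_def e)
 show "frechet_derivative f (at x) = frechet_derivative g (at x)" by (simp add: frechet_derivative_def e)
qed

lemma Ck_on_cong:
 assumes "open S" "!!y. y \<in> S ==> f y = g y"
 shows "Ck_on k S f \<longleftrightarrow> Ck_on k S g"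
 using assms(2)
proof (induction k arbitrary: f g)
 case 0
 then show ?case by (simp cong: continuous_on_cong)
next
 case (Suc k)
 have "frechet_derivative f (at y) = frechet_derivative g (at y)" if "y \<in> S" for y
  using frechet_derivative_cong_open(2)[OF assms(1) that Suc.prems] by simp
 then have "Ck_on k S (\<lambda>x. frechet_derivative f (at x) v) \<longleftrightarrow> Ck_on k S (\<lambda>x. frechet_derivative g (at x) v)" for v
  by (intro Suc.IH) simp
 then show ?case using frechet_derivative_cong_open(1)[OF assms(1) _ Suc.prems] by simp
qed

text \<open>Affine inner maps cover all compositions that occur: fibre slices of \<open>F\<close>,
  linear changes of time, straight segments. The induction closes because the derivative of f (b + l
  x) in direction v is that of f in direction l v, again composed with the same affine map.\<close>

lemma Ck_on_affine:
 fixes f :: "'b::real_normed_vector => 'c::real_normed_vector" and l :: "'a::real_normed_vector => 'b"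
 assumes "Ck_on k S f" "bounded_linear l" "open T" "!!x. x \<in> T ==> b + l x \<in> S"
 shows "Ck_on k T (\<lambda>x. f (b + l x))"
 using assms(1)
proof (induction k arbitrary: f)
 case 0
 have "continuous_on T (\<lambda>x. b + l x)"
  using assms(2) by (intro continuous_intros linear_continuous_on)
 then show ?case using 0 assms(4) by (auto intro: continuous_on_compose2)
next
 case (Suc k)
 have d: "((\<lambda>x. f (b + l x)) has_derivative (\<lambda>v. frechet_derivative f (at (b + l x)) (l v))) (at x)" if "x \<in> T" for x
 proof -
  have "(f has_derivative frechet_derivative f (at (b + l x))) (at (b + l x))"
   using Suc.prems assms(4)[OF that] by (simp add: frechet_derivative_works)
  moreover have "((\<lambda>x. b + l x) has_derivative l) (at x)"
   using assms(2) by (auto intro!: derivative_eq_intros bounded_linear_imp_has_derivative)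
  ultimately show ?thesis by (rule has_derivative_compose[rotated])
 qed
 show ?case
  unfolding Ck_on.simps
 proof (intro conjI ballI allI)
  show "(\<lambda>x. f (b + l x)) differentiable at x" if "x \<in> T" for x
   using d[OF that] by (auto simp: differentiable_def)
  fix v
  have "Ck_on k T (\<lambda>x. frechet_derivative f (at (b + l x)) (l v))"
   using Suc.prems by (intro Suc.IH) simp
  moreover have "frechet_derivative f (at (b + l x)) (l v) = frechet_derivative (\<lambda>x. f (b + l x)) (at x) v" if "x \<in> T" for x
   using frechet_derivative_at[OF d[OF that]] by (metis)
  ultimately show "Ck_on k T (\<lambda>x. frechet_derivative (\<lambda>x. f (b + l x)) (at x) v)"
   using Ck_on_cong[OF assms(3)] by (metis (no_types, lifting))
 qed
qed

lemma Ck1_has_derivative: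
 "Ck_on (Suc 0) S f ==> x \<in> S ==> (f has_derivative frechet_derivative f (at x)) (at x)"
 by (simp add: frechet_derivative_works[symmetric])

lemma frechet_derivative_linear: "f differentiable (at x) ==> linear (frechet_derivative f (at x))"
 using frechet_derivative_works has_derivative_linear by blast

text \<open>\<open>Ck_on\<close> controls each directional derivative separately; linearity over a
  finite basis makes the derivative jointly continuous in point and direction.\<close>

lemma continuous_on_frechet_derivative:
 fixes f :: "'a::euclidean_space => 'b::real_normed_vector"
 assumes f: "Ck_on (Suc 0) S f" and y: "continuous_on T y" "y ` T \<subseteq> S" and w: "continuous_on T w"
 shows "continuous_on T (\<lambda>t. frechet_derivative f (at (y t)) (w t))"
proof -
 have "frechet_derivative f (at (y t)) (w t) = (\<Sum>b\<in>Basis. (w t \<bullet> b) *\<^sub>R frechet_derivative f (at (y t)) b)" if "t \<in> T" for t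
 proof -
  have l: "linear (frechet_derivative f (at (y t)))"
   using f y(2) that by (intro frechet_derivative_linear) auto
  have "frechet_derivative f (at (y t)) (\<Sum>b\<in>Basis. (w t \<bullet> b) *\<^sub>R b) = (\<Sum>b\<in>Basis. (w t \<bullet> b) *\<^sub>R frechet_derivative f (at (y t)) b)"
   using l by (simp add: linear_sum linear_scale)
  then show ?thesis by (simp add: euclidean_representation)
 qed
 moreover have "continuous_on T (\<lambda>t. \<Sum>b\<in>Basis. (w t \<bullet> b) *\<^sub>R frechet_derivative f (at (y t)) b)"
 proof (intro continuous_on_sum continuous_on_scaleR continuous_on_inner w continuous_on_const)
  fix b
  have "continuous_on S (\<lambda>x. frechet_derivative f (at x) b)" using f by simp
  then show "continuous_on T (\<lambda>t. frechet_derivative f (at (y t)) b)" using y by (rule continuous_on_compose2)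
 qed
 ultimately show ?thesis by (simp cong: continuous_on_cong)
qed

section \<open>Charts, tangent vectors and the pairing with differentials\<close>

locale manifold =
 fixes A :: "('a::{t2_space, second_countable_topology}, 'n::finite) chart set"
 assumes atlas: "smooth_atlas A"
begin

lemma chart:
 assumes "c \<in> A"
 shows chart_open: "open (fst c)" "open (snd c ` fst c)"
  and chart_homeo: "homeomorphism (fst c) (snd c ` fst c) (snd c) (chart_inv c)"
  and chart_cont: "continuous_on (fst c) (snd c)" "continuous_on (snd c ` fst c) (chart_inv c)"
 using atlas assms by (auto simp: smooth_atlas_def is_chart_def homeomorphism_def)

lemma chart_inv[simp]: "c \<in> A ==> x \<in> fst c ==> chart_inv c (snd c x) = x"
 using chart_homeo by (rule homeomorphism_apply1)

lemma chart_inv2: "c \<in> A ==> z \<in> snd c ` fst c ==> snd c (chart_inv c z) = z"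
 by auto

lemma chart_inv_in: "c \<in> A ==> z \<in> snd c ` fst c ==> chart_inv c z \<in> fst c"
 by auto

lemma charts_at_nonempty: "charts_at A x \<noteq> {}"
 using atlas by (simp add: smooth_atlas_def)

lemma charts_atD: "c \<in> charts_at A x ==> c \<in> A" "c \<in> charts_at A x ==> x \<in> fst c"
 by (auto simp: charts_at_def)

lemma open_chart_image:
 assumes "c \<in> A" "open W" "W \<subseteq> fst c" shows "open (snd c ` W)"
proof -
 have "openin (top_of_set (snd c ` fst c)) (snd c ` W)"
  by (rule homeomorphism_imp_open_map[OF chart_homeo[OF assms(1)]]) (use assms in \<open>auto simp: openin_open\<close>)
 then show ?thesis using chart_open(2)[OF assms(1)] by (simp add: openin_open_eq)
qed

lemma open_chart_inv_image:
 assumes "c \<in> A" "open W" "W \<subseteq> snd c ` fst c" shows "open (chart_inv c ` W)"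
proof -
 have "openin (top_of_set (fst c)) (chart_inv c ` W)"
  by (rule homeomorphism_imp_open_map[OF homeomorphism_symD[OF chart_homeo[OF assms(1)]]]) (use assms in \<open>auto simp: openin_open\<close>)
 then show ?thesis using chart_open(1)[OF assms(1)] by (simp add: openin_open_eq)
qed

abbreviation overlap :: "('a, 'n) chart => ('a, 'n) chart => (real ^ 'n) set" where
 "overlap c c' \<equiv> snd c ` (fst c \<inter> fst c')"

lemma open_overlap: "c \<in> A ==> c' \<in> A ==> open (overlap c c')"
 by (intro open_chart_image open_Int) (auto dest: chart_open)

lemma transition_smooth: "c \<in> A ==> c' \<in> A ==> smooth_on (overlap c c') (snd c' \<circ> chart_inv c)"
 using atlas by (simp add: smooth_atlas_def)

lemma transition_has_derivative:
 assumes "c \<in> charts_at A x" "c' \<in> charts_at A x"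
 shows "((snd c' \<circ> chart_inv c) has_derivative transition_deriv c c' x) (at (snd c x))"
proof -
 have "Ck_on (Suc 0) (overlap c c') (snd c' \<circ> chart_inv c)"
  using transition_smooth[of c c'] assms by (auto simp: smooth_on_def charts_at_def)
 moreover have "snd c x \<in> overlap c c'" using assms by (auto simp: charts_at_def)
 ultimately show ?thesis unfolding transition_deriv_def by (rule Ck1_has_derivative)
qed

lemma transition_linear: "c \<in> charts_at A x ==> c' \<in> charts_at A x ==> linear (transition_deriv c c' x)"
 using transition_has_derivative has_derivative_linear by blast

text \<open>The chain rule through a transition map. With values in any normed space it applies to
  transition maps, which gives the cocycle rule, and to functions on the manifold, which gives chart
  independence of the pairing.\<close>

lemma change_of_chart:
 fixes \<phi> :: "'a => 'b::real_normed_vector"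
 assumes c: "c \<in> charts_at A x" "c' \<in> charts_at A x"
  and D: "((\<phi> \<circ> chart_inv c') has_derivative D) (at (snd c' x))"
 shows "((\<phi> \<circ> chart_inv c) has_derivative (\<lambda>y. D (transition_deriv c c' x y))) (at (snd c x))"
proof -
 have cA: "c \<in> A" "c' \<in> A" "x \<in> fst c" "x \<in> fst c'" using c by (auto simp: charts_at_def)
 have "((\<phi> \<circ> chart_inv c') has_derivative D) (at ((snd c' \<circ> chart_inv c) (snd c x)))"
  using D cA by simp
 from has_derivative_compose[OF transition_has_derivative[OF c] this]
 have "((\<lambda>z. (\<phi> \<circ> chart_inv c') ((snd c' \<circ> chart_inv c) z)) has_derivative (\<lambda>y. D (transition_deriv c c' x y))) (at (snd c x))" .
 then show ?thesis
  by (rule has_derivative_transform_within_open[OF _ open_overlap[OF cA(1,2)]]) (use cA in auto)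
qed

lemma transition_comp:
 assumes "c \<in> charts_at A x" "c' \<in> charts_at A x" "c'' \<in> charts_at A x"
 shows "transition_deriv c' c'' x (transition_deriv c c' x y) = transition_deriv c c'' x y"
 using has_derivative_unique[OF change_of_chart[OF assms(1,2) transition_has_derivative[OF assms(2,3)]]
   transition_has_derivative[OF assms(1,3)]] by metis

lemma tangent_of_in_bundle: "c \<in> charts_at A x ==> tangent_of A c x y \<in> tangent_bundle A"
 by (auto simp: tangent_bundle_def tangent_of_def transition_comp)

lemma fst_tangent_of[simp]: "fst (tangent_of A c x y) = x" by (simp add: tangent_of_def)

lemma tangent_of_change:
 assumes "c \<in> charts_at A x" "c' \<in> charts_at A x"
 shows "tangent_of A c x y = tangent_of A c' x (transition_deriv c c' x y)"
 using assms by (auto simp: tangent_of_def transition_comp)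

lemma tscale_tangent_of: "c \<in> charts_at A x ==> tscale r (tangent_of A c x y) = tangent_of A c x (r *\<^sub>R y)"
 by (auto simp: tscale_def tangent_of_def fun_eq_iff linear_scale[OF transition_linear])

lemma tneg_tangent_of: "c \<in> charts_at A x ==> tneg (tangent_of A c x y) = tangent_of A c x (- y)"
 by (auto simp: tneg_def tangent_of_def fun_eq_iff linear_neg[OF transition_linear])

lemma C1_has_derivative:
 assumes "Ck_function 1 A \<phi>" "c \<in> charts_at A x"
 shows "((\<phi> \<circ> chart_inv c) has_derivative frechet_derivative (\<phi> \<circ> chart_inv c) (at (snd c x))) (at (snd c x))"
proof -
 have "Ck_on (Suc 0) (snd c ` fst c) (\<phi> \<circ> chart_inv c)" "snd c x \<in> snd c ` fst c"
  using assms by (auto simp: Ck_function_def charts_at_def)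
 then show ?thesis by (rule Ck1_has_derivative)
qed

text \<open>Eliminates the arbitrary chart chosen in \<open>pairing\<close>: by uniqueness of
  derivatives the value is the same in every chart.\<close>

lemma pairing_tangent_of:
 assumes \<phi>: "Ck_function 1 A \<phi>" and c: "c \<in> charts_at A x"
 shows "pairing A (tangent_of A c x y) \<phi> = frechet_derivative (\<phi> \<circ> chart_inv c) (at (snd c x)) y"
proof -
 define d where "d = (SOME c. c \<in> charts_at A x)"
 have d: "d \<in> charts_at A x" unfolding d_def using charts_at_nonempty[of x] by (simp add: some_in_eq)
 have "pairing A (tangent_of A c x y) \<phi> = frechet_derivative (\<phi> \<circ> chart_inv d) (at (snd d x)) (transition_deriv c d x y)"
  using d by (simp add: pairing_def d_def[symmetric] Let_def) (simp add: tangent_of_def)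
 also have "\<dots> = frechet_derivative (\<phi> \<circ> chart_inv c) (at (snd c x)) y"
  using has_derivative_unique[OF change_of_chart[OF c d C1_has_derivative[OF \<phi> d]] C1_has_derivative[OF \<phi> c]] by metis
 finally show ?thesis .
qed

lemma C1_continuous:
 assumes "Ck_function 1 A \<phi>" shows "continuous_on UNIV \<phi>"
proof (rule continuous_at_imp_continuous_on, rule ballI)
 fix x
 obtain c where c: "c \<in> charts_at A x" using charts_at_nonempty by blast
 then have cA: "c \<in> A" "x \<in> fst c" by (auto simp: charts_at_def)
 have "continuous_on (snd c ` fst c) (\<phi> \<circ> chart_inv c)"
  using assms cA(1) unfolding Ck_function_def by (blast intro: Ck_on_continuous)
 then have "continuous_on (fst c) (\<lambda>y. (\<phi> \<circ> chart_inv c) (snd c y))"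
  by (rule continuous_on_compose2[OF _ chart_cont(1)[OF cA(1)]]) auto
 then have "continuous_on (fst c) \<phi>" using cA by (simp cong: continuous_on_cong)
 then show "continuous (at x) \<phi>" using chart_open(1)[OF cA(1)] cA(2) by (simp add: continuous_on_eq_continuous_at)
qed

lemma topspace_tangent: "topspace (tangent_topology A) = tangent_bundle A"
proof -
 have "openin (tangent_topology A) (tangent_bundle A)"
  unfolding openin_tangent_topology
 proof (intro conjI ballI subset_refl)
  fix c assume c: "c \<in> A"
  have "{(z, y). z \<in> snd c ` fst c \<and> tangent_of A c (chart_inv c z) y \<in> tangent_bundle A} = (snd c ` fst c) \<times> UNIV"
   using c by (auto simp: charts_at_def intro!: tangent_of_in_bundle)
  then show "open {(z, y). z \<in> snd c ` fst c \<and> tangent_of A c (chart_inv c z) y \<in> tangent_bundle A}"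
   using chart_open(2)[OF c] by (simp add: open_Times)
 qed
 moreover have "S \<subseteq> tangent_bundle A" if "openin (tangent_topology A) S" for S
  using that by (simp add: openin_tangent_topology)
 ultimately show ?thesis by (auto simp: topspace_def)
qed

end

section \<open>The Finsler function in coordinates and its Legendre transform\<close>

locale finsler =
 fixes A :: "('a::{t2_space, second_countable_topology}, 'n::finite) chart set"
  and F :: "('a, 'n) tvec => real"
 assumes finsler: "finsler_manifold A F"

sublocale finsler \<subseteq> manifold A
 by standard (use finsler in \<open>simp add: finsler_manifold_def\<close>)

context finsler
begin

definition Fc :: "('a, 'n) chart => real ^ 'n => real ^ 'n => real" where
 "Fc c z y = F (tangent_of A c (chart_inv c z) y)"

lemma charts_at_inv: "c \<in> A ==> z \<in> snd c ` fst c ==> c \<in> charts_at A (chart_inv c z)"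
 by (auto simp: charts_at_def)

lemma Fc_chart: "c \<in> charts_at A x ==> Fc c (snd c x) y = F (tangent_of A c x y)"
 by (simp add: Fc_def charts_at_def)

lemma F_scale: "w \<in> tangent_bundle A ==> 0 <= r ==> F (tscale r w) = r * F w"
 using finsler by (simp add: finsler_manifold_def)

lemma Fc_nonneg: "c \<in> A ==> z \<in> snd c ` fst c ==> 0 <= Fc c z y"
 using finsler tangent_of_in_bundle[OF charts_at_inv] by (simp add: Fc_def finsler_manifold_def)

lemma Fc_scale: "c \<in> A ==> z \<in> snd c ` fst c ==> 0 <= r ==> Fc c z (r *\<^sub>R y) = r * Fc c z y"
 using F_scale[OF tangent_of_in_bundle[OF charts_at_inv, of c z y], of r] tscale_tangent_of[OF charts_at_inv, of c z r y]
 by (simp add: Fc_def)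

lemma Fc_zero: "c \<in> A ==> z \<in> snd c ` fst c ==> Fc c z 0 = 0"
 using Fc_scale[of c z 0 0] by simp

text \<open>Read off the bundle topology, so that the zero section is included; smoothness of
  \<open>F\<close> is available only off it.\<close>

lemma Fc_continuous:
 assumes c: "c \<in> A" shows "continuous_on (snd c ` fst c \<times> UNIV) (\<lambda>(z, y). Fc c z y)"
proof -
 have op: "open (snd c ` fst c \<times> (UNIV :: (real ^ 'n) set))" using chart_open(2)[OF c] by (simp add: open_Times)
 show ?thesis
  unfolding continuous_on_open_vimage[OF op]
 proof (intro allI impI)
  fix B :: "real set" assume B: "open B"
  have "continuous_map (tangent_topology A) euclideanreal F" using finsler by (simp add: finsler_manifold_def)
  then have "openin (tangent_topology A) {w \<in> topspace (tangent_topology A). F w \<in> B}"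
   using B by (intro openin_continuous_map_preimage) auto
  then have "open {(z, y). z \<in> snd c ` fst c \<and> tangent_of A c (chart_inv c z) y \<in> {w \<in> topspace (tangent_topology A). F w \<in> B}}"
   using c by (simp add: openin_tangent_topology)
  also have "{(z, y). z \<in> snd c ` fst c \<and> tangent_of A c (chart_inv c z) y \<in> {w \<in> topspace (tangent_topology A). F w \<in> B}}
    = (\<lambda>(z, y). Fc c z y) -` B \<inter> (snd c ` fst c \<times> UNIV)"
   using tangent_of_in_bundle[OF charts_at_inv[OF c]] by (auto simp: topspace_tangent Fc_def)
  finally show "open ((\<lambda>(z, y). Fc c z y) -` B \<inter> (snd c ` fst c \<times> UNIV))" .
 qed
qed

lemma Fc_continuous2:
 assumes "c \<in> A" "continuous_on T z" "z ` T \<subseteq> snd c ` fst c" "continuous_on T y"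
 shows "continuous_on T (\<lambda>t. Fc c (z t) (y t))"
 using continuous_on_compose2[OF Fc_continuous[OF assms(1)] continuous_on_Pair[OF assms(2,4)]] assms(3) by auto

text \<open>The fibre derivative, written as the total derivative in the direction (0, v): its
  continuity in base point and fibre together is then part of the smoothness of
  \<open>F\<close>.\<close>

definition DF :: "('a, 'n) chart => real ^ 'n => real ^ 'n => real ^ 'n => real" where
 "DF c z y v = frechet_derivative (\<lambda>(z, y). Fc c z y) (at (z, y)) (0, v)"

lemma Fc_smooth: "c \<in> A ==> smooth_on (snd c ` fst c \<times> (UNIV - {0})) (\<lambda>(z, y). Fc c z y)"
 using finsler by (simp add: finsler_manifold_def Fc_def)

lemma Pair_const_bounded_linear: "bounded_linear (\<lambda>y::'c::real_normed_vector. (0::'b::real_normed_vector, y))"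
 by (intro bounded_linear_Pair bounded_linear_zero bounded_linear_ident)

lemma Fc_Ck:
 assumes "c \<in> A" "z \<in> snd c ` fst c" shows "Ck_on k (UNIV - {0}) (Fc c z)"
proof -
 have "Ck_on k (snd c ` fst c \<times> (UNIV - {0})) (\<lambda>(z, y). Fc c z y)"
  using Fc_smooth[OF assms(1)] by (simp add: smooth_on_def)
 from Ck_on_affine[OF this Pair_const_bounded_linear, of "UNIV - {0}" "(z, 0)"] assms(2)
 show ?thesis by (simp add: open_Diff)
qed

lemma DF_eq:
 assumes "c \<in> A" "z \<in> snd c ` fst c" "y \<noteq> 0"
 shows "(Fc c z has_derivative DF c z y) (at y)" "frechet_derivative (Fc c z) (at y) = DF c z y"
proof -
 have 1: "Ck_on (Suc 0) (snd c ` fst c \<times> (UNIV - {0})) (\<lambda>(z, y). Fc c z y)"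
  using Fc_smooth[OF assms(1)] by (simp only: smooth_on_def)
 have d: "((\<lambda>(z, y). Fc c z y) has_derivative frechet_derivative (\<lambda>(z, y). Fc c z y) (at (z, y))) (at (z, y))"
  by (rule Ck1_has_derivative[OF 1]) (use assms in auto)
 have p: "((\<lambda>y. (z, y)) has_derivative (\<lambda>v. (0, v))) (at y)"
  by (auto intro!: derivative_eq_intros)
 from has_derivative_compose[OF p d] show D: "(Fc c z has_derivative DF c z y) (at y)"
  by (simp add: DF_def[abs_def])
 show "frechet_derivative (Fc c z) (at y) = DF c z y" using frechet_derivative_at[OF D] by simp
qed

lemma DF_continuous:
 assumes "c \<in> A" shows "continuous_on (snd c ` fst c \<times> (UNIV - {0})) (\<lambda>(z, y). DF c z y v)"
proof -
 have "Ck_on (Suc 0) (snd c ` fst c \<times> (UNIV - {0})) (\<lambda>(z, y). Fc c z y)"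
  using Fc_smooth[OF assms(1)] by (simp only: smooth_on_def)
 then have "continuous_on (snd c ` fst c \<times> (UNIV - {0})) (\<lambda>x. frechet_derivative (\<lambda>(z, y). Fc c z y) (at x) (0, v))"
  by simp
 then show ?thesis by (simp add: DF_def case_prod_beta)
qed

definition DE :: "('a, 'n) chart => real ^ 'n => real ^ 'n => real ^ 'n => real" where
 "DE c z y v = (if y = 0 then 0 else Fc c z y * DF c z y v)"

context
 fixes c z assumes c: "c \<in> A" and z: "z \<in> snd c ` fst c"
begin

lemma axis_expansion: "(\<Sum>j\<in>UNIV. w $ j *\<^sub>R axis j 1) = (w :: real ^ 'n)"
 using basis_expansion[of w] by (simp add: scalar_mult_eq_scaleR)

lemma E_has_derivative:
 assumes "y \<noteq> 0" shows "((\<lambda>u. (Fc c z u)\<^sup>2 / 2) has_derivative DE c z y) (at y)"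
 using assms by (auto intro!: derivative_eq_intros DF_eq(1)[OF c z] simp: DE_def fun_eq_iff)

lemma DE_linear: "linear (DE c z y)"
proof (cases "y = 0")
 case True
 then have "DE c z y = (\<lambda>_. 0)" by (simp add: DE_def fun_eq_iff)
 then show ?thesis by (simp add: linear_iff)
next
 case False
 then show ?thesis using E_has_derivative has_derivative_linear by blast
qed

lemma DE_differentiable:
 assumes y: "y \<noteq> 0" shows "(\<lambda>u. DE c z u v) differentiable (at y)"
proof -
 have "Ck_on (Suc (Suc 0)) (UNIV - {0}) (Fc c z)" by (rule Fc_Ck[OF c z])
 then have "(\<lambda>u. frechet_derivative (Fc c z) (at u) v) differentiable (at y)" "Fc c z differentiable (at y)"
  using y by auto
 then have "(\<lambda>u. Fc c z u * frechet_derivative (Fc c z) (at u) v) differentiable (at y)" by simp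
 moreover have "Fc c z u * frechet_derivative (Fc c z) (at u) v = DE c z u v" if "u \<in> UNIV - {0}" for u
  using that by (simp add: DE_def DF_eq(2)[OF c z])
 ultimately show ?thesis
  using frechet_derivative_cong_open(1)[of "UNIV - {0}" y "\<lambda>u. Fc c z u * frechet_derivative (Fc c z) (at u) v" "\<lambda>u. DE c z u v"] y
  by (simp add: open_Diff)
qed

text \<open>The fundamental tensor holds the second derivatives along the coordinate axes; expanding
  w in these axes, first in the outer and then in the inner derivative, turns its quadratic form
  into the second derivative along w.\<close>

lemma Hessian_pos:
 assumes y: "y \<noteq> 0" and w: "w \<noteq> 0"
 shows "0 < frechet_derivative (\<lambda>u. DE c z u w) (at y) w"
proof -
 let ?x = "chart_inv c z"
 have ca: "c \<in> charts_at A ?x" by (rule charts_at_inv[OF c z])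
 have E: "(\<lambda>u. (F (tangent_of A c ?x u))\<^sup>2 / 2) = (\<lambda>u. (Fc c z u)\<^sup>2 / 2)" by (simp add: Fc_def)
 have DEeq: "frechet_derivative (\<lambda>u. (Fc c z u)\<^sup>2 / 2) (at u) v = DE c z u v" if "u \<in> UNIV - {0}" for u v
  using frechet_derivative_at[OF E_has_derivative[of u]] that by simp
 have g: "fundamental_tensor A F c ?x y $ i $ j = frechet_derivative (\<lambda>u. DE c z u (axis i 1)) (at y) (axis j 1)" for i j
  unfolding fundamental_tensor_def Let_def E
  using frechet_derivative_cong_open(2)[of "UNIV - {0}" y "\<lambda>u. frechet_derivative (\<lambda>u. (Fc c z u)\<^sup>2 / 2) (at u) (axis i 1)" "\<lambda>u. DE c z u (axis i 1)"] DEeq y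
  by (simp add: open_Diff)
 have "0 < w \<bullet> (fundamental_tensor A F c ?x y *v w)"
 proof -
  have "\<forall>c\<in>A. \<forall>x\<in>fst c. \<forall>y. y \<noteq> 0 --> (\<forall>u. u \<noteq> 0 --> 0 < u \<bullet> (fundamental_tensor A F c x y *v u))"
   using finsler unfolding finsler_manifold_def by (elim conjE)
  moreover have "?x \<in> fst c" using ca by (simp add: charts_at_def)
  ultimately show ?thesis using c y w by simp
 qed
 also have "w \<bullet> (fundamental_tensor A F c ?x y *v w)
   = (\<Sum>i\<in>UNIV. \<Sum>j\<in>UNIV. w $ i * w $ j * frechet_derivative (\<lambda>u. DE c z u (axis i 1)) (at y) (axis j 1))"
  by (simp add: inner_vec_def matrix_vector_mult_def g sum_distrib_left ac_simps)
 also have "\<dots> = (\<Sum>i\<in>UNIV. w $ i * frechet_derivative (\<lambda>u. DE c z u (axis i 1)) (at y) w)"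
 proof (rule sum.cong[OF refl])
  fix i
  have l: "linear (frechet_derivative (\<lambda>u. DE c z u (axis i 1)) (at y))"
   by (rule frechet_derivative_linear[OF DE_differentiable[OF y]])
  have "frechet_derivative (\<lambda>u. DE c z u (axis i 1)) (at y) w = frechet_derivative (\<lambda>u. DE c z u (axis i 1)) (at y) (\<Sum>j\<in>UNIV. w $ j *\<^sub>R axis j 1)"
   by (simp only: axis_expansion)
  also have "\<dots> = (\<Sum>j\<in>UNIV. w $ j * frechet_derivative (\<lambda>u. DE c z u (axis i 1)) (at y) (axis j 1))"
   using l by (simp add: linear_sum linear_scale)
  finally show "(\<Sum>j\<in>UNIV. w $ i * w $ j * frechet_derivative (\<lambda>u. DE c z u (axis i 1)) (at y) (axis j 1))
    = w $ i * frechet_derivative (\<lambda>u. DE c z u (axis i 1)) (at y) w"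
   by (simp add: sum_distrib_left mult.assoc)
 qed
 also have "\<dots> = frechet_derivative (\<lambda>u. DE c z u w) (at y) w"
 proof -
  have "DE c z u w = (\<Sum>i\<in>UNIV. w $ i * DE c z u (axis i 1))" for u
  proof -
   have "DE c z u w = DE c z u (\<Sum>j\<in>UNIV. w $ j *\<^sub>R axis j 1)" by (simp only: axis_expansion)
   then show ?thesis using DE_linear[of u] by (simp add: linear_sum linear_scale)
  qed
  then have e: "(\<lambda>u. DE c z u w) = (\<lambda>u. \<Sum>i\<in>UNIV. w $ i * DE c z u (axis i 1))" by auto
  have "((\<lambda>u. \<Sum>i\<in>UNIV. w $ i * DE c z u (axis i 1)) has_derivative
    (\<lambda>v. \<Sum>i\<in>UNIV. w $ i * frechet_derivative (\<lambda>u. DE c z u (axis i 1)) (at y) v)) (at y)"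
   using DE_differentiable[OF y]
   by (intro has_derivative_sum has_derivative_mult_right) (simp add: frechet_derivative_works)
  from frechet_derivative_at[OF this]
  have "frechet_derivative (\<lambda>u. DE c z u w) (at y) w
    = (\<Sum>i\<in>UNIV. w $ i * frechet_derivative (\<lambda>u. DE c z u (axis i 1)) (at y) w)"
   unfolding e by (rule fun_cong[OF sym])
  then show ?thesis by (rule sym)
 qed
 finally show ?thesis .
qed

lemma line_derivatives:
 assumes "y + s *\<^sub>R w \<noteq> 0"
 shows "((\<lambda>s. (Fc c z (y + s *\<^sub>R w))\<^sup>2 / 2) has_real_derivative DE c z (y + s *\<^sub>R w) w) (at s)"
  "((\<lambda>s. DE c z (y + s *\<^sub>R w) w) has_real_derivative frechet_derivative (\<lambda>u. DE c z u w) (at (y + s *\<^sub>R w)) w) (at s)"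
proof -
 have l: "((\<lambda>s. y + s *\<^sub>R w) has_derivative (\<lambda>h. h *\<^sub>R w)) (at s)"
  by (auto intro!: derivative_eq_intros)
 have *: "((\<lambda>s. (Fc c z (y + s *\<^sub>R w))\<^sup>2 / 2) has_derivative (\<lambda>h. DE c z (y + s *\<^sub>R w) (h *\<^sub>R w))) (at s)"
  by (rule has_derivative_compose[OF l E_has_derivative[OF assms]])
 show "((\<lambda>s. (Fc c z (y + s *\<^sub>R w))\<^sup>2 / 2) has_real_derivative DE c z (y + s *\<^sub>R w) w) (at s)"
 proof -
  have "(\<lambda>h. DE c z (y + s *\<^sub>R w) (h *\<^sub>R w)) = (*) (DE c z (y + s *\<^sub>R w) w)"
   by (rule ext) (simp only: linear_scale[OF DE_linear] real_scaleR_def mult.commute)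
  then show ?thesis using * by (simp only: has_field_derivative_def)
 qed
 have d: "((\<lambda>u. DE c z u w) has_derivative frechet_derivative (\<lambda>u. DE c z u w) (at (y + s *\<^sub>R w))) (at (y + s *\<^sub>R w))"
  using DE_differentiable[OF assms] by (simp add: frechet_derivative_works)
 have **: "((\<lambda>s. DE c z (y + s *\<^sub>R w) w) has_derivative (\<lambda>h. frechet_derivative (\<lambda>u. DE c z u w) (at (y + s *\<^sub>R w)) (h *\<^sub>R w))) (at s)"
  by (rule has_derivative_compose[OF l d])
 show "((\<lambda>s. DE c z (y + s *\<^sub>R w) w) has_real_derivative frechet_derivative (\<lambda>u. DE c z u w) (at (y + s *\<^sub>R w)) w) (at s)"
 proof -
  have "(\<lambda>h. frechet_derivative (\<lambda>u. DE c z u w) (at (y + s *\<^sub>R w)) (h *\<^sub>R w))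
    = (*) (frechet_derivative (\<lambda>u. DE c z u w) (at (y + s *\<^sub>R w)) w)"
   by (rule ext) (simp only: linear_scale[OF frechet_derivative_linear[OF DE_differentiable[OF assms]]] real_scaleR_def mult.commute)
  then show ?thesis using ** by (simp only: has_field_derivative_def)
 qed
qed

text \<open>Along the ray y + s y homogeneity makes F^2 / 2 equal to (1 + s)^2 times its value at y;
  the derivative at s = 0 is computed in both ways.\<close>

lemma Euler: "DE c z y y = (Fc c z y)\<^sup>2"
proof (cases "y = 0")
 case True
 then show ?thesis using Fc_zero[OF c z] by (simp add: DE_def)
next
 case False
 have "((\<lambda>s. (Fc c z (y + s *\<^sub>R y))\<^sup>2 / 2) has_real_derivative DE c z y y) (at 0)"
  using line_derivatives(1)[of y 0 y] False by simp
 moreover have "((\<lambda>s. (Fc c z (y + s *\<^sub>R y))\<^sup>2 / 2) has_real_derivative (Fc c z y)\<^sup>2) (at 0)"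
 proof (rule has_field_derivative_transform_within_open[where S="{-1<..}"])
  show "((\<lambda>s. (1 + s)\<^sup>2 * (Fc c z y)\<^sup>2 / 2) has_real_derivative (Fc c z y)\<^sup>2) (at 0)"
   by (auto intro!: derivative_eq_intros)
  fix s :: real assume "s \<in> {-1<..}"
  then have "Fc c z ((1 + s) *\<^sub>R y) = (1 + s) * Fc c z y" by (intro Fc_scale[OF c z]) simp
  then show "(1 + s)\<^sup>2 * (Fc c z y)\<^sup>2 / 2 = (Fc c z (y + s *\<^sub>R y))\<^sup>2 / 2"
   by (simp add: scaleR_add_left power_mult_distrib)
 qed auto
 ultimately show ?thesis by (rule DERIV_unique)
qed

text \<open>If F vanished at y it would vanish along the ray through y, and so would the second
  derivative of F^2 / 2 in direction y, against the positivity of the Hessian.\<close>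

lemma Fc_pos: assumes y: "y \<noteq> 0" shows "0 < Fc c z y"
proof (rule ccontr)
 assume "\<not> 0 < Fc c z y"
 then have f0: "Fc c z y = 0" using Fc_nonneg[OF c z, of y] by simp
 have "((\<lambda>s. DE c z (y + s *\<^sub>R y) y) has_real_derivative frechet_derivative (\<lambda>u. DE c z u y) (at y) y) (at 0)"
  using line_derivatives(2)[of y 0 y] y by simp
 moreover have "((\<lambda>s. DE c z (y + s *\<^sub>R y) y) has_real_derivative 0) (at 0)"
 proof (rule has_field_derivative_transform_within_open[where S="{-1<..}"])
  show "((\<lambda>_. 0) has_real_derivative 0) (at (0::real))" by simp
  fix s :: real assume s: "s \<in> {-1<..}"
  have "Fc c z ((1 + s) *\<^sub>R y) = 0" using Fc_scale[OF c z, of "1 + s" y] s f0 by simp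
  then show "0 = DE c z (y + s *\<^sub>R y) y" by (simp add: DE_def scaleR_add_left)
 qed auto
 ultimately have "frechet_derivative (\<lambda>u. DE c z u y) (at y) y = 0" by (rule DERIV_unique)
 then show False using Hessian_pos[OF y y] by simp
qed

text \<open>When the segment from \<open>y\<close> to \<open>u\<close> avoids the
 origin it follows from the convexity of \<open>F\<^sup>2/2\<close> along the segment; otherwise \<open>u\<close> is a
 nonpositive multiple of \<open>y\<close>.\<close>

lemma fundamental_inequality: "DE c z y u <= Fc c z y * Fc c z u"
proof (cases "y = 0 \<or> u = 0")
 case True
 then show ?thesis
 proof
  assume "y = 0"
  then show ?thesis by (simp add: DE_def Fc_zero[OF c z])
 next
  assume "u = 0"
  then show ?thesis using linear_0[OF DE_linear, of y] by (simp add: Fc_zero[OF c z])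
 qed
next
 case False
 then have y: "y \<noteq> 0" and u: "u \<noteq> 0" by auto
 have pos: "0 < Fc c z y" "0 < Fc c z u" using y u Fc_pos by auto
 \<comment> \<open>Rescales u to a vector w with F w = F y; both sides of the claim are homogeneous
   in u, so it becomes DE y w <= F(y)^2.\<close>
 define kk where "kk = Fc c z y / Fc c z u"
 define w where "w = kk *\<^sub>R u"
 have l0: "0 < kk" using pos by (simp add: kk_def)
 have Fw: "Fc c z w = Fc c z y" using Fc_scale[OF c z, of kk u] l0 pos by (simp add: w_def kk_def)
 have "DE c z y w <= (Fc c z y)\<^sup>2"
 proof (cases "\<exists>s\<in>{0..1}. y + s *\<^sub>R (w - y) = 0")
  case True
  then obtain s where s: "0 <= s" "s <= 1" "y + s *\<^sub>R (w - y) = 0" by auto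
  then have "s *\<^sub>R w = - (1 - s) *\<^sub>R y" by (simp add: algebra_simps)
  then have "s * DE c z y w = - (1 - s) * DE c z y y"
   using linear_scale[OF DE_linear, of y s w] linear_scale[OF DE_linear, of y "- (1 - s)" y] by simp
  then have "s * DE c z y w <= 0" using s Euler by (simp add: mult_nonpos_nonneg)
  moreover have "0 < s" using s y by (cases "s = 0") auto
  ultimately have "DE c z y w <= 0" by (simp add: mult_le_0_iff)
  then show ?thesis by (meson order_trans zero_le_power2)
 next
  case False
  then have nz: "y + s *\<^sub>R (w - y) \<noteq> 0" if "0 <= s" "s <= 1" for s using that by auto
  have wy: "DE c z y (w - y) <= 0"
  proof (cases "w = y")
   case True
   then show ?thesis using linear_0[OF DE_linear] by simp
  next
   case wne: False
   let ?E = "\<lambda>s. (Fc c z (y + s *\<^sub>R (w - y)))\<^sup>2 / 2"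
   \<comment> \<open>F^2 / 2 has equal values at both ends of the segment, so its derivative along
     the segment vanishes at some interior t; that derivative is nondecreasing, hence at most 0 at
     the starting point y.\<close>
   have "\<exists>t. 0 < t \<and> t < 1 \<and> ?E 1 - ?E 0 = (1 - 0) * DE c z (y + t *\<^sub>R (w - y)) (w - y)"
   proof (rule MVT2)
    show "(?E has_real_derivative DE c z (y + s *\<^sub>R (w - y)) (w - y)) (at s)" if "0 <= s" "s <= 1" for s
     by (rule line_derivatives(1)[OF nz[OF that]])
   qed simp
   then obtain t where t: "0 < t" "t < 1" "DE c z (y + t *\<^sub>R (w - y)) (w - y) = ?E 1 - ?E 0" by auto
   have "DE c z (y + 0 *\<^sub>R (w - y)) (w - y) <= DE c z (y + t *\<^sub>R (w - y)) (w - y)"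
   proof (rule DERIV_nonneg_imp_nondecreasing[where f="\<lambda>s. DE c z (y + s *\<^sub>R (w - y)) (w - y)" and a=0 and b=t])
    show "0 <= t" using t by simp
    fix s assume s: "0 <= s" "s <= t"
    then have ne: "y + s *\<^sub>R (w - y) \<noteq> 0" using nz t by simp
    have "0 <= frechet_derivative (\<lambda>u. DE c z u (w - y)) (at (y + s *\<^sub>R (w - y))) (w - y)"
     using Hessian_pos[OF ne, of "w - y"] wne by simp
    then show "\<exists>D. ((\<lambda>s. DE c z (y + s *\<^sub>R (w - y)) (w - y)) has_real_derivative D) (at s) \<and> 0 <= D"
     using line_derivatives(2)[OF ne] by blast
   qed
   then show ?thesis using t Fw by simp
  qed
  have "DE c z y w = DE c z y (w - y) + DE c z y y"
   using linear_diff[OF DE_linear, of y w y] by simp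
  then show ?thesis using wy Euler by simp
 qed
 moreover have "DE c z y w = kk * DE c z y u" using linear_scale[OF DE_linear] by (simp add: w_def)
 ultimately have "kk * DE c z y u <= (Fc c z y)\<^sup>2" by simp
 then have "DE c z y u <= (Fc c z y)\<^sup>2 / kk" using l0 by (simp add: field_simps)
 also have "\<dots> = Fc c z y * Fc c z u" using pos by (simp add: kk_def power2_eq_square)
 finally show ?thesis .
qed

end

text \<open>F is continuous and positive on the compact product of a closed coordinate ball and the
  unit sphere; homogeneity carries its extreme values there over to all y.\<close>

lemma local_comparison:
 assumes c: "c \<in> charts_at A x0"
 obtains \<rho> r R where "0 < \<rho>" "0 < r" "0 < R" "cball (snd c x0) \<rho> \<subseteq> snd c ` fst c"
  "!!z y. z \<in> cball (snd c x0) \<rho> ==> r * norm y <= Fc c z y"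
  "!!z y. z \<in> cball (snd c x0) \<rho> ==> Fc c z y <= R * norm y"
proof -
 have cA: "c \<in> A" "x0 \<in> fst c" using c by (auto simp: charts_at_def)
 obtain \<rho> where \<rho>: "0 < \<rho>" "cball (snd c x0) \<rho> \<subseteq> snd c ` fst c"
  using chart_open(2)[OF cA(1)] cA(2) unfolding open_contains_cball by (meson imageI)
 let ?K = "cball (snd c x0) \<rho> \<times> sphere (0 :: real ^ 'n) 1"
 have K: "compact ?K" by (intro compact_Times) auto
 have ne_in: "x \<in> B ==> B \<noteq> {}" for x and B :: "((real ^ 'n) \<times> (real ^ 'n)) set" by auto
 have Kne: "?K \<noteq> {}"
 proof -
  have "norm (axis undefined 1 :: real ^ 'n) = 1" by simp
  then have "(snd c x0, axis undefined 1) \<in> ?K" using \<rho>(1) by simp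
  then show ?thesis by (rule ne_in)
 qed
 have cont: "continuous_on ?K (\<lambda>(z, y). Fc c z y)"
  by (rule continuous_on_subset[OF Fc_continuous[OF cA(1)]]) (use \<rho> in auto)
 obtain k1 where k1: "k1 \<in> ?K" "!!k. k \<in> ?K ==> (\<lambda>(z, y). Fc c z y) k1 <= (\<lambda>(z, y). Fc c z y) k"
  using continuous_attains_inf[OF K Kne cont] by metis
 obtain k2 where k2: "k2 \<in> ?K" "!!k. k \<in> ?K ==> (\<lambda>(z, y). Fc c z y) k <= (\<lambda>(z, y). Fc c z y) k2"
  using continuous_attains_sup[OF K Kne cont] by metis
 define r R where "r = Fc c (fst k1) (snd k1)" and "R = Fc c (fst k2) (snd k2)"
 have r: "r <= Fc c z y" and R: "Fc c z y <= R" if "z \<in> cball (snd c x0) \<rho>" "norm y = 1" for z y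
  using k1(2)[of "(z, y)"] k2(2)[of "(z, y)"] that by (auto simp: r_def R_def case_prod_beta)
 have rp: "0 < r" unfolding r_def
  by (rule Fc_pos[OF cA(1)]) (use k1(1) \<rho>(2) in \<open>auto simp: mem_Times_iff\<close>)
 have Rp: "0 < R" unfolding R_def
  by (rule Fc_pos[OF cA(1)]) (use k2(1) \<rho>(2) in \<open>auto simp: mem_Times_iff\<close>)
 have both: "r * norm y <= Fc c z y \<and> Fc c z y <= R * norm y" if z: "z \<in> cball (snd c x0) \<rho>" for z y
 proof (cases "y = 0")
  case True
  then show ?thesis using Fc_zero[OF cA(1)] \<rho>(2) z by auto
 next
  case False
  have "Fc c z (norm y *\<^sub>R (y /\<^sub>R norm y)) = norm y * Fc c z (y /\<^sub>R norm y)"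
   by (rule Fc_scale[OF cA(1)]) (use \<rho>(2) z in auto)
  then have "Fc c z y = norm y * Fc c z (y /\<^sub>R norm y)" using False by simp
  moreover have "norm (y /\<^sub>R norm y) = 1" using False by simp
  note rr = r[OF z this] R[OF z this]
  ultimately show ?thesis
   using mult_left_mono[OF rr(1), of "norm y"] mult_left_mono[OF rr(2), of "norm y"] by (simp add: mult.commute)
 qed
 show ?thesis by (rule that[OF \<rho>(1) rp Rp \<rho>(2)]) (use both in auto)
qed

end

section \<open>Curves and the Finsler distance\<close>

text \<open>\<open>D\<close> and \<open>K\<close> are kept apart because the speed of a smooth piece
  is controlled only on the open interval, while compactness is that of the closed one.\<close>

lemma compact_locally_bounded:
 fixes f :: "'a::topological_space => real"
 assumes K: "compact K" and loc: "!!t. t \<in> K ==> \<exists>T B. open T \<and> t \<in> T \<and> (\<forall>s\<in>D \<inter> T. f s <= B)"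
 shows "\<exists>B. \<forall>s\<in>D \<inter> K. f s <= B"
proof -
 obtain T B where T: "!!t. t \<in> K ==> open (T t)" "!!t. t \<in> K ==> t \<in> T t" "!!t s. t \<in> K ==> s \<in> D \<inter> T t ==> f s <= B t"
  using loc by metis
 obtain C where C: "C \<subseteq> K" "finite C" "K \<subseteq> (\<Union>t\<in>C. T t)"
  using compactE_image[OF K, of K T] T(1,2) by blast
 have "f s <= (\<Sum>t\<in>C. \<bar>B t\<bar>)" if s: "s \<in> D \<inter> K" for s
 proof -
  obtain t where t: "t \<in> C" "s \<in> T t" using C(3) s by blast
  then have "f s <= \<bar>B t\<bar>" using T(3)[of t s] C(1) s by fastforce
  also have "\<dots> <= (\<Sum>t\<in>C. \<bar>B t\<bar>)" by (rule member_le_sum[OF t(1)]) (use C(2) in auto)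
  finally show ?thesis .
 qed
 then show ?thesis by blast
qed

lemma increasing_partition_covers:
 fixes \<tau> :: "nat => real"
 assumes "\<tau> 0 <= t" "t <= \<tau> N" "0 < N"
 shows "\<exists>i<N. \<tau> i <= t \<and> t <= \<tau> (Suc i)"
 using assms
proof (induction N)
 case (Suc N)
 show ?case
 proof (cases "t <= \<tau> N \<and> 0 < N")
  case True
  then show ?thesis using Suc by (meson less_Suc_eq)
 next
  case False
  then have "\<tau> N <= t" using Suc.prems by (cases N) auto
  then show ?thesis using Suc.prems by blast
 qed
qed simp

section \<open>Speed and length of piecewise smooth curves\<close>

context finsler
begin

text \<open>Differentiability in every chart around the point. The neighbourhood T that stays inside
  the chart is recorded because changing charts under the derivative needs it.\<close>

definition regular_at :: "(real => 'a) => real => bool" where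
 "regular_at g t \<longleftrightarrow> (\<forall>c\<in>charts_at A (g t). \<exists>w T. open T \<and> t \<in> T \<and> g ` T \<subseteq> fst c \<and>
   ((\<lambda>s. snd c (g s)) has_vector_derivative w) (at t))"

lemma velocity_chart:
 assumes c: "c \<in> charts_at A (g s)" and T: "open T" "s \<in> T" "g ` T \<subseteq> fst c"
  and w: "((\<lambda>s. snd c (g s)) has_vector_derivative w) (at s)"
 shows "velocity A g s = tangent_of A c (g s) w"
proof -
 have "vector_derivative (\<lambda>s. snd c' (g s)) (at s) = transition_deriv c c' (g s) w"
  if c': "c' \<in> charts_at A (g s)" for c'
 proof (rule vector_derivative_at)
  have cA: "c \<in> A" using c by (rule charts_atD)
  have "((\<lambda>u. (snd c' \<circ> chart_inv c) (snd c (g u))) has_derivative (\<lambda>h. transition_deriv c c' (g s) (h *\<^sub>R w))) (at s)"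
   by (rule has_derivative_compose[OF w[unfolded has_vector_derivative_def] transition_has_derivative[OF c c']])
  then have "((\<lambda>u. (snd c' \<circ> chart_inv c) (snd c (g u))) has_vector_derivative transition_deriv c c' (g s) w) (at s)"
   by (simp add: has_vector_derivative_def linear_scale[OF transition_linear[OF c c']])
  then show "((\<lambda>s. snd c' (g s)) has_vector_derivative transition_deriv c c' (g s) w) (at s)"
   by (rule has_vector_derivative_transform_within_open[OF _ T(1,2)]) (use T(3) cA in auto)
 qed
 then show ?thesis by (auto simp: velocity_def tangent_of_def fun_eq_iff)
qed

lemma regular_velocity:
 assumes "regular_at g t" "c \<in> charts_at A (g t)"
 obtains w T where "open T" "t \<in> T" "g ` T \<subseteq> fst c" "((\<lambda>s. snd c (g s)) has_vector_derivative w) (at t)"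
  "velocity A g t = tangent_of A c (g t) w" "F (velocity A g t) = Fc c (snd c (g t)) w"
proof -
 obtain w T where w: "open T" "t \<in> T" "g ` T \<subseteq> fst c" "((\<lambda>s. snd c (g s)) has_vector_derivative w) (at t)"
  using assms unfolding regular_at_def by blast
 have v: "velocity A g t = tangent_of A c (g t) w" by (rule velocity_chart[OF assms(2) w])
 then have "F (velocity A g t) = Fc c (snd c (g t)) w" using assms(2) by (simp add: Fc_chart)
 then show ?thesis using that w v by blast
qed

lemma regular_speed_nonneg: "regular_at g t ==> 0 <= F (velocity A g t)"
proof -
 assume r: "regular_at g t"
 obtain c where c: "c \<in> charts_at A (g t)" using charts_at_nonempty by blast
 obtain w where "F (velocity A g t) = Fc c (snd c (g t)) w" using regular_velocity[OF r c] by metis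
 then show ?thesis using Fc_nonneg[of c] c by (simp add: charts_at_def)
qed

text \<open>Near every parameter of the closed interval, its ends included, the coordinates extend
  to a function that is C^1 on a full neighbourhood. This is what bounds the speed up to the ends,
  although the velocity is identified only inside.\<close>

lemma smooth_curve_local:
 assumes sm: "smooth_curve_on A {a..b} g" and t: "t \<in> {a..b}" and c: "c \<in> charts_at A (g t)"
 obtains e h h' where "0 < e" "continuous_on {t - e<..<t + e} h" "continuous_on {t - e<..<t + e} h'"
  "h ` {t - e<..<t + e} \<subseteq> snd c ` fst c"
  "!!s. s \<in> {a..b} \<inter> {t - e<..<t + e} ==> g s \<in> fst c \<and> snd c (g s) = h s"
  "!!s. s \<in> {a<..<b} \<inter> {t - e<..<t + e} ==> ((\<lambda>s. snd c (g s)) has_vector_derivative h' s) (at s)"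
proof -
 have cA: "c \<in> A" using c by (rule charts_atD)
 obtain e0 h where e0: "0 < e0" and h: "smooth_on {t - e0<..<t + e0} h"
  and hs: "\<forall>s\<in>{a..b} \<inter> {t - e0<..<t + e0}. g s \<in> fst c \<and> snd c (g s) = h s"
  using sm t c unfolding smooth_curve_on_def by blast
 have C1: "Ck_on (Suc 0) {t - e0<..<t + e0} h" using h by (simp only: smooth_on_def)
 have hc: "continuous_on {t - e0<..<t + e0} h" by (rule Ck_on_continuous[OF C1])
 have ht: "h t \<in> snd c ` fst c" using hs t e0 by force
 have "open ({t - e0<..<t + e0} \<inter> h -` (snd c ` fst c))"
  using hc chart_open(2)[OF cA] by (intro continuous_open_preimage) auto
 then obtain e1 where e1: "0 < e1" "ball t e1 \<subseteq> {t - e0<..<t + e0} \<inter> h -` (snd c ` fst c)"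
  using e0 ht unfolding open_contains_ball by (metis IntI greaterThanLessThan_iff less_add_same_cancel1 diff_less_eq vimageI2)
 have b: "ball t e1 = {t - e1<..<t + e1}" by (auto simp: dist_real_def)
 define h' where "h' s = frechet_derivative h (at s) 1" for s
 show ?thesis
 proof (rule that[OF e1(1)])
  have sub: "{t - e1<..<t + e1} \<subseteq> {t - e0<..<t + e0}" using e1(2) b by auto
  show "continuous_on {t - e1<..<t + e1} h" using hc sub by (rule continuous_on_subset)
  have "continuous_on {t - e0<..<t + e0} h'" using C1 by (simp add: h'_def)
  then show "continuous_on {t - e1<..<t + e1} h'" using sub by (rule continuous_on_subset)
  show "h ` {t - e1<..<t + e1} \<subseteq> snd c ` fst c" using e1(2) b by auto
  show "g s \<in> fst c \<and> snd c (g s) = h s" if "s \<in> {a..b} \<inter> {t - e1<..<t + e1}" for s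
   using hs that sub by blast
  fix s assume s: "s \<in> {a<..<b} \<inter> {t - e1<..<t + e1}"
  have hd: "(h has_derivative frechet_derivative h (at s)) (at s)"
   by (rule Ck1_has_derivative[OF C1]) (use s sub in auto)
  have "frechet_derivative h (at s) = (\<lambda>r. r *\<^sub>R h' s)"
  proof
   fix r
   have "frechet_derivative h (at s) (r *\<^sub>R 1) = r *\<^sub>R frechet_derivative h (at s) 1"
    by (rule linear_scale[OF has_derivative_linear[OF hd]])
   then show "frechet_derivative h (at s) r = r *\<^sub>R h' s" by (simp only: h'_def real_scaleR_def mult_1_right)
  qed
  with hd have "(h has_vector_derivative h' s) (at s)"
   unfolding has_vector_derivative_def by simp
  then show "((\<lambda>s. snd c (g s)) has_vector_derivative h' s) (at s)"
   by (rule has_vector_derivative_transform_within_open[where S="{a<..<b} \<inter> {t - e1<..<t + e1}"])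
    (use hs s sub in \<open>auto intro!: open_Int\<close>)
 qed
qed

lemma smooth_curve_regular:
 assumes sm: "smooth_curve_on A {a..b} g" and t: "t \<in> {a<..<b}"
 shows "regular_at g t"
 unfolding regular_at_def
proof
 fix c assume c: "c \<in> charts_at A (g t)"
 have t': "t \<in> {a..b}" using t by auto
 obtain e h h' where e: "0 < e"
  and 1: "!!s. s \<in> {a..b} \<inter> {t - e<..<t + e} ==> g s \<in> fst c \<and> snd c (g s) = h s"
  and 2: "!!s. s \<in> {a<..<b} \<inter> {t - e<..<t + e} ==> ((\<lambda>s. snd c (g s)) has_vector_derivative h' s) (at s)"
  by (rule smooth_curve_local[OF sm t' c]) (rule that, assumption+)
 have "g ` ({a<..<b} \<inter> {t - e<..<t + e}) \<subseteq> fst c" using 1 by auto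
 moreover have "t \<in> {a<..<b} \<inter> {t - e<..<t + e}" using t e by auto
 moreover have "open ({a<..<b} \<inter> {t - e<..<t + e})" by (intro open_Int) auto
 ultimately show "\<exists>w T. open T \<and> t \<in> T \<and> g ` T \<subseteq> fst c \<and> ((\<lambda>s. snd c (g s)) has_vector_derivative w) (at t)"
  using 2 by blast
qed

lemma smooth_curve_speed:
 assumes sm: "smooth_curve_on A {a..b} g"
 shows "continuous_on {a<..<b} (\<lambda>t. F (velocity A g t))" "\<exists>B. \<forall>t\<in>{a<..<b}. F (velocity A g t) <= B"
proof -
 have loc: "\<exists>e>0. \<exists>u. continuous_on {t - e<..<t + e} u \<and> (\<forall>s\<in>{a<..<b} \<inter> {t - e<..<t + e}. F (velocity A g s) = u s)"
  if t: "t \<in> {a..b}" for t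
 proof -
  obtain c where c: "c \<in> charts_at A (g t)" using charts_at_nonempty by blast
  have cA: "c \<in> A" using c by (rule charts_atD)
  obtain e h h' where e: "0 < e" and h: "continuous_on {t - e<..<t + e} h" "continuous_on {t - e<..<t + e} h'"
   "h ` {t - e<..<t + e} \<subseteq> snd c ` fst c"
   and 1: "!!s. s \<in> {a..b} \<inter> {t - e<..<t + e} ==> g s \<in> fst c \<and> snd c (g s) = h s"
   and 2: "!!s. s \<in> {a<..<b} \<inter> {t - e<..<t + e} ==> ((\<lambda>s. snd c (g s)) has_vector_derivative h' s) (at s)"
   by (rule smooth_curve_local[OF sm t c]) (rule that, assumption+)
  have "F (velocity A g s) = Fc c (h s) (h' s)" if s: "s \<in> {a<..<b} \<inter> {t - e<..<t + e}" for s
  proof -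
   have s': "s \<in> {a..b} \<inter> {t - e<..<t + e}" using s by auto
   have cs: "c \<in> charts_at A (g s)" using 1[OF s'] cA by (simp add: charts_at_def)
   have "velocity A g s = tangent_of A c (g s) (h' s)"
    by (rule velocity_chart[OF cs _ s _ 2[OF s]]) (use 1 in \<open>auto intro!: open_Int\<close>)
   then show ?thesis using Fc_chart[OF cs, of "h' s"] 1[OF s'] by simp
  qed
  moreover have "continuous_on {t - e<..<t + e} (\<lambda>s. Fc c (h s) (h' s))"
   by (rule Fc_continuous2[OF cA h(1) h(3) h(2)])
  ultimately show ?thesis using e by blast
 qed
 show "continuous_on {a<..<b} (\<lambda>t. F (velocity A g t))"
 proof (rule continuous_at_imp_continuous_on, rule ballI)
  fix t assume t: "t \<in> {a<..<b}"
  then have "t \<in> {a..b}" by auto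
  from loc[OF this] obtain e u where e: "0 < e" "continuous_on {t - e<..<t + e} u"
   "\<forall>s\<in>{a<..<b} \<inter> {t - e<..<t + e}. F (velocity A g s) = u s" by blast
  have "continuous_on ({a<..<b} \<inter> {t - e<..<t + e}) (\<lambda>t. F (velocity A g t))"
   by (rule continuous_on_eq[OF continuous_on_subset[OF e(2)]]) (use e(3) in auto)
  moreover have "open ({a<..<b} \<inter> {t - e<..<t + e})" by (intro open_Int) auto
  ultimately show "continuous (at t) (\<lambda>t. F (velocity A g t))"
   using t e(1) by (simp add: continuous_on_eq_continuous_at)
 qed
 have "\<exists>B. \<forall>s\<in>{a<..<b} \<inter> {a..b}. F (velocity A g s) <= B"
 proof (rule compact_locally_bounded)
  fix t assume "t \<in> {a..b}"
  from loc[OF this] obtain e u where e: "0 < e" "continuous_on {t - e<..<t + e} u"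
   "\<forall>s\<in>{a<..<b} \<inter> {t - e<..<t + e}. F (velocity A g s) = u s" by blast
  have sub: "{t - e/2..t + e/2} \<subseteq> {t - e<..<t + e}" using e(1) by auto
  have "compact (u ` {t - e/2..t + e/2})"
   by (intro compact_continuous_image continuous_on_subset[OF e(2) sub]) simp
  then have "bounded (u ` {t - e/2..t + e/2})" by (rule compact_imp_bounded)
  then obtain B where "\<forall>x\<in>u ` {t - e/2..t + e/2}. norm x <= B" unfolding bounded_iff by blast
  then have B: "\<bar>u s\<bar> <= B" if "s \<in> {t - e/2..t + e/2}" for s using that by simp
  show "\<exists>T B. open T \<and> t \<in> T \<and> (\<forall>s\<in>{a<..<b} \<inter> T. F (velocity A g s) <= B)"
  proof (intro exI conjI ballI)
   show "open {t - e/2<..<t + e/2}" by simp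
   show "t \<in> {t - e/2<..<t + e/2}" using e(1) by simp
   fix s assume s: "s \<in> {a<..<b} \<inter> {t - e/2<..<t + e/2}"
   then have "s \<in> {t - e/2..t + e/2}" by auto
   moreover have "F (velocity A g s) = u s" using e(3) s e(1) by auto
   ultimately show "F (velocity A g s) <= B" using B[of s] by simp
  qed
 qed simp
 then show "\<exists>B. \<forall>t\<in>{a<..<b}. F (velocity A g t) <= B" by (metis IntI atLeastAtMost_iff greaterThanLessThan_iff less_imp_le)
qed

lemma piecewise_curve:
 assumes pw: "piecewise_smooth_curve A g"
 obtains P B where "finite P" "0 \<in> P" "1 \<in> P" "!!t. t \<in> {0..1} - P ==> regular_at g t"
  "continuous_on ({0..1} - P) (\<lambda>t. F (velocity A g t))" "!!t. t \<in> {0..1} - P ==> F (velocity A g t) <= B"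
proof -
 obtain N :: nat and \<tau> where \<tau>: "\<tau> 0 = 0" "\<tau> N = 1" "!!i. i < N ==> \<tau> i < \<tau> (Suc i)"
  "!!i. i < N ==> smooth_curve_on A {\<tau> i..\<tau> (Suc i)} g"
  using pw unfolding piecewise_smooth_curve_def by blast
 have N: "0 < N" using \<tau>(1,2) by (cases N) auto
 define P where "P = \<tau> ` {..N}"
 have piece: "\<exists>i<N. t \<in> {\<tau> i<..<\<tau> (Suc i)}" if t: "t \<in> {0..1} - P" for t
 proof -
  obtain i where i: "i < N" "\<tau> i <= t" "t <= \<tau> (Suc i)"
   using increasing_partition_covers[of \<tau> t N] \<tau>(1,2) t N by auto
  have "\<tau> i \<in> P" "\<tau> (Suc i) \<in> P" using i(1) by (auto simp: P_def)
  then have "t \<noteq> \<tau> i" "t \<noteq> \<tau> (Suc i)" using t by auto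
  then show ?thesis using i by auto
 qed
 have "\<exists>B. \<forall>i. i < N --> (\<forall>t\<in>{\<tau> i<..<\<tau> (Suc i)}. F (velocity A g t) <= B i)"
  using smooth_curve_speed(2)[OF \<tau>(4)] by metis
 then obtain B where B: "!!i t. i < N ==> t \<in> {\<tau> i<..<\<tau> (Suc i)} ==> F (velocity A g t) <= B i" by blast
 show ?thesis
 proof (rule that[of P "\<Sum>i<N. \<bar>B i\<bar>"])
  show "finite P" by (simp add: P_def)
  show "0 \<in> P" using \<tau>(1) by (force simp: P_def)
  show "1 \<in> P" using \<tau>(2) by (force simp: P_def)
  show "regular_at g t" if "t \<in> {0..1} - P" for t
   using piece[OF that] smooth_curve_regular[OF \<tau>(4)] by blast
  show "F (velocity A g t) <= (\<Sum>i<N. \<bar>B i\<bar>)" if t: "t \<in> {0..1} - P" for t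
  proof -
   obtain i where i: "i < N" "t \<in> {\<tau> i<..<\<tau> (Suc i)}" using piece[OF t] by blast
   have "F (velocity A g t) <= \<bar>B i\<bar>" using B[OF i] by simp
   also have "\<dots> <= (\<Sum>i<N. \<bar>B i\<bar>)" by (rule member_le_sum) (use i in auto)
   finally show ?thesis .
  qed
  show "continuous_on ({0..1} - P) (\<lambda>t. F (velocity A g t))"
  proof (rule continuous_at_imp_continuous_on, rule ballI)
   fix t assume "t \<in> {0..1} - P"
   then obtain i where i: "i < N" "t \<in> {\<tau> i<..<\<tau> (Suc i)}" using piece by blast
   show "continuous (at t) (\<lambda>t. F (velocity A g t))"
    using smooth_curve_speed(1)[OF \<tau>(4)[OF i(1)]] i(2) by (simp add: continuous_on_eq_continuous_at)
  qed
 qed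
qed

text \<open>At the finitely many points of \<open>P\<close> the velocity is arbitrary, so the speed
  is replaced there by 0; off them it is continuous and bounded.\<close>

lemma speed_integrable:
 assumes pw: "piecewise_smooth_curve A \<gamma>" and ab: "0 <= a" "b <= 1"
 shows "(\<lambda>t. F (velocity A \<gamma> t)) integrable_on {a..b}"
proof -
 obtain P B where P: "finite P" "0 \<in> P" "1 \<in> P" "!!t. t \<in> {0..1} - P ==> regular_at \<gamma> t"
  "continuous_on ({0..1} - P) (\<lambda>t. F (velocity A \<gamma> t))" "!!t. t \<in> {0..1} - P ==> F (velocity A \<gamma> t) <= B"
  using piecewise_curve[OF pw] by metis
 define g where "g t = indicator ({0..1} - P) t *\<^sub>R F (velocity A \<gamma> t)" for t
 have D: "{0..1} - P \<in> sets borel" using borel_closed[OF finite_imp_closed[OF P(1)]] by simp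
 have g[measurable]: "g \<in> borel_measurable borel"
  unfolding g_def by (rule borel_measurable_continuous_on_indicator[OF D P(5)])
 have gB: "\<bar>g t\<bar> <= \<bar>B\<bar>" for t
  using P(6)[of t] regular_speed_nonneg[OF P(4), of t] by (auto simp: g_def indicator_def)
 have "set_integrable lborel {a..b} g"
  unfolding set_integrable_def
 proof (rule Bochner_Integration.integrable_bound)
  show "integrable lborel (\<lambda>t. \<bar>B\<bar> * indicator {a..b} t)" by (intro integrable_mult_right integrable_real_indicator) (auto simp: emeasure_lborel_Icc_eq)
  show "AE t in lborel. norm (indicator {a..b} t *\<^sub>R g t) <= norm (\<bar>B\<bar> * indicator {a..b} t)"
   using gB by (intro AE_I2) (auto simp: indicator_def)
 qed measurable
 then have "g integrable_on {a..b}" by (rule set_borel_integral_eq_integral(1))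
 then show ?thesis
  by (rule integrable_spike_finite[OF P(1), rotated]) (use ab in \<open>auto simp: g_def indicator_def\<close>)
qed

definition len :: "(real => 'a) => real => real => real" where
 "len g a b = integral {a..b} (\<lambda>t. F (velocity A g t))"

lemma len_combine:
 assumes "piecewise_smooth_curve A g" "0 <= a" "a <= c" "c <= b" "b <= 1"
 shows "len g a c + len g c b = len g a b"
 unfolding len_def
 by (rule Henstock_Kurzweil_Integration.integral_combine) (use assms speed_integrable[of g a b] in auto)

text \<open>The one device by which length bounds an increment. It is applied to the constant 0 in
  \<open>len_nonneg\<close>, to a coordinate in \<open>chart_localization\<close> and to a test
  function in \<open>curve_slope\<close>.\<close>

lemma curve_growth:
 assumes pw: "piecewise_smooth_curve A g" and ab: "0 <= a" "a <= b" "b <= 1"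
  and cont: "continuous_on {a..b} \<psi>"
  and D: "!!t. t \<in> {a<..<b} ==> regular_at g t ==> \<exists>d. (\<psi> has_real_derivative d) (at t) \<and> d <= C * F (velocity A g t)"
 shows "\<psi> b - \<psi> a <= C * len g a b"
proof -
 obtain P where P: "finite P" "!!t. t \<in> {0..1} - P ==> regular_at g t"
  using piecewise_curve[OF pw] by metis
 have "\<exists>d. (\<psi> has_real_derivative d) (at t) \<and> d <= C * F (velocity A g t)" if "t \<in> {a<..<b} - P" for t
  using D[of t] P(2)[of t] that ab by auto
 then obtain d where d: "!!t. t \<in> {a<..<b} - P ==> (\<psi> has_real_derivative d t) (at t)"
  "!!t. t \<in> {a<..<b} - P ==> d t <= C * F (velocity A g t)" by metis
 \<comment> \<open>At the exceptional points the derivative is replaced by the bound itself, so that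
   the comparison of integrands holds everywhere.\<close>
 define d' where "d' t = (if t \<in> {a<..<b} - P then d t else C * F (velocity A g t))" for t
 have "(d' has_integral (\<psi> b - \<psi> a)) {a..b}"
  by (rule fundamental_theorem_of_calculus_interior_strong[OF P(1) ab(2) _ cont])
   (use d(1) in \<open>auto simp: d'_def has_real_derivative_iff_has_vector_derivative[symmetric]\<close>)
 moreover have "((\<lambda>t. C * F (velocity A g t)) has_integral (C * len g a b)) {a..b}"
  unfolding len_def by (rule has_integral_mult_right[OF integrable_integral[OF speed_integrable[OF pw ab(1,3)]]])
 moreover have "d' t <= C * F (velocity A g t)" for t using d(2)[of t] by (auto simp: d'_def)
 ultimately show ?thesis by (rule has_integral_le)
qed

lemma len_nonneg:
 assumes "piecewise_smooth_curve A g" "0 <= a" "a <= b" "b <= 1" shows "0 <= len g a b"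
proof -
 have "(0::real) - 0 <= 1 * len g a b"
 proof (rule curve_growth[OF assms, of "\<lambda>_. 0"])
  fix t assume "regular_at g t"
  then show "\<exists>d. ((\<lambda>_. 0) has_real_derivative d) (at t) \<and> d <= 1 * F (velocity A g t)"
   by (intro exI[of _ 0]) (simp add: regular_speed_nonneg)
 qed simp
 then show ?thesis by simp
qed

text \<open>Argues backwards from the end of the curve. After the last time s at which it is outside
  the coordinate ball, the length bounds the coordinate distance to the end point by len / r. By
  continuity the point at s then lies in a closed ball strictly inside, a contradiction. Fixing the
  end point, not the start, is what the slope estimate and the backward topology call for.\<close>

lemma chart_localization:
 assumes cA: "c \<in> A" and r: "0 < r" and sub: "cball z0 \<rho> \<subseteq> snd c ` fst c"
  and cmp: "!!z y. z \<in> cball z0 \<rho> ==> r * norm y <= Fc c z y"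
  and pw: "piecewise_smooth_curve A g" and ab: "0 <= a" "a <= b" "b <= 1"
  and end_in: "g b \<in> fst c" and small: "dist (snd c (g b)) z0 + len g a b / r < \<rho>"
  and t: "t \<in> {a..b}"
 shows "g t \<in> fst c" "dist (snd c (g t)) (snd c (g b)) <= len g a b / r" "dist (snd c (g t)) z0 < \<rho>"
proof -
 have cont: "continuous_on {0..1} g" using pw by (simp add: piecewise_smooth_curve_def)
 define \<kappa> where "\<kappa> t = snd c (g t)" for t
 define W where "W = chart_inv c ` ball z0 \<rho>"
 have bs: "ball z0 \<rho> \<subseteq> snd c ` fst c" using sub ball_subset_cball by blast
 have W: "open W" unfolding W_def by (rule open_chart_inv_image[OF cA open_ball bs])
 have Wiff: "x \<in> W \<longleftrightarrow> x \<in> fst c \<and> snd c x \<in> ball z0 \<rho>" for x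
 proof
  assume "x \<in> W"
  then obtain z where z: "z \<in> ball z0 \<rho>" "x = chart_inv c z" by (auto simp: W_def)
  then have "z \<in> snd c ` fst c" using bs by auto
  then show "x \<in> fst c \<and> snd c x \<in> ball z0 \<rho>" using z cA by (auto simp: chart_inv2)
 next
  assume "x \<in> fst c \<and> snd c x \<in> ball z0 \<rho>"
  then show "x \<in> W" unfolding W_def using cA by (metis chart_inv imageI)
 qed
 have len_le: "len g s b <= len g a b" if "s \<in> {a..b}" for s
  using len_combine[OF pw ab(1) _ _ ab(3), of s] len_nonneg[OF pw ab(1), of s] that ab by auto
 have step: "dist (\<kappa> s) (\<kappa> b) <= len g a b / r" if s: "s \<in> {a..b}" and inW: "!!x. x \<in> {s..b} ==> g x \<in> W" for s
 proof (cases "\<kappa> s = \<kappa> b")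
  case True
  then show ?thesis using len_nonneg[OF pw ab] r by simp
 next
  case False
  \<comment> \<open>Projecting onto the direction of the displacement makes it a scalar increment,
    to which \<open>curve_growth\<close> applies.\<close>
  define u where "u = (\<kappa> s - \<kappa> b) /\<^sub>R norm (\<kappa> s - \<kappa> b)"
  have u: "norm u = 1" using False by (simp add: u_def)
  have \<kappa>c: "continuous_on {s..b} \<kappa>"
   unfolding \<kappa>_def
   by (rule continuous_on_compose2[OF chart_cont(1)[OF cA] continuous_on_subset[OF cont]])
    (use s ab inW Wiff in auto)
  have "- (u \<bullet> \<kappa> b) - - (u \<bullet> \<kappa> s) <= 1 / r * len g s b"
  proof (rule curve_growth[OF pw, where \<psi>="\<lambda>x. - (u \<bullet> \<kappa> x)"])
   show "continuous_on {s..b} (\<lambda>x. - (u \<bullet> \<kappa> x))" by (intro continuous_intros \<kappa>c)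
   fix x assume x: "x \<in> {s<..<b}" and reg: "regular_at g x"
   then have xW: "g x \<in> W" using inW by auto
   then have c: "c \<in> charts_at A (g x)" using cA Wiff by (simp add: charts_at_def)
   obtain w where w: "((\<lambda>s. snd c (g s)) has_vector_derivative w) (at x)" "F (velocity A g x) = Fc c (snd c (g x)) w"
    using regular_velocity[OF reg c] by metis
   have "((\<lambda>x. - (u \<bullet> \<kappa> x)) has_real_derivative - (u \<bullet> w)) (at x)"
    using w(1) unfolding \<kappa>_def has_field_derivative_def has_vector_derivative_def
    by (auto intro!: derivative_eq_intros simp: fun_eq_iff)
   moreover have "- (u \<bullet> w) <= norm w" using norm_cauchy_schwarz[of "- u" w] u by simp
   moreover have "r * norm w <= F (velocity A g x)" using cmp[of "snd c (g x)" w] w(2) xW Wiff by simp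
   then have "norm w <= 1 / r * F (velocity A g x)" using r by (simp add: field_simps)
   ultimately show "\<exists>d. ((\<lambda>x. - (u \<bullet> \<kappa> x)) has_real_derivative d) (at x) \<and> d <= 1 / r * F (velocity A g x)"
    by (meson order_trans)
  qed (use s ab in auto)
  moreover have "u \<bullet> \<kappa> s - u \<bullet> \<kappa> b = norm (\<kappa> s - \<kappa> b)"
  proof -
   have "u \<bullet> (\<kappa> s - \<kappa> b) = norm (\<kappa> s - \<kappa> b)"
    using False by (simp add: u_def power2_norm_eq_inner[symmetric] power2_eq_square)
   then show ?thesis by (simp add: inner_diff_right)
  qed
  ultimately have "norm (\<kappa> s - \<kappa> b) <= len g s b / r" by simp
  also have "\<dots> <= len g a b / r" using len_le[OF s] r by (simp add: divide_right_mono)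
  finally show ?thesis by (simp add: dist_norm)
 qed
 have allW: "g x \<in> W" if x: "x \<in> {a..b}" for x
 proof (rule ccontr)
  assume nW: "g x \<notin> W"
  define S where "S = {a..b} \<inter> g -` (- W)"
  have cab: "continuous_on {a..b} g" by (rule continuous_on_subset[OF cont]) (use ab in auto)
  have Sc: "closed S" unfolding S_def by (rule continuous_closed_preimage[OF cab]) (use W in auto)
  have Sn: "S \<noteq> {}" "bdd_above S" using x nW by (auto simp: S_def)
  define s where "s = Sup S"
  have sS: "s \<in> S" unfolding s_def by (rule closed_contains_Sup[OF Sn Sc])
  have bW: "g b \<in> W" using end_in small len_nonneg[OF pw ab] r by (auto simp: Wiff dist_commute intro: le_less_trans[rotated])
  have sb: "a <= s" "s < b" using sS bW by (auto simp: S_def less_le)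
  have after: "g y \<in> W" if "s < y" "y <= b" for y
  proof (rule ccontr)
   assume "g y \<notin> W"
   then have "y \<in> S" using that sb by (auto simp: S_def)
   then have "y <= s" unfolding s_def by (rule cSup_upper[OF _ Sn(2)])
   then show False using that by simp
  qed
  \<comment> \<open>Its image is compact, hence closed in the Hausdorff manifold; it contains the
    curve on the half-open interval after s and therefore also the point at s.\<close>
  define C where "C = cball (\<kappa> b) (len g a b / r)"
  have CW: "C \<subseteq> ball z0 \<rho>"
  proof
   fix y assume "y \<in> C"
   then have "dist y z0 <= len g a b / r + dist (\<kappa> b) z0"
    using dist_triangle[of y z0 "\<kappa> b"] by (simp add: C_def dist_commute)
   then show "y \<in> ball z0 \<rho>" using small by (simp add: \<kappa>_def dist_commute)
  qed
  have "compact (chart_inv c ` C)"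
   by (rule compact_continuous_image[OF continuous_on_subset[OF chart_cont(2)[OF cA]]]) (use CW bs in \<open>auto simp: C_def\<close>)
  then have "closed (chart_inv c ` C)" by (rule compact_imp_closed)
  then have cl: "closed ({a..b} \<inter> g -` (chart_inv c ` C))" by (intro continuous_closed_preimage[OF cab]) auto
  have "{s<..b} \<subseteq> {a..b} \<inter> g -` (chart_inv c ` C)"
  proof
   fix y assume y: "y \<in> {s<..b}"
   then have yW: "g y \<in> W" using after by simp
   have "dist (\<kappa> y) (\<kappa> b) <= len g a b / r" by (rule step) (use y sb after in auto)
   then have "\<kappa> y \<in> C" by (simp add: C_def dist_commute)
   moreover have "g y = chart_inv c (\<kappa> y)" using yW cA by (simp add: Wiff \<kappa>_def)
   ultimately show "y \<in> {a..b} \<inter> g -` (chart_inv c ` C)" using y sb by auto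
  qed
  from closure_minimal[OF this cl] have "{s..b} \<subseteq> {a..b} \<inter> g -` (chart_inv c ` C)"
   using sb by simp
  moreover have "s \<in> {s..b}" using sb by simp
  ultimately have "g s \<in> chart_inv c ` C" by blast
  then have "g s \<in> W" using CW by (auto simp: W_def)
  then show False using sS by (simp add: S_def)
 qed
 show "g t \<in> fst c" "dist (snd c (g t)) z0 < \<rho>" using allW[OF t] by (auto simp: Wiff dist_commute)
 show "dist (snd c (g t)) (snd c (g b)) <= len g a b / r"
  using step[OF t] allW t by (auto simp: \<kappa>_def)
qed

end

section \<open>Concatenation of curves and the distance function\<close>

context finsler
begin

lemma smooth_curve_affine:
 assumes sm: "smooth_curve_on A I \<gamma>" and k: "0 < k" and I': "!!t. t \<in> I' ==> m + k * t \<in> I"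
  and eq: "!!t. t \<in> I' ==> g t = \<gamma> (m + k * t)"
 shows "smooth_curve_on A I' g"
 unfolding smooth_curve_on_def
proof (intro ballI)
 fix t c assume t: "t \<in> I'" and c: "c \<in> charts_at A (g t)"
 have "c \<in> charts_at A (\<gamma> (m + k * t))" using c eq[OF t] by simp
 then obtain e h where e: "0 < e" "smooth_on {m + k * t - e<..<m + k * t + e} h"
  "\<forall>s\<in>I \<inter> {m + k * t - e<..<m + k * t + e}. \<gamma> s \<in> fst c \<and> snd c (\<gamma> s) = h s"
  using sm I'[OF t] unfolding smooth_curve_on_def by blast
 have aff: "m + k * s \<in> {m + k * t - e<..<m + k * t + e}" if "s \<in> {t - e / k<..<t + e / k}" for s
  using that k by (auto simp: field_simps)
 have "smooth_on {t - e / k<..<t + e / k} (\<lambda>s. h (m + k * s))"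
  unfolding smooth_on_def
 proof
  fix n
  have "Ck_on n {m + k * t - e<..<m + k * t + e} h" using e(2) by (simp add: smooth_on_def)
  from Ck_on_affine[OF this bounded_linear_mult_right[of k], of "{t - e / k<..<t + e / k}" m] aff
  show "Ck_on n {t - e / k<..<t + e / k} (\<lambda>s. h (m + k * s))" by simp
 qed
 moreover have "g s \<in> fst c \<and> snd c (g s) = h (m + k * s)" if "s \<in> I' \<inter> {t - e / k<..<t + e / k}" for s
  using e(3) I'[of s] aff[of s] eq[of s] that by auto
 moreover have "0 < e / k" using e(1) k by simp
 ultimately show "\<exists>e>0. \<exists>h. smooth_on {t - e<..<t + e} h \<and> (\<forall>s\<in>I' \<inter> {t - e<..<t + e}. g s \<in> fst c \<and> snd c (g s) = h s)"
  by (intro exI[of _ "e / k"] exI[of _ "\<lambda>s. h (m + k * s)"] conjI ballI) auto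
qed

lemma speed_affine:
 assumes reg: "regular_at \<gamma> (m + k * t)" and k: "0 < k" and T: "open T" "t \<in> T"
  and eq: "!!s. s \<in> T ==> g s = \<gamma> (m + k * s)"
 shows "F (velocity A g t) = k * F (velocity A \<gamma> (m + k * t))"
proof -
 obtain c where c: "c \<in> charts_at A (\<gamma> (m + k * t))" using charts_at_nonempty by blast
 have cA: "c \<in> A" using c by (rule charts_atD)
 have cg: "c \<in> charts_at A (g t)" using c eq[OF T(2)] by simp
 obtain w U where U: "open U" "m + k * t \<in> U" "\<gamma> ` U \<subseteq> fst c"
  and w: "((\<lambda>s. snd c (\<gamma> s)) has_vector_derivative w) (at (m + k * t))"
  and v: "F (velocity A \<gamma> (m + k * t)) = Fc c (snd c (\<gamma> (m + k * t))) w"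
  using regular_velocity[OF reg c] by metis
 have V: "open (T \<inter> (\<lambda>s. m + k * s) -` U)"
  by (intro open_Int T open_vimage U(1) continuous_intros)
 have "((\<lambda>s. snd c (\<gamma> (m + k * s))) has_derivative (\<lambda>h. (k * h) *\<^sub>R w)) (at t)"
 proof -
  have l: "((\<lambda>s. m + k * s) has_derivative (\<lambda>h. k * h)) (at t)" by (auto intro!: derivative_eq_intros)
  show ?thesis by (rule has_derivative_compose[OF l w[unfolded has_vector_derivative_def]])
 qed
 then have "((\<lambda>s. snd c (\<gamma> (m + k * s))) has_vector_derivative k *\<^sub>R w) (at t)"
  by (simp add: has_vector_derivative_def mult.commute)
 then have d: "((\<lambda>s. snd c (g s)) has_vector_derivative k *\<^sub>R w) (at t)"
  by (rule has_vector_derivative_transform_within_open[OF _ T]) (simp add: eq)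
 have "velocity A g t = tangent_of A c (g t) (k *\<^sub>R w)"
  by (rule velocity_chart[OF cg V _ _ d]) (use T U eq in auto)
 then have "F (velocity A g t) = Fc c (snd c (\<gamma> (m + k * t))) (k *\<^sub>R w)"
  using Fc_chart[OF cg] eq[OF T(2)] by simp
 also have "\<dots> = k * Fc c (snd c (\<gamma> (m + k * t))) w"
  using k c by (intro Fc_scale cA) (auto simp: charts_at_def)
 finally show ?thesis by (simp add: v)
qed

text \<open>Homogeneity multiplies the speed by k, the change of variable divides the integral by k.
  Agreement on the open interval is enough; at the ends the joined curve need not be
  differentiable.\<close>

lemma len_affine:
 assumes pw: "piecewise_smooth_curve A \<gamma>" and k: "0 < k" and eq: "!!t. t \<in> {a<..<b} ==> g t = \<gamma> (m + k * t)"
  and ends: "m + k * a = 0" "m + k * b = 1"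
 shows "((\<lambda>t. F (velocity A g t)) has_integral len \<gamma> 0 1) {a..b}"
proof -
 obtain P where P: "finite P" "!!t. t \<in> {0..1} - P ==> regular_at \<gamma> t"
  using piecewise_curve[OF pw] by metis
 have "((\<lambda>t. F (velocity A \<gamma> t)) has_integral len \<gamma> 0 1) (cbox 0 1)"
  unfolding len_def using integrable_integral[OF speed_integrable[OF pw, of 0 1]] by simp
 from has_integral_affinity[OF this, of k m] k
 have "((\<lambda>t. F (velocity A \<gamma> (k * t + m))) has_integral len \<gamma> 0 1 / k) ((\<lambda>x. (1 / k) * x + - ((1 / k) * m)) ` {0..1})"
  by (simp add: divide_inverse mult.commute)
 also have "(\<lambda>x. (1 / k) * x + - ((1 / k) * m)) ` {0..1} = {a..b}"
 proof -
  have a: "a = - ((1 / k) * m)" "b = 1 / k + - ((1 / k) * m)" using ends k by (auto simp: field_simps)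
  have "(\<lambda>x. (1 / k) * x + - ((1 / k) * m)) ` {0..1} = {(1 / k) * 0 + - ((1 / k) * m)..(1 / k) * 1 + - ((1 / k) * m)}"
   using image_affinity_atLeastAtMost[of "1 / k" "- ((1 / k) * m)" 0 "1::real"] k by simp
  then show ?thesis using a by simp
 qed
 finally have "((\<lambda>t. k * F (velocity A \<gamma> (k * t + m))) has_integral k * (len \<gamma> 0 1 / k)) {a..b}"
  by (rule has_integral_mult_right)
 then have I: "((\<lambda>t. k * F (velocity A \<gamma> (m + k * t))) has_integral len \<gamma> 0 1) {a..b}"
  using k by (simp add: add.commute)
 have "finite ({a, b} \<union> (\<lambda>p. (p - m) / k) ` P)" using P(1) by simp
 then show ?thesis
 proof (rule has_integral_spike_finite[OF _ _ I])
  fix t assume t: "t \<in> {a..b} - ({a, b} \<union> (\<lambda>p. (p - m) / k) ` P)"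
  then have tab: "t \<in> {a<..<b}" by auto
  have "m + k * a <= m + k * t" "m + k * t <= m + k * b" using t k by auto
  moreover have "m + k * t \<notin> P"
  proof
   assume "m + k * t \<in> P"
   moreover have "t = (m + k * t - m) / k" using k by simp
   ultimately show False using t by blast
  qed
  ultimately have "regular_at \<gamma> (m + k * t)" using P(2) ends by simp
  from speed_affine[OF this k _ tab eq]
  show "F (velocity A g t) = k * F (velocity A \<gamma> (m + k * t))" by simp
 qed
qed

lemma concat_curves:
 assumes pw1: "piecewise_smooth_curve A \<gamma>1" and pw2: "piecewise_smooth_curve A \<gamma>2" and eq: "\<gamma>1 1 = \<gamma>2 0"
 obtains g where "piecewise_smooth_curve A g" "g 0 = \<gamma>1 0" "g 1 = \<gamma>2 1"
  "len g 0 1 = len \<gamma>1 0 1 + len \<gamma>2 0 1"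
proof -
 define g where "g = \<gamma>1 +++ \<gamma>2"
 have g1: "g t = \<gamma>1 (0 + 2 * t)" if "t <= 1/2" for t using that by (simp add: g_def joinpaths_def)
 have g2: "g t = \<gamma>2 (- 1 + 2 * t)" if "1/2 <= t" for t
 proof (cases "t = 1/2")
  case True
  show ?thesis unfolding True using eq by (simp add: g_def joinpaths_def)
 next
  case False
  then show ?thesis using that by (simp add: g_def joinpaths_def)
 qed
 obtain N1 :: nat and \<tau>1 where \<tau>1: "\<tau>1 0 = 0" "\<tau>1 N1 = 1" "!!i. i < N1 ==> \<tau>1 i < \<tau>1 (Suc i)"
  "!!i. i < N1 ==> smooth_curve_on A {\<tau>1 i..\<tau>1 (Suc i)} \<gamma>1"
  using pw1 unfolding piecewise_smooth_curve_def by blast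
 obtain N2 :: nat and \<tau>2 where \<tau>2: "\<tau>2 0 = 0" "\<tau>2 N2 = 1" "!!i. i < N2 ==> \<tau>2 i < \<tau>2 (Suc i)"
  "!!i. i < N2 ==> smooth_curve_on A {\<tau>2 i..\<tau>2 (Suc i)} \<gamma>2"
  using pw2 unfolding piecewise_smooth_curve_def by blast
 have inc: "\<tau> 0 <= \<tau> i" if "!!i. i < N ==> \<tau> i < \<tau> (Suc i)" "i <= N" for \<tau> :: "nat => real" and i N
  using that(2)
 proof (induction i)
  case (Suc i)
  then show ?case using that(1)[of i] by simp
 qed simp
 have dec: "\<tau> i <= \<tau> N" if "!!i. i < N ==> \<tau> i < \<tau> (Suc i)" "i <= N" for \<tau> :: "nat => real" and i N
  using that(2) by (induction i rule: inc_induct) (use that(1) in \<open>auto intro: order_trans less_imp_le\<close>)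
 \<comment> \<open>The two partitions, halved and put side by side. At i = N1 both formulas give
   1/2, so the second holds from \<open>N1\<close> on.\<close>
 define \<tau> where "\<tau> i = (if i <= N1 then \<tau>1 i / 2 else 1/2 + \<tau>2 (i - N1) / 2)" for i
 have t2: "\<tau> i = 1/2 + \<tau>2 (i - N1) / 2" if "N1 <= i" for i
  using that \<tau>1(2) \<tau>2(1) by (cases "i = N1") (auto simp: \<tau>_def)
 have pw: "piecewise_smooth_curve A g"
  unfolding piecewise_smooth_curve_def
 proof (intro conjI exI allI impI)
  show "continuous_on {0..1} g"
   unfolding g_def using pw1 pw2 eq
   by (intro continuous_on_joinpaths) (auto simp: piecewise_smooth_curve_def pathfinish_def pathstart_def)
  show "\<tau> 0 = 0" using \<tau>1(1) by (simp add: \<tau>_def)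
  show "\<tau> (N1 + N2) = 1" using t2[of "N1 + N2"] \<tau>2(2) by simp
  fix i assume i: "i < N1 + N2"
  show "\<tau> i < \<tau> (Suc i)"
  proof (cases "i < N1")
   case True
   then show ?thesis using \<tau>1(3)[OF True] by (simp add: \<tau>_def)
  next
   case False
   then show ?thesis using t2[of i] t2[of "Suc i"] \<tau>2(3)[of "i - N1"] i by (simp add: Suc_diff_le)
  qed
  show "smooth_curve_on A {\<tau> i..\<tau> (Suc i)} g"
  proof (cases "i < N1")
   case True
   have le: "\<tau> (Suc i) <= 1/2" using dec[of N1 \<tau>1 "Suc i"] \<tau>1 True by (simp add: \<tau>_def)
   show ?thesis
    by (rule smooth_curve_affine[OF \<tau>1(4)[OF True], of 2 _ 0]) (use le g1 True in \<open>auto simp: \<tau>_def\<close>)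
  next
   case False
   then have iN: "i - N1 < N2" "N1 <= i" "N1 <= Suc i" using i by auto
   have ge: "1/2 <= \<tau> i" using inc[of N2 \<tau>2 "i - N1"] \<tau>2 iN t2[of i] by simp
   show ?thesis
    by (rule smooth_curve_affine[OF \<tau>2(4)[OF iN(1)], of 2 _ "- 1"])
     (use ge g2 t2[OF iN(2)] t2[OF iN(3)] iN in \<open>auto simp: Suc_diff_le\<close>)
  qed
 qed
 have "((\<lambda>t. F (velocity A g t)) has_integral len \<gamma>1 0 1) {0..1/2}"
  by (rule len_affine[OF pw1, of 2 _ _ _ 0]) (use g1 in auto)
 moreover have "((\<lambda>t. F (velocity A g t)) has_integral len \<gamma>2 0 1) {1/2..1}"
  by (rule len_affine[OF pw2, of 2 _ _ _ "-1"]) (use g2 in auto)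
 ultimately have "((\<lambda>t. F (velocity A g t)) has_integral (len \<gamma>1 0 1 + len \<gamma>2 0 1)) {0..1}"
  by (rule has_integral_combine[rotated 2]) auto
 then have "len g 0 1 = len \<gamma>1 0 1 + len \<gamma>2 0 1" unfolding len_def by (rule integral_unique)
 moreover have "g 0 = \<gamma>1 0" "g 1 = \<gamma>2 1" using g1[of 0] g2[of 1] by auto
 ultimately show ?thesis by (intro that[OF pw])
qed

lemma segment_curve:
 assumes cA: "c \<in> A" and sub: "cball z0 \<rho> \<subseteq> snd c ` fst c" and R: "0 < R"
  and cmp: "!!z y. z \<in> cball z0 \<rho> ==> Fc c z y <= R * norm y"
  and z: "z \<in> cball z0 \<rho>" and z': "z' \<in> cball z0 \<rho>"
 obtains g where "piecewise_smooth_curve A g" "g 0 = chart_inv c z" "g 1 = chart_inv c z'"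
  "len g 0 1 <= R * dist z z'"
proof -
 define w where "w = z' - z"
 define g where "g t = chart_inv c (z + t *\<^sub>R w)" for t
 have seg: "z + t *\<^sub>R w \<in> cball z0 \<rho>" if "t \<in> {0..1}" for t
 proof -
  have "(1 - t) *\<^sub>R z + t *\<^sub>R z' \<in> cball z0 \<rho>"
   by (rule convexD_alt[OF convex_cball z z']) (use that in auto)
  then show ?thesis by (simp add: w_def algebra_simps)
 qed
 have lc: "continuous_on UNIV (\<lambda>t. z + t *\<^sub>R w)" by (intro continuous_intros)
 have sm: "smooth_curve_on A {0..1} g"
  unfolding smooth_curve_on_def
 proof (intro ballI)
  fix t c' assume t: "t \<in> {0..1}" and c': "c' \<in> charts_at A (g t)"
  have c'A: "c' \<in> A" "g t \<in> fst c'" using c' by (auto simp: charts_at_def)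
  have zt: "z + t *\<^sub>R w \<in> snd c ` fst c" using seg[OF t] sub by blast
  have "z + t *\<^sub>R w \<in> overlap c c'"
   using chart_inv2[OF cA zt] chart_inv_in[OF cA zt] c'A(2) unfolding g_def by (metis IntI imageI)
  moreover have "open ((\<lambda>t. z + t *\<^sub>R w) -` overlap c c')"
   by (rule open_vimage[OF open_overlap[OF cA c'A(1)] lc])
  ultimately obtain e where e: "0 < e" "ball t e \<subseteq> (\<lambda>t. z + t *\<^sub>R w) -` overlap c c'"
   unfolding open_contains_ball by blast
  have b: "ball t e = {t - e<..<t + e}" by (auto simp: dist_real_def)
  have "smooth_on {t - e<..<t + e} (\<lambda>s. (snd c' \<circ> chart_inv c) (z + s *\<^sub>R w))"
   unfolding smooth_on_def
  proof
   fix n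
   have "Ck_on n (overlap c c') (snd c' \<circ> chart_inv c)"
    using transition_smooth[OF cA c'A(1)] by (simp add: smooth_on_def)
   moreover have "z + s *\<^sub>R w \<in> overlap c c'" if "s \<in> {t - e<..<t + e}" for s
    using e(2) b that by auto
   ultimately show "Ck_on n {t - e<..<t + e} (\<lambda>s. (snd c' \<circ> chart_inv c) (z + s *\<^sub>R w))"
    by (rule Ck_on_affine[OF _ bounded_linear_scaleR_left open_greaterThanLessThan])
  qed
  moreover have "g s \<in> fst c' \<and> snd c' (g s) = (snd c' \<circ> chart_inv c) (z + s *\<^sub>R w)"
   if "s \<in> {0..1} \<inter> {t - e<..<t + e}" for s
  proof -
   have "z + s *\<^sub>R w \<in> overlap c c'" using e(2) b that by auto
   then have "g s \<in> fst c'" unfolding g_def using cA by auto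
   then show ?thesis by (simp add: g_def)
  qed
  ultimately show "\<exists>e>0. \<exists>h. smooth_on {t - e<..<t + e} h \<and>
    (\<forall>s\<in>{0..1} \<inter> {t - e<..<t + e}. g s \<in> fst c' \<and> snd c' (g s) = h s)"
   using e(1) by blast
 qed
 have pw: "piecewise_smooth_curve A g"
  unfolding piecewise_smooth_curve_def
 proof (intro conjI exI[of _ "1::nat"] exI[of _ real])
  show "continuous_on {0..1} g"
   unfolding g_def
   by (rule continuous_on_compose2[OF chart_cont(2)[OF cA] continuous_on_subset[OF lc]]) (use seg sub in auto)
 qed (use sm in auto)
 have speed: "F (velocity A g t) <= R * norm w" if t: "t \<in> {0<..<1}" for t
 proof -
  have t': "t \<in> {0..1}" using t by auto
  have zs: "z + s *\<^sub>R w \<in> snd c ` fst c" if "s \<in> {0<..<1}" for s using seg[of s] sub that by auto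
  have s: "snd c (g s) = z + s *\<^sub>R w" "g s \<in> fst c" if "s \<in> {0<..<1}" for s
   unfolding g_def using chart_inv2[OF cA zs[OF that]] chart_inv_in[OF cA zs[OF that]] by auto
  have c: "c \<in> charts_at A (g t)" using s(2)[OF t] cA by (simp add: charts_at_def)
  have "((\<lambda>s. z + s *\<^sub>R w) has_vector_derivative w) (at t)"
   by (auto intro!: derivative_eq_intros)
  then have d: "((\<lambda>s. snd c (g s)) has_vector_derivative w) (at t)"
   by (rule has_vector_derivative_transform_within_open[OF _ open_greaterThanLessThan t]) (simp add: s(1))
  have "velocity A g t = tangent_of A c (g t) w"
   by (rule velocity_chart[OF c open_greaterThanLessThan t _ d]) (use s(2) in auto)
  then have "F (velocity A g t) = Fc c (z + t *\<^sub>R w) w" using Fc_chart[OF c] s(1)[OF t] by simp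
  then show ?thesis using cmp[OF seg[OF t'], of w] by simp
 qed
 have "len g 0 1 <= R * norm w"
 proof -
  let ?f = "\<lambda>t. if t \<in> {0<..<1} then F (velocity A g t) else 0"
  have "(?f has_integral len g 0 1) {0..1}"
   unfolding len_def
   by (rule has_integral_spike_finite[OF _ _ integrable_integral[OF speed_integrable[OF pw, of 0 1]], of "{0, 1}"]) auto
  moreover have "((\<lambda>_. R * norm w) has_integral (1 - 0) *\<^sub>R (R * norm w)) {0..1::real}"
   using has_integral_const_real[of "R * norm w" 0 1] by simp
  ultimately have "len g 0 1 <= (1 - 0) *\<^sub>R (R * norm w)"
   by (rule has_integral_le) (use speed R in auto)
  then show ?thesis by simp
 qed
 moreover have "norm w = dist z z'" by (simp add: w_def dist_norm norm_minus_commute)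
 ultimately show ?thesis by (intro that[OF pw]) (auto simp: g_def w_def)
qed

definition joined :: "'a => 'a => bool" where
 "joined x y \<longleftrightarrow> (\<exists>g. piecewise_smooth_curve A g \<and> g 0 = x \<and> g 1 = y)"

abbreviation d :: "'a => 'a => real" where "d \<equiv> finsler_dist A F"

lemma joined_trans: "joined x y ==> joined y z ==> joined x z"
 unfolding joined_def by (metis concat_curves)

lemma dist_bdd: "bdd_below {integral {0..1} (\<lambda>t. F (velocity A g t)) | g. piecewise_smooth_curve A g \<and> g 0 = x \<and> g 1 = y}"
 by (rule bdd_belowI[of _ 0]) (use len_nonneg[of _ 0 1] in \<open>auto simp: len_def\<close>)

lemma dist_le_len: "piecewise_smooth_curve A g ==> d (g 0) (g 1) <= len g 0 1"
 unfolding finsler_dist_def len_def by (rule cInf_lower[OF _ dist_bdd]) blast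

text \<open>Straight coordinate segments inside a small ball have length at most R times the
  coordinate distance of their ends; either end may be the starting point, so both orders of the
  asymmetric distance are bounded.\<close>

lemma local_dist_bound:
 obtains W c R where "open W" "x0 \<in> W" "c \<in> A" "W \<subseteq> fst c" "0 < R"
  "!!x y. x \<in> W ==> y \<in> W ==> joined x y \<and> d x y <= R * dist (snd c x) (snd c y)"
proof -
 obtain c where c: "c \<in> charts_at A x0" using charts_at_nonempty by blast
 then have cA: "c \<in> A" "x0 \<in> fst c" by (auto simp: charts_at_def)
 obtain \<rho> r R where \<rho>: "0 < \<rho>" "0 < R" "cball (snd c x0) \<rho> \<subseteq> snd c ` fst c"
  "!!z y. z \<in> cball (snd c x0) \<rho> ==> Fc c z y <= R * norm y"
  using local_comparison[OF c] by metis
 define W where "W = chart_inv c ` ball (snd c x0) \<rho>"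
 have bs: "ball (snd c x0) \<rho> \<subseteq> snd c ` fst c" using \<rho>(3) ball_subset_cball by blast
 show ?thesis
 proof (rule that[of W c R])
  show "open W" unfolding W_def by (rule open_chart_inv_image[OF cA(1) open_ball bs])
  show "x0 \<in> W" unfolding W_def using cA \<rho>(1) by (metis centre_in_ball chart_inv imageI)
  show "W \<subseteq> fst c" unfolding W_def using bs cA(1) by auto
  fix x y assume "x \<in> W" "y \<in> W"
  then obtain z z' where z: "z \<in> ball (snd c x0) \<rho>" "x = chart_inv c z" and z': "z' \<in> ball (snd c x0) \<rho>" "y = chart_inv c z'"
   unfolding W_def by blast
  have zb: "z \<in> cball (snd c x0) \<rho>" "z' \<in> cball (snd c x0) \<rho>" using z z' by auto
  have s: "snd c x = z" "snd c y = z'" using z z' bs chart_inv2[OF cA(1)] by auto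
  obtain g where g: "piecewise_smooth_curve A g" "g 0 = x" "g 1 = y" "len g 0 1 <= R * dist z z'"
   using segment_curve[OF cA(1) \<rho>(3,2,4) zb] z(2) z'(2) by metis
  then show "joined x y \<and> d x y <= R * dist (snd c x) (snd c y)"
   using dist_le_len[OF g(1)] s by (auto simp: joined_def)
 qed (use cA \<rho> in auto)
qed

lemma locally_joined: "\<exists>W. open W \<and> x0 \<in> W \<and> (\<forall>x\<in>W. \<forall>y\<in>W. joined x y)"
proof -
 obtain W c R where "open W" "x0 \<in> W" "c \<in> A" "W \<subseteq> fst c" "0 < R"
  "!!x y. x \<in> W ==> y \<in> W ==> joined x y \<and> d x y <= R * dist (snd c x) (snd c y)"
  by (rule local_dist_bound[of x0]) (rule that, assumption+)
 then show ?thesis by auto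
qed

text \<open>The set reachable from x is open, and so is its complement, since nearby points are
  joined in both directions. The infimum defining \<open>finsler_dist\<close> thus runs over a
  nonempty set.\<close>

lemma all_joined: "joined x y"
proof -
 have op: "open {y. joined x y}"
 proof (subst open_subopen, intro ballI)
  fix y assume y: "y \<in> {y. joined x y}"
  obtain W where "open W" "y \<in> W" "\<forall>z\<in>W. joined y z" using locally_joined[of y] by blast
  then show "\<exists>T. open T \<and> y \<in> T \<and> T \<subseteq> {y. joined x y}" using joined_trans y by blast
 qed
 have cl: "open (- {y. joined x y})"
 proof (subst open_subopen, intro ballI)
  fix y assume y: "y \<in> - {y. joined x y}"
  obtain W where "open W" "y \<in> W" "\<forall>z\<in>W. joined z y" using locally_joined[of y] by blast
  then show "\<exists>T. open T \<and> y \<in> T \<and> T \<subseteq> - {y. joined x y}" using joined_trans y by blast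
 qed
 have x: "x \<in> {y. joined x y}" using locally_joined[of x] by blast
 have "connected (UNIV :: 'a set)" using finsler by (simp add: finsler_manifold_def)
 then have "{y. joined x y} \<inter> UNIV = {} \<or> - {y. joined x y} \<inter> UNIV = {}"
  by (rule connectedD) (use op cl in auto)
 then show ?thesis using x by auto
qed

lemma dist_approx:
 assumes "d x y < L"
 obtains g where "piecewise_smooth_curve A g" "g 0 = x" "g 1 = y" "len g 0 1 < L"
proof -
 let ?S = "{integral {0..1} (\<lambda>t. F (velocity A g t)) | g. piecewise_smooth_curve A g \<and> g 0 = x \<and> g 1 = y}"
 have "?S \<noteq> {}" using all_joined[of x y] unfolding joined_def by blast
 moreover have "Inf ?S < L" using assms by (simp add: finsler_dist_def)
 ultimately have "\<exists>l\<in>?S. l < L" by (rule cInf_lessD)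
 then obtain g where "piecewise_smooth_curve A g \<and> g 0 = x \<and> g 1 = y"
  "integral {0..1} (\<lambda>t. F (velocity A g t)) < L" by auto
 then show ?thesis by (intro that[of g]) (auto simp: len_def)
qed

lemma dist_nonneg: "0 <= d x y"
proof (rule ccontr)
 assume "\<not> 0 <= d x y"
 then have "d x y < 0" by simp
 then obtain g where "piecewise_smooth_curve A g" "len g 0 1 < 0" using dist_approx by metis
 then show False using len_nonneg[of g 0 1] by simp
qed

lemma dist_triangle_ineq: "d x z <= d x y + d y z"
proof (rule field_le_epsilon)
 fix e :: real assume e: "0 < e"
 obtain \<gamma>1 where 1: "piecewise_smooth_curve A \<gamma>1" "\<gamma>1 0 = x" "\<gamma>1 1 = y" "len \<gamma>1 0 1 < d x y + e / 2"
  using dist_approx[of x y "d x y + e / 2"] e by auto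
 obtain \<gamma>2 where 2: "piecewise_smooth_curve A \<gamma>2" "\<gamma>2 0 = y" "\<gamma>2 1 = z" "len \<gamma>2 0 1 < d y z + e / 2"
  using dist_approx[of y z "d y z + e / 2"] e by auto
 obtain g where g: "piecewise_smooth_curve A g" "g 0 = x" "g 1 = z" "len g 0 1 = len \<gamma>1 0 1 + len \<gamma>2 0 1"
  using concat_curves[OF 1(1) 2(1)] 1 2 by metis
 have "d x z <= len g 0 1" using dist_le_len[OF g(1)] g by simp
 then show "d x z <= d x y + d y z + e" using g(4) 1(4) 2(4) by simp
qed

lemma dist_self: "d x x = 0"
proof -
 obtain W c R where "open W" "x \<in> W" "c \<in> A" "W \<subseteq> fst c" "0 < R"
  "!!y z. y \<in> W ==> z \<in> W ==> joined y z \<and> d y z <= R * dist (snd c y) (snd c z)"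
  by (rule local_dist_bound[of x]) (rule that, assumption+)
 then have "d x x <= R * dist (snd c x) (snd c x)" by blast
 then show ?thesis using dist_nonneg[of x x] by simp
qed

lemma small_neighbourhood:
 assumes e: "0 < e"
 obtains W where "open W" "x0 \<in> W" "!!x y. x \<in> W ==> y \<in> W ==> d x y < e"
proof -
 obtain W c R where W: "open W" "x0 \<in> W" "c \<in> A" "W \<subseteq> fst c" "0 < R"
  "!!x y. x \<in> W ==> y \<in> W ==> joined x y \<and> d x y <= R * dist (snd c x) (snd c y)"
  by (rule local_dist_bound[of x0]) (rule that, assumption+)
 have "open (W \<inter> snd c -` ball (snd c x0) (e / (3 * R)))"
  using continuous_on_subset[OF chart_cont(1)[OF W(3)] W(4)] W(1) by (intro continuous_open_preimage) auto
 moreover have "x0 \<in> W \<inter> snd c -` ball (snd c x0) (e / (3 * R))" using W e by simp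
 moreover have "d x y < e" if "x \<in> W \<inter> snd c -` ball (snd c x0) (e / (3 * R))" "y \<in> W \<inter> snd c -` ball (snd c x0) (e / (3 * R))" for x y
 proof -
  have "dist (snd c x) (snd c y) < e / (3 * R) + e / (3 * R)"
   by (rule dist_triangle_less_add) (use that in \<open>auto simp: dist_commute\<close>)
  then have "R * dist (snd c x) (snd c y) < R * (e / (3 * R) + e / (3 * R))"
   by (rule mult_strict_left_mono) (rule W(5))
  also have "\<dots> < e" using W(5) e by (simp add: field_simps)
  finally show ?thesis using W(6)[of x y] that by auto
 qed
 ultimately show ?thesis using that by blast
qed

lemma dist_continuous: "continuous_on UNIV (\<lambda>z. d (fst z) (snd z))"
proof (rule continuous_at_imp_continuous_on, rule ballI)
 fix z0 :: "'a \<times> 'a"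
 show "continuous (at z0) (\<lambda>z. d (fst z) (snd z))"
  unfolding continuous_at
 proof (rule tendstoI)
  fix e :: real assume e: "0 < e"
  then have e2: "0 < e / 2" by simp
  obtain W1 where W1: "open W1" "fst z0 \<in> W1" "!!x y. x \<in> W1 ==> y \<in> W1 ==> d x y < e / 2"
   using small_neighbourhood[OF e2] by metis
  obtain W2 where W2: "open W2" "snd z0 \<in> W2" "!!x y. x \<in> W2 ==> y \<in> W2 ==> d x y < e / 2"
   using small_neighbourhood[OF e2] by metis
  have "\<forall>\<^sub>F z in at z0. z \<in> W1 \<times> W2"
   by (rule topological_tendstoD[OF tendsto_ident_at]) (use W1 W2 in \<open>auto simp: open_Times mem_Times_iff\<close>)
  then show "\<forall>\<^sub>F z in at z0. dist (d (fst z) (snd z)) (d (fst z0) (snd z0)) < e"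
  proof eventually_elim
   case (elim z)
   then have z: "fst z \<in> W1" "snd z \<in> W2" by (auto simp: mem_Times_iff)
   have "d (fst z) (snd z) <= d (fst z) (fst z0) + (d (fst z0) (snd z0) + d (snd z0) (snd z))"
    by (rule order_trans[OF dist_triangle_ineq add_left_mono[OF dist_triangle_ineq]])
   moreover have "d (fst z0) (snd z0) <= d (fst z0) (fst z) + (d (fst z) (snd z) + d (snd z) (snd z0))"
    by (rule order_trans[OF dist_triangle_ineq add_left_mono[OF dist_triangle_ineq]])
   moreover have "d (fst z) (fst z0) < e / 2" "d (fst z0) (fst z) < e / 2" "d (snd z0) (snd z) < e / 2" "d (snd z) (snd z0) < e / 2"
    using W1 W2 z by auto
   ultimately show ?case by (simp add: dist_real_def)
  qed
 qed
qed

text \<open>A short curve ending near x0 stays in a coordinate ball, and so does its starting point.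
  One \<delta> serves all end points in \<open>W\<close>; in \<open>kernel_open_measurable\<close>
  this makes the distance from the complement of an open set positive inside it.\<close>

lemma backward_localization:
 assumes U: "open U" "x0 \<in> U"
 obtains W \<delta> where "open W" "x0 \<in> W" "0 < \<delta>" "!!x z. z \<in> W ==> d x z < \<delta> ==> x \<in> U"
proof -
 obtain c where c: "c \<in> charts_at A x0" using charts_at_nonempty by blast
 then have cA: "c \<in> A" "x0 \<in> fst c" by (auto simp: charts_at_def)
 obtain \<rho>0 r where \<rho>0: "0 < \<rho>0" "0 < r" "cball (snd c x0) \<rho>0 \<subseteq> snd c ` fst c"
  "!!z y. z \<in> cball (snd c x0) \<rho>0 ==> r * norm y <= Fc c z y"
  using local_comparison[OF c] by metis
 have "open (snd c ` (U \<inter> fst c))" using open_chart_image[OF cA(1), of "U \<inter> fst c"] U(1) chart_open(1)[OF cA(1)] by auto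
 moreover have "snd c x0 \<in> snd c ` (U \<inter> fst c)" using U cA by auto
 ultimately obtain \<rho>1 where \<rho>1: "0 < \<rho>1" "ball (snd c x0) \<rho>1 \<subseteq> snd c ` (U \<inter> fst c)"
  unfolding open_contains_ball by blast
 define \<rho> where "\<rho> = min \<rho>0 \<rho>1"
 have \<rho>: "0 < \<rho>" "\<rho> <= \<rho>0" "\<rho> <= \<rho>1" using \<rho>0 \<rho>1 by (auto simp: \<rho>_def)
 have cb: "cball (snd c x0) \<rho> \<subseteq> cball (snd c x0) \<rho>0" using \<rho> by auto
 have bs: "ball (snd c x0) (\<rho> / 2) \<subseteq> snd c ` fst c" using \<rho>0(3) \<rho> by (auto simp: subset_iff)
 define W where "W = chart_inv c ` ball (snd c x0) (\<rho> / 2)"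
 show ?thesis
 proof (rule that[of W "r * \<rho> / 2"])
  show "open W" unfolding W_def by (rule open_chart_inv_image[OF cA(1) open_ball bs])
  show "x0 \<in> W" unfolding W_def using cA \<rho>(1) by (metis centre_in_ball chart_inv half_gt_zero imageI)
  show "0 < r * \<rho> / 2" using \<rho> \<rho>0 by simp
  fix x z assume z: "z \<in> W" and dxz: "d x z < r * \<rho> / 2"
  obtain g where g: "piecewise_smooth_curve A g" "g 0 = x" "g 1 = z" "len g 0 1 < r * \<rho> / 2"
   using dist_approx[OF dxz] by metis
  have zc: "z \<in> fst c" "snd c z \<in> ball (snd c x0) (\<rho> / 2)"
   using z bs cA chart_inv2[OF cA(1)] unfolding W_def by auto
  have "len g 0 1 / r < \<rho> / 2" using g(4) \<rho>0(2) by (simp add: field_simps)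
  moreover have "dist (snd c (g 1)) (snd c x0) < \<rho> / 2"
   using zc(2) unfolding g(3) by (simp only: mem_ball dist_commute)
  ultimately have small: "dist (snd c (g 1)) (snd c x0) + len g 0 1 / r < \<rho>" by linarith
  have "g 0 \<in> fst c" "dist (snd c (g 0)) (snd c x0) < \<rho>"
   using chart_localization[OF cA(1) \<rho>0(2) subset_trans[OF cb \<rho>0(3)] \<rho>0(4)[OF subsetD[OF cb]] g(1), of 0 1 0] small zc g by auto
  then have x: "x \<in> fst c" "snd c x \<in> ball (snd c x0) \<rho>1" using g(2) \<rho> by (auto simp: dist_commute)
  then obtain y where "y \<in> U \<inter> fst c" "snd c x = snd c y" using \<rho>1(2) by auto
  then show "x \<in> U" using x cA(1) by (metis IntE chart_inv)
 qed
qed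

end

section \<open>Slopes of test functions\<close>

text \<open>Uniform continuity on the compact product of K with the unit sphere, carried over to all
  v by homogeneity.\<close>

lemma uniform_homogeneous:
 fixes f :: "'a::euclidean_space => 'b::euclidean_space => real"
 assumes K: "compact K" and cont: "continuous_on (K \<times> UNIV) (\<lambda>(z, v). f z v)"
  and hom: "!!z r v. z \<in> K ==> 0 <= r ==> f z (r *\<^sub>R v) = r * f z v" and e: "0 < e"
 obtains \<eta> where "0 < \<eta>" "!!z x v. z \<in> K ==> x \<in> K ==> dist z x < \<eta> ==> \<bar>f z v - f x v\<bar> <= e * norm v"
proof -
 have "uniformly_continuous_on (K \<times> sphere 0 1) (\<lambda>(z, v). f z v)"
  by (rule compact_uniformly_continuous) (auto intro!: compact_Times K continuous_on_subset[OF cont])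
 then obtain \<eta> where \<eta>: "0 < \<eta>" "!!k k'. k \<in> K \<times> sphere 0 1 ==> k' \<in> K \<times> sphere 0 1 ==> dist k' k < \<eta> ==>
   dist ((\<lambda>(z, v). f z v) k') ((\<lambda>(z, v). f z v) k) < e"
  using e unfolding uniformly_continuous_on_def by metis
 show ?thesis
 proof (rule that[OF \<eta>(1)])
  fix z x v assume z: "z \<in> K" and x: "x \<in> K" and zx: "dist z x < \<eta>"
  show "\<bar>f z v - f x v\<bar> <= e * norm v"
  proof (cases "v = 0")
   case True
   then show ?thesis using hom[OF z, of 0 0] hom[OF x, of 0 0] by simp
  next
   case False
   define u where "u = v /\<^sub>R norm v"
   have u: "norm u = 1" "v = norm v *\<^sub>R u" using False by (auto simp: u_def)
   have "dist (f z u) (f x u) < e"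
    using \<eta>(2)[of "(x, u)" "(z, u)"] z x zx u(1) by (simp add: dist_Pair_Pair)
   then have "\<bar>f z u - f x u\<bar> <= e" by (simp add: dist_real_def)
   moreover have "f z v = norm v * f z u" "f x v = norm v * f x u"
    using hom[OF z, of "norm v" u] hom[OF x, of "norm v" u] u(2) by simp_all
   then have "\<bar>f z v - f x v\<bar> = norm v * \<bar>f z u - f x u\<bar>"
    by (simp add: right_diff_distrib[symmetric] abs_mult)
   ultimately show ?thesis using mult_left_mono[of "\<bar>f z u - f x u\<bar>" e "norm v"] by (simp add: mult.commute)
  qed
 qed
qed

context manifold
begin

definition dphi :: "('a => real) => ('a, 'n) chart => real ^ 'n => real ^ 'n => real" where
 "dphi \<phi> c z v = frechet_derivative (\<phi> \<circ> chart_inv c) (at z) v"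

lemma dphi_continuous:
 assumes "Ck_function 1 A \<phi>" "c \<in> A"
 shows "continuous_on (snd c ` fst c \<times> UNIV) (\<lambda>(z, v). dphi \<phi> c z v)"
proof -
 have "Ck_on (Suc 0) (snd c ` fst c) (\<phi> \<circ> chart_inv c)" using assms by (simp add: Ck_function_def)
 then have "continuous_on (snd c ` fst c \<times> UNIV) (\<lambda>k. frechet_derivative (\<phi> \<circ> chart_inv c) (at (fst k)) (snd k))"
  by (rule continuous_on_frechet_derivative) (auto intro!: continuous_intros)
 then show ?thesis by (simp add: dphi_def case_prod_beta)
qed

lemma dphi_linear:
 assumes "Ck_function 1 A \<phi>" "c \<in> A" "z \<in> snd c ` fst c" shows "linear (dphi \<phi> c z)"
proof -
 have "Ck_on (Suc 0) (snd c ` fst c) (\<phi> \<circ> chart_inv c)" using assms by (simp add: Ck_function_def)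
 then have "linear (frechet_derivative (\<phi> \<circ> chart_inv c) (at z))"
  using assms(3) by (intro has_derivative_linear[OF Ck1_has_derivative])
 then show ?thesis by (simp add: dphi_def[abs_def])
qed

lemma pairing_dphi:
 "Ck_function 1 A \<phi> ==> c \<in> charts_at A x ==> pairing A (tangent_of A c x y) \<phi> = dphi \<phi> c (snd c x) y"
 by (simp add: pairing_tangent_of dphi_def)

end

context finsler
begin

text \<open>K dominates the dual Finsler norm of the differential of \<phi> at x. As a relation it
  avoids forming the supremum, and quantifying over all charts avoids choosing one.\<close>

definition slope_le :: "('a => real) => 'a => real => bool" where
 "slope_le \<phi> x K \<longleftrightarrow> (\<forall>c\<in>charts_at A x. \<forall>v. dphi \<phi> c (snd c x) v <= K * Fc c (snd c x) v)"

lemma slope_le_chart: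
 assumes \<phi>: "Ck_function 1 A \<phi>" and c: "c \<in> charts_at A x" and le: "!!v. dphi \<phi> c (snd c x) v <= K * Fc c (snd c x) v"
 shows "slope_le \<phi> x K"
 unfolding slope_le_def
proof (intro ballI allI)
 fix c' v assume c': "c' \<in> charts_at A x"
 define w where "w = transition_deriv c' c x v"
 have t: "tangent_of A c' x v = tangent_of A c x w" unfolding w_def by (rule tangent_of_change[OF c' c])
 have "dphi \<phi> c' (snd c' x) v = dphi \<phi> c (snd c x) w"
  using pairing_dphi[OF \<phi> c', of v] pairing_dphi[OF \<phi> c, of w] t by simp
 moreover have "Fc c' (snd c' x) v = Fc c (snd c x) w" using Fc_chart[OF c', of v] Fc_chart[OF c, of w] t by simp
 ultimately show "dphi \<phi> c' (snd c' x) v <= K * Fc c' (snd c' x) v" using le by simp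
qed

lemma slope_le_mono: "slope_le \<phi> x K ==> K <= L ==> slope_le \<phi> x L"
 unfolding slope_le_def
 by (meson Fc_nonneg charts_atD imageI mult_right_mono order_trans)

definition supp :: "('a => real) => 'a set" where "supp \<phi> = closure {x. \<phi> x \<noteq> 0}"

lemma slope_off_support:
 assumes \<phi>: "Ck_function 1 A \<phi>" and x: "x \<notin> supp \<phi>" and K: "0 <= K" shows "slope_le \<phi> x K"
 unfolding slope_le_def
proof (intro ballI allI)
 fix c v assume c: "c \<in> charts_at A x"
 have cA: "c \<in> A" "x \<in> fst c" using c by (auto simp: charts_at_def)
 have "open (snd c ` (fst c - supp \<phi>))"
  by (rule open_chart_image[OF cA(1)]) (use chart_open(1)[OF cA(1)] in \<open>auto simp: supp_def open_Diff\<close>)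
 moreover have "snd c x \<in> snd c ` (fst c - supp \<phi>)" using cA x by blast
 moreover have "(\<phi> \<circ> chart_inv c) z = (\<lambda>_. 0) z" if "z \<in> snd c ` (fst c - supp \<phi>)" for z
  using that cA(1) closure_subset[of "{x. \<phi> x \<noteq> 0}"] by (auto simp: supp_def)
 ultimately have "frechet_derivative (\<phi> \<circ> chart_inv c) (at (snd c x)) = frechet_derivative (\<lambda>_. 0) (at (snd c x))"
  by (rule frechet_derivative_cong_open(2))
 then have "dphi \<phi> c (snd c x) v = 0" by (simp add: dphi_def frechet_derivative_const)
 then show "dphi \<phi> c (snd c x) v <= K * Fc c (snd c x) v"
  using K Fc_nonneg[OF cA(1), of "snd c x" v] cA(2) by simp
qed

context
 fixes \<phi> :: "'a => real"
 assumes \<phi>: "\<phi> \<in> test_functions A"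
begin

lemma test_C1: "Ck_function 1 A \<phi>" using \<phi> by (simp add: test_functions_def)

lemma test_compact: "compact (supp \<phi>)" using \<phi> by (simp add: test_functions_def supp_def)

text \<open>Locally the differential is bounded in the Euclidean sense and F bounds the Euclidean
  norm from above up to the factor r; finitely many such neighbourhoods cover the support, and off
  it the slope is 0.\<close>

lemma slope_bounded: obtains C where "0 <= C" "!!x. slope_le \<phi> x C"
proof -
 have loc: "\<exists>W B. open W \<and> x0 \<in> W \<and> 0 <= B \<and> (\<forall>x\<in>W. slope_le \<phi> x B)" for x0
 proof -
  obtain c where c: "c \<in> charts_at A x0" using charts_at_nonempty by blast
  then have cA: "c \<in> A" "x0 \<in> fst c" by (auto simp: charts_at_def)
  obtain \<rho> r R where \<rho>: "0 < \<rho>" "0 < r" "0 < R" "cball (snd c x0) \<rho> \<subseteq> snd c ` fst c"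
   "!!z y. z \<in> cball (snd c x0) \<rho> ==> r * norm y <= Fc c z y"
   "!!z y. z \<in> cball (snd c x0) \<rho> ==> Fc c z y <= R * norm y"
   by (rule local_comparison[OF c]) (rule that, assumption+)
  let ?K = "cball (snd c x0) \<rho> \<times> sphere (0 :: real ^ 'n) 1"
  have "compact ((\<lambda>(z, v). dphi \<phi> c z v) ` ?K)"
   by (intro compact_continuous_image compact_Times continuous_on_subset[OF dphi_continuous[OF test_C1 cA(1)]])
    (use \<rho>(4) in auto)
  then have "bounded ((\<lambda>(z, v). dphi \<phi> c z v) ` ?K)" by (rule compact_imp_bounded)
  then obtain M where M: "\<forall>k\<in>(\<lambda>(z, v). dphi \<phi> c z v) ` ?K. norm k <= M" "0 < M" unfolding bounded_pos by blast
  have dM: "dphi \<phi> c z v <= M / r * Fc c z v" if z: "z \<in> cball (snd c x0) \<rho>" for z v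
  proof -
   have l: "linear (dphi \<phi> c z)" by (rule dphi_linear[OF test_C1 cA(1)]) (use z \<rho>(4) in auto)
   have "dphi \<phi> c z v <= M * norm v"
   proof (cases "v = 0")
    case False
    then have "(z, v /\<^sub>R norm v) \<in> ?K" using z by simp
    then have "\<bar>dphi \<phi> c z (v /\<^sub>R norm v)\<bar> <= M" using M(1) by fastforce
    moreover have "dphi \<phi> c z v = norm v * dphi \<phi> c z (v /\<^sub>R norm v)"
     using linear_scale[OF l, of "inverse (norm v)" v] False by simp
    ultimately show ?thesis using mult_left_mono[of "dphi \<phi> c z (v /\<^sub>R norm v)" M "norm v"] by (simp add: mult.commute)
   qed (simp add: linear_0[OF l])
   also have "M * norm v <= M / r * Fc c z v"
    using mult_left_mono[OF \<rho>(5)[OF z, of v], of "M / r"] M(2) \<rho>(2) by simp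
   finally show ?thesis .
  qed
  define W where "W = chart_inv c ` ball (snd c x0) \<rho>"
  have bs: "ball (snd c x0) \<rho> \<subseteq> snd c ` fst c" using \<rho>(4) ball_subset_cball by blast
  have "open W" unfolding W_def by (rule open_chart_inv_image[OF cA(1) open_ball bs])
  moreover have "x0 \<in> W" unfolding W_def using cA \<rho>(1) by (metis centre_in_ball chart_inv imageI)
  moreover have "slope_le \<phi> x (M / r)" if xW: "x \<in> W" for x
  proof -
   obtain z where z: "z \<in> ball (snd c x0) \<rho>" "x = chart_inv c z" using xW unfolding W_def by blast
   then have "z \<in> snd c ` fst c" using bs by blast
   then have s: "snd c x = z" "x \<in> fst c" using z(2) cA(1) chart_inv2 chart_inv_in by auto
   show ?thesis by (rule slope_le_chart[OF test_C1, of c]) (use s cA z dM in \<open>auto simp: charts_at_def\<close>)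
  qed
  moreover have "0 <= M / r" using M \<rho> by simp
  ultimately show ?thesis by blast
 qed
 then obtain W B where W: "!!x0. open (W x0)" "!!x0. x0 \<in> W x0" "!!x0. 0 <= B x0" "!!x0 x. x \<in> W x0 ==> slope_le \<phi> x (B x0)"
  by metis
 obtain D where D: "D \<subseteq> supp \<phi>" "finite D" "supp \<phi> \<subseteq> (\<Union>x\<in>D. W x)"
  using compactE_image[OF test_compact, of "supp \<phi>" W] W(1,2) by blast
 have C0: "0 <= (\<Sum>x\<in>D. B x)" using W(3) by (simp add: sum_nonneg)
 show ?thesis
 proof (rule that[OF C0])
  fix x show "slope_le \<phi> x (\<Sum>x\<in>D. B x)"
  proof (cases "x \<in> supp \<phi>")
   case True
   then obtain y where y: "y \<in> D" "x \<in> W y" using D(3) by blast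
   have "B y <= (\<Sum>x\<in>D. B x)" by (rule member_le_sum[OF y(1)]) (use W(3) D(2) in auto)
   then show ?thesis using slope_le_mono[OF W(4)[OF y(2)]] by blast
  qed (rule slope_off_support[OF test_C1 _ C0])
 qed
qed

lemma curve_slope:
 assumes pw: "piecewise_smooth_curve A g" and C: "!!t. t \<in> {0..1} ==> slope_le \<phi> (g t) C"
 shows "\<phi> (g 1) - \<phi> (g 0) <= C * len g 0 1"
proof (rule curve_growth[OF pw, where \<psi>="\<lambda>t. \<phi> (g t)"])
 show "continuous_on {0..1} (\<lambda>t. \<phi> (g t))"
  by (rule continuous_on_compose2[OF C1_continuous[OF test_C1]]) (use pw in \<open>auto simp: piecewise_smooth_curve_def\<close>)
 fix t assume t: "t \<in> {0<..<1::real}" and reg: "regular_at g t"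
 obtain c where c: "c \<in> charts_at A (g t)" using charts_at_nonempty by blast
 then have cA: "c \<in> A" by (rule charts_atD)
 obtain w T where w: "open T" "t \<in> T" "g ` T \<subseteq> fst c" "((\<lambda>s. snd c (g s)) has_vector_derivative w) (at t)"
  "velocity A g t = tangent_of A c (g t) w" "F (velocity A g t) = Fc c (snd c (g t)) w"
  by (rule regular_velocity[OF reg c]) (rule that, assumption+)
 have l: "linear (dphi \<phi> c (snd c (g t)))"
  by (rule dphi_linear[OF test_C1 cA]) (use c in \<open>auto simp: charts_at_def\<close>)
 have "((\<lambda>s. (\<phi> \<circ> chart_inv c) (snd c (g s))) has_derivative (\<lambda>h. dphi \<phi> c (snd c (g t)) (h *\<^sub>R w))) (at t)"
  unfolding dphi_def
  by (rule has_derivative_compose[OF w(4)[unfolded has_vector_derivative_def] C1_has_derivative[OF test_C1 c]])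
 moreover have "(\<lambda>h. dphi \<phi> c (snd c (g t)) (h *\<^sub>R w)) = (*) (dphi \<phi> c (snd c (g t)) w)"
  by (rule ext) (simp only: linear_scale[OF l] real_scaleR_def mult.commute)
 ultimately have "((\<lambda>s. (\<phi> \<circ> chart_inv c) (snd c (g s))) has_derivative (*) (dphi \<phi> c (snd c (g t)) w)) (at t)"
  by simp
 then have "((\<lambda>s. \<phi> (g s)) has_derivative (*) (dphi \<phi> c (snd c (g t)) w)) (at t)"
  by (rule has_derivative_transform_within_open[OF _ w(1,2)]) (use w(3) cA in auto)
 then have "((\<lambda>s. \<phi> (g s)) has_real_derivative dphi \<phi> c (snd c (g t)) w) (at t)"
  by (simp only: has_field_derivative_def)
 moreover have "dphi \<phi> c (snd c (g t)) w <= C * F (velocity A g t)"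
  using C[of t] t c w(6) unfolding slope_le_def by auto
 ultimately show "\<exists>d. ((\<lambda>t. \<phi> (g t)) has_real_derivative d) (at t) \<and> d <= C * F (velocity A g t)" by blast
qed simp_all

lemma slope_lipschitz:
 assumes C: "0 <= C" "!!x. slope_le \<phi> x C" shows "\<phi> y - \<phi> x <= C * d x y"
proof (rule field_le_epsilon)
 fix e :: real assume e: "0 < e"
 define e' where "e' = e / (C + 1)"
 have e': "0 < e'" using e C(1) by (simp add: e'_def)
 then obtain g where g: "piecewise_smooth_curve A g" "g 0 = x" "g 1 = y" "len g 0 1 < d x y + e'"
  using dist_approx[of x y "d x y + e'"] by auto
 have "\<phi> y - \<phi> x <= C * len g 0 1" using curve_slope[OF g(1), of C] C(2) g(2,3) by simp
 also have "\<dots> <= C * (d x y + e')" using g(4) C(1) by (intro mult_left_mono) auto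
 also have "C * e' <= e" using e C(1) by (simp add: e'_def field_simps)
 then have "C * (d x y + e') <= C * d x y + e" by (simp add: distrib_left)
 finally show "\<phi> y - \<phi> x <= C * d x y + e" .
qed

text \<open>Upper semicontinuity of the slope, uniform by compactness of the support and phrased
  along curves, as it is used next. Localisation around the end point brings the starting point into
  the same coordinate ball, on which both the differential and F vary little.\<close>

lemma slope_semicontinuous:
 assumes e: "0 < e"
 obtains \<delta> where "0 < \<delta>" "!!g b K. piecewise_smooth_curve A g ==> 0 <= b ==> b <= 1 ==> len g 0 b < \<delta> ==>
   0 <= K ==> slope_le \<phi> (g 0) K ==> slope_le \<phi> (g b) (K + e)"
proof -
 obtain C where C: "0 <= C" "!!x. slope_le \<phi> x C" by (rule slope_bounded) (rule that)
 have loc: "\<exists>W \<delta>. open W \<and> x0 \<in> W \<and> 0 < \<delta> \<and> (\<forall>g b K. piecewise_smooth_curve A g --> 0 <= b --> b <= 1 --> len g 0 b < \<delta> -->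
   0 <= K --> slope_le \<phi> (g 0) K --> g b \<in> W --> slope_le \<phi> (g b) (K + e))" for x0
 proof -
  obtain c where c: "c \<in> charts_at A x0" using charts_at_nonempty by blast
  then have cA: "c \<in> A" "x0 \<in> fst c" by (auto simp: charts_at_def)
  obtain \<rho>0 r R where \<rho>0: "0 < \<rho>0" "0 < r" "0 < R" "cball (snd c x0) \<rho>0 \<subseteq> snd c ` fst c"
   "!!z y. z \<in> cball (snd c x0) \<rho>0 ==> r * norm y <= Fc c z y"
   "!!z y. z \<in> cball (snd c x0) \<rho>0 ==> Fc c z y <= R * norm y"
   by (rule local_comparison[OF c]) (rule that, assumption+)
  define z0 where "z0 = snd c x0"
  \<comment> \<open>The constants are such that (C + 1) e2 + e1 = e r: the Euclidean error e r |v|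
    is then at most e F(v), because r |v| <= F(v).\<close>
  define e1 where "e1 = e * r / 2"
  define e2 where "e2 = e * r / (2 * (C + 1))"
  have e12: "0 < e1" "0 < e2" using e \<rho>0(2) C(1) by (auto simp: e1_def e2_def)
  have Kc: "compact (cball z0 \<rho>0)" by simp
  have KV: "cball z0 \<rho>0 \<subseteq> snd c ` fst c" using \<rho>0(4) by (simp add: z0_def)
  obtain \<eta>1 where \<eta>1: "0 < \<eta>1" "!!z x v. z \<in> cball z0 \<rho>0 ==> x \<in> cball z0 \<rho>0 ==> dist z x < \<eta>1 ==> \<bar>dphi \<phi> c z v - dphi \<phi> c x v\<bar> <= e1 * norm v"
  proof (rule uniform_homogeneous[OF Kc _ _ e12(1), of "dphi \<phi> c"])
   show "continuous_on (cball z0 \<rho>0 \<times> UNIV) (\<lambda>(z, v). dphi \<phi> c z v)"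
    by (rule continuous_on_subset[OF dphi_continuous[OF test_C1 cA(1)]]) (use KV in auto)
   show "dphi \<phi> c z (k *\<^sub>R v) = k * dphi \<phi> c z v" if "z \<in> cball z0 \<rho>0" "0 <= k" for z k v
    using linear_scale[OF dphi_linear[OF test_C1 cA(1), of z], of k v] KV that by auto
  qed (rule that)
  obtain \<eta>2 where \<eta>2: "0 < \<eta>2" "!!z x v. z \<in> cball z0 \<rho>0 ==> x \<in> cball z0 \<rho>0 ==> dist z x < \<eta>2 ==> \<bar>Fc c z v - Fc c x v\<bar> <= e2 * norm v"
  proof (rule uniform_homogeneous[OF Kc _ _ e12(2), of "Fc c"])
   show "continuous_on (cball z0 \<rho>0 \<times> UNIV) (\<lambda>(z, v). Fc c z v)"
    by (rule continuous_on_subset[OF Fc_continuous[OF cA(1)]]) (use KV in auto)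
   show "Fc c z (k *\<^sub>R v) = k * Fc c z v" if "z \<in> cball z0 \<rho>0" "0 <= k" for z k v
    by (rule Fc_scale[OF cA(1) _ that(2)]) (use KV that in auto)
  qed (rule that)
  define \<rho> where "\<rho> = min \<rho>0 (min \<eta>1 \<eta>2)"
  have \<rho>: "0 < \<rho>" "\<rho> <= \<rho>0" "\<rho> <= \<eta>1" "\<rho> <= \<eta>2" using \<rho>0 \<eta>1 \<eta>2 by (auto simp: \<rho>_def)
  have cb: "cball z0 \<rho> \<subseteq> cball z0 \<rho>0" using \<rho> by auto
  have bs: "ball z0 (\<rho> / 2) \<subseteq> snd c ` fst c" using KV \<rho> by (auto simp: subset_iff)
  define W where "W = chart_inv c ` ball z0 (\<rho> / 2)"
  have "open W" unfolding W_def by (rule open_chart_inv_image[OF cA(1) open_ball bs])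
  moreover have "x0 \<in> W" unfolding W_def z0_def using cA \<rho>(1) by (metis centre_in_ball chart_inv half_gt_zero imageI)
  moreover have "0 < r * \<rho> / 2" using \<rho> \<rho>0 by simp
  moreover have "slope_le \<phi> (g b) (K + e)"
   if pw: "piecewise_smooth_curve A g" and b: "0 <= b" "b <= 1" and small: "len g 0 b < r * \<rho> / 2"
    and K: "0 <= K" "slope_le \<phi> (g 0) K" and bW: "g b \<in> W" for g b K
  proof -
   have bc: "g b \<in> fst c" "snd c (g b) \<in> ball z0 (\<rho> / 2)"
    using bW bs cA chart_inv2[OF cA(1)] unfolding W_def by auto
   have lr: "len g 0 b / r < \<rho> / 2" using small \<rho>0(2) by (simp add: field_simps)
   have "dist (snd c (g b)) z0 < \<rho> / 2" using bc(2) by (simp only: mem_ball dist_commute)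
   with lr have sm: "dist (snd c (g b)) z0 + len g 0 b / r < \<rho>" by linarith
   have cmp: "!!z y. z \<in> cball z0 \<rho> ==> r * norm y <= Fc c z y" using \<rho>0(5) cb unfolding z0_def by blast
   have "(0::real) \<in> {0..b}" using b by simp
   note L = chart_localization[OF cA(1) \<rho>0(2) subset_trans[OF cb KV] cmp pw order_refl b bc(1) sm this]
   define z x where "z = snd c (g b)" and "x = snd c (g 0)"
   have zx: "z \<in> cball z0 \<rho>0" "x \<in> cball z0 \<rho>0" using bc(2) L(3) \<rho> by (auto simp: z_def x_def dist_commute)
   have "dist (snd c (g 0)) (snd c (g b)) < \<rho>" using L(2) lr \<rho>(1) by linarith
   then have dzx: "dist z x < \<rho>" by (simp add: z_def x_def dist_commute)
   have cb': "c \<in> charts_at A (g b)" "c \<in> charts_at A (g 0)" using bc(1) L(1) cA by (auto simp: charts_at_def)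
   \<comment> \<open>The variation of F costs K times e2, so K must be bounded independently of the
     curve; the global slope bound C allows replacing it by the minimum.\<close>
   define K' where "K' = min K C"
   have K': "0 <= K'" "K' <= C" "K' <= K" "slope_le \<phi> (g 0) K'" using K C by (auto simp: K'_def min_def)
   show ?thesis
   proof (rule slope_le_chart[OF test_C1 cb'(1)], fold z_def)
    fix v
    have 1: "dphi \<phi> c z v <= dphi \<phi> c x v + e1 * norm v" using \<eta>1(2)[OF zx, of v] dzx \<rho>(3) by linarith
    have 2: "dphi \<phi> c x v <= K' * Fc c x v" using K'(4) cb'(2) unfolding slope_le_def x_def by blast
    have "Fc c x v <= Fc c z v + e2 * norm v" using \<eta>2(2)[OF zx, of v] dzx \<rho>(4) by linarith
    from mult_left_mono[OF this K'(1)] have 3: "K' * Fc c x v <= K' * Fc c z v + K' * e2 * norm v" by (simp add: distrib_left)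
    have Fz: "r * norm v <= Fc c z v" using \<rho>0(5) zx(1) unfolding z0_def by blast
    have F0: "0 <= Fc c z v" using order_trans[OF _ Fz, of 0] \<rho>0(2) by simp
    have "K' * e2 + e1 <= e * r"
    proof -
     have "K' * e2 <= (C + 1) * e2" using K' e12(2) by (intro mult_right_mono) auto
     also have "(C + 1) * e2 = e * r / 2"
     proof -
      have "C + 1 \<noteq> 0" using C(1) by simp
      then show ?thesis unfolding e2_def by (metis mult.commute nonzero_mult_divide_mult_cancel_left times_divide_eq_right)
     qed
     finally show ?thesis by (simp add: e1_def)
    qed
    then have "(K' * e2 + e1) * norm v <= e * r * norm v" by (rule mult_right_mono) simp
    also have "\<dots> <= e * Fc c z v" using mult_left_mono[OF Fz, of e] e by (simp add: mult.assoc)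
    finally have 4: "K' * e2 * norm v + e1 * norm v <= e * Fc c z v" by (simp add: distrib_right)
    have "K' * Fc c z v <= K * Fc c z v" using K'(3) F0 by (rule mult_right_mono)
    then show "dphi \<phi> c z v <= (K + e) * Fc c z v" using 1 2 3 4 by (simp add: distrib_right)
   qed
  qed
  ultimately show ?thesis by blast
 qed
 then obtain W \<delta> where W: "!!x0. open (W x0)" "!!x0. x0 \<in> W x0" "!!x0. 0 < \<delta> x0"
  and sl: "!!x0 g b K. piecewise_smooth_curve A g ==> 0 <= b ==> b <= 1 ==> len g 0 b < \<delta> x0 ==>
   0 <= K ==> slope_le \<phi> (g 0) K ==> g b \<in> W x0 ==> slope_le \<phi> (g b) (K + e)"
  by metis
 obtain D where D: "D \<subseteq> supp \<phi>" "finite D" "supp \<phi> \<subseteq> (\<Union>x\<in>D. W x)"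
  using compactE_image[OF test_compact, of "supp \<phi>" W] W(1,2) by blast
 define \<delta>0 where "\<delta>0 = Min (insert 1 (\<delta> ` D))"
 have \<delta>0: "0 < \<delta>0" "!!x. x \<in> D ==> \<delta>0 <= \<delta> x" using D(2) W(3) by (auto simp: \<delta>0_def)
 show ?thesis
 proof (rule that[OF \<delta>0(1)])
  fix g b and K :: real
  assume *: "piecewise_smooth_curve A g" "0 <= b" "b <= 1" "len g 0 b < \<delta>0" "0 <= K" "slope_le \<phi> (g 0) K"
  show "slope_le \<phi> (g b) (K + e)"
  proof (cases "g b \<in> supp \<phi>")
   case True
   then obtain y where y: "y \<in> D" "g b \<in> W y" using D(3) by blast
   show ?thesis by (rule sl[OF *(1-3) _ *(5,6) y(2)]) (use *(4) \<delta>0(2)[OF y(1)] in simp)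
  qed (use slope_off_support[OF test_C1] *(5) e in auto)
 qed
qed

text \<open>Every point of a nearly minimising curve from x to y is reached within length \<delta>,
  so the slope along it is at most K + e, and integration gives the bound. The choice of \<delta>
  depends on neither x, y nor K.\<close>

lemma slope_local_lipschitz:
 assumes e: "0 < e"
 obtains \<delta> where "0 < \<delta>" "!!x y K. 0 <= K ==> slope_le \<phi> x K ==> d x y < \<delta> ==> \<phi> y - \<phi> x <= (K + e) * d x y"
proof -
 obtain \<delta> where \<delta>: "0 < \<delta>" "!!g b K. piecewise_smooth_curve A g ==> 0 <= b ==> b <= 1 ==> len g 0 b < \<delta> ==>
   0 <= K ==> slope_le \<phi> (g 0) K ==> slope_le \<phi> (g b) (K + e)"
  by (rule slope_semicontinuous[OF e]) (rule that, assumption+)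
 show ?thesis
 proof (rule that[OF \<delta>(1)])
  fix x y and K :: real assume K: "0 <= K" "slope_le \<phi> x K" and xy: "d x y < \<delta>"
  show "\<phi> y - \<phi> x <= (K + e) * d x y"
  proof (rule field_le_epsilon)
   fix \<eta> :: real assume \<eta>: "0 < \<eta>"
   \<comment> \<open>The first entry keeps the curve shorter than \<delta>, the second makes the
     excess length contribute at most \<eta>.\<close>
   define \<eta>' where "\<eta>' = min (\<delta> - d x y) (\<eta> / (K + e))"
   have \<eta>': "0 < \<eta>'" "\<eta>' <= \<delta> - d x y" "\<eta>' <= \<eta> / (K + e)" using \<eta> xy e K by (auto simp: \<eta>'_def)
   obtain g where g: "piecewise_smooth_curve A g" "g 0 = x" "g 1 = y" "len g 0 1 < d x y + \<eta>'"
    using dist_approx[of x y "d x y + \<eta>'"] \<eta>'(1) by auto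
   have "slope_le \<phi> (g t) (K + e)" if t: "t \<in> {0..1}" for t
   proof (rule \<delta>(2)[OF g(1)])
    have "len g 0 t <= len g 0 1"
     using len_combine[OF g(1), of 0 t 1] len_nonneg[OF g(1), of t 1] t by auto
    then show "len g 0 t < \<delta>" using g(4) \<eta>'(2) by simp
   qed (use t K g(2) in auto)
   from curve_slope[OF g(1) this] have "\<phi> y - \<phi> x <= (K + e) * len g 0 1" using g(2,3) by simp
   also have "\<dots> <= (K + e) * (d x y + \<eta>')" using g(4) K e by (intro mult_left_mono) auto
   also have "(K + e) * \<eta>' <= \<eta>" using mult_left_mono[OF \<eta>'(3), of "K + e"] K e by simp
   then have "(K + e) * (d x y + \<eta>') <= (K + e) * d x y + \<eta>" by (simp add: distrib_left)
   finally show "\<phi> y - \<phi> x <= (K + e) * d x y + \<eta>" .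
  qed
 qed
qed

end

end

section \<open>The Wasserstein distance\<close>

lemma ennreal_powr_less_iff:
 assumes "0 < w" "0 < p"
 shows "ennreal_powr a (1 / p) < ennreal w \<longleftrightarrow> a < ennreal (w powr p)"
proof (cases "a = \<infinity>")
 case False
 then obtain r where r: "a = ennreal r" "0 <= r" by (cases a) auto
 have "r powr (1 / p) < w \<longleftrightarrow> r < w powr p"
 proof
  assume "r powr (1 / p) < w"
  then have "(r powr (1 / p)) powr p < w powr p" using assms by (intro powr_less_mono2) auto
  then show "r < w powr p" using r assms by (simp add: powr_powr)
 next
  assume "r < w powr p"
  then have "r powr (1 / p) < (w powr p) powr (1 / p)" using assms r by (intro powr_less_mono2) auto
  then show "r powr (1 / p) < w" using assms by (simp add: powr_powr)
 qed
 then show ?thesis using r assms by (simp add: ennreal_powr_def ennreal_less_iff)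
qed (simp add: ennreal_powr_def)

lemma couplings_props:
 assumes "\<pi> \<in> couplings \<mu> \<nu>"
 shows "prob_space \<pi>" "sets \<pi> = sets borel"
  "f \<in> borel_measurable borel ==> (\<integral>\<^sup>+ z. f (fst z) \<partial>\<pi>) = (\<integral>\<^sup>+ x. f x \<partial>\<mu>)"
  "f \<in> borel_measurable borel ==> (\<integral>\<^sup>+ z. f (snd z) \<partial>\<pi>) = (\<integral>\<^sup>+ x. f x \<partial>\<nu>)"
proof -
 show 1: "prob_space \<pi>" and 2: "sets \<pi> = sets borel" using assms by (auto simp: couplings_def borel_probs_def)
 have m: "distr \<pi> borel fst = \<mu>" "distr \<pi> borel snd = \<nu>" using assms by (auto simp: couplings_def)
 have f: "fst \<in> measurable \<pi> borel" "snd \<in> measurable \<pi> borel"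
  by (subst measurable_cong_sets[OF 2 refl], intro borel_measurable_continuous_onI continuous_intros)+
 show "(\<integral>\<^sup>+ z. f (fst z) \<partial>\<pi>) = (\<integral>\<^sup>+ x. f x \<partial>\<mu>)" if "f \<in> borel_measurable borel"
  unfolding m(1)[symmetric] by (rule nn_integral_distr[OF f(1), symmetric]) (simp add: that)
 show "(\<integral>\<^sup>+ z. f (snd z) \<partial>\<pi>) = (\<integral>\<^sup>+ x. f x \<partial>\<nu>)" if "f \<in> borel_measurable borel"
  unfolding m(2)[symmetric] by (rule nn_integral_distr[OF f(2), symmetric]) (simp add: that)
qed

text \<open>Discretised gluing. Instead of disintegrating with respect to the middle marginal, the two
 couplings are glued along a countable partition of the middle space, with the product density that is
 constant on pairs of points in the same cell.\<close>

lemma gluing: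
 fixes \<pi>1 :: "('a::second_countable_topology \<times> 'a) measure" and idx :: "'a => nat"
 assumes \<pi>1: "\<pi>1 \<in> couplings \<mu>1 \<mu>2" and \<pi>2: "\<pi>2 \<in> couplings \<mu>2 \<mu>3" and \<mu>2: "prob_space \<mu>2" "sets \<mu>2 = sets borel"
  and idx[measurable]: "idx \<in> borel \<rightarrow>\<^sub>M count_space UNIV"
 obtains \<Gamma> :: "(('a \<times> 'a) \<times> ('a \<times> 'a)) measure" where "sets \<Gamma> = sets (borel \<Otimes>\<^sub>M borel)"
  "!!f. f \<in> borel_measurable borel ==> (\<integral>\<^sup>+ w. f (fst w) \<partial>\<Gamma>) = (\<integral>\<^sup>+ z. f z \<partial>\<pi>1)"
  "!!f. f \<in> borel_measurable borel ==> (\<integral>\<^sup>+ w. f (snd w) \<partial>\<Gamma>) = (\<integral>\<^sup>+ z. f z \<partial>\<pi>2)"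
  "AE w in \<Gamma>. idx (snd (fst w)) = idx (fst (snd w))"
proof -
 interpret p1: prob_space \<pi>1 by (rule couplings_props[OF \<pi>1])
 interpret p2: prob_space \<pi>2 by (rule couplings_props[OF \<pi>2])
 interpret P: pair_sigma_finite \<pi>1 \<pi>2 ..
 have s1: "sets \<pi>1 = sets (borel \<Otimes>\<^sub>M borel)" and s2: "sets \<pi>2 = sets (borel \<Otimes>\<^sub>M borel)"
  unfolding borel_prod by (rule couplings_props(2)[OF \<pi>1] couplings_props(2)[OF \<pi>2])+
 note [measurable_cong] = s1 s2
 \<comment> \<open>Normalises each cell: integrating the density over either factor gives the cell
   mass times its inverse. On a null cell the inverse is infinite, but almost surely neither middle
   coordinate lies in one.\<close>
 define c where "c k = inverse (emeasure \<mu>2 (idx -` {k}))" for k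
 define h where "h w = (if idx (snd (fst w)) = idx (fst (snd w)) then c (idx (snd (fst w))) else 0)"
  for w :: "('a \<times> 'a) \<times> ('a \<times> 'a)"
 have i1[measurable]: "(\<lambda>w. idx (snd (fst w))) \<in> \<pi>1 \<Otimes>\<^sub>M \<pi>2 \<rightarrow>\<^sub>M count_space UNIV" by measurable
 have i2[measurable]: "(\<lambda>w. idx (fst (snd w))) \<in> \<pi>1 \<Otimes>\<^sub>M \<pi>2 \<rightarrow>\<^sub>M count_space UNIV" by measurable
 have ci[measurable]: "(\<lambda>w. c (idx (snd (fst w)))) \<in> borel_measurable (\<pi>1 \<Otimes>\<^sub>M \<pi>2)"
  by (rule measurable_compose[OF i1]) simp
 have [measurable]: "(\<lambda>w. real (idx (snd (fst w)))) \<in> borel_measurable (\<pi>1 \<Otimes>\<^sub>M \<pi>2)"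
  "(\<lambda>w. real (idx (fst (snd w)))) \<in> borel_measurable (\<pi>1 \<Otimes>\<^sub>M \<pi>2)"
  by (rule measurable_compose[OF i1], simp, rule measurable_compose[OF i2], simp)
 have "{w \<in> space (\<pi>1 \<Otimes>\<^sub>M \<pi>2). real (idx (snd (fst w))) = real (idx (fst (snd w)))} \<in> sets (\<pi>1 \<Otimes>\<^sub>M \<pi>2)"
  by measurable
 then have hm[measurable]: "h \<in> borel_measurable (\<pi>1 \<Otimes>\<^sub>M \<pi>2)"
  unfolding h_def by (intro measurable_If ci) simp_all
 define \<Gamma> where "\<Gamma> = density (\<pi>1 \<Otimes>\<^sub>M \<pi>2) h"
 have cell: "idx -` {k} \<in> sets borel" for k
  using measurable_sets[OF idx, of "{k}"] by simp
 have int2: "(\<integral>\<^sup>+ z'. h (z, z') \<partial>\<pi>2) = c (idx (snd z)) * emeasure \<mu>2 (idx -` {idx (snd z)})" for z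
 proof -
  have "(\<integral>\<^sup>+ z'. h (z, z') \<partial>\<pi>2) = (\<integral>\<^sup>+ z'. c (idx (snd z)) * indicator (idx -` {idx (snd z)}) (fst z') \<partial>\<pi>2)"
   by (intro nn_integral_cong) (auto simp: h_def indicator_def)
  also have "\<dots> = (\<integral>\<^sup>+ y. c (idx (snd z)) * indicator (idx -` {idx (snd z)}) y \<partial>\<mu>2)"
   by (rule couplings_props(3)[OF \<pi>2]) (use cell in measurable)
  also have "\<dots> = c (idx (snd z)) * emeasure \<mu>2 (idx -` {idx (snd z)})"
   using cell \<mu>2(2) by (subst nn_integral_cmult_indicator) auto
  finally show ?thesis .
 qed
 have int1: "(\<integral>\<^sup>+ z. h (z, z') \<partial>\<pi>1) = c (idx (fst z')) * emeasure \<mu>2 (idx -` {idx (fst z')})" for z'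
 proof -
  have "(\<integral>\<^sup>+ z. h (z, z') \<partial>\<pi>1) = (\<integral>\<^sup>+ z. c (idx (fst z')) * indicator (idx -` {idx (fst z')}) (snd z) \<partial>\<pi>1)"
   by (intro nn_integral_cong) (auto simp: h_def indicator_def)
  also have "\<dots> = (\<integral>\<^sup>+ y. c (idx (fst z')) * indicator (idx -` {idx (fst z')}) y \<partial>\<mu>2)"
   by (rule couplings_props(4)[OF \<pi>1]) (use cell in measurable)
  also have "\<dots> = c (idx (fst z')) * emeasure \<mu>2 (idx -` {idx (fst z')})"
   using cell \<mu>2(2) by (subst nn_integral_cmult_indicator) auto
  finally show ?thesis .
 qed
 have fin2: "emeasure \<mu>2 B \<noteq> \<top>" for B
  using finite_measure.emeasure_finite[OF prob_space.finite_measure[OF \<mu>2(1)]] by simp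
 have one: "c k * emeasure \<mu>2 (idx -` {k}) = 1" if "emeasure \<mu>2 (idx -` {k}) \<noteq> 0" for k
  using that fin2[of "idx -` {k}"] ennreal_divide_self[of "emeasure \<mu>2 (idx -` {k})"]
  by (simp add: c_def divide_ennreal_def mult.commute top.not_eq_extremum)
 have null: "AE y in \<mu>2. emeasure \<mu>2 (idx -` {idx y}) \<noteq> 0"
 proof -
  have "AE y in \<mu>2. \<forall>k. emeasure \<mu>2 (idx -` {k}) = 0 --> y \<notin> idx -` {k}"
   unfolding AE_all_countable
  proof
   fix k
   show "AE y in \<mu>2. emeasure \<mu>2 (idx -` {k}) = 0 --> y \<notin> idx -` {k}"
    using AE_not_in[of "idx -` {k}" \<mu>2] cell[of k] \<mu>2(2) by (cases "emeasure \<mu>2 (idx -` {k}) = 0") (auto simp: null_sets_def)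
  qed
  then show ?thesis by eventually_elim auto
 qed
 have pred: "{y. emeasure \<mu>2 (idx -` {idx y}) \<noteq> 0} \<in> sets borel"
 proof -
  have "(\<lambda>y. emeasure \<mu>2 (idx -` {idx y})) \<in> borel_measurable borel"
   by (rule measurable_compose[OF idx]) simp
  then show ?thesis by measurable
 qed
 have null1: "AE z in \<pi>1. emeasure \<mu>2 (idx -` {idx (snd z)}) \<noteq> 0"
 proof -
  have e: "distr \<pi>1 borel snd = \<mu>2" using \<pi>1 by (simp add: couplings_def)
  have m: "snd \<in> \<pi>1 \<rightarrow>\<^sub>M borel" by measurable
  have "AE y in distr \<pi>1 borel snd. emeasure \<mu>2 (idx -` {idx y}) \<noteq> 0" unfolding e by (rule null)
  then show ?thesis by (subst (asm) AE_distr_iff[OF m]) (use pred in auto)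
 qed
 have null2: "AE z in \<pi>2. emeasure \<mu>2 (idx -` {idx (fst z)}) \<noteq> 0"
 proof -
  have e: "distr \<pi>2 borel fst = \<mu>2" using \<pi>2 by (simp add: couplings_def)
  have m: "fst \<in> \<pi>2 \<rightarrow>\<^sub>M borel" by measurable
  have "AE y in distr \<pi>2 borel fst. emeasure \<mu>2 (idx -` {idx y}) \<noteq> 0" unfolding e by (rule null)
  then show ?thesis by (subst (asm) AE_distr_iff[OF m]) (use pred in auto)
 qed
 show ?thesis
 proof (rule that[of \<Gamma>])
  show "sets \<Gamma> = sets (borel \<Otimes>\<^sub>M borel)"
   using sets_pair_measure_cong[OF s1 s2] unfolding \<Gamma>_def sets_density borel_prod .
  show "(\<integral>\<^sup>+ w. f (fst w) \<partial>\<Gamma>) = (\<integral>\<^sup>+ z. f z \<partial>\<pi>1)" if f: "f \<in> borel_measurable borel" for f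
  proof -
   have f'[measurable]: "f \<in> borel_measurable (borel \<Otimes>\<^sub>M borel)" using f by (simp add: borel_prod)
   have "(\<integral>\<^sup>+ w. f (fst w) \<partial>\<Gamma>) = (\<integral>\<^sup>+ w. h w * f (fst w) \<partial>(\<pi>1 \<Otimes>\<^sub>M \<pi>2))"
    unfolding \<Gamma>_def by (rule nn_integral_density) measurable
   also have "\<dots> = (\<integral>\<^sup>+ z. \<integral>\<^sup>+ z'. h (z, z') * f z \<partial>\<pi>2 \<partial>\<pi>1)"
    by (subst p2.nn_integral_fst[symmetric]) auto
   also have "\<dots> = (\<integral>\<^sup>+ z. (\<integral>\<^sup>+ z'. h (z, z') \<partial>\<pi>2) * f z \<partial>\<pi>1)"
    by (intro nn_integral_cong nn_integral_multc measurable_compose[OF measurable_Pair1' hm]) auto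
   also have "\<dots> = (\<integral>\<^sup>+ z. f z \<partial>\<pi>1)"
    by (rule nn_integral_cong_AE) (use null1 in eventually_elim, simp add: int2 one)
   finally show ?thesis .
  qed
  show "(\<integral>\<^sup>+ w. f (snd w) \<partial>\<Gamma>) = (\<integral>\<^sup>+ z. f z \<partial>\<pi>2)" if f: "f \<in> borel_measurable borel" for f
  proof -
   have f'[measurable]: "f \<in> borel_measurable (borel \<Otimes>\<^sub>M borel)" using f by (simp add: borel_prod)
   have "(\<integral>\<^sup>+ w. f (snd w) \<partial>\<Gamma>) = (\<integral>\<^sup>+ w. h w * f (snd w) \<partial>(\<pi>1 \<Otimes>\<^sub>M \<pi>2))"
    unfolding \<Gamma>_def by (rule nn_integral_density) measurable
   also have "\<dots> = (\<integral>\<^sup>+ z'. \<integral>\<^sup>+ z. h (z, z') * f z' \<partial>\<pi>1 \<partial>\<pi>2)"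
    by (subst P.nn_integral_snd[symmetric]) auto
   also have "\<dots> = (\<integral>\<^sup>+ z'. (\<integral>\<^sup>+ z. h (z, z') \<partial>\<pi>1) * f z' \<partial>\<pi>2)"
    by (intro nn_integral_cong nn_integral_multc measurable_compose[OF measurable_Pair2' hm]) auto
   also have "\<dots> = (\<integral>\<^sup>+ z. f z \<partial>\<pi>2)"
    by (rule nn_integral_cong_AE) (use null2 in eventually_elim, simp add: int1 one)
   finally show ?thesis .
  qed
  show "AE w in \<Gamma>. idx (snd (fst w)) = idx (fst (snd w))"
   unfolding \<Gamma>_def by (subst AE_density[OF hm]) (auto simp: h_def split: if_splits)
 qed
qed

section \<open>Triangle inequality of the Wasserstein distance and the coupling estimate\<close>

context finsler
begin

lemma d_borel[measurable]: "(\<lambda>z. d (fst z) (snd z)) \<in> borel_measurable borel"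
 by (rule borel_measurable_continuous_onI[OF dist_continuous])

text \<open>The Lindelof property yields countably many sets on which the distance is below e in
  both orders; the first set containing a point is its label.\<close>

lemma small_partition:
 assumes e: "0 < e"
 obtains idx :: "'a => nat" where "idx \<in> borel \<rightarrow>\<^sub>M count_space UNIV" "!!x y. idx x = idx y ==> d x y < e"
proof -
 obtain W where W: "!!x0. open (W x0)" "!!x0. x0 \<in> W x0" "!!x0 x y. x \<in> W x0 ==> y \<in> W x0 ==> d x y < e"
 proof -
  have "\<exists>N. open N \<and> x0 \<in> N \<and> (\<forall>x\<in>N. \<forall>y\<in>N. d x y < e)" for x0
   by (rule small_neighbourhood[OF e, of x0]) blast
  then show ?thesis using that by metis
 qed
 obtain F' where F': "F' \<subseteq> range W" "countable F'" "\<Union>F' = \<Union>(range W)"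
  using Lindelof[of "range W"] W(1) by (metis rangeE)
 have U: "\<Union>F' = UNIV" using F'(3) W(2) by blast
 then have "F' \<noteq> {}" by auto
 then obtain V :: "nat => 'a set" where V: "range V = F'" using F'(2) by (metis uncountable_def)
 have ex: "\<exists>k. x \<in> V k" for x using U V by blast
 define idx where "idx x = (LEAST k :: nat. x \<in> V k)" for x
 have Vo[measurable]: "V k \<in> sets borel" for k using V F'(1) W(1) by (metis borel_open rangeE rangeI subsetD)
 show ?thesis
 proof (rule that[of idx])
  show "idx \<in> borel \<rightarrow>\<^sub>M count_space UNIV" unfolding idx_def by measurable
  fix x y assume eq: "idx x = idx y"
  have x: "x \<in> V (idx x)" and y: "y \<in> V (idx y)" unfolding idx_def using ex by (auto intro: LeastI_ex)
  obtain x0 where "V (idx x) = W x0" using V F'(1) by (metis rangeE rangeI subsetD)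
  then show "d x y < e" using W(3) x y eq by metis
 qed
qed

abbreviation W :: "real => 'a measure => 'a measure => ennreal" where "W \<equiv> wasserstein A F"

text \<open>A strict bound trades the infimum for one coupling with an explicit cost; all later
  arguments use such nearly optimal couplings.\<close>

lemma W_less_iff:
 assumes "0 < w" "0 < p"
 shows "W p \<mu> \<nu> < ennreal w \<longleftrightarrow> (\<exists>\<pi>\<in>couplings \<mu> \<nu>. (\<integral>\<^sup>+ z. ennreal (d (fst z) (snd z) powr p) \<partial>\<pi>) < ennreal (w powr p))"
 unfolding wasserstein_def INF_less_iff ennreal_powr_less_iff[OF assms] by (simp add: case_prod_beta')

lemma W_le_of_coupling:
 assumes p: "0 < p" and w: "0 <= w" and \<pi>: "\<pi> \<in> couplings \<mu> \<nu>"
  and le: "(\<integral>\<^sup>+ z. ennreal (d (fst z) (snd z) powr p) \<partial>\<pi>) <= ennreal (w powr p)"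
 shows "W p \<mu> \<nu> <= ennreal w"
proof (rule ennreal_le_epsilon)
 fix e :: real assume e: "0 < e"
 have "w powr p < (w + e) powr p" using p w e by (intro powr_less_mono2) auto
 then have "ennreal (w powr p) < ennreal ((w + e) powr p)" by (simp add: ennreal_less_iff)
 then have "W p \<mu> \<nu> < ennreal (w + e)"
  using W_less_iff[of "w + e" p \<mu> \<nu>] p w e \<pi> le by (auto intro: le_less_trans)
 then show "W p \<mu> \<nu> <= ennreal w + ennreal e" using w e by (simp add: ennreal_plus[symmetric] less_imp_le del: ennreal_plus)
qed

text \<open>Gluing leaves an error of at most e between the two middle points. The Minkowski
  inequality is applied once to absorb this constant into the first cost and once more to add the
  second cost.\<close>

lemma W_triangle_real:
 assumes p: "1 <= p" and \<mu>: "\<mu>2 \<in> borel_probs"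
  and 1: "W p \<mu>1 \<mu>2 < ennreal a" and 2: "W p \<mu>2 \<mu>3 < ennreal b" and ab: "0 < a" "0 < b" and e: "0 < e"
 shows "W p \<mu>1 \<mu>3 <= ennreal (a + e + b)"
proof -
 have p0: "0 < p" using p by simp
 obtain \<pi>1 where \<pi>1: "\<pi>1 \<in> couplings \<mu>1 \<mu>2" "(\<integral>\<^sup>+ z. ennreal (d (fst z) (snd z) powr p) \<partial>\<pi>1) < ennreal (a powr p)"
  using 1 W_less_iff[OF ab(1) p0] by blast
 obtain \<pi>2 where \<pi>2: "\<pi>2 \<in> couplings \<mu>2 \<mu>3" "(\<integral>\<^sup>+ z. ennreal (d (fst z) (snd z) powr p) \<partial>\<pi>2) < ennreal (b powr p)"
  using 2 W_less_iff[OF ab(2) p0] by blast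
 obtain idx :: "'a => nat" where idx: "idx \<in> borel \<rightarrow>\<^sub>M count_space UNIV" "!!x y. idx x = idx y ==> d x y < e"
  by (rule small_partition[OF e]) (rule that)
 have \<mu>2: "prob_space \<mu>2" "sets \<mu>2 = sets borel" using \<mu> by (auto simp: borel_probs_def)
 obtain \<Gamma> where \<Gamma>: "sets \<Gamma> = sets (borel \<Otimes>\<^sub>M borel)"
  "!!f. f \<in> borel_measurable borel ==> (\<integral>\<^sup>+ w. f (fst w) \<partial>\<Gamma>) = (\<integral>\<^sup>+ z. f z \<partial>\<pi>1)"
  "!!f. f \<in> borel_measurable borel ==> (\<integral>\<^sup>+ w. f (snd w) \<partial>\<Gamma>) = (\<integral>\<^sup>+ z. f z \<partial>\<pi>2)"
  "AE w in \<Gamma>. idx (snd (fst w)) = idx (fst (snd w))"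
  by (rule gluing[OF \<pi>1(1) \<pi>2(1) \<mu>2 idx(1)]) (rule that, assumption+)
 note [measurable_cong] = \<Gamma>(1)
 have G1: "emeasure \<Gamma> (space \<Gamma>) = 1"
  using \<Gamma>(2)[of "\<lambda>_. 1"] prob_space.emeasure_space_1[OF couplings_props(1)[OF \<pi>1(1)]] by simp
 interpret G: prob_space \<Gamma> by (rule prob_spaceI[OF G1])
 have bp: "borel \<Otimes>\<^sub>M borel = (borel :: ('a \<times> 'a) measure)" by (rule borel_prod)
 have mm: "(\<lambda>w. (fst (fst w), snd (snd w))) \<in> measurable \<Gamma> (borel :: ('a \<times> 'a) measure)"
  unfolding measurable_cong_sets[OF \<Gamma>(1) refl] bp[symmetric] by measurable
 define \<pi> where "\<pi> = distr \<Gamma> (borel :: ('a \<times> 'a) measure) (\<lambda>w. (fst (fst w), snd (snd w)))"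
 have fs: "fst \<in> measurable (borel :: ('a \<times> 'a) measure) borel" "snd \<in> measurable (borel :: ('a \<times> 'a) measure) borel"
  unfolding bp[symmetric] by measurable
 have \<mu>13: "distr \<pi>1 borel fst = \<mu>1" "distr \<pi>2 borel snd = \<mu>3" using \<pi>1(1) \<pi>2(1) by (auto simp: couplings_def)
 have s1: "sets \<mu>1 = sets borel" "sets \<mu>3 = sets borel" using \<mu>13 sets_distr by metis+
 have \<pi>c: "\<pi> \<in> couplings \<mu>1 \<mu>3"
  unfolding couplings_def borel_probs_def mem_Collect_eq
 proof (intro conjI)
  show "prob_space \<pi>" unfolding \<pi>_def by (rule G.prob_space_distr[OF mm])
  show "sets \<pi> = sets borel" by (simp add: \<pi>_def)
  show "distr \<pi> borel fst = \<mu>1"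
  proof (rule measure_eqI)
   fix B assume "B \<in> sets (distr \<pi> borel fst)"
   then have B[measurable]: "B \<in> sets borel" by simp
   have "emeasure (distr \<pi> borel fst) B = (\<integral>\<^sup>+ z. indicator B (fst z) \<partial>\<pi>)"
    using nn_integral_distr[of fst \<pi> borel "indicator B"] fs(1) by (simp add: \<pi>_def)
   also have "\<dots> = (\<integral>\<^sup>+ w. indicator B (fst (fst w)) \<partial>\<Gamma>)"
    unfolding \<pi>_def by (subst nn_integral_distr[OF mm]) (use measurable_compose[OF fs(1), of "indicator B" borel] in auto)
   also have "\<dots> = (\<integral>\<^sup>+ z. indicator B (fst z) \<partial>\<pi>1)"
    by (rule \<Gamma>(2)) (rule measurable_compose[OF fs(1)], simp)
   also have "\<dots> = (\<integral>\<^sup>+ x. indicator B x \<partial>\<mu>1)" by (rule couplings_props(3)[OF \<pi>1(1)]) simp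
   also have "\<dots> = emeasure \<mu>1 B" using s1 by simp
   finally show "emeasure (distr \<pi> borel fst) B = emeasure \<mu>1 B" .
  qed (use s1 in simp)
  show "distr \<pi> borel snd = \<mu>3"
  proof (rule measure_eqI)
   fix B assume "B \<in> sets (distr \<pi> borel snd)"
   then have B[measurable]: "B \<in> sets borel" by simp
   have "emeasure (distr \<pi> borel snd) B = (\<integral>\<^sup>+ z. indicator B (snd z) \<partial>\<pi>)"
    using nn_integral_distr[of snd \<pi> borel "indicator B"] fs(2) by (simp add: \<pi>_def)
   also have "\<dots> = (\<integral>\<^sup>+ w. indicator B (snd (snd w)) \<partial>\<Gamma>)"
    unfolding \<pi>_def by (subst nn_integral_distr[OF mm]) (use measurable_compose[OF fs(2), of "indicator B" borel] in auto)
   also have "\<dots> = (\<integral>\<^sup>+ z. indicator B (snd z) \<partial>\<pi>2)"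
    by (rule \<Gamma>(3)) (rule measurable_compose[OF fs(2)], simp)
   also have "\<dots> = (\<integral>\<^sup>+ x. indicator B x \<partial>\<mu>3)" by (rule couplings_props(4)[OF \<pi>2(1)]) simp
   also have "\<dots> = emeasure \<mu>3 B" using s1 by simp
   finally show "emeasure (distr \<pi> borel snd) B = emeasure \<mu>3 B" .
  qed (use s1 in simp)
 qed
 have dm: "(\<lambda>z. d (fst z) (snd z)) \<in> borel_measurable (borel \<Otimes>\<^sub>M borel :: ('a \<times> 'a) measure)"
  using d_borel by (simp add: bp)
 have m1[measurable]: "(\<lambda>w. d (fst (fst w)) (snd (fst w))) \<in> borel_measurable \<Gamma>"
  using measurable_compose[OF measurable_fst d_borel] by (simp add: measurable_cong_sets[OF \<Gamma>(1) refl])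
 have m2[measurable]: "(\<lambda>w. d (fst (snd w)) (snd (snd w))) \<in> borel_measurable \<Gamma>"
  using measurable_compose[OF measurable_snd d_borel] by (simp add: measurable_cong_sets[OF \<Gamma>(1) refl])
 have "(\<integral>\<^sup>+ z. ennreal (d (fst z) (snd z) powr p) \<partial>\<pi>) = (\<integral>\<^sup>+ w. ennreal (d (fst (fst w)) (snd (snd w)) powr p) \<partial>\<Gamma>)"
  unfolding \<pi>_def by (subst nn_integral_distr[OF mm]) auto
 \<comment> \<open>Almost surely the two middle points share a cell, so the step between them costs
   less than e.\<close>
 also have "\<dots> <= (\<integral>\<^sup>+ w. ennreal (((d (fst (fst w)) (snd (fst w)) + e) + d (fst (snd w)) (snd (snd w))) powr p) \<partial>\<Gamma>)"
 proof (rule nn_integral_mono_AE, use \<Gamma>(4) in eventually_elim)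
  fix w :: "('a \<times> 'a) \<times> ('a \<times> 'a)" assume "idx (snd (fst w)) = idx (fst (snd w))"
  then have "d (snd (fst w)) (fst (snd w)) < e" by (rule idx(2))
  moreover have "d (fst (fst w)) (snd (snd w)) <= d (fst (fst w)) (snd (fst w)) + (d (snd (fst w)) (fst (snd w)) + d (fst (snd w)) (snd (snd w)))"
   by (rule order_trans[OF dist_triangle_ineq add_left_mono[OF dist_triangle_ineq]])
  ultimately show "ennreal (d (fst (fst w)) (snd (snd w)) powr p) <= ennreal (((d (fst (fst w)) (snd (fst w)) + e) + d (fst (snd w)) (snd (snd w))) powr p)"
   using p0 by (intro ennreal_leI powr_mono2) (auto simp: dist_nonneg)
 qed
 also have "\<dots> <= ennreal ((a + e + b) powr p)"
 proof (rule nn_integral_Minkowski)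
  show "(\<integral>\<^sup>+ w. ennreal ((d (fst (fst w)) (snd (fst w)) + e) powr p) \<partial>\<Gamma>) <= ennreal ((a + e) powr p)"
  proof (rule nn_integral_Minkowski)
   have "(\<integral>\<^sup>+ w. ennreal (d (fst (fst w)) (snd (fst w)) powr p) \<partial>\<Gamma>) = (\<integral>\<^sup>+ z. ennreal (d (fst z) (snd z) powr p) \<partial>\<pi>1)"
    by (rule \<Gamma>(2)) measurable
   then show "(\<integral>\<^sup>+ w. ennreal (d (fst (fst w)) (snd (fst w)) powr p) \<partial>\<Gamma>) <= ennreal (a powr p)" using \<pi>1(2) by simp
  qed (use ab e p in \<open>auto simp: dist_nonneg G1\<close>)
  have "(\<integral>\<^sup>+ w. ennreal (d (fst (snd w)) (snd (snd w)) powr p) \<partial>\<Gamma>) = (\<integral>\<^sup>+ z. ennreal (d (fst z) (snd z) powr p) \<partial>\<pi>2)"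
   by (rule \<Gamma>(3)) measurable
  then show "(\<integral>\<^sup>+ w. ennreal (d (fst (snd w)) (snd (snd w)) powr p) \<partial>\<Gamma>) <= ennreal (b powr p)" using \<pi>2(2) by simp
 qed (use ab e p in \<open>auto simp: dist_nonneg\<close>)
 finally show ?thesis using ab e p0 by (intro W_le_of_coupling[OF _ _ \<pi>c]) auto
qed

lemma W_triangle:
 assumes p: "1 <= p" and \<mu>: "\<mu>2 \<in> borel_probs"
 shows "W p \<mu>1 \<mu>3 <= W p \<mu>1 \<mu>2 + W p \<mu>2 \<mu>3"
proof (cases "W p \<mu>1 \<mu>2 = \<top> \<or> W p \<mu>2 \<mu>3 = \<top>")
 case False
 then obtain a b where ab: "W p \<mu>1 \<mu>2 = ennreal a" "0 <= a" "W p \<mu>2 \<mu>3 = ennreal b" "0 <= b"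
  by (metis ennreal_cases)
 show ?thesis
 proof (rule ennreal_le_epsilon)
  fix e :: real assume e: "0 < e"
  have "W p \<mu>1 \<mu>3 <= ennreal ((a + e / 3) + e / 3 + (b + e / 3))"
   by (rule W_triangle_real[OF p \<mu>]) (use ab e in \<open>auto simp: ennreal_less_iff\<close>)
  also have "\<dots> = W p \<mu>1 \<mu>2 + W p \<mu>2 \<mu>3 + ennreal e"
   using ab e by (simp add: ennreal_plus[symmetric] del: ennreal_plus)
  finally show "W p \<mu>1 \<mu>3 <= W p \<mu>1 \<mu>2 + W p \<mu>2 \<mu>3 + ennreal e" .
 qed
qed auto

lemma lipschitz_continuous:
 assumes "0 <= L" "!!x y. u y - u x <= L * d x y" shows "continuous_on UNIV (u :: 'a => real)"
proof (rule continuous_at_imp_continuous_on, rule ballI)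
 fix x0
 show "continuous (at x0) u"
  unfolding continuous_at
 proof (rule tendstoI)
  fix e :: real assume e: "0 < e"
  then have e': "0 < e / (L + 1)" using assms(1) by simp
  obtain N where N: "open N" "x0 \<in> N" "!!x y. x \<in> N ==> y \<in> N ==> d x y < e / (L + 1)"
   by (rule small_neighbourhood[OF e', of x0]) (rule that, assumption+)
  have "\<forall>\<^sub>F x in at x0. x \<in> N" by (rule topological_tendstoD[OF tendsto_ident_at N(1,2)])
  then show "\<forall>\<^sub>F x in at x0. dist (u x) (u x0) < e"
  proof eventually_elim
   case (elim x)
   have small: "L * d y z < e" if "y \<in> N" "z \<in> N" for y z
   proof -
    have "L * d y z <= (L + 1) * d y z" using dist_nonneg[of y z] by (simp add: distrib_right)
    also have "\<dots> < e" using N(3)[OF that] assms(1) by (simp add: field_simps)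
    finally show ?thesis .
   qed
   show ?case using assms(2)[of x x0] assms(2)[of x0 x] small[of x x0] small[of x0 x] elim N(2)
    by (simp add: dist_real_def)
  qed
 qed
qed

text \<open>The estimate behind the upper bound of the derivative of \<open>t \<mapsto> \<integral>\<phi> d\<mu>\<^sub>t\<close>: a difference of integrals is
 split along a coupling into short displacements, controlled by the local slope, and long ones, controlled by
 the Markov inequality.\<close>

lemma coupling_estimate:
 fixes u g :: "'a => real"
 assumes pq: "1 < p" "1 < q" "1 / p + 1 / q = 1"
  and \<mu>: "\<mu> \<in> borel_probs" and \<nu>: "\<nu> \<in> borel_probs" and w: "0 < w" "W p \<mu> \<nu> < ennreal w"
  and um[measurable]: "u \<in> borel_measurable borel" and ub: "!!x. \<bar>u x\<bar> <= B"
  and gm[measurable]: "g \<in> borel_measurable borel" and g: "!!x. 0 <= g x" "!!x. g x <= C"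
  and e: "0 < e" and \<delta>: "0 < \<delta>" and C: "0 < C"
  and short: "!!x y. d x y < \<delta> ==> u y - u x <= (g x + e) * d x y"
  and long: "!!x y. u y - u x <= C * d x y"
 shows "(LINT x|\<nu>. u x) - (LINT x|\<mu>. u x) <= w * (Lnorm q \<mu> g + 2 * e + C * (w / \<delta>) powr (p / q))"
proof -
 have p0: "0 < p" and q0: "0 < q" using pq by auto
 obtain \<pi> where \<pi>: "\<pi> \<in> couplings \<mu> \<nu>" "(\<integral>\<^sup>+ z. ennreal (d (fst z) (snd z) powr p) \<partial>\<pi>) < ennreal (w powr p)"
  using w W_less_iff[OF w(1) p0] by blast
 interpret P: prob_space \<pi> by (rule couplings_props[OF \<pi>(1)])
 interpret M: prob_space \<mu> using \<mu> by (simp add: borel_probs_def)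
 note [measurable_cong] = couplings_props(2)[OF \<pi>(1)]
 have fs[measurable]: "fst \<in> measurable (borel :: ('a \<times> 'a) measure) borel" "snd \<in> measurable (borel :: ('a \<times> 'a) measure) borel"
  unfolding borel_prod[symmetric] by measurable
 have uf[measurable]: "(\<lambda>z. u (fst z)) \<in> borel_measurable (borel :: ('a \<times> 'a) measure)" "(\<lambda>z. u (snd z)) \<in> borel_measurable (borel :: ('a \<times> 'a) measure)"
  "(\<lambda>z. g (fst z)) \<in> borel_measurable (borel :: ('a \<times> 'a) measure)"
  using measurable_compose[OF fs(1) um] measurable_compose[OF fs(2) um] measurable_compose[OF fs(1) gm] by auto
 have m\<mu>: "(LINT z|\<pi>. u (fst z)) = (LINT x|\<mu>. u x)"
  using integral_distr[of fst \<pi> borel u] \<pi>(1) by (simp add: couplings_def)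
 have m\<nu>: "(LINT z|\<pi>. u (snd z)) = (LINT x|\<nu>. u x)"
  using integral_distr[of snd \<pi> borel u] \<pi>(1) by (simp add: couplings_def)
 have i1: "integrable \<pi> (\<lambda>z. u (fst z))" "integrable \<pi> (\<lambda>z. u (snd z))"
  by (rule P.integrable_const_bound[where B=B]; use ub in auto)+
 \<comment> \<open>One effective slope for all displacements; apart from the indicator it depends
   only on the starting point, whose law is \<mu>.\<close>
 define H where "H z = (g (fst z) + e) + C * indicator {z. \<delta> <= d (fst z) (snd z)} z" for z :: "'a \<times> 'a"
 have Hset[measurable]: "{z :: 'a \<times> 'a. \<delta> <= d (fst z) (snd z)} \<in> sets borel" by measurable
 have H0: "0 <= H z" for z using g e C by (auto simp: H_def indicator_def)
 define n where "n = Lnorm q \<mu> g"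
 have n0: "0 <= n" by (simp add: n_def Lnorm_def)
 \<comment> \<open>One e is the slack in the short-range slope, the other makes the bound n + e on
   the norm of \<open>g\<close> positive, as the Minkowski inequality asks.\<close>
 define b where "b = n + 2 * e + C * (w / \<delta>) powr (p / q)"
 have wd: "0 < (w / \<delta>) powr (p / q)" using w \<delta> by simp
 have b0: "0 < b" using n0 e C wd by (simp add: b_def add_pos_pos add_nonneg_pos)
 have le: "u (snd z) - u (fst z) <= d (fst z) (snd z) * H z" for z
 proof (cases "d (fst z) (snd z) < \<delta>")
  case True
  then show ?thesis using short[OF True] by (simp add: H_def mult.commute)
 next
  case False
  have "u (snd z) - u (fst z) <= C * d (fst z) (snd z)" by (rule long)
  also have "\<dots> <= d (fst z) (snd z) * H z"
   using False g(1)[of "fst z"] e dist_nonneg[of "fst z" "snd z"]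
   by (simp add: H_def distrib_left mult.commute)
  finally show ?thesis .
 qed
 have gq: "(\<integral>\<^sup>+ z. ennreal (g (fst z) powr q) \<partial>\<pi>) <= ennreal ((n + e) powr q)"
 proof -
  have "(\<integral>\<^sup>+ z. ennreal (g (fst z) powr q) \<partial>\<pi>) = (\<integral>\<^sup>+ x. ennreal (g x powr q) \<partial>\<mu>)"
   by (rule couplings_props(3)[OF \<pi>(1)]) measurable
  also have "\<dots> = ennreal (LINT x|\<mu>. g x powr q)"
  proof (rule nn_integral_eq_integral)
   have "g \<in> borel_measurable \<mu>" using gm \<mu> by (subst measurable_cong_sets[of \<mu> borel]) (auto simp: borel_probs_def)
   then show "integrable \<mu> (\<lambda>x. g x powr q)"
    using integrable_bounded_powr[OF M.prob_space_axioms, of q g C] pq g by simp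
  qed simp
  also have "(LINT x|\<mu>. g x powr q) = n powr q"
   using q0 by (simp add: n_def Lnorm_def powr_powr)
  also have "ennreal (n powr q) <= ennreal ((n + e) powr q)"
   using n0 e q0 by (intro ennreal_leI powr_mono2) auto
  finally show ?thesis .
 qed
 \<comment> \<open>Markov's inequality: on the long displacements 1 is at most the p-th power of d /
   \<delta>. The exponent p / q turns into p under the q-th power.\<close>
 have tail: "(\<integral>\<^sup>+ z. ennreal ((C * indicator {z. \<delta> <= d (fst z) (snd z)} z) powr q) \<partial>\<pi>) <= ennreal ((C * (w / \<delta>) powr (p / q)) powr q)"
 proof -
  have "(\<integral>\<^sup>+ z. ennreal ((C * indicator {z. \<delta> <= d (fst z) (snd z)} z) powr q) \<partial>\<pi>)
    <= (\<integral>\<^sup>+ z. ennreal (C powr q / \<delta> powr p) * ennreal (d (fst z) (snd z) powr p) \<partial>\<pi>)"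
  proof (rule nn_integral_mono)
   fix z :: "'a \<times> 'a"
   show "ennreal ((C * indicator {z. \<delta> <= d (fst z) (snd z)} z) powr q) <= ennreal (C powr q / \<delta> powr p) * ennreal (d (fst z) (snd z) powr p)"
   proof (cases "\<delta> <= d (fst z) (snd z)")
    case True
    have "\<delta> powr p <= d (fst z) (snd z) powr p" using True \<delta> p0 by (intro powr_mono2) auto
    then have "C powr q <= C powr q / \<delta> powr p * d (fst z) (snd z) powr p"
     using \<delta> by (simp add: field_simps mult_left_mono)
    then show ?thesis using True by (simp add: ennreal_mult'[symmetric] ennreal_leI)
   qed simp
  qed
  also have "\<dots> = ennreal (C powr q / \<delta> powr p) * (\<integral>\<^sup>+ z. ennreal (d (fst z) (snd z) powr p) \<partial>\<pi>)"
   by (rule nn_integral_cmult) measurable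
  also have "\<dots> <= ennreal (C powr q / \<delta> powr p) * ennreal (w powr p)"
   using \<pi>(2) by (intro mult_left_mono) auto
  also have "\<dots> = ennreal ((C * (w / \<delta>) powr (p / q)) powr q)"
   using w \<delta> C q0 by (simp add: ennreal_mult'[symmetric] powr_mult powr_powr powr_divide)
  finally show ?thesis .
 qed
 have Hq: "(\<integral>\<^sup>+ z. ennreal (H z powr q) \<partial>\<pi>) <= ennreal (b powr q)"
 proof -
  have "(\<integral>\<^sup>+ z. ennreal (((g (fst z) + e) + C * indicator {z. \<delta> <= d (fst z) (snd z)} z) powr q) \<partial>\<pi>)
    <= ennreal (((n + e + e) + C * (w / \<delta>) powr (p / q)) powr q)"
  proof (rule nn_integral_Minkowski)
   show "(\<integral>\<^sup>+ z. ennreal ((g (fst z) + e) powr q) \<partial>\<pi>) <= ennreal ((n + e + e) powr q)"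
    by (rule nn_integral_Minkowski) (use gq g e n0 pq P.emeasure_space_1 in auto)
  qed (use tail g e n0 pq C wd in auto)
  then show ?thesis by (simp add: H_def b_def algebra_simps)
 qed
 have "(\<integral>\<^sup>+ z. ennreal (d (fst z) (snd z) * H z) \<partial>\<pi>) <= ennreal (w * b)"
 proof (rule nn_integral_Holder[OF _ _ _ _ w(1) b0 pq _ Hq])
  show "H \<in> borel_measurable \<pi>" unfolding H_def by measurable
 qed (use \<pi>(2) H0 dist_nonneg in auto)
 moreover have "ennreal (LINT z|\<pi>. u (snd z) - u (fst z)) <= (\<integral>\<^sup>+ z. ennreal (u (snd z) - u (fst z)) \<partial>\<pi>)"
 proof -
  have "integrable \<pi> (\<lambda>z. u (snd z) - u (fst z))" using i1 by simp
  then have "(LINT z|\<pi>. u (snd z) - u (fst z)) <= (LINT z|\<pi>. max 0 (u (snd z) - u (fst z)))"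
   by (intro integral_mono integrable_max) auto
  moreover have "(\<integral>\<^sup>+ z. ennreal (u (snd z) - u (fst z)) \<partial>\<pi>) = ennreal (LINT z|\<pi>. max 0 (u (snd z) - u (fst z)))"
  proof -
   have im: "integrable \<pi> (\<lambda>z. max 0 (u (snd z) - u (fst z)))" using i1 by (intro integrable_max) auto
   show ?thesis
    by (subst nn_integral_eq_integral[OF im, symmetric]) (auto intro!: nn_integral_cong simp: max_def ennreal_neg)
  qed
  ultimately show ?thesis by (simp add: ennreal_leI)
 qed
 moreover have "(\<integral>\<^sup>+ z. ennreal (u (snd z) - u (fst z)) \<partial>\<pi>) <= (\<integral>\<^sup>+ z. ennreal (d (fst z) (snd z) * H z) \<partial>\<pi>)"
  by (intro nn_integral_mono ennreal_leI le)
 ultimately have "ennreal (LINT z|\<pi>. u (snd z) - u (fst z)) <= ennreal (w * b)" by (meson order_trans)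
 then have "(LINT z|\<pi>. u (snd z) - u (fst z)) <= w * b" using w b0 by (simp add: ennreal_le_iff)
 then show ?thesis using i1 m\<mu> m\<nu> by (simp add: b_def n_def)
qed

end

section \<open>Absolutely continuous curves of measures and the kernel they form\<close>

lemma borel_version_Icc:
 fixes f :: "real => real"
 assumes f: "f \<in> borel_measurable (lebesgue_on {0..1})" and f0: "!!t. t \<in> {0..1} ==> 0 <= f t"
 obtains g where "g \<in> borel_measurable borel" "!!t. 0 <= g t"
  "AE t in lebesgue. t \<in> {0..1} --> f t = g t"
proof -
 have "(\<lambda>t. if t \<in> {0..1} then f t else 0) \<in> borel_measurable lebesgue"
  using f by (subst borel_measurable_if) auto
 then obtain g where g: "g \<in> borel_measurable lborel" and "AE t in lborel. (if t \<in> {0..1} then f t else 0) = g t"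
  using completion_ex_borel_measurable_real by blast
 then have ae: "AE t in lebesgue. (if t \<in> {0..1} then f t else 0) = g t" by (simp add: AE_completion)
 show thesis
 proof (rule that)
  show "(\<lambda>t. max 0 (g t)) \<in> borel_measurable borel" using g by simp
  show "AE t in lebesgue. t \<in> {0..1} --> f t = max 0 (g t)" using ae
  proof eventually_elim
   case (elim t) then show ?case using f0[of t] by auto
  qed
 qed simp
qed

context finsler
begin

text \<open>The density of an absolutely continuous curve is only Lebesgue measurable; a Borel
  version, nonnegative everywhere, has the same integrals. Its integrability follows from f <= 1 +
  f^p.\<close>

lemma AC_bound:
 assumes \<mu>: "\<mu> \<in> AC_curves A F p star" and p: "1 < p"
 obtains f where "f \<in> borel_measurable borel" "!!t. 0 <= f t" "set_integrable lborel {0..1} f"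
  "(\<integral>\<^sup>+ t\<in>{0..1}. ennreal (f t powr p) \<partial>lborel) < \<infinity>"
  "!!s t. 0 <= s ==> s <= t ==> t <= 1 ==> W p (\<mu> s) (\<mu> t) <= ennreal (LINT y:{s..t}|lborel. f y)"
  "!!s t. 0 <= s ==> s <= t ==> t <= 1 ==> W p (\<mu> t) (\<mu> s) <= ennreal (LINT y:{s..t}|lborel. f y)"
proof -
 obtain f0 where f0: "f0 \<in> borel_measurable (lebesgue_on {0..1})" "\<forall>t\<in>{0..1}. 0 <= f0 t"
   and f0p: "(\<integral>\<^sup>+ t\<in>{0..1}. ennreal (f0 t powr p) \<partial>lebesgue) < \<infinity>"
   and Wf: "\<forall>t1 t2. 0 <= t1 \<and> t1 <= t2 \<and> t2 <= 1 -->
      W p (\<mu> t1) (\<mu> t2) <= (\<integral>\<^sup>+ t\<in>{t1..t2}. ennreal (f0 t) \<partial>lebesgue) \<and>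
      W p (\<mu> t2) (\<mu> t1) <= (\<integral>\<^sup>+ t\<in>{t1..t2}. ennreal (f0 t) \<partial>lebesgue)"
  using \<mu> unfolding AC_curves_def by blast
 obtain f where f[measurable]: "f \<in> borel_measurable borel" and fn: "!!t. 0 <= f t"
  and ae: "AE t in lebesgue. t \<in> {0..1} --> f0 t = f t"
  using borel_version_Icc[of f0] f0 by blast
 have "(\<integral>\<^sup>+ t\<in>{0..1}. ennreal (f0 t powr p) \<partial>lebesgue) = (\<integral>\<^sup>+ t\<in>{0..1}. ennreal (f t powr p) \<partial>lebesgue)"
  by (rule nn_integral_cong_AE) (use ae in eventually_elim, auto split: split_indicator)
 also have "\<dots> = (\<integral>\<^sup>+ t\<in>{0..1}. ennreal (f t powr p) \<partial>lborel)" by (rule nn_integral_completion)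
 finally have fp: "(\<integral>\<^sup>+ t\<in>{0..1}. ennreal (f t powr p) \<partial>lborel) < \<infinity>" using f0p by simp
 have "(\<integral>\<^sup>+ t. ennreal (norm (indicator {0..1} t *\<^sub>R f t)) \<partial>lborel)
   <= (\<integral>\<^sup>+ t. indicator {0..1} t + ennreal (f t powr p) * indicator {0..1} t \<partial>lborel)"
 proof (rule nn_integral_mono)
  fix t :: real
  have "f t <= 1 + f t powr p"
  proof (cases "f t <= 1")
   case False
   then have "f t powr 1 <= f t powr p" using p by (intro powr_mono) auto
   then show ?thesis using False by simp
  qed (simp add: add_increasing2)
  then have "ennreal (f t) <= 1 + ennreal (f t powr p)"
   by (metis ennreal_1 ennreal_leI ennreal_plus powr_ge_zero zero_le_one)
  then show "ennreal (norm (indicator {0..1} t *\<^sub>R f t)) <= indicator {0..1} t + ennreal (f t powr p) * indicator {0..1} t"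
   using fn[of t] by (auto split: split_indicator)
 qed
 also have "\<dots> = 1 + (\<integral>\<^sup>+ t\<in>{0..1}. ennreal (f t powr p) \<partial>lborel)"
  by (subst nn_integral_add) auto
 also have "\<dots> < \<infinity>" using fp by (simp add: ennreal_add_less_top)
 finally have i: "set_integrable lborel {0..1} f" unfolding set_integrable_def
  by (intro integrableI_bounded) simp_all
 have eq: "(\<integral>\<^sup>+ t\<in>{a..b}. ennreal (f0 t) \<partial>lebesgue) = ennreal (LINT y:{a..b}|lborel. f y)"
  if ab: "0 <= a" "b <= 1" for a b
 proof -
  have "(\<integral>\<^sup>+ t\<in>{a..b}. ennreal (f0 t) \<partial>lebesgue) = (\<integral>\<^sup>+ t\<in>{a..b}. ennreal (f t) \<partial>lebesgue)"
  proof (rule nn_integral_cong_AE)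
   show "AE t in lebesgue. ennreal (f0 t) * indicator {a..b} t = ennreal (f t) * indicator {a..b} t"
    using ae by eventually_elim (use ab in \<open>auto split: split_indicator\<close>)
  qed
  also have "\<dots> = (\<integral>\<^sup>+ t\<in>{a..b}. ennreal (f t) \<partial>lborel)" by (rule nn_integral_completion)
  also have "\<dots> = (\<integral>\<^sup>+ t. ennreal (indicator {a..b} t *\<^sub>R f t) \<partial>lborel)"
   by (rule nn_integral_cong) (auto split: split_indicator)
  also have "\<dots> = ennreal (LINT y:{a..b}|lborel. f y)" unfolding set_lebesgue_integral_def
  proof (rule nn_integral_eq_integral)
   have "set_integrable lborel {a..b} f" using i by (rule set_integrable_subset) (use ab in auto)
   then show "integrable lborel (\<lambda>t. indicator {a..b} t *\<^sub>R f t)" unfolding set_integrable_def .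
  qed (simp add: fn)
  finally show ?thesis .
 qed
 show thesis
 proof (rule that[OF f fn i fp])
  fix s t :: real assume st: "0 <= s" "s <= t" "t <= 1"
  then show "W p (\<mu> s) (\<mu> t) <= ennreal (LINT y:{s..t}|lborel. f y)"
   "W p (\<mu> t) (\<mu> s) <= ennreal (LINT y:{s..t}|lborel. f y)"
   using Wf[rule_format, of s t] eq[of s t] by auto
 qed
qed

text \<open>\<open>coupling_estimate\<close> with a constant slope slightly above L, followed by e
  -> 0. As the slope bound holds for displacements of any size, the threshold \<delta> is
  free.\<close>

lemma W_lipschitz:
 assumes p: "1 < p" and \<mu>: "\<mu> \<in> borel_probs" and \<nu>: "\<nu> \<in> borel_probs" and w: "W p \<mu> \<nu> <= ennreal w" "0 <= w"
  and um[measurable]: "u \<in> borel_measurable borel" and ub: "!!x. \<bar>u x\<bar> <= B" and L: "0 <= L"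
  and lip: "!!x y. u y - u x <= L * d x y"
 shows "(LINT x|\<nu>. u x) - (LINT x|\<mu>. u x) <= L * w"
proof (rule field_le_epsilon)
 fix \<epsilon> :: real assume \<epsilon>: "0 < \<epsilon>"
 define q where "q = p / (p - 1)"
 have q: "1 < q" "1 / p + 1 / q = 1" using p unfolding q_def by (auto simp: field_simps)
 interpret M: prob_space \<mu> using \<mu> unfolding borel_probs_def by simp
 have s\<mu>: "sets \<mu> = sets borel" using \<mu> unfolding borel_probs_def by simp
 have main: "(LINT x|\<nu>. u x) - (LINT x|\<mu>. u x) <= (w + e) * (L + 4 * e)" if e: "0 < e" for e
 proof -
  have w1: "W p \<mu> \<nu> < ennreal (w + e)" using w e by (smt (verit) ennreal_lessI order.strict_trans1)
  \<comment> \<open>Solves (L + e) ((w + e) / \<delta>)^(p / q) = e for \<delta>, so that the tail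
    term is exactly e.\<close>
  define \<delta> where "\<delta> = (w + e) / (e / (L + e)) powr (q / p)"
  have le: "0 < e / (L + e)" using e L by simp
  have \<delta>: "0 < \<delta>" unfolding \<delta>_def using e w(2) le by (intro divide_pos_pos) (auto simp: powr_gt_zero simp del: divide_less_0_iff zero_less_divide_iff)
  have "(w + e) / \<delta> = (e / (L + e)) powr (q / p)"
  proof -
   have "0 < (e / (L + e)) powr (q / p)" using le by (simp only: powr_gt_zero less_imp_neq[symmetric] not_False_eq_True)
   then show ?thesis unfolding \<delta>_def using e w(2) by simp
  qed
  then have "((w + e) / \<delta>) powr (p / q) = (e / (L + e)) powr 1" using p q by (simp only: powr_powr) simp
  then have "((w + e) / \<delta>) powr (p / q) = e / (L + e)" using le by (simp only: powr_one)
  then have 2: "(L + e) * ((w + e) / \<delta>) powr (p / q) = e" using e L by simp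
  have d0: "0 <= d x y" for x y by (rule dist_nonneg)
  have lip': "u y - u x <= (L + e) * d x y" for x y
   using lip[of y x] mult_right_mono[of L "L + e" "d x y"] d0[of x y] e by linarith
  have "(LINT x|\<nu>. u x) - (LINT x|\<mu>. u x) <= (w + e) * (Lnorm q \<mu> (\<lambda>_. L) + 2 * e + (L + e) * ((w + e) / \<delta>) powr (p / q))"
   by (rule coupling_estimate[OF p q \<mu> \<nu> _ w1 um ub _ L _ e \<delta> _ lip' lip'])
    (use w(2) e L in auto)
  also have "\<dots> <= (w + e) * (L + 4 * e)"
  proof (rule mult_left_mono)
   have "Lnorm q \<mu> (\<lambda>_. L) <= L" by (rule Lnorm_le_const) (use q L M.prob_space_axioms in auto)
   then show "Lnorm q \<mu> (\<lambda>_. L) + 2 * e + (L + e) * ((w + e) / \<delta>) powr (p / q) <= L + 4 * e"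
    unfolding 2 using e by simp
  qed (use w(2) e in simp)
  finally show ?thesis .
 qed
 have "((\<lambda>e. (w + e) * (L + 4 * e)) \<longlongrightarrow> (w + 0) * (L + 4 * 0)) (at_right 0)"
  by (intro tendsto_intros)
 moreover have "eventually (\<lambda>e. (LINT x|\<nu>. u x) - (LINT x|\<mu>. u x) <= (w + e) * (L + 4 * e)) (at_right 0)"
  using main by (auto simp: eventually_at_filter)
 ultimately have "(LINT x|\<nu>. u x) - (LINT x|\<mu>. u x) <= (w + 0) * (L + 4 * 0)"
  by (rule tendsto_lowerbound) simp
 then show "(LINT x|\<nu>. u x) - (LINT x|\<mu>. u x) <= L * w + \<epsilon>" using \<epsilon> by (simp add: mult.commute)
qed

end

locale finsler_curve = finsler A F for A :: "('a::{t2_space, second_countable_topology}, 'n::finite) chart set" and F +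
 fixes p :: real and \<mu> :: "real => 'a measure" and f :: "real => real"
 assumes p: "1 < p" and probs: "t \<in> {0..1} ==> \<mu> t \<in> borel_probs"
  and f_borel[measurable]: "f \<in> borel_measurable borel" and f0: "0 <= f t" and f_int: "set_integrable lborel {0..1} f"
  and f_pint: "(\<integral>\<^sup>+ t\<in>{0..1}. ennreal (f t powr p) \<partial>lborel) < \<infinity>"
  and W_fwd: "0 <= s ==> s <= t ==> t <= 1 ==> W p (\<mu> s) (\<mu> t) <= ennreal (LINT y:{s..t}|lborel. f y)"
  and W_bwd: "0 <= s ==> s <= t ==> t <= 1 ==> W p (\<mu> t) (\<mu> s) <= ennreal (LINT y:{s..t}|lborel. f y)"
begin

lemma f_sub_int: "0 <= s ==> t <= 1 ==> 0 <= (LINT y:{s..t}|lborel. f y)"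
 by (rule set_integral_nonneg_Icc) (rule f0)

lemma integral_lipschitz:
 assumes um: "u \<in> borel_measurable borel" and ub: "!!x. \<bar>u x\<bar> <= B" and L: "0 <= L"
  and lip: "!!x y. u y - u x <= L * d x y" and st: "0 <= s" "s <= t" "t <= 1"
 shows "\<bar>(LINT x|\<mu> t. u x) - (LINT x|\<mu> s. u x)\<bar> <= (LINT y:{s..t}|lborel. L * f y)"
proof -
 have P: "\<mu> s \<in> borel_probs" "\<mu> t \<in> borel_probs" using probs st by auto
 have I: "0 <= (LINT y:{s..t}|lborel. f y)" using f_sub_int st by simp
 have "(LINT x|\<mu> t. u x) - (LINT x|\<mu> s. u x) <= L * (LINT y:{s..t}|lborel. f y)"
  by (rule W_lipschitz[OF p P W_fwd[OF st] I um ub L lip])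
 moreover have "(LINT x|\<mu> s. u x) - (LINT x|\<mu> t. u x) <= L * (LINT y:{s..t}|lborel. f y)"
  by (rule W_lipschitz[OF p P(2,1) W_bwd[OF st] I um ub L lip])
 ultimately show ?thesis by (simp add: abs_le_iff)
qed

lemma integral_continuous:
 assumes um: "u \<in> borel_measurable borel" and ub: "!!x. \<bar>u x\<bar> <= B" and L: "0 <= L"
  and lip: "!!x y. u y - u x <= L * d x y"
 shows "continuous_on {0..1} (\<lambda>t. LINT x|\<mu> t. u x)"
 unfolding continuous_on_iff
proof (intro ballI allI impI)
 fix c e :: real assume c: "c \<in> {0..1}" and e: "0 < e"
 have i: "set_integrable lborel {0..1} (\<lambda>y. L * f y)" using f_int by simp
 obtain \<delta> where \<delta>: "0 < \<delta>" "!!x. x \<in> {0..1} ==> \<bar>x - c\<bar> < \<delta> ==>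
   \<bar>(LINT t:{min x c..max x c}|lborel. L * f t)\<bar> < e" using set_integral_small[OF i c e] by blast
 show "\<exists>\<delta>>0. \<forall>x\<in>{0..1}. dist x c < \<delta> --> dist (LINT y|\<mu> x. u y) (LINT y|\<mu> c. u y) < e"
 proof (intro exI[of _ \<delta>] conjI ballI impI)
  fix x :: real assume x: "x \<in> {0..1}" "dist x c < \<delta>"
  have "\<bar>(LINT y|\<mu> (max x c). u y) - (LINT y|\<mu> (min x c). u y)\<bar> <= (LINT t:{min x c..max x c}|lborel. L * f t)"
   by (rule integral_lipschitz[OF um ub L lip]) (use x c in auto)
  moreover have "\<bar>(LINT t:{min x c..max x c}|lborel. L * f t)\<bar> < e" using \<delta>(2)[of x] x by (simp add: dist_real_def)
  ultimately show "dist (LINT y|\<mu> x. u y) (LINT y|\<mu> c. u y) < e"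
   by (cases "x <= c") (auto simp: dist_real_def max_def min_def)
 qed (rule \<delta>)
qed

definition T :: "real measure" where "T = restrict_space lborel {0..1}"

lemma space_T[simp]: "space T = {0..1}" unfolding T_def by (simp add: space_restrict_space)
lemma sets_T: "sets T = sets (restrict_space borel {0..1})" unfolding T_def
 by (simp add: sets_restrict_space)
lemma borel_T: "g \<in> borel_measurable borel ==> g \<in> borel_measurable T"
 unfolding T_def by (rule measurable_restrict_space1) simp
lemma prob_T: "prob_space T" unfolding T_def
 by (rule prob_spaceI) (simp add: space_restrict_space emeasure_restrict_space)
lemma integral_T: "(LINT t|T. g t) = (LINT t:{0..1}|lborel. g t)" for g :: "real => real"
 unfolding T_def set_lebesgue_integral_def by (subst integral_restrict_space) auto
lemma integrable_T: "integrable T g \<longleftrightarrow> set_integrable lborel {0..1} g" for g :: "real => real"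
 unfolding T_def set_integrable_def by (subst integrable_restrict_space) auto
lemma nn_integral_T: "(\<integral>\<^sup>+ t. g t \<partial>T) = (\<integral>\<^sup>+ t\<in>{0..1}. g t \<partial>lborel)"
 unfolding T_def by (subst nn_integral_restrict_space) auto
lemma AE_T: "(AE t in T. P t) \<longleftrightarrow> (AE t in lborel. t \<in> {0..1} --> P t)"
 unfolding T_def by (subst AE_restrict_space_iff) auto

text \<open>The indicator of U is the limit of the truncations min 1 (k D), where D is the distance
  from the complement. Each truncation is Lipschitz, so its integral is continuous in t, and
  dominated convergence yields a measurable limit.\<close>

lemma kernel_open_measurable:
 assumes U: "open (U :: 'a set)"
 shows "(\<lambda>t. emeasure (\<mu> t) U) \<in> borel_measurable T"
proof (cases "U = UNIV")
 case True
 have "emeasure (\<mu> t) U = 1" if "t \<in> space T" for t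
 proof -
  have "prob_space (\<mu> t)" "sets (\<mu> t) = sets borel" using probs[of t] that unfolding borel_probs_def by auto
  then show ?thesis using True prob_space.emeasure_space_1[of "\<mu> t"] sets_eq_imp_space_eq[of "\<mu> t" borel] by simp
 qed
 then show ?thesis by (subst measurable_cong[of _ _ "\<lambda>_. 1"]) auto
next
 case False
 \<comment> \<open>The order of the arguments matters: measured from the complement to x, D
   satisfies D y <= D x + d x y, which is the one-sided Lipschitz condition used throughout.\<close>
 define D where "D x = (INF z\<in>-U. d z x)" for x
 define u where "u k x = min 1 (real k * D x)" for k x
 have bdd: "bdd_below ((\<lambda>z. d z x) ` (-U))" for x by (rule bdd_belowI2[of _ 0]) (rule dist_nonneg)
 have D0: "0 <= D x" for x unfolding D_def by (rule cINF_greatest) (use False dist_nonneg in auto)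
 have Dlip: "D y <= D x + d x y" for x y
 proof -
  have "D y - d x y <= d z x" if "z \<in> -U" for z
   using cINF_lower[OF bdd that, of y] dist_triangle_ineq[of z y x] unfolding D_def by linarith
  then have "D y - d x y <= D x" unfolding D_def[of x] by (intro cINF_greatest) (use False in auto)
  then show ?thesis by simp
 qed
 have Dz: "D x = 0" if "x \<notin> U" for x
  using cINF_lower[OF bdd, of x x] that D0[of x] dist_self[of x] unfolding D_def by simp
 have Dp: "0 < D x" if xU: "x \<in> U" for x
 proof -
  obtain V \<delta> where V: "open V" "x \<in> V" "0 < \<delta>" "!!z y. z \<in> V ==> d y z < \<delta> ==> y \<in> U"
   by (rule backward_localization[OF U xU]) (rule that, assumption+)
  have "\<delta> <= D x" unfolding D_def
  proof (rule cINF_greatest)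
   fix z assume "z \<in> -U" then show "\<delta> <= d z x" using V(4)[OF V(2), of z] by (meson ComplD leI)
  qed (use False in auto)
  then show ?thesis using V(3) by linarith
 qed
 have u0: "0 <= u k x" for k x unfolding u_def using D0[of x] by simp
 have u1: "u k x <= 1" for k x unfolding u_def by simp
 have ub: "\<bar>u k x\<bar> <= 1" for k x using u0[of k x] u1[of k x] by simp
 have ulip: "u k y - u k x <= real k * d x y" for k x y
 proof -
  have "real k * D y <= real k * D x + real k * d x y" using mult_left_mono[OF Dlip[of y x], of "real k"] by (simp add: distrib_left)
  moreover have "0 <= real k * d x y" using dist_nonneg[of x y] by simp
  ultimately show ?thesis unfolding u_def by linarith
 qed
 have um: "u k \<in> borel_measurable borel" for k
  by (rule borel_measurable_continuous_onI, rule lipschitz_continuous[of "real k"]) (use ulip in auto)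
 have ul: "(\<lambda>k. u k x) \<longlonglongrightarrow> indicator U x" for x
 proof (cases "x \<in> U")
  case True
  obtain N :: nat where "1 / D x < real N" using reals_Archimedean2 by blast
  then have N: "1 < real N * D x" using Dp[OF True] by (simp add: field_simps)
  have "u k x = 1" if "k \<ge> N" for k
  proof -
   have "real N * D x <= real k * D x" using that D0[of x] by (intro mult_right_mono) auto
   then show ?thesis unfolding u_def using N by simp
  qed
  then have "eventually (\<lambda>k. u k x = 1) sequentially" by (auto simp: eventually_sequentially)
  then have "(\<lambda>k. u k x) \<longlonglongrightarrow> 1" by (rule tendsto_eventually)
  then show ?thesis using True by simp
 next
  case False then show ?thesis by (simp add: u_def Dz)
 qed
 have cont: "continuous_on {0..1} (\<lambda>t. LINT x|\<mu> t. u k x)" for k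
  by (rule integral_continuous[OF um ub _ ulip]) simp
 have m: "(\<lambda>t. LINT x|\<mu> t. u k x) \<in> borel_measurable T" for k
 proof -
  have "(\<lambda>t. LINT x|\<mu> t. u k x) \<in> borel_measurable (restrict_space borel {0..1})"
   using cont by (rule borel_measurable_continuous_on_restrict)
  then show ?thesis using measurable_cong_sets[OF sets_T refl] by blast
 qed
 have lim: "(\<lambda>k. LINT x|\<mu> t. u k x) \<longlonglongrightarrow> measure (\<mu> t) U" if t: "t \<in> {0..1}" for t
 proof -
  interpret M: prob_space "\<mu> t" using probs[OF t] unfolding borel_probs_def by simp
  have s: "sets (\<mu> t) = sets borel" using probs[OF t] unfolding borel_probs_def by simp
  have Us: "U \<in> sets (\<mu> t)" using s U by simp
  have "(\<lambda>k. LINT x|\<mu> t. u k x) \<longlonglongrightarrow> (LINT x|\<mu> t. indicator U x)"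
  proof (rule integral_dominated_convergence[where w = "\<lambda>_. 1"])
   show "u k \<in> borel_measurable (\<mu> t)" for k using um measurable_cong_sets[OF s refl] by blast
  qed (use ul ub Us in auto)
  then show ?thesis using Us by simp
 qed
 have "(\<lambda>t. measure (\<mu> t) U) \<in> borel_measurable T"
  by (rule borel_measurable_LIMSEQ_real[where u = "\<lambda>k t. LINT x|\<mu> t. u k x"]) (use lim m in auto)
 then have "(\<lambda>t. ennreal (measure (\<mu> t) U)) \<in> borel_measurable T" by simp
 moreover have "emeasure (\<mu> t) U = ennreal (measure (\<mu> t) U)" if "t \<in> space T" for t
 proof -
  interpret M: prob_space "\<mu> t" using probs[of t] that unfolding borel_probs_def by simp
  show ?thesis by (rule M.emeasure_eq_measure)
 qed
 ultimately show ?thesis by (subst measurable_cong[of _ _ "\<lambda>t. ennreal (measure (\<mu> t) U)"]) auto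
qed

lemma kernel: "prob_kernel T borel \<mu>"
proof (rule prob_kernel.intro)
 have s: "sets borel = sigma_sets UNIV {U :: 'a set. open U}" by (simp add: borel_def)
 show "\<mu> \<in> T \<rightarrow>\<^sub>M prob_algebra borel"
 proof (rule measurable_prob_algebra_generated[OF s])
  show "Int_stable {U :: 'a set. open U}" by (auto simp: Int_stable_def)
  show "prob_space (\<mu> t)" "sets (\<mu> t) = sets borel" if "t \<in> space T" for t
   using probs[of t] that unfolding borel_probs_def by auto
  show "(\<lambda>t. emeasure (\<mu> t) U) \<in> borel_measurable T" if "U \<in> {U. open U}" for U
   using that kernel_open_measurable[of U] by simp
  show "{U :: 'a set. open U} \<subseteq> Pow UNIV" by simp
 qed
qed (rule prob_T)

sublocale prob_kernel T "borel :: 'a measure" \<mu> by (rule kernel)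

end

text \<open>Stated for an extended-valued \<open>V\<close> in place of the Wasserstein distance, so
  that the same distance with its arguments exchanged covers the other metric derivative. On [0, 1]
  the bounds \<open>fwd\<close> and \<open>bwd\<close> make \<open>V\<close> finite.\<close>

lemma metric_derivative_ennreal:
 fixes f :: "real => real" and V :: "real => real => ennreal"
 assumes f[measurable]: "f \<in> borel_measurable borel" and f0: "!!t. 0 <= f t"
  and i: "set_integrable lborel {0..1} f"
  and tri: "!!r s t. r \<in> {0..1} ==> s \<in> {0..1} ==> t \<in> {0..1} ==> V r t <= V r s + V s t"
  and fwd: "!!s t. 0 <= s ==> s <= t ==> t <= 1 ==> V s t <= ennreal (LINT y:{s..t}|lborel. f y)"
  and bwd: "!!s t. 0 <= s ==> s <= t ==> t <= 1 ==> V t s <= ennreal (LINT y:{s..t}|lborel. f y)"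
 obtains m where "m \<in> borel_measurable borel" "!!t. 0 <= m t" "!!t. m t <= f t"
  "AE t in lborel. 0 < t \<and> t < 1 --> Lim (at t) (\<lambda>s. V (min s t) (max s t) / ennreal \<bar>t - s\<bar>) = ennreal (m t)"
  "AE t in lborel. 0 < t \<and> t < 1 --> (\<forall>e>0. \<exists>\<delta>>0. \<forall>s s'. short_interval t \<delta> s s' -->
    V s s' <= ennreal ((m t + e) * (s' - s)))"
proof -
 define w where "w s t = enn2real (V s t)" for s t
 have I: "0 <= (LINT y:{s..t}|lborel. f y)" for s t by (rule set_integral_nonneg_Icc) (rule f0)
 have fin: "V s t < \<top>" if "s \<in> {0..1}" "t \<in> {0..1}" for s t
  using fwd[of s t] bwd[of t s] that by (cases "s <= t") (auto intro: le_less_trans)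
 have Vw: "V s t = ennreal (w s t)" if "s \<in> {0..1}" "t \<in> {0..1}" for s t
  using fin[OF that] unfolding w_def by simp
 have w0: "0 <= w s t" for s t unfolding w_def by simp
 have wtri: "w r t <= w r s + w s t" if "r \<in> {0..1}" "s \<in> {0..1}" "t \<in> {0..1}" for r s t
  using tri[OF that] Vw that w0 by (metis add_nonneg_nonneg ennreal_le_iff ennreal_plus)
 have wfwd: "w s t <= (LINT y:{s..t}|lborel. f y)" if "0 <= s" "s <= t" "t <= 1" for s t
  using fwd[OF that] that I by (simp add: Vw)
 have wbwd: "w t s <= (LINT y:{s..t}|lborel. f y)" if "0 <= s" "s <= t" "t <= 1" for s t
  using bwd[OF that] that I by (simp add: Vw)
 obtain m where m: "m \<in> borel_measurable borel" "!!t. 0 <= m t" "!!t. m t <= f t"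
  and ae: "AE t in lborel. 0 < t \<and> t < 1 --> (\<forall>e>0. \<exists>\<delta>>0. \<forall>s s'. short_interval t \<delta> s s' -->
    \<bar>w s s' - m t * (s' - s)\<bar> <= e * (s' - s))"
  by (rule metric_derivative[OF f f0 i w0 wtri wfwd wbwd]) (assumption | (rule that; assumption))+
 show thesis
 proof (rule that[OF m])
  show "AE t in lborel. 0 < t \<and> t < 1 --> Lim (at t) (\<lambda>s. V (min s t) (max s t) / ennreal \<bar>t - s\<bar>) = ennreal (m t)"
   using ae
  proof (eventually_elim, intro impI)
   fix t assume H: "0 < t \<and> t < 1 --> (\<forall>e>0. \<exists>\<delta>>0. \<forall>s s'. short_interval t \<delta> s s' -->
    \<bar>w s s' - m t * (s' - s)\<bar> <= e * (s' - s))" and t: "0 < t \<and> t < 1"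
   have ev01: "eventually (\<lambda>s. 0 < s \<and> s < 1 \<and> s \<noteq> t) (at t)"
    unfolding eventually_at using t by (intro exI[of _ "min t (1 - t)"]) (auto simp: dist_real_def)
   have "((\<lambda>s. w (min s t) (max s t) / \<bar>t - s\<bar>) \<longlongrightarrow> m t) (at t)"
   proof (rule tendstoI)
    fix e :: real assume e: "0 < e"
    obtain \<delta> where \<delta>: "\<delta> > 0" "!!s s'. short_interval t \<delta> s s' ==>
      \<bar>w s s' - m t * (s' - s)\<bar> <= e / 2 * (s' - s)" using H[THEN mp, OF t, THEN spec, THEN mp, OF half_gt_zero[OF e]] by blast
    have "eventually (\<lambda>s. dist s t < \<delta>) (at t)" using \<delta>(1) by (auto simp: eventually_at)
    with ev01 show "eventually (\<lambda>s. dist (w (min s t) (max s t) / \<bar>t - s\<bar>) (m t) < e) (at t)"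
    proof eventually_elim
     case (elim s)
     then have p: "0 < \<bar>t - s\<bar>" and eq: "max s t - min s t = \<bar>t - s\<bar>" by auto
     have "\<bar>w (min s t) (max s t) - m t * \<bar>t - s\<bar>\<bar> <= e / 2 * \<bar>t - s\<bar>"
      using \<delta>(2)[of "min s t" "max s t"] elim t unfolding eq by (auto simp: dist_real_def abs_minus_commute)
     then have "\<bar>w (min s t) (max s t) - m t * \<bar>t - s\<bar>\<bar> / \<bar>t - s\<bar> <= e / 2" using p by (simp add: field_simps)
     also have "\<bar>w (min s t) (max s t) - m t * \<bar>t - s\<bar>\<bar> / \<bar>t - s\<bar> = \<bar>w (min s t) (max s t) / \<bar>t - s\<bar> - m t\<bar>"
     proof -
      have "w (min s t) (max s t) / \<bar>t - s\<bar> - m t = (w (min s t) (max s t) - m t * \<bar>t - s\<bar>) / \<bar>t - s\<bar>"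
       using p by (simp only: diff_divide_distrib nonzero_mult_div_cancel_right less_imp_neq[symmetric] not_False_eq_True)
      then show ?thesis by simp
     qed
     finally show ?case using e by (simp add: dist_real_def)
    qed
   qed
   then have "((\<lambda>s. ennreal (w (min s t) (max s t) / \<bar>t - s\<bar>)) \<longlongrightarrow> ennreal (m t)) (at t)" by (rule tendsto_ennrealI)
   moreover have "eventually (\<lambda>s. V (min s t) (max s t) / ennreal \<bar>t - s\<bar> = ennreal (w (min s t) (max s t) / \<bar>t - s\<bar>)) (at t)"
    using ev01
   proof eventually_elim
    case (elim s)
    then show ?case using t w0 by (subst Vw) (auto simp: divide_ennreal min_def max_def)
   qed
   ultimately have "((\<lambda>s. V (min s t) (max s t) / ennreal \<bar>t - s\<bar>) \<longlongrightarrow> ennreal (m t)) (at t)"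
    by (simp add: tendsto_cong)
   then show "Lim (at t) (\<lambda>s. V (min s t) (max s t) / ennreal \<bar>t - s\<bar>) = ennreal (m t)"
    by (intro tendsto_Lim) auto
  qed
  show "AE t in lborel. 0 < t \<and> t < 1 --> (\<forall>e>0. \<exists>\<delta>>0. \<forall>s s'. short_interval t \<delta> s s' -->
    V s s' <= ennreal ((m t + e) * (s' - s)))"
   using ae
  proof (eventually_elim, intro impI allI)
   fix t e :: real assume H: "0 < t \<and> t < 1 --> (\<forall>e>0. \<exists>\<delta>>0. \<forall>s s'. short_interval t \<delta> s s' -->
    \<bar>w s s' - m t * (s' - s)\<bar> <= e * (s' - s))" and t: "0 < t \<and> t < 1" and e: "0 < e"
   obtain \<delta> where \<delta>: "\<delta> > 0" "!!s s'. short_interval t \<delta> s s' ==>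
      \<bar>w s s' - m t * (s' - s)\<bar> <= e * (s' - s)" using H[THEN mp, OF t, THEN spec, THEN mp, OF e] by blast
   show "\<exists>\<delta>>0. \<forall>s s'. short_interval t \<delta> s s' --> V s s' <= ennreal ((m t + e) * (s' - s))"
   proof (intro exI[of _ \<delta>] conjI allI impI)
    fix s s' assume ss: "short_interval t \<delta> s s'"
    have "w s s' <= (m t + e) * (s' - s)" using \<delta>(2)[OF ss] by (simp add: abs_le_iff distrib_right)
    then show "V s s' <= ennreal ((m t + e) * (s' - s))" using ss by (subst Vw) (auto intro: ennreal_leI)
   qed (rule \<delta>)
  qed
 qed
qed

section \<open>Metric speed and derivatives of integrals of test functions\<close>

context finsler_curve
begin

definition q :: real where "q = p / (p - 1)"

lemma pq: "1 < p" "1 < q" "1 / p + 1 / q = 1" using p unfolding q_def by (auto simp: field_simps)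

text \<open>The sign selects between \<open>|\<mu>'\<^sub>+|\<close> and \<open>|\<mu>'\<^sub>-|\<close>: moving forwards in time for \<open>\<sigma> = 1\<close>, backwards for \<open>\<sigma> = -1\<close>.\<close>

definition speed_at_most :: "real => real => real => bool" where
 "speed_at_most \<sigma> t m \<longleftrightarrow> (\<forall>e>0. \<exists>\<delta>>0. \<forall>h. 0 < h \<and> h < \<delta> -->
   t + \<sigma> * h \<in> {0..1} \<and> W p (\<mu> t) (\<mu> (t + \<sigma> * h)) <= ennreal ((m + e) * h))"

lemma metric_speeds:
 assumes "\<sigma> = 1 \<and> D = metric_deriv_plus A F p \<mu> \<or> \<sigma> = - 1 \<and> D = metric_deriv_minus A F p \<mu>"
 obtains m where "m \<in> borel_measurable borel" "!!t. 0 <= m t" "!!t. m t <= f t"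
  "AE t in lborel. 0 < t \<and> t < 1 --> D t = ennreal (m t)"
  "AE t in lborel. 0 < t \<and> t < 1 --> speed_at_most \<sigma> t (m t)"
proof -
 \<comment> \<open>Exchanging the arguments preserves the triangle inequality and the two integral
   bounds; for \<sigma> = -1, V (t - h) t is the cost of moving from \<open>\<mu> t\<close> back to
   time t - h.\<close>
 define V where "V s t = (if \<sigma> = 1 then W p (\<mu> s) (\<mu> t) else W p (\<mu> t) (\<mu> s))" for s t
 have tri: "V r t <= V r s + V s t" if "r \<in> {0..1}" "s \<in> {0..1}" "t \<in> {0..1}" for r s t
  using W_triangle[OF _ probs[OF that(2)], of p "\<mu> r" "\<mu> t"] W_triangle[OF _ probs[OF that(2)], of p "\<mu> t" "\<mu> r"] p
  unfolding V_def by (simp add: add.commute)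
 have bd: "V s t <= ennreal (LINT y:{s..t}|lborel. f y)" "V t s <= ennreal (LINT y:{s..t}|lborel. f y)"
  if "0 <= s" "s <= t" "t <= 1" for s t
  using W_fwd[OF that] W_bwd[OF that] unfolding V_def by simp_all
 obtain m where m: "m \<in> borel_measurable borel" "!!t. 0 <= m t" "!!t. m t <= f t"
  and 1: "AE t in lborel. 0 < t \<and> t < 1 --> Lim (at t) (\<lambda>s. V (min s t) (max s t) / ennreal \<bar>t - s\<bar>) = ennreal (m t)"
  and 2: "AE t in lborel. 0 < t \<and> t < 1 --> (\<forall>e>0. \<exists>\<delta>>0. \<forall>s s'. short_interval t \<delta> s s' -->
   V s s' <= ennreal ((m t + e) * (s' - s)))"
  by (rule metric_derivative_ennreal[of f V, OF f_borel f0 f_int tri bd]) (assumption | (rule that; assumption))+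
 have D: "D t = Lim (at t) (\<lambda>s. V (min s t) (max s t) / ennreal \<bar>t - s\<bar>)" for t
  using assms unfolding V_def by (auto simp: metric_deriv_plus_def metric_deriv_minus_def)
 show thesis
 proof (rule that[OF m])
  show "AE t in lborel. 0 < t \<and> t < 1 --> D t = ennreal (m t)" using 1 unfolding D .
  show "AE t in lborel. 0 < t \<and> t < 1 --> speed_at_most \<sigma> t (m t)" using 2
  proof (eventually_elim, intro impI, unfold speed_at_most_def, intro allI impI)
   fix t e :: real
   assume H: "0 < t \<and> t < 1 --> (\<forall>e>0. \<exists>\<delta>>0. \<forall>s s'. short_interval t \<delta> s s' -->
    V s s' <= ennreal ((m t + e) * (s' - s)))" and t: "0 < t \<and> t < 1" and e: "0 < e"
   obtain \<delta> where \<delta>: "\<delta> > 0" "!!s s'. short_interval t \<delta> s s' ==>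
    V s s' <= ennreal ((m t + e) * (s' - s))" using H[THEN mp, OF t, THEN spec, THEN mp, OF e] by blast
   show "\<exists>\<delta>>0. \<forall>h. 0 < h \<and> h < \<delta> --> t + \<sigma> * h \<in> {0..1} \<and> W p (\<mu> t) (\<mu> (t + \<sigma> * h)) <= ennreal ((m t + e) * h)"
   proof (intro exI[of _ "min \<delta> (min t (1 - t))"] conjI allI impI)
    fix h assume h: "0 < h \<and> h < min \<delta> (min t (1 - t))"
    then show "t + \<sigma> * h \<in> {0..1}" using t assms by auto
    show "W p (\<mu> t) (\<mu> (t + \<sigma> * h)) <= ennreal ((m t + e) * h)"
     using \<delta>(2)[of t "t + h"] \<delta>(2)[of "t - h" t] h t assms by (auto simp: V_def)
   qed (use \<delta> t in auto)
  qed
 qed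
qed

lemma test_function_borel: "\<psi> \<in> test_functions A ==> \<psi> \<in> borel_measurable borel"
 by (intro borel_measurable_continuous_onI C1_continuous test_C1)

lemma test_function_bounded:
 assumes \<psi>: "\<psi> \<in> test_functions A" obtains B where "0 <= B" "!!x. \<bar>\<psi> x\<bar> <= B"
proof -
 have "compact (\<psi> ` supp \<psi>)"
  by (rule compact_continuous_image[OF continuous_on_subset[OF C1_continuous[OF test_C1[OF \<psi>]]] test_compact[OF \<psi>]]) simp
 then have "bounded (\<psi> ` supp \<psi>)" by (rule compact_imp_bounded)
 then obtain B where "\<forall>y\<in>\<psi> ` supp \<psi>. \<bar>y\<bar> <= B" unfolding bounded_real by blast
 then have B: "\<bar>\<psi> x\<bar> <= B" if "x \<in> supp \<psi>" for x using that by blast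
 have "\<bar>\<psi> x\<bar> <= max B 0" for x
 proof (cases "\<psi> x = 0")
  case False
  then have "x \<in> supp \<psi>" unfolding supp_def by (intro subsetD[OF closure_subset]) simp
  then show ?thesis using B[of x] by simp
 qed simp
 then show thesis by (intro that[of "max B 0"]) auto
qed

text \<open>Apply \<open>coupling_estimate\<close> with w = (m + 2 e) h and divide by h. As h -> 0
  the tail term, a positive power of h, vanishes; then e -> 0. The coupling starts at
  \<open>\<mu> t\<close> in either direction of time, so the slope is integrated against
  \<open>\<mu> t\<close>, and the increment from t to t + \<sigma> h has rate \<sigma> D.\<close>

lemma derivative_estimate:
 assumes \<psi>: "\<psi> \<in> test_functions A" and t: "0 < t" "t < 1"
  and sp: "speed_at_most \<sigma> t m" and m: "0 <= m"
  and D: "((\<lambda>s. LINT x|\<mu> s. \<psi> x) has_real_derivative D) (at t)"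
  and gm: "g \<in> borel_measurable borel" and g: "!!x. 0 <= g x" "!!x. g x <= C" "!!x. slope_le \<psi> x (g x)"
 shows "\<sigma> * D <= m * Lnorm q (\<mu> t) g"
proof -
 define \<Phi> where "\<Phi> s = (LINT x|\<mu> s. \<psi> x)" for s
 define N where "N = Lnorm q (\<mu> t) g"
 define L where "L = max C 0 + 1"
 obtain B where B: "!!x. \<bar>\<psi> x\<bar> <= B" by (rule test_function_bounded[OF \<psi>]) (rule that, assumption+)
 have lip: "\<psi> y - \<psi> x <= L * d x y" for x y
 proof (rule slope_lipschitz[OF \<psi>])
  show "slope_le \<psi> x L" for x by (rule slope_le_mono[OF g(3)]) (use g(2)[of x] in \<open>simp add: L_def\<close>)
 qed (simp add: L_def)
 have L0: "0 < L" "!!x. g x <= L"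
 proof -
  show "g x <= L" for x using g(2)[of x] unfolding L_def by simp
 qed (simp add: L_def)
 have Pt: "\<mu> t \<in> borel_probs" using probs[of t] t by simp
 have main: "\<sigma> * D <= (m + 2 * e) * (N + 2 * e)" if e: "0 < e" for e
 proof -
  obtain \<delta> where \<delta>: "0 < \<delta>" "!!x y K. 0 <= K ==> slope_le \<psi> x K ==> d x y < \<delta> ==> \<psi> y - \<psi> x <= (K + e) * d x y"
   by (rule slope_local_lipschitz[OF \<psi> e]) (rule that, assumption+)
  obtain \<delta>' where \<delta>': "\<delta>' > 0" "!!h. 0 < h ==> h < \<delta>' ==>
   t + \<sigma> * h \<in> {0..1} \<and> W p (\<mu> t) (\<mu> (t + \<sigma> * h)) <= ennreal ((m + e) * h)"
   using sp[unfolded speed_at_most_def, THEN spec, THEN mp, OF e] by blast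
  have est: "(\<Phi> (t + \<sigma> * h) - \<Phi> t) / h <= (m + 2 * e) * (N + 2 * e + L * ((m + 2 * e) * h / \<delta>) powr (p / q))"
   if h: "0 < h" "h < \<delta>'" for h
  proof -
   \<comment> \<open>\<open>speed_at_most\<close> yields the bound (m + e) h with equality allowed;
     the second e makes it strict, as \<open>coupling_estimate\<close> asks.\<close>
   have w: "0 < (m + 2 * e) * h" using m e h by simp
   have "(m + e) * h < (m + 2 * e) * h" using e h by simp
   then have W: "W p (\<mu> t) (\<mu> (t + \<sigma> * h)) < ennreal ((m + 2 * e) * h)"
    using \<delta>'(2)[OF h] w by (meson ennreal_lessI order.strict_trans1)
   have P: "\<mu> (t + \<sigma> * h) \<in> borel_probs" using probs \<delta>'(2)[OF h] by blast
   have "\<Phi> (t + \<sigma> * h) - \<Phi> t <= (m + 2 * e) * h * (N + 2 * e + L * ((m + 2 * e) * h / \<delta>) powr (p / q))"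
    unfolding \<Phi>_def N_def
    by (rule coupling_estimate[OF pq Pt P w W test_function_borel[OF \<psi>] B gm g(1) L0(2) e \<delta>(1) L0(1) \<delta>(2)[OF g(1) g(3)] lip])
   then show ?thesis using h by (simp add: field_simps)
  qed
  have "((\<lambda>h. \<Phi> (t + \<sigma> * h)) has_real_derivative D * \<sigma>) (at 0)"
   by (rule DERIV_chain2[where f = \<Phi>]) (use D in \<open>auto simp: \<Phi>_def[abs_def] intro!: derivative_eq_intros\<close>)
  then have "((\<lambda>h. (\<Phi> (t + \<sigma> * h) - \<Phi> t) / h) \<longlongrightarrow> \<sigma> * D) (at 0)"
   unfolding DERIV_def by (simp add: mult.commute)
  then have 1: "((\<lambda>h. (\<Phi> (t + \<sigma> * h) - \<Phi> t) / h) \<longlongrightarrow> \<sigma> * D) (at_right 0)"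
   by (rule tendsto_within_subset) simp
  have pq0: "0 < p / q" using pq by simp
  have "((\<lambda>h. (m + 2 * e) * h / \<delta>) \<longlongrightarrow> (m + 2 * e) * 0 / \<delta>) (at_right 0)" by (intro tendsto_intros) (use \<delta> in auto)
  then have "((\<lambda>h. ((m + 2 * e) * h / \<delta>) powr (p / q)) \<longlongrightarrow> 0) (at_right 0)"
  proof (intro tendsto_zero_powrI)
   show "eventually (\<lambda>h. 0 <= (m + 2 * e) * h / \<delta>) (at_right 0)"
    using m e \<delta> by (auto simp: eventually_at_filter)
  qed (use pq0 in auto)
  then have 2: "((\<lambda>h. (m + 2 * e) * (N + 2 * e + L * ((m + 2 * e) * h / \<delta>) powr (p / q))) \<longlongrightarrow> (m + 2 * e) * (N + 2 * e + L * 0)) (at_right 0)"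
   by (intro tendsto_intros)
  have "eventually (\<lambda>h. (\<Phi> (t + \<sigma> * h) - \<Phi> t) / h <= (m + 2 * e) * (N + 2 * e + L * ((m + 2 * e) * h / \<delta>) powr (p / q))) (at_right 0)"
   unfolding eventually_at_right_field using est \<delta>'(1) by auto
  from tendsto_le[OF _ 2 1 this] show ?thesis by simp
 qed
 have "((\<lambda>e. (m + 2 * e) * (N + 2 * e)) \<longlongrightarrow> (m + 2 * 0) * (N + 2 * 0)) (at_right 0)" by (intro tendsto_intros)
 moreover have "eventually (\<lambda>e. \<sigma> * D <= (m + 2 * e) * (N + 2 * e)) (at_right 0)"
  using main by (auto simp: eventually_at_filter)
 ultimately have "\<sigma> * D <= (m + 2 * 0) * (N + 2 * 0)" by (rule tendsto_lowerbound) simp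
 then show ?thesis by (simp add: N_def)
qed

end

section \<open>A measurable frame\<close>

lemma measurable_on_labels:
 fixes l :: "'m => nat"
 assumes l: "l \<in> M \<rightarrow>\<^sub>M count_space UNIV"
  and f: "!!k. f \<in> restrict_space M {w \<in> space M. l w = k} \<rightarrow>\<^sub>M N"
 shows "f \<in> M \<rightarrow>\<^sub>M N"
proof (rule measurable_piecewise_restrict[where C = "range (\<lambda>k. {w \<in> space M. l w = k})"])
 fix \<Omega> assume "\<Omega> \<in> range (\<lambda>k. {w \<in> space M. l w = k})"
 then obtain k where k: "\<Omega> = {w \<in> space M. l w = k}" by blast
 have "l -` {k} \<inter> space M \<in> sets M" by (rule measurable_sets[OF l]) simp
 also have "l -` {k} \<inter> space M = \<Omega> \<inter> space M" using k by auto
 finally show "\<Omega> \<inter> space M \<in> sets M" .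
 show "f \<in> restrict_space M \<Omega> \<rightarrow>\<^sub>M N" unfolding k by (rule f)
qed auto

context manifold
begin

lemma dphi_has_derivative:
 assumes "Ck_function 1 A \<phi>" "c \<in> A" and z: "z \<in> snd c ` fst c"
 shows "(\<phi> \<circ> chart_inv c has_derivative dphi \<phi> c z) (at z)"
proof -
 have "Ck_on (Suc 0) (snd c ` fst c) (\<phi> \<circ> chart_inv c)" using assms unfolding Ck_function_def One_nat_def by blast
 from Ck1_has_derivative[OF this z] show ?thesis unfolding dphi_def[abs_def] .
qed

lemma C1_linear_combination:
 assumes \<phi>: "Ck_function 1 A \<phi>" and \<psi>: "Ck_function 1 A \<psi>"
 shows "Ck_function 1 A (\<lambda>x. a * \<phi> x + b * \<psi> x)"
  "c \<in> A ==> z \<in> snd c ` fst c ==> dphi (\<lambda>x. a * \<phi> x + b * \<psi> x) c z v = a * dphi \<phi> c z v + b * dphi \<psi> c z v"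
proof -
 have D: "((\<lambda>x. a * \<phi> x + b * \<psi> x) \<circ> chart_inv c has_derivative
   (\<lambda>v. a * dphi \<phi> c z v + b * dphi \<psi> c z v)) (at z)" if c: "c \<in> A" and z: "z \<in> snd c ` fst c" for c z
 proof -
  have 1: "(\<phi> \<circ> chart_inv c has_derivative dphi \<phi> c z) (at z)" by (rule dphi_has_derivative[OF \<phi> c z])
  have 2: "(\<psi> \<circ> chart_inv c has_derivative dphi \<psi> c z) (at z)" by (rule dphi_has_derivative[OF \<psi> c z])
  have "((\<lambda>z. a * (\<phi> \<circ> chart_inv c) z + b * (\<psi> \<circ> chart_inv c) z) has_derivative
   (\<lambda>v. a * dphi \<phi> c z v + b * dphi \<psi> c z v)) (at z)"
   by (intro has_derivative_add has_derivative_mult_right 1 2)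
  then show ?thesis by (simp add: o_def)
 qed
 show E: "dphi (\<lambda>x. a * \<phi> x + b * \<psi> x) c z v = a * dphi \<phi> c z v + b * dphi \<psi> c z v"
  if "c \<in> A" "z \<in> snd c ` fst c" for c z v
  using fun_cong[OF frechet_derivative_at[OF D[OF that]], of v] unfolding dphi_def[of "\<lambda>x. a * \<phi> x + b * \<psi> x"] by (rule sym)
 show "Ck_function 1 A (\<lambda>x. a * \<phi> x + b * \<psi> x)" unfolding Ck_function_def One_nat_def Ck_on.simps
 proof (intro ballI conjI allI)
  fix c z assume c: "c \<in> A" and z: "z \<in> snd c ` fst c"
  show "(\<lambda>x. a * \<phi> x + b * \<psi> x) \<circ> chart_inv c differentiable (at z)"
   using D[OF c z] by (rule differentiableI)
 next
  fix c and v :: "real ^ 'n" assume c: "c \<in> A"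
  have co: "continuous_on (snd c ` fst c) (\<lambda>z. dphi \<zeta> c z v)" if "Ck_function 1 A \<zeta>" for \<zeta>
   using that c unfolding Ck_function_def dphi_def by simp
  have "continuous_on (snd c ` fst c) (\<lambda>z. a * dphi \<phi> c z v + b * dphi \<psi> c z v)"
   by (intro continuous_intros co \<phi> \<psi>)
  then show "continuous_on (snd c ` fst c) (\<lambda>z. frechet_derivative ((\<lambda>x. a * \<phi> x + b * \<psi> x) \<circ> chart_inv c) (at z) v)"
   by (rule continuous_on_eq) (use E[OF c] in \<open>simp add: dphi_def\<close>)
 qed
qed

lemma test_functions_linear_combination:
 assumes \<phi>: "\<phi> \<in> test_functions A" and \<psi>: "\<psi> \<in> test_functions A"
 shows "(\<lambda>x. a * \<phi> x + b * \<psi> x) \<in> test_functions A"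
proof -
 have "closure {x. a * \<phi> x + b * \<psi> x \<noteq> 0} \<subseteq> closure {x. \<phi> x \<noteq> 0} \<union> closure {x. \<psi> x \<noteq> 0}"
  unfolding closure_Un[symmetric] by (rule closure_mono) auto
 then have eq: "(closure {x. \<phi> x \<noteq> 0} \<union> closure {x. \<psi> x \<noteq> 0}) \<inter> closure {x. a * \<phi> x + b * \<psi> x \<noteq> 0} =
   closure {x. a * \<phi> x + b * \<psi> x \<noteq> 0}" by (rule Int_absorb1)
 have "compact (closure {x. \<phi> x \<noteq> 0} \<union> closure {x. \<psi> x \<noteq> 0})"
  using \<phi> \<psi> unfolding test_functions_def by (intro compact_Un) simp_all
 from compact_Int_closed[OF this closed_closure[of "{x. a * \<phi> x + b * \<psi> x \<noteq> 0}"]]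
 have "compact (closure {x. a * \<phi> x + b * \<psi> x \<noteq> 0})" unfolding eq .
 then show ?thesis using C1_linear_combination(1)[of \<phi> \<psi> a b] \<phi> \<psi> unfolding test_functions_def by simp
qed

end

text \<open>A countable cover by chart pieces on each of which F is comparable with the Euclidean
  norm, with constants depending on the piece. The first piece containing x selects the chart at x,
  which trivialises the tangent bundle measurably.\<close>

locale finsler_cells = finsler A F for A :: "('a::{t2_space, second_countable_topology}, 'n::finite) chart set" and F +
 fixes C :: "nat => ('a, 'n) chart" and B :: "nat => 'a set" and r R :: "nat => real"
 assumes C: "C k \<in> A" and B: "open (B k)" "B k \<subseteq> fst (C k)" and cover: "\<exists>k. x \<in> B k"
  and r: "0 < r k" and R: "0 < R k"
  and ge: "x \<in> B k ==> r k * norm y <= Fc (C k) (snd (C k) x) y"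
  and le: "x \<in> B k ==> Fc (C k) (snd (C k) x) y <= R k * norm y"
begin

definition idx :: "'a => nat" where "idx x = (LEAST k. x \<in> B k)"

lemma idx: "x \<in> B (idx x)" unfolding idx_def using cover by (rule LeastI_ex)
lemma idx_le: "x \<in> B k ==> idx x <= k" unfolding idx_def by (rule Least_le)

lemma idx_meas[measurable]: "idx \<in> borel \<rightarrow>\<^sub>M count_space UNIV"
 unfolding measurable_count_space_eq2_countable
proof (intro conjI ballI)
 fix k
 have "idx -` {k} = B k - (\<Union>j<k. B j)"
 proof (intro set_eqI iffI)
  fix x assume "x \<in> idx -` {k}"
  then show "x \<in> B k - (\<Union>j<k. B j)" using idx[of x] by (auto dest!: idx_le)
 next
  fix x assume x: "x \<in> B k - (\<Union>j<k. B j)"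
  then have "idx x <= k" "\<not> idx x < k" using idx_le[of x k] idx[of x] by auto
  then show "x \<in> idx -` {k}" by simp
 qed
 then show "idx -` {k} \<inter> space borel \<in> sets borel" using B(1) by simp
qed simp

definition ch :: "'a => ('a, 'n) chart" where "ch x = C (idx x)"
text \<open>Components are divided by the comparison constant of the cell; this makes the Finsler
  norm at least the Euclidean norm of the components, uniformly over the whole manifold, as
  \<open>dual_setting\<close> requires.\<close>

definition frame :: "'a => real ^ 'n => ('a, 'n) tvec" where
 "frame x y = tangent_of A (ch x) x (y /\<^sub>R r (idx x))"
definition G :: "'a => real ^ 'n => real" where
 "G x y = Fc (ch x) (snd (ch x) x) (y /\<^sub>R r (idx x))"
text \<open>The Legendre transform as a vector of components. Dividing by the cell constant is the
  dual of the rescaling in \<open>frame\<close>, so that the Euclidean inner product is the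
  pairing.\<close>

definition J :: "'a => real ^ 'n => real ^ 'n" where
 "J x y = (\<chi> i. DE (ch x) (snd (ch x) x) (y /\<^sub>R r (idx x)) (axis i 1) / r (idx x))"
definition cov :: "('a => real) => 'a => real ^ 'n" where
 "cov \<phi> x = (\<chi> i. dphi \<phi> (ch x) (snd (ch x) x) (axis i 1) / r (idx x))"

lemma ch: "ch x \<in> charts_at A x" "ch x \<in> A" "snd (ch x) x \<in> snd (ch x) ` fst (ch x)"
proof -
 have "x \<in> fst (ch x)" unfolding ch_def using idx[of x] B(2) by blast
 then show "ch x \<in> charts_at A x" "ch x \<in> A" "snd (ch x) x \<in> snd (ch x) ` fst (ch x)"
  using C unfolding ch_def charts_at_def by auto
qed

lemma linear_components:
 fixes L :: "real ^ 'n => real"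
 assumes "linear L" shows "(\<chi> i. L (axis i 1) / c) \<bullet> y = L (y /\<^sub>R c)"
proof -
 have "(\<Sum>j\<in>UNIV. (y /\<^sub>R c) $ j *\<^sub>R axis j 1) = y /\<^sub>R c"
  using basis_expansion[of "y /\<^sub>R c"] by (simp only: scalar_mult_eq_scaleR)
 then have "L (y /\<^sub>R c) = L (\<Sum>j\<in>UNIV. (y /\<^sub>R c) $ j *\<^sub>R axis j 1)" by (simp only:)
 also have "\<dots> = (\<Sum>j\<in>UNIV. (y /\<^sub>R c) $ j *\<^sub>R L (axis j 1))"
  by (simp only: linear_sum[OF assms] linear_scale[OF assms])
 also have "\<dots> = (\<chi> i. L (axis i 1) / c) \<bullet> y" by (simp add: inner_vec_def divide_inverse mult_ac)
 finally show ?thesis by simp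
qed

lemma J_inner: "J x y \<bullet> u = DE (ch x) (snd (ch x) x) (y /\<^sub>R r (idx x)) (u /\<^sub>R r (idx x))"
 unfolding J_def by (rule linear_components) (rule DE_linear[OF ch(2,3)])

lemma cov_inner: "Ck_function 1 A \<phi> ==> cov \<phi> x \<bullet> y = dphi \<phi> (ch x) (snd (ch x) x) (y /\<^sub>R r (idx x))"
 unfolding cov_def by (rule linear_components) (rule dphi_linear[OF _ ch(2,3)])

lemma G_ge: "norm y <= G x y"
proof -
 have "r (idx x) * norm (y /\<^sub>R r (idx x)) = norm y" using r[of "idx x"] by (simp add: mult.assoc[symmetric])
 then show ?thesis using ge[OF idx[of x], of "y /\<^sub>R r (idx x)"] unfolding G_def ch_def by (simp only:)
qed

lemma G_0: "G x 0 = 0" unfolding G_def using Fc_zero[OF ch(2,3)] by simp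
lemma J_self: "J x y \<bullet> y = (G x y)\<^sup>2" unfolding J_inner G_def by (rule Euler[OF ch(2,3)])
lemma J_le: "J x y \<bullet> u <= G x y * G x u" unfolding J_inner G_def by (rule fundamental_inequality[OF ch(2,3)])
lemma G_cont: "continuous_on UNIV (G x)" unfolding G_def
 by (rule Fc_continuous2[OF ch(2)]) (use ch(3) in \<open>auto intro!: continuous_intros\<close>)

lemma F_frame: "F (frame x y) = G x y" unfolding frame_def G_def by (rule Fc_chart[OF ch(1), symmetric])
lemma tneg_frame: "tneg (frame x y) = frame x (- y)" unfolding frame_def by (simp add: tneg_tangent_of[OF ch(1)])
lemma frame_tangent: "frame x y \<in> tangent_space A x"
 unfolding frame_def tangent_space_def using tangent_of_in_bundle[OF ch(1)] by simp
lemma pairing_frame: "Ck_function 1 A \<phi> ==> pairing A (frame x y) \<phi> = cov \<phi> x \<bullet> y"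
 unfolding frame_def cov_inner by (rule pairing_dphi[OF _ ch(1)])

lemma slope_cov:
 assumes \<phi>: "Ck_function 1 A \<phi>" and K: "!!y. cov \<phi> x \<bullet> y <= K * G x y"
 shows "slope_le \<phi> x K"
proof (rule slope_le_chart[OF \<phi> ch(1)])
 fix v :: "real ^ 'n"
 have "(r (idx x) *\<^sub>R v) /\<^sub>R r (idx x) = v" using r[of "idx x"] by simp
 then show "dphi \<phi> (ch x) (snd (ch x) x) v <= K * Fc (ch x) (snd (ch x) x) v"
  using K[of "r (idx x) *\<^sub>R v"] unfolding cov_inner[OF \<phi>] G_def by simp
qed

lemma ch_continuous: "continuous_on {w. idx (g w) = k} g ==> continuous_on {w. idx (g w) = k} (\<lambda>w. snd (C k) (g w))"
 "(\<lambda>w. snd (C k) (g w)) ` {w. idx (g w) = k} \<subseteq> snd (C k) ` fst (C k)"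
proof -
 have s: "g ` {w. idx (g w) = k} \<subseteq> fst (C k)" using idx B(2) by blast
 show "continuous_on {w. idx (g w) = k} g ==> continuous_on {w. idx (g w) = k} (\<lambda>w. snd (C k) (g w))"
  by (rule continuous_on_compose2[OF chart_cont(1)[OF C] _ s])
 show "(\<lambda>w. snd (C k) (g w)) ` {w. idx (g w) = k} \<subseteq> snd (C k) ` fst (C k)" using s by blast
qed

lemma G_meas: "(\<lambda>z. G (fst z) (snd z)) \<in> borel_measurable (borel \<Otimes>\<^sub>M borel)"
 unfolding borel_prod
proof (rule measurable_on_labels[of "\<lambda>z. idx (fst z)"])
 have "idx \<circ> fst \<in> (borel :: ('a \<times> (real ^ 'n)) measure) \<rightarrow>\<^sub>M count_space UNIV"
  by (rule measurable_comp[OF _ idx_meas]) (intro borel_measurable_continuous_onI continuous_intros)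
 then show "(\<lambda>z. idx (fst z)) \<in> (borel :: ('a \<times> (real ^ 'n)) measure) \<rightarrow>\<^sub>M count_space UNIV" by (simp add: o_def)
 fix k
 let ?S = "{w :: 'a \<times> (real ^ 'n). idx (fst w) = k}"
 have "continuous_on ?S (\<lambda>w. Fc (C k) (snd (C k) (fst w)) (snd w /\<^sub>R r k))"
  by (rule Fc_continuous2[OF C]) (intro ch_continuous continuous_intros)+
 then have "continuous_on ?S (\<lambda>w. G (fst w) (snd w))"
  by (rule continuous_on_eq) (auto simp: G_def ch_def)
 then show "(\<lambda>w. G (fst w) (snd w)) \<in> borel_measurable (restrict_space borel {w \<in> space borel. idx (fst w) = k})"
  by (intro borel_measurable_continuous_on_restrict) simp
qed

lemma J_meas: "(\<lambda>z. J (fst z) (snd z)) \<in> borel_measurable (borel \<Otimes>\<^sub>M borel)"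
 unfolding borel_prod
\<comment> \<open>Label 0 collects the zero section, where \<open>J\<close> is 0 by the convention
  in \<open>DE\<close>; the cells are shifted by one to make room. On each label \<open>J\<close> is
  continuous.\<close>
proof (rule measurable_on_labels[of "\<lambda>z. if snd z = 0 then 0 else Suc (idx (fst z))"])
 have [measurable]: "fst \<in> (borel :: ('a \<times> (real ^ 'n)) measure) \<rightarrow>\<^sub>M borel" "snd \<in> (borel :: ('a \<times> (real ^ 'n)) measure) \<rightarrow>\<^sub>M borel"
  by (intro borel_measurable_continuous_onI continuous_intros)+
 show "(\<lambda>z. if snd z = 0 then 0 else Suc (idx (fst z))) \<in> (borel :: ('a \<times> (real ^ 'n)) measure) \<rightarrow>\<^sub>M count_space UNIV"
  by measurable
 fix k
 let ?S = "{w :: 'a \<times> (real ^ 'n). (if snd w = 0 then 0 else Suc (idx (fst w))) = k}"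
 have "continuous_on ?S (\<lambda>w. J (fst w) (snd w))"
 proof (cases k)
  case 0
  have "J (fst w) (snd w) = 0" if "w \<in> ?S" for w
   using that 0 unfolding J_def DE_def by (auto simp: vec_eq_iff split: if_splits)
  then show ?thesis by (subst continuous_on_cong[OF refl, of _ _ "\<lambda>_. 0"]) auto
 next
  case (Suc j)
  have S: "?S \<subseteq> {w. idx (fst w) = j}" "!!w. w \<in> ?S ==> snd w \<noteq> 0" using Suc by (auto split: if_splits)
  have z: "continuous_on ?S (\<lambda>w. snd (C j) (fst w))" "(\<lambda>w. snd (C j) (fst w)) ` ?S \<subseteq> snd (C j) ` fst (C j)"
  proof -
   show "continuous_on ?S (\<lambda>w. snd (C j) (fst w))"
    by (rule continuous_on_subset[OF ch_continuous(1) S(1)]) (intro continuous_intros)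
   show "(\<lambda>w. snd (C j) (fst w)) ` ?S \<subseteq> snd (C j) ` fst (C j)"
    using order_trans[OF image_mono[OF S(1)] ch_continuous(2)[of j fst]] .
  qed
  have y: "continuous_on ?S (\<lambda>w. snd w /\<^sub>R r j)" by (intro continuous_intros)
  have "continuous_on ?S (\<lambda>w. DF (C j) (snd (C j) (fst w)) (snd w /\<^sub>R r j) v)" for v
  proof -
   have "continuous_on ?S (\<lambda>w. (\<lambda>(z, y). DF (C j) z y v) (snd (C j) (fst w), snd w /\<^sub>R r j))"
   proof (rule continuous_on_compose2[OF DF_continuous[OF C, of j v]])
    show "continuous_on ?S (\<lambda>w. (snd (C j) (fst w), snd w /\<^sub>R r j))" by (rule continuous_on_Pair[OF z(1) y])
    show "(\<lambda>w. (snd (C j) (fst w), snd w /\<^sub>R r j)) ` ?S \<subseteq> snd (C j) ` fst (C j) \<times> (UNIV - {0})"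
    proof (rule image_subsetI)
     fix w assume w: "w \<in> ?S"
     have "snd w /\<^sub>R r j \<noteq> 0" using S(2)[OF w] r[of j] by simp
     then show "(snd (C j) (fst w), snd w /\<^sub>R r j) \<in> snd (C j) ` fst (C j) \<times> (UNIV - {0})"
      using subsetD[OF z(2) imageI[OF w]] by (intro SigmaI) simp_all
    qed
   qed
   then show ?thesis by simp
  qed
  then have "continuous_on ?S (\<lambda>w. \<chi> i. Fc (C j) (snd (C j) (fst w)) (snd w /\<^sub>R r j) *
    DF (C j) (snd (C j) (fst w)) (snd w /\<^sub>R r j) (axis i 1) / r j)"
   using r[of j] by (intro continuous_intros Fc_continuous2[OF C z y]) auto
  then show ?thesis
  proof (rule continuous_on_eq)
   fix w assume w: "w \<in> ?S"
   have "idx (fst w) = j" "snd w \<noteq> 0" using subsetD[OF S(1) w] S(2)[OF w] by simp_all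
   then show "(\<chi> i. Fc (C j) (snd (C j) (fst w)) (snd w /\<^sub>R r j) *
    DF (C j) (snd (C j) (fst w)) (snd w /\<^sub>R r j) (axis i 1) / r j) = J (fst w) (snd w)"
    using r[of j] by (simp add: J_def DE_def ch_def)
  qed
 qed
 then show "(\<lambda>w. J (fst w) (snd w)) \<in> borel_measurable (restrict_space borel
   {w \<in> space borel. (if snd w = 0 then 0 else Suc (idx (fst w))) = k})"
  by (intro borel_measurable_continuous_on_restrict) simp
qed

lemma cov_meas:
 assumes \<phi>: "Ck_function 1 A \<phi>" shows "cov \<phi> \<in> borel_measurable borel"
proof (rule measurable_on_labels[OF idx_meas])
 fix k
 have "continuous_on {x. idx x = k} (\<lambda>x. dphi \<phi> (C k) (snd (C k) x) v)" for v
 proof -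
  have "continuous_on {x. idx x = k} (\<lambda>x. (\<lambda>(z, v). dphi \<phi> (C k) z v) (snd (C k) x, v))"
  proof (rule continuous_on_compose2[OF dphi_continuous[OF \<phi> C[of k]]])
   show "continuous_on {x. idx x = k} (\<lambda>x. (snd (C k) x, v))"
    by (rule continuous_on_Pair[OF ch_continuous(1)[of "\<lambda>x. x"] continuous_on_const]) (rule continuous_on_id)
   show "(\<lambda>x. (snd (C k) x, v)) ` {x. idx x = k} \<subseteq> snd (C k) ` fst (C k) \<times> UNIV"
   proof (rule image_subsetI)
    fix x assume "x \<in> {x. idx x = k}"
    from subsetD[OF ch_continuous(2)[of k "\<lambda>x. x"] imageI[OF this]]
    show "(snd (C k) x, v) \<in> snd (C k) ` fst (C k) \<times> UNIV" by (intro SigmaI) simp_all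
   qed
  qed
  then show ?thesis by simp
 qed
 then have "continuous_on {x. idx x = k} (\<lambda>x. \<chi> i. dphi \<phi> (C k) (snd (C k) x) (axis i 1) / r k)"
  using r[of k] by (intro continuous_intros) auto
 then have "continuous_on {x. idx x = k} (cov \<phi>)"
  by (rule continuous_on_eq) (auto simp: cov_def ch_def)
 then show "cov \<phi> \<in> borel_measurable (restrict_space borel {x \<in> space borel. idx x = k})"
  by (intro borel_measurable_continuous_on_restrict) simp
qed

lemma cov_linear_combination:
 assumes "Ck_function 1 A \<phi>" "Ck_function 1 A \<psi>"
 shows "cov (\<lambda>x. a * \<phi> x + b * \<psi> x) x = a *\<^sub>R cov \<phi> x + b *\<^sub>R cov \<psi> x"
 unfolding cov_def using C1_linear_combination(2)[OF assms ch(2,3)] by (simp add: vec_eq_iff add_divide_distrib)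

text \<open>The squared norm of the covector is its pairing with itself, at most L G <= L (R / r)
  times the norm. The ratio R / r depends on the cell, but the compact support meets only finitely
  many cells.\<close>

lemma cov_bounded:
 assumes \<phi>: "\<phi> \<in> test_functions A"
 obtains K where "!!x. norm (cov \<phi> x) <= K"
proof -
 obtain L where L: "0 <= L" "!!x. slope_le \<phi> x L" by (rule slope_bounded[OF \<phi>]) (rule that, assumption+)
 obtain J where "J \<subseteq> UNIV" "finite J" "supp \<phi> \<subseteq> (\<Union>k\<in>J. B k)"
 proof (rule compactE_image[OF test_compact[OF \<phi>], of UNIV B])
  show "supp \<phi> \<subseteq> (\<Union>k. B k)" using cover by blast
 qed (rule B(1), rule that, assumption+)
 obtain N where JN: "\<forall>k\<in>J. k <= N" using \<open>finite J\<close> unfolding finite_nat_set_iff_bounded_le by blast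
 \<comment> \<open>The label is the least index of a piece containing x, hence at most the index of
   any piece of the finite subcover that does.\<close>
 have N: "idx x <= N" if x: "x \<in> supp \<phi>" for x
 proof -
  obtain k where "k \<in> J" "x \<in> B k" using subsetD[OF \<open>supp \<phi> \<subseteq> _\<close> x] by blast
  then show ?thesis using idx_le[of x k] bspec[OF JN, of k] by simp
 qed
 define K where "K = (\<Sum>k\<le>N. L * (R k / r k))"
 have t: "0 <= L * (R k / r k)" for k using L(1) r[of k] R[of k] by simp
 have C1: "Ck_function 1 A \<phi>" by (rule test_C1[OF \<phi>])
 have "norm (cov \<phi> x) <= K" for x
 proof (cases "x \<in> supp \<phi>")
  case True
  have G: "G x y <= R (idx x) / r (idx x) * norm y" for y
   using le[OF idx[of x], of "y /\<^sub>R r (idx x)"] r[of "idx x"] unfolding G_def ch_def by (simp add: field_simps)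
  have "(norm (cov \<phi> x))\<^sup>2 <= L * G x (cov \<phi> x)"
   using L(2)[of x] ch(1)[of x] unfolding slope_le_def G_def power2_norm_eq_inner cov_inner[OF C1] by blast
  also have "\<dots> <= L * (R (idx x) / r (idx x)) * norm (cov \<phi> x)"
   using mult_left_mono[OF G L(1)] by (simp add: mult.assoc)
  finally have *: "norm (cov \<phi> x) * norm (cov \<phi> x) <= L * (R (idx x) / r (idx x)) * norm (cov \<phi> x)"
   by (simp only: power2_eq_square)
  have "norm (cov \<phi> x) <= L * (R (idx x) / r (idx x))"
  proof (cases "cov \<phi> x = 0")
   case True then show ?thesis using t[of "idx x"] by simp
  next
   case False then show ?thesis by (intro mult_right_le_imp_le[OF *]) simp
  qed
  also have "\<dots> <= K" unfolding K_def by (rule member_le_sum) (use N[OF True] t in auto)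
  finally show ?thesis .
 next
  case False
  have "(norm (cov \<phi> x))\<^sup>2 <= 0 * G x (cov \<phi> x)"
   using slope_off_support[OF C1 False order_refl] ch(1)[of x]
   unfolding slope_le_def G_def power2_norm_eq_inner cov_inner[OF C1] by blast
  then have "cov \<phi> x = 0" by simp
  then show ?thesis unfolding K_def using t by (simp add: sum_nonneg)
 qed
 then show thesis by (rule that)
qed

text \<open>On one cell \<open>frame\<close> is a fixed bundle chart evaluated at the coordinates of
  X and the rescaled components Y, and openness in the bundle is defined by preimages under such
  charts.\<close>

lemma frame_measurable:
 assumes X: "X \<in> M \<rightarrow>\<^sub>M borel" and Y: "Y \<in> M \<rightarrow>\<^sub>M borel"
 shows "(\<lambda>w. frame (X w) (Y w)) \<in> M \<rightarrow>\<^sub>M tangent_borel A"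
proof (rule measurable_on_labels[of "\<lambda>w. idx (X w)"])
 show "(\<lambda>w. idx (X w)) \<in> M \<rightarrow>\<^sub>M count_space UNIV" by (rule measurable_compose[OF X idx_meas])
 fix k
 let ?M = "restrict_space M {w \<in> space M. idx (X w) = k}"
 have sp: "space ?M = {w \<in> space M. idx (X w) = k}" by (auto simp: space_restrict_space)
 have "snd (C k) \<in> borel_measurable (restrict_space borel {x. idx x = k})"
  by (intro borel_measurable_continuous_on_restrict ch_continuous(1)[of "\<lambda>x. x"] continuous_intros)
 moreover have "X \<in> ?M \<rightarrow>\<^sub>M restrict_space borel {x. idx x = k}"
  by (rule measurable_restrict_space3[OF X]) auto
 ultimately have 1: "(\<lambda>w. snd (C k) (X w)) \<in> ?M \<rightarrow>\<^sub>M borel" by (rule measurable_compose[rotated])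
 have "Y \<in> ?M \<rightarrow>\<^sub>M borel" by (rule measurable_restrict_space1[OF Y])
 then have 2: "(\<lambda>w. Y w /\<^sub>R r k) \<in> ?M \<rightarrow>\<^sub>M borel" by measurable
 have g: "(\<lambda>w. (snd (C k) (X w), Y w /\<^sub>R r k)) \<in> ?M \<rightarrow>\<^sub>M borel" using borel_measurable_Pair[OF 1 2] .
 show "(\<lambda>w. frame (X w) (Y w)) \<in> ?M \<rightarrow>\<^sub>M tangent_borel A" unfolding tangent_borel_def
 proof (rule measurable_measure_of)
  show "{S. openin (tangent_topology A) S} \<subseteq> Pow (tangent_bundle A)"
   by (auto simp: openin_tangent_topology)
  show "(\<lambda>w. frame (X w) (Y w)) \<in> space ?M \<rightarrow> tangent_bundle A"
   using frame_tangent unfolding tangent_space_def by auto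
  fix S assume "S \<in> {S. openin (tangent_topology A) S}"
  then have "open {(z, y). z \<in> snd (C k) ` fst (C k) \<and> tangent_of A (C k) (chart_inv (C k) z) y \<in> S}" (is "open ?O")
   using C[of k] unfolding openin_tangent_topology mem_Collect_eq by blast
  moreover define Q where "Q = ?O"
  ultimately have "(\<lambda>w. (snd (C k) (X w), Y w /\<^sub>R r k)) -` Q \<inter> space ?M \<in> sets ?M"
   by (intro measurable_sets[OF g]) simp
  also have "(\<lambda>w. (snd (C k) (X w), Y w /\<^sub>R r k)) -` Q \<inter> space ?M = (\<lambda>w. frame (X w) (Y w)) -` S \<inter> space ?M"
  proof -
   have "(snd (C k) (X w), Y w /\<^sub>R r k) \<in> Q \<longleftrightarrow> frame (X w) (Y w) \<in> S" if "w \<in> space ?M" for w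
   proof -
    have k: "idx (X w) = k" using that sp by simp
    have "snd (C k) (X w) \<in> snd (C k) ` fst (C k)" using ch(3)[of "X w"] k by (simp add: ch_def)
    moreover have "chart_inv (C k) (snd (C k) (X w)) = X w"
     by (rule chart_inv[OF C]) (use idx[of "X w"] k B(2)[of k] in blast)
    ultimately show ?thesis using k by (simp add: frame_def ch_def Q_def)
   qed
   then show ?thesis by blast
  qed
  finally show "(\<lambda>w. frame (X w) (Y w)) -` S \<inter> space ?M \<in> sets ?M" .
 qed
qed

end

text \<open>Every point has a coordinate ball with comparison constants by
  \<open>local_comparison\<close>; second countability reduces the cover to a sequence.\<close>

lemma (in finsler) finsler_cells_exist: "\<exists>C B r R. finsler_cells A F C B r R"
proof -
 define P where "P U c r R \<longleftrightarrow> c \<in> A \<and> open U \<and> U \<subseteq> fst c \<and> 0 < r \<and> 0 < R \<and>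
   (\<forall>x\<in>U. \<forall>y. r * norm y <= Fc c (snd c x) y \<and> Fc c (snd c x) y <= R * norm y)" for U c and r R :: real
 define \<U> where "\<U> = {U. \<exists>c r R. P U c r R}"
 have ex: "\<exists>U\<in>\<U>. x \<in> U" for x
 proof -
  obtain c where c: "c \<in> charts_at A x" using charts_at_nonempty by blast
  obtain \<rho> r R where \<rho>: "0 < \<rho>" and rR: "0 < r" "0 < R" and sub: "cball (snd c x) \<rho> \<subseteq> snd c ` fst c"
   and 1: "!!z y. z \<in> cball (snd c x) \<rho> ==> r * norm y <= Fc c z y"
   and 2: "!!z y. z \<in> cball (snd c x) \<rho> ==> Fc c z y <= R * norm y"
   by (rule local_comparison[OF c]) (rule that, assumption+)
  have cA: "c \<in> A" "x \<in> fst c" using charts_atD[OF c] by auto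
  have bs: "ball (snd c x) \<rho> \<subseteq> snd c ` fst c" using sub ball_subset_cball by blast
  have "P (chart_inv c ` ball (snd c x) \<rho>) c r R" unfolding P_def
  proof (intro conjI ballI allI)
   show "open (chart_inv c ` ball (snd c x) \<rho>)" by (rule open_chart_inv_image[OF cA(1) _ bs]) simp
   show "chart_inv c ` ball (snd c x) \<rho> \<subseteq> fst c" using chart_inv_in[OF cA(1)] bs by blast
   fix u y assume "u \<in> chart_inv c ` ball (snd c x) \<rho>"
   then have "snd c u \<in> cball (snd c x) \<rho>" using chart_inv2[OF cA(1)] bs by auto
   then show "r * norm y <= Fc c (snd c u) y" "Fc c (snd c u) y <= R * norm y" using 1 2 by auto
  qed (use cA rR in auto)
  moreover have "x \<in> chart_inv c ` ball (snd c x) \<rho>"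
   using chart_inv[OF cA] \<rho> by (intro image_eqI[of _ _ "snd c x"]) auto
  ultimately show ?thesis unfolding \<U>_def by blast
 qed
 obtain \<V> where V: "\<V> \<subseteq> \<U>" "countable \<V>" "\<Union>\<V> = \<Union>\<U>"
  by (rule Lindelof[of \<U>]) (auto simp: \<U>_def P_def)
 have "\<V> \<noteq> {}" using V(3) ex by blast
 then have rg: "range (from_nat_into \<V>) = \<V>" using V(2) by (rule range_from_nat_into)
 have "\<forall>k. \<exists>crR. P (from_nat_into \<V> k) (fst crR) (fst (snd crR)) (snd (snd crR))"
 proof
  fix k
  have "from_nat_into \<V> k \<in> \<U>" using rg V(1) by blast
  then show "\<exists>crR. P (from_nat_into \<V> k) (fst crR) (fst (snd crR)) (snd (snd crR))" unfolding \<U>_def by auto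
 qed
 from choice[OF this] obtain s where "\<forall>k. P (from_nat_into \<V> k) (fst (s k)) (fst (snd (s k))) (snd (snd (s k)))" by blast
 then have s: "P (from_nat_into \<V> k) (fst (s k)) (fst (snd (s k))) (snd (snd (s k)))" for k by blast
 have "finsler_cells A F (\<lambda>k. fst (s k)) (from_nat_into \<V>) (\<lambda>k. fst (snd (s k))) (\<lambda>k. snd (snd (s k)))"
 proof (rule finsler_cells.intro[OF finsler_axioms], rule finsler_cells_axioms.intro)
  fix x :: 'a and y :: "real ^ 'n" and k
  obtain U where U: "U \<in> \<V>" "x \<in> U" using ex[of x] V(3) by blast
  then obtain k' where "U = from_nat_into \<V> k'" using rg by blast
  with U show "\<exists>k. x \<in> from_nat_into \<V> k" by blast
  show "fst (s k) \<in> A" "open (from_nat_into \<V> k)" "from_nat_into \<V> k \<subseteq> fst (fst (s k))" "0 < fst (snd (s k))" "0 < snd (snd (s k))"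
   using s[of k] unfolding P_def by simp_all
  assume x: "x \<in> from_nat_into \<V> k"
  show "fst (snd (s k)) * norm y <= Fc (fst (s k)) (snd (fst (s k)) x) y"
   "Fc (fst (s k)) (snd (fst (s k)) x) y <= snd (snd (s k)) * norm y"
   using s[of k] x unfolding P_def by simp_all
 qed
 then show ?thesis by blast
qed

section \<open>Derivatives almost everywhere and integration by parts in time\<close>

lemma absolutely_continuous_real_derivative:
 fixes f \<phi> :: "real => real"
 assumes f: "f \<in> borel_measurable borel" and f0: "!!t. 0 <= f t"
  and i: "set_integrable lborel {0..1} f"
  and \<phi>: "!!s t. 0 <= s ==> s <= t ==> t <= 1 ==> \<bar>\<phi> t - \<phi> s\<bar> <= (LINT y:{s..t}|lborel. f y)"
 obtains u where "u \<in> borel_measurable borel" "set_integrable lborel {0..1} u"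
  "\<phi> 1 - \<phi> 0 = (LINT y:{0..1}|lborel. u y)"
  "AE t in lborel. 0 < t \<and> t < 1 --> (\<phi> has_real_derivative u t) (at t)"
proof -
 obtain u where u: "u \<in> borel_measurable borel" "set_integrable lborel {0..1} u"
  and inc: "!!s t. 0 <= s ==> s <= t ==> t <= 1 ==> \<phi> t - \<phi> s = (LINT y:{s..t}|lborel. u y)"
  by (rule absolutely_continuous_real[OF f f0 i \<phi>]) (assumption | (rule that; assumption))+
 have "AE t in lborel. 0 < t \<and> t < 1 --> (\<phi> has_real_derivative u t) (at t)"
  using lebesgue_differentiation[OF u]
 proof (eventually_elim, intro impI)
  fix t assume H: "0 < t \<and> t < 1 --> (\<forall>e>0. \<exists>d>0. \<forall>s t'. short_interval t d s t' -->
   \<bar>(LINT y:{s..t'}|lborel. u y) - u t * (t' - s)\<bar> <= e * (t' - s))" and t: "0 < t \<and> t < 1"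
  have "((\<lambda>h. (\<phi> (t + h) - \<phi> t) / h) \<longlongrightarrow> u t) (at 0)"
  proof (rule tendstoI)
   fix e :: real assume e: "0 < e"
   obtain d where d: "0 < d" "\<forall>s t'. short_interval t d s t' -->
    \<bar>(LINT y:{s..t'}|lborel. u y) - u t * (t' - s)\<bar> <= e / 2 * (t' - s)"
    using H[THEN mp, OF t, THEN spec, THEN mp, OF half_gt_zero[OF e]] by blast
   have ev: "eventually (\<lambda>h. h \<noteq> 0 \<and> \<bar>h\<bar> < min d (min t (1 - t))) (at (0 :: real))"
    unfolding eventually_at using d t by (intro exI[of _ "min d (min t (1 - t))"]) (simp add: dist_real_def)
   show "eventually (\<lambda>h. dist ((\<phi> (t + h) - \<phi> t) / h) (u t) < e) (at 0)" using ev
   proof eventually_elim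
    case (elim h)
    have "\<bar>\<phi> (t + h) - \<phi> t - u t * h\<bar> <= e / 2 * \<bar>h\<bar>"
    proof (cases "0 < h")
     case True
     have "\<bar>(LINT y:{t..t + h}|lborel. u y) - u t * (t + h - t)\<bar> <= e / 2 * (t + h - t)"
      using d(2)[rule_format, of t "t + h"] elim t True by simp
     moreover have "\<phi> (t + h) - \<phi> t = (LINT y:{t..t + h}|lborel. u y)" by (rule inc) (use elim t True in auto)
     ultimately show ?thesis using True by simp
    next
     case False
     then have h: "h < 0" using elim by simp
     have "\<bar>(LINT y:{t + h..t}|lborel. u y) - u t * (t - (t + h))\<bar> <= e / 2 * (t - (t + h))"
      using d(2)[rule_format, of "t + h" t] elim t h by simp
     moreover have "\<phi> t - \<phi> (t + h) = (LINT y:{t + h..t}|lborel. u y)" by (rule inc) (use elim t h in auto)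
     ultimately have "\<bar>\<phi> t - \<phi> (t + h) + u t * h\<bar> <= e / 2 * (- h)" by simp
     moreover have "\<phi> (t + h) - \<phi> t - u t * h = - (\<phi> t - \<phi> (t + h) + u t * h)" by simp
     ultimately show ?thesis using h by (simp only: abs_minus_cancel abs_of_neg)
    qed
    moreover have "(\<phi> (t + h) - \<phi> t) / h - u t = (\<phi> (t + h) - \<phi> t - u t * h) / h"
     using elim by (simp add: diff_divide_distrib)
    ultimately have "\<bar>(\<phi> (t + h) - \<phi> t) / h - u t\<bar> <= e / 2"
     using elim by (simp add: divide_le_eq)
    then show ?case using e unfolding dist_real_def by linarith
   qed
  qed
  then show "(\<phi> has_real_derivative u t) (at t)" unfolding DERIV_def .
 qed
 with u inc[of 0 1] show thesis by (intro that) auto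
qed

lemma set_integral_Ioo_Icc: "(LINT t:{0<..<1}|lborel. g t) = (LINT t:{0..1}|lborel. g t)" for g :: "real => real"
 by (rule set_integral_discrete_difference[where X = "{0, 1}"]) auto

lemma smooth_real:
 fixes \<eta> :: "real => real"
 assumes "smooth_on UNIV \<eta>"
 shows "(\<eta> has_real_derivative deriv \<eta> t) (at t)" "continuous_on UNIV \<eta>" "continuous_on UNIV (deriv \<eta>)"
proof -
 have c: "Ck_on (Suc 0) UNIV \<eta>" using assms unfolding smooth_on_def by blast
 have D: "(\<eta> has_real_derivative deriv \<eta> t) (at t)" for t
  using c DERIV_deriv_iff_real_differentiable[of \<eta> t] by simp
 show "(\<eta> has_real_derivative deriv \<eta> t) (at t)" by (rule D)
 show "continuous_on UNIV \<eta>" using D by (intro DERIV_continuous_on) auto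
 have "frechet_derivative \<eta> (at t) 1 = deriv \<eta> t" for t
  using fun_cong[OF frechet_derivative_at[OF D[unfolded has_field_derivative_def]], of t 1] by simp
 moreover have "continuous_on UNIV (\<lambda>t. frechet_derivative \<eta> (at t) 1)" using c by simp
 ultimately show "continuous_on UNIV (deriv \<eta>)" by (simp cong: continuous_on_cong)
qed

text \<open>\<open>\<eta> \<phi>\<close> is again absolutely continuous.\<close>

lemma integration_by_parts:
 fixes f \<phi> \<eta> u :: "real => real"
 assumes f: "f \<in> borel_measurable borel" and f0: "!!t. 0 <= f t"
  and i: "set_integrable lborel {0..1} f"
  and \<phi>: "!!s t. 0 <= s ==> s <= t ==> t <= 1 ==> \<bar>\<phi> t - \<phi> s\<bar> <= (LINT y:{s..t}|lborel. f y)"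
  and cont: "continuous_on {0..1} \<phi>"
  and u: "u \<in> borel_measurable borel" "set_integrable lborel {0..1} u"
  and D: "AE t in lborel. 0 < t \<and> t < 1 --> (\<phi> has_real_derivative u t) (at t)"
  and \<eta>: "smooth_on UNIV \<eta>" "\<eta> 0 = 0" "\<eta> 1 = 0"
 shows "- (LINT t:{0..1}|lborel. deriv \<eta> t * \<phi> t) = (LINT t:{0..1}|lborel. \<eta> t * u t)"
proof -
 note \<eta>' = smooth_real[OF \<eta>(1)]
 have bound: "\<exists>b\<ge>0. \<forall>t\<in>{0..1}. \<bar>g t\<bar> <= b" if "continuous_on {0..1} g" for g :: "real => real"
 proof -
  have "bounded (g ` {0..1})" by (intro compact_imp_bounded compact_continuous_image that compact_Icc)
  then obtain b where "\<forall>y\<in>g ` {0..1}. \<bar>y\<bar> <= b" unfolding bounded_real by blast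
  then show ?thesis by (intro exI[of _ "max b 0"]) auto
 qed
 obtain b where b: "0 <= b" "\<forall>t\<in>{0..1}. \<bar>\<eta> t\<bar> <= b" using bound[OF continuous_on_subset[OF \<eta>'(2)]] by blast
 obtain l where l: "0 <= l" "\<forall>t\<in>{0..1}. \<bar>deriv \<eta> t\<bar> <= l" using bound[OF continuous_on_subset[OF \<eta>'(3)]] by blast
 obtain k where k: "0 <= k" "\<forall>t\<in>{0..1}. \<bar>\<phi> t\<bar> <= k" using bound[OF cont] by blast
 have lip: "\<bar>\<eta> t - \<eta> s\<bar> <= l * (t - s)" if "0 <= s" "s <= t" "t <= 1" for s t
 proof -
  have "norm (\<eta> t - \<eta> s) <= l * norm (t - s)"
   by (rule field_differentiable_bound[of "{0..1}" \<eta> "deriv \<eta>"])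
    (use that l in \<open>auto intro: has_field_derivative_at_within \<eta>'(1)\<close>)
  then show ?thesis using that by simp
 qed
 \<comment> \<open>With |\<eta>| <= b, |\<phi>| <= k and \<eta> Lipschitz with constant l on [0, 1],
   the integral of this function bounds the increments of the product.\<close>
 define g where "g t = b * f t + k * l" for t
 have gb: "g \<in> borel_measurable borel" unfolding g_def using f by measurable
 have ib: "set_integrable lborel {s..t} (\<lambda>t. b * f t)" "set_integrable lborel {s..t} (\<lambda>_. k * l)" if "0 <= s" "t <= 1" for s t
 proof -
  have "set_integrable lborel {s..t} f" by (rule set_integrable_subset[OF i]) (use that in auto)
  then show "set_integrable lborel {s..t} (\<lambda>t. b * f t)" by simp
  show "set_integrable lborel {s..t} (\<lambda>_. k * l)" by (rule borel_integrable_atLeastAtMost') (rule continuous_on_const)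
 qed
 have gi: "set_integrable lborel {0..1} g" unfolding g_def by (rule set_integral_add(1)[OF ib]) auto
 have g0: "0 <= g t" for t unfolding g_def using b(1) f0[of t] k(1) l(1) by simp
 define H where "H t = \<eta> t * \<phi> t" for t
 have H: "\<bar>H t - H s\<bar> <= (LINT y:{s..t}|lborel. g y)" if st: "0 <= s" "s <= t" "t <= 1" for s t
 proof -
  have "H t - H s = \<eta> t * (\<phi> t - \<phi> s) + \<phi> s * (\<eta> t - \<eta> s)" unfolding H_def by (simp add: algebra_simps)
  then have "\<bar>H t - H s\<bar> <= \<bar>\<eta> t\<bar> * \<bar>\<phi> t - \<phi> s\<bar> + \<bar>\<phi> s\<bar> * \<bar>\<eta> t - \<eta> s\<bar>" using abs_triangle_ineq[of "\<eta> t * (\<phi> t - \<phi> s)" "\<phi> s * (\<eta> t - \<eta> s)"] by (simp only: abs_mult)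
  also have "\<dots> <= b * (LINT y:{s..t}|lborel. f y) + k * (l * (t - s))"
   using b k st by (intro add_mono mult_mono \<phi> lip) auto
  also have "\<dots> = (LINT y:{s..t}|lborel. g y)"
  proof -
   have "(LINT y:{s..t}|lborel. k * l) = k * (l * (t - s))" unfolding set_lebesgue_integral_def using st by simp
   moreover have "(LINT y:{s..t}|lborel. b * f y) = b * (LINT y:{s..t}|lborel. f y)" by simp
   ultimately show ?thesis unfolding g_def using set_integral_add(2)[OF ib[OF st(1,3)]] by (simp only:)
  qed
  finally show ?thesis .
 qed
 obtain w where w: "w \<in> borel_measurable borel" "set_integrable lborel {0..1} w"
  and Hw: "H 1 - H 0 = (LINT y:{0..1}|lborel. w y)"
  and Dw: "AE t in lborel. 0 < t \<and> t < 1 --> (H has_real_derivative w t) (at t)"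
  by (rule absolutely_continuous_real_derivative[OF gb g0 gi H]) (assumption | (rule that; assumption))+
 have i1: "set_integrable lborel {0..1} (\<lambda>t. deriv \<eta> t * \<phi> t)"
  by (intro borel_integrable_atLeastAtMost' continuous_intros continuous_on_subset[OF \<eta>'(3)] cont) simp
 have i2: "set_integrable lborel {0..1} (\<lambda>t. \<eta> t * u t)"
  unfolding set_integrable_def
 proof (rule Bochner_Integration.integrable_bound)
  show "integrable lborel (\<lambda>t. b * (indicator {0..1} t *\<^sub>R u t))" using u(2) unfolding set_integrable_def by simp
  have "\<eta> \<in> borel_measurable borel" by (rule borel_measurable_continuous_onI[OF \<eta>'(2)])
  then show "(\<lambda>t. indicator {0..1} t *\<^sub>R (\<eta> t * u t)) \<in> borel_measurable lborel" using u(1) by simp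
  show "AE t in lborel. norm (indicator {0..1} t *\<^sub>R (\<eta> t * u t)) <= norm (b * (indicator {0..1} t *\<^sub>R u t))"
   using b by (intro AE_I2) (auto split: split_indicator simp: abs_mult intro!: mult_right_mono)
 qed
 have e01: "AE t in lborel. t \<noteq> 0 \<and> t \<noteq> (1::real)" using AE_lborel_singleton[of "0::real"] AE_lborel_singleton[of "1::real"] by eventually_elim simp
 have "(LINT t:{0..1}|lborel. w t) = (LINT t:{0..1}|lborel. deriv \<eta> t * \<phi> t + \<eta> t * u t)"
  unfolding set_lebesgue_integral_def
 proof (rule integral_cong_AE)
  show "AE t in lborel. indicator {0..1} t *\<^sub>R w t = indicator {0..1} t *\<^sub>R (deriv \<eta> t * \<phi> t + \<eta> t * u t)"
   using Dw D e01
  proof eventually_elim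
   case (elim t)
   show ?case
   proof (cases "0 < t \<and> t < 1")
    case True
    have "(H has_real_derivative deriv \<eta> t * \<phi> t + u t * \<eta> t) (at t)" unfolding H_def[abs_def]
     by (rule DERIV_mult[OF \<eta>'(1)]) (use elim True in blast)
    moreover have "(H has_real_derivative w t) (at t)" using elim True by blast
    ultimately have "deriv \<eta> t * \<phi> t + u t * \<eta> t = w t" by (rule DERIV_unique)
    then show ?thesis by (simp add: mult.commute)
   qed (use elim in \<open>auto split: split_indicator\<close>)
  qed
  show "(\<lambda>t. indicator {0..1} t *\<^sub>R w t) \<in> borel_measurable lborel" using w(1) by simp
  show "(\<lambda>t. indicator {0..1} t *\<^sub>R (deriv \<eta> t * \<phi> t + \<eta> t * u t)) \<in> borel_measurable lborel"
   using set_integral_add(1)[OF i1 i2] unfolding set_integrable_def by (rule borel_measurable_integrable)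
 qed
 also have "\<dots> = (LINT t:{0..1}|lborel. deriv \<eta> t * \<phi> t) + (LINT t:{0..1}|lborel. \<eta> t * u t)"
  by (rule set_integral_add(2)[OF i1 i2])
 finally show ?thesis using Hw \<eta> unfolding H_def by simp
qed

section \<open>The space-time measure and test functions along the curve\<close>

context finsler_curve
begin

lemma time_space_sets: "sets (T \<Otimes>\<^sub>M (borel :: 'a measure)) = sets time_space_borel"
proof (rule antisym)
 let ?R = "restrict_space borel ({0..1} \<times> UNIV) :: (real \<times> 'a) measure"
 have sp: "space (T \<Otimes>\<^sub>M (borel :: 'a measure)) = {0..1} \<times> UNIV" "space ?R = {0..1} \<times> UNIV"
  by (simp_all add: space_pair_measure space_restrict_space)
 have T1: "(\<lambda>t. t) \<in> T \<rightarrow>\<^sub>M borel" by (rule borel_T) simp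
 have "(\<lambda>z. (fst z, snd z)) \<in> (T \<Otimes>\<^sub>M (borel :: 'a measure)) \<rightarrow>\<^sub>M borel"
  by (rule borel_measurable_Pair) (use measurable_compose[OF measurable_fst T1] measurable_snd in auto)
 then have 1: "(\<lambda>z. z) \<in> (T \<Otimes>\<^sub>M (borel :: 'a measure)) \<rightarrow>\<^sub>M ?R"
  by (intro measurable_restrict_space2) (auto simp: sp)
 have f: "fst \<in> (borel :: (real \<times> 'a) measure) \<rightarrow>\<^sub>M lborel" "snd \<in> (borel :: (real \<times> 'a) measure) \<rightarrow>\<^sub>M borel"
  by (simp_all add: borel_measurable_continuous_onI continuous_on_fst continuous_on_snd)
 have "fst \<in> ?R \<rightarrow>\<^sub>M T" unfolding T_def
  by (rule measurable_restrict_space3[OF f(1)]) auto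
 moreover have "snd \<in> ?R \<rightarrow>\<^sub>M borel" by (rule measurable_restrict_space1[OF f(2)])
 ultimately have "(\<lambda>z. (fst z, snd z)) \<in> ?R \<rightarrow>\<^sub>M T \<Otimes>\<^sub>M borel" by (rule measurable_Pair)
 then have 2: "(\<lambda>z. z) \<in> ?R \<rightarrow>\<^sub>M T \<Otimes>\<^sub>M borel" by simp
 show "sets (T \<Otimes>\<^sub>M (borel :: 'a measure)) \<subseteq> sets time_space_borel" unfolding time_space_borel_def
 proof
  fix E assume E: "E \<in> sets (T \<Otimes>\<^sub>M (borel :: 'a measure))"
  then have "E \<subseteq> {0..1} \<times> UNIV" using sets.sets_into_space sp(1) by blast
  then show "E \<in> sets ?R" using measurable_sets[OF 2 E] sp(2) by (simp add: Int_absorb2)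
 qed
 show "sets time_space_borel \<subseteq> sets (T \<Otimes>\<^sub>M (borel :: 'a measure))" unfolding time_space_borel_def
 proof
  fix E assume E: "E \<in> sets ?R"
  then have "E \<subseteq> {0..1} \<times> UNIV" using sets.sets_into_space sp(2) by blast
  then show "E \<in> sets (T \<Otimes>\<^sub>M borel)" using measurable_sets[OF 1 E] sp(1) by (simp add: Int_absorb2)
 qed
qed

text \<open>Fubini gives the defining identity for \<open>joint\<close>, and testing it with
  indicators gives uniqueness, so the definite description in \<open>associated_measure\<close> is
  resolved.\<close>

lemma associated_measure_joint: "associated_measure \<mu> = joint"
 unfolding associated_measure_def
proof (rule the_equality)
 let ?P = "\<lambda>m. prob_space m \<and> sets m = sets time_space_borel \<and>
   (\<forall>\<phi> \<in> borel_measurable time_space_borel. bounded (\<phi> ` ({0..1} \<times> UNIV)) -->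
    (LINT z|m. \<phi> z) = (LINT t:{0..1}|lborel. (LINT x|\<mu> t. \<phi> (t, x) :: real)))"
 show P: "?P joint"
 proof (intro conjI ballI impI)
  show "prob_space joint" by (rule prob_space_joint)
  show "sets joint = sets time_space_borel" using time_space_sets by simp
  fix \<phi> :: "real \<times> 'a => real"
  assume m: "\<phi> \<in> borel_measurable time_space_borel" and b: "bounded (\<phi> ` ({0..1} \<times> UNIV))"
  interpret P: prob_space joint by (rule prob_space_joint)
  obtain K where K: "\<forall>y\<in>\<phi> ` ({0..1} \<times> UNIV). \<bar>y\<bar> <= K" using b unfolding bounded_real by blast
  have "integrable joint \<phi>"
  proof (rule P.integrable_const_bound)
   show "AE z in joint. norm (\<phi> z) <= K" using K by (intro AE_I2) (auto simp: space_pair_measure)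
   show "\<phi> \<in> borel_measurable joint" using m by (simp only: measurable_joint measurable_cong_sets[OF time_space_sets refl])
  qed
  then show "(LINT z|joint. \<phi> z) = (LINT t:{0..1}|lborel. (LINT x|\<mu> t. \<phi> (t, x)))"
   by (subst integral_joint(3)) (simp_all add: integral_T)
 qed
 fix M :: "(real \<times> 'a) measure" assume M: "?P M"
 show "M = joint"
 proof (rule measure_eqI)
  show s: "sets M = sets joint" using M P by simp
  fix E assume E: "E \<in> sets M"
  interpret M: prob_space M using M by simp
  interpret N: prob_space joint by (rule prob_space_joint)
  have E': "E \<in> sets joint" "E \<in> sets time_space_borel" using E s M by simp_all
  have i: "(indicator E :: real \<times> 'a => real) \<in> borel_measurable time_space_borel" using E'(2) by simp
  have b: "bounded ((indicator E :: real \<times> 'a => real) ` ({0..1} \<times> UNIV))"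
   unfolding bounded_real by (intro exI[of _ 1]) (auto split: split_indicator)
  have "(LINT z|M. indicator E z) = (LINT t:{0..1}|lborel. (LINT x|\<mu> t. indicator E (t, x) :: real))" using M i b by blast
  moreover have "(LINT z|joint. indicator E z) = (LINT t:{0..1}|lborel. (LINT x|\<mu> t. indicator E (t, x) :: real))" using P i b by blast
  ultimately have "(LINT z|M. indicator E z :: real) = (LINT z|joint. indicator E z)" by simp
  then have "measure M E = measure joint E" using E E'(1) by simp
  then show "emeasure M E = emeasure joint E" by (simp only: M.emeasure_eq_measure N.emeasure_eq_measure)
 qed
qed

lemma AE_T_interior: "AE t in T. 0 < t \<and> t < 1"
 unfolding AE_T using AE_lborel_singleton[of "0::real"] AE_lborel_singleton[of "1::real"] by eventually_elim auto

lemma test_integrable: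
 assumes \<psi>: "\<psi> \<in> test_functions A" and s: "s \<in> {0..1}" shows "integrable (\<mu> s) \<psi>"
proof -
 obtain B where B: "!!x. \<bar>\<psi> x\<bar> <= B" by (rule test_function_bounded[OF \<psi>]) (rule that, assumption+)
 interpret M: prob_space "\<mu> s" using probs[OF s] unfolding borel_probs_def by simp
 have "sets (\<mu> s) = sets borel" using probs[OF s] unfolding borel_probs_def by simp
 then have "\<psi> \<in> borel_measurable (\<mu> s)" using test_function_borel[OF \<psi>] measurable_cong_sets by blast
 then show ?thesis using B by (intro M.integrable_const_bound[of _ B]) simp_all
qed

lemma test_function_curve:
 assumes \<phi>: "\<phi> \<in> test_functions A"
 obtains L where "0 <= L" "continuous_on {0..1} (\<lambda>t. LINT x|\<mu> t. \<phi> x)"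
  "!!s t. 0 <= s ==> s <= t ==> t <= 1 ==> \<bar>(LINT x|\<mu> t. \<phi> x) - (LINT x|\<mu> s. \<phi> x)\<bar> <= (LINT y:{s..t}|lborel. L * f y)"
proof -
 obtain B where B: "!!x. \<bar>\<phi> x\<bar> <= B" by (rule test_function_bounded[OF \<phi>]) (rule that, assumption+)
 obtain L where L: "0 <= L" "!!x. slope_le \<phi> x L" by (rule slope_bounded[OF \<phi>]) (rule that, assumption+)
 note l = slope_lipschitz[OF \<phi> L]
 show thesis
  by (rule that[OF L(1) integral_continuous[OF test_function_borel[OF \<phi>] B L(1) l]
   integral_lipschitz[OF test_function_borel[OF \<phi>] B L(1) l]])
qed

end

section \<open>The velocity fields\<close>

lemma (in manifold) test_functions_zero: "(\<lambda>_. 0) \<in> test_functions A"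
proof -
 have "(\<lambda>_. 0) \<circ> chart_inv c = (\<lambda>_. 0 :: real)" for c :: "('a, 'n) chart" by (simp add: o_def)
 then show ?thesis unfolding test_functions_def Ck_function_def by simp
qed

locale finsler_curve_cells = finsler_curve A F p \<mu> f + finsler_cells A F C B r R
 for A :: "('a::{t2_space, second_countable_topology}, 'n::finite) chart set" and F p \<mu> f C B r R
begin

lemma dual:
 assumes m: "m \<in> borel_measurable borel" "!!t. 0 <= m t" "!!t. m t <= f t"
 shows "dual_setting T borel \<mu> G J m p q"
proof (rule dual_setting.intro[OF kernel], rule dual_setting_axioms.intro)
 show "m \<in> borel_measurable T" by (rule borel_T[OF m(1)])
 show "integrable T m"
 proof (rule Bochner_Integration.integrable_bound)
  show "integrable T f" unfolding integrable_T by (rule f_int)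
  show "AE t in T. norm (m t) <= norm (f t)" using m f0 by (intro AE_I2) simp
 qed (rule borel_T[OF m(1)])
 show "space (borel :: 'a measure) = UNIV" by simp
qed (rule pq G_meas J_meas G_ge G_cont G_0 J_self J_le m(2))+

text \<open>The continuity equation in frame components, with bounded Borel weights \<eta> and any
  integrable version u of the derivative. Taking \<eta> = 1 gives integrability of the pairing,
  smooth \<eta> the equation itself.\<close>

definition velocity_field :: "real => (real \<times> 'a => real ^ 'n) => bool" where
 "velocity_field \<sigma> v \<longleftrightarrow> (\<forall>\<phi>\<in>test_functions A. \<forall>\<eta>\<in>borel_measurable borel. \<forall>u\<in>borel_measurable borel. \<forall>b :: real.
   (\<forall>t\<in>{0..1}. \<bar>\<eta> t\<bar> <= b) --> set_integrable lborel {0..1} u -->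
   (AE t in lborel. 0 < t \<and> t < 1 --> ((\<lambda>s. LINT x|\<mu> s. \<phi> x) has_real_derivative u t) (at t)) -->
   integrable joint (\<lambda>z. (\<eta> (fst z) *\<^sub>R cov \<phi> (snd z)) \<bullet> v z) \<and>
   \<sigma> * (LINT t:{0..1}|lborel. \<eta> t * u t) = (LINT z|joint. (\<eta> (fst z) *\<^sub>R cov \<phi> (snd z)) \<bullet> v z))"

lemma velocity_exists:
 assumes \<sigma>: "\<sigma> = 1 \<or> \<sigma> = - 1"
  and m: "m \<in> borel_measurable borel" "!!t. 0 <= m t" "!!t. m t <= f t"
  and sp: "AE t in lborel. 0 < t \<and> t < 1 --> speed_at_most \<sigma> t (m t)"
 obtains v where "v \<in> borel_measurable (T \<Otimes>\<^sub>M borel)"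
  "velocity_field \<sigma> v"
  "AE t in T. (\<integral>\<^sup>+ x. ennreal (G x (v (t, x)) powr p) \<partial>\<mu> t) <= ennreal (m t powr p)"
proof -
 interpret D: dual_setting T borel \<mu> G J m p q by (rule dual[OF m])
 define adm where "adm h a \<psi> w \<longleftrightarrow> (\<forall>t. \<psi> t \<in> test_functions A) \<and> (\<forall>z. h z = cov (\<psi> (fst z)) (snd z)) \<and>
   integrable T w \<and> a = \<sigma> * (LINT t|T. w t) \<and>
   (AE t in T. ((\<lambda>s. LINT x|\<mu> s. \<psi> t x) has_real_derivative w t) (at t))" for h a \<psi> and w :: "real => real"
 define RR where "RR = {(h, a). h \<in> D.bounded_fields \<and> (\<exists>\<psi> w. adm h a \<psi> w)}"
 have lin: "((\<lambda>z. \<alpha> *\<^sub>R g z + \<beta> *\<^sub>R h z), \<alpha> * a + \<beta> * b) \<in> RR" if gh: "(g, a) \<in> RR" "(h, b) \<in> RR" for g h a b \<alpha> \<beta>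
 proof -
  obtain \<psi>1 w1 \<psi>2 w2 where 1: "adm g a \<psi>1 w1" and 2: "adm h b \<psi>2 w2"
   and bf: "g \<in> D.bounded_fields" "h \<in> D.bounded_fields" using gh unfolding RR_def by blast
  obtain K1 where K1: "g \<in> borel_measurable (T \<Otimes>\<^sub>M borel)" "!!t x. t \<in> space T ==> norm (g (t, x)) <= K1"
   by (rule D.bounded_fieldsE[OF bf(1)]) (rule that, assumption+)
  obtain K2 where K2: "h \<in> borel_measurable (T \<Otimes>\<^sub>M borel)" "!!t x. t \<in> space T ==> norm (h (t, x)) <= K2"
   by (rule D.bounded_fieldsE[OF bf(2)]) (rule that, assumption+)
  have "(\<lambda>z. \<alpha> *\<^sub>R g z + \<beta> *\<^sub>R h z) \<in> D.bounded_fields"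
  proof (rule D.bounded_fieldsI)
   show "(\<lambda>z. \<alpha> *\<^sub>R g z + \<beta> *\<^sub>R h z) \<in> borel_measurable (T \<Otimes>\<^sub>M borel)" using K1(1) K2(1) by measurable
   fix t x assume t: "t \<in> space T"
   have "norm (\<alpha> *\<^sub>R g (t, x) + \<beta> *\<^sub>R h (t, x)) <= norm (\<alpha> *\<^sub>R g (t, x)) + norm (\<beta> *\<^sub>R h (t, x))" by (rule norm_triangle_ineq)
   also have "\<dots> <= \<bar>\<alpha>\<bar> * K1 + \<bar>\<beta>\<bar> * K2"
    unfolding norm_scaleR by (intro add_mono mult_left_mono K1(2) K2(2) t abs_ge_zero)
   finally show "norm (\<alpha> *\<^sub>R g (t, x) + \<beta> *\<^sub>R h (t, x)) <= \<bar>\<alpha>\<bar> * K1 + \<bar>\<beta>\<bar> * K2" .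
  qed
  moreover have "adm (\<lambda>z. \<alpha> *\<^sub>R g z + \<beta> *\<^sub>R h z) (\<alpha> * a + \<beta> * b) (\<lambda>t x. \<alpha> * \<psi>1 t x + \<beta> * \<psi>2 t x) (\<lambda>t. \<alpha> * w1 t + \<beta> * w2 t)"
   unfolding adm_def
  proof (intro conjI allI)
   have \<psi>: "\<psi>1 t \<in> test_functions A" "\<psi>2 t \<in> test_functions A" for t using 1 2 unfolding adm_def by blast+
   show "(\<lambda>x. \<alpha> * \<psi>1 t x + \<beta> * \<psi>2 t x) \<in> test_functions A" for t
    by (rule test_functions_linear_combination[OF \<psi>])
   show "\<alpha> *\<^sub>R g z + \<beta> *\<^sub>R h z = cov (\<lambda>x. \<alpha> * \<psi>1 (fst z) x + \<beta> * \<psi>2 (fst z) x) (snd z)" for z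
   proof -
    have "g z = cov (\<psi>1 (fst z)) (snd z)" "h z = cov (\<psi>2 (fst z)) (snd z)" using 1 2 unfolding adm_def by blast+
    then show ?thesis unfolding cov_linear_combination[OF test_C1[OF \<psi>(1)] test_C1[OF \<psi>(2)]] by (simp only:)
   qed
   have w: "integrable T w1" "integrable T w2" using 1 2 unfolding adm_def by blast+
   then show "integrable T (\<lambda>t. \<alpha> * w1 t + \<beta> * w2 t)" by simp
   have "a = \<sigma> * (LINT t|T. w1 t)" "b = \<sigma> * (LINT t|T. w2 t)" using 1 2 unfolding adm_def by blast+
   then show "\<alpha> * a + \<beta> * b = \<sigma> * (LINT t|T. \<alpha> * w1 t + \<beta> * w2 t)" using w by (simp add: algebra_simps)
   have "AE t in T. ((\<lambda>s. LINT x|\<mu> s. \<psi>1 t x) has_real_derivative w1 t) (at t)"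
    "AE t in T. ((\<lambda>s. LINT x|\<mu> s. \<psi>2 t x) has_real_derivative w2 t) (at t)" using 1 2 unfolding adm_def by blast+
   then show "AE t in T. ((\<lambda>s. LINT x|\<mu> s. \<alpha> * \<psi>1 t x + \<beta> * \<psi>2 t x) has_real_derivative \<alpha> * w1 t + \<beta> * w2 t) (at t)"
    using AE_T_interior
   proof eventually_elim
    case (elim t)
    have "((\<lambda>s. \<alpha> * (LINT x|\<mu> s. \<psi>1 t x) + \<beta> * (LINT x|\<mu> s. \<psi>2 t x)) has_real_derivative \<alpha> * w1 t + \<beta> * w2 t) (at t)"
     by (intro DERIV_add DERIV_cmult elim)
    then show ?case
    proof (rule has_field_derivative_transform_within_open)
     show "t \<in> {0<..<1}" using elim by simp
     fix s :: real assume "s \<in> {0<..<1}"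
     then have s: "s \<in> {0..1}" by simp
     show "\<alpha> * (LINT x|\<mu> s. \<psi>1 t x) + \<beta> * (LINT x|\<mu> s. \<psi>2 t x) = (LINT x|\<mu> s. \<alpha> * \<psi>1 t x + \<beta> * \<psi>2 t x)"
      using test_integrable[OF \<psi>(1) s] test_integrable[OF \<psi>(2) s] by simp
    qed simp
   qed
  qed
  ultimately show ?thesis unfolding RR_def by blast
 qed
 have basic: "((\<lambda>z. \<eta> (fst z) *\<^sub>R cov \<phi> (snd z)), \<sigma> * (LINT t:{0..1}|lborel. \<eta> t * u t)) \<in> RR"
  if \<phi>: "\<phi> \<in> test_functions A" and \<eta>: "\<eta> \<in> borel_measurable borel" and b: "!!t. t \<in> {0..1} ==> \<bar>\<eta> t\<bar> <= b"
   and u: "u \<in> borel_measurable borel" "set_integrable lborel {0..1} u"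
   and D: "AE t in lborel. 0 < t \<and> t < 1 --> ((\<lambda>s. LINT x|\<mu> s. \<phi> x) has_real_derivative u t) (at t)"
  for \<phi> \<eta> u b
 proof -
  obtain K where K: "!!x. norm (cov \<phi> x) <= K" by (rule cov_bounded[OF \<phi>]) (rule that, assumption+)
  have C1: "Ck_function 1 A \<phi>" by (rule test_C1[OF \<phi>])
  have "(\<lambda>z. \<eta> (fst z) *\<^sub>R cov \<phi> (snd z)) \<in> D.bounded_fields"
  proof (rule D.bounded_fieldsI)
   have "(\<lambda>z. \<eta> (fst z)) \<in> borel_measurable (T \<Otimes>\<^sub>M (borel :: 'a measure))"
    by (rule measurable_compose[OF measurable_fst borel_T[OF \<eta>]])
   moreover have "(\<lambda>z. cov \<phi> (snd z)) \<in> borel_measurable (T \<Otimes>\<^sub>M borel)"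
    by (rule measurable_compose[OF measurable_snd cov_meas[OF C1]])
   ultimately show "(\<lambda>z. \<eta> (fst z) *\<^sub>R cov \<phi> (snd z)) \<in> borel_measurable (T \<Otimes>\<^sub>M borel)"
    by (rule borel_measurable_scaleR)
   fix t x assume "t \<in> space T"
   then have "\<bar>\<eta> t\<bar> <= b" using b by simp
   then show "norm (\<eta> (fst (t, x)) *\<^sub>R cov \<phi> (snd (t, x))) <= b * K"
    using K[of x] by (simp add: mult_mono)
  qed
  \<comment> \<open>The vanishing second summand brings the scaled test function into the form of
    the two-term closure lemmas for test functions and for \<open>cov\<close>.\<close>
  moreover have "adm (\<lambda>z. \<eta> (fst z) *\<^sub>R cov \<phi> (snd z)) (\<sigma> * (LINT t:{0..1}|lborel. \<eta> t * u t))
    (\<lambda>t x. \<eta> t * \<phi> x + 0 * \<phi> x) (\<lambda>t. \<eta> t * u t)"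
   unfolding adm_def
  proof (intro conjI allI)
   show "(\<lambda>x. \<eta> t * \<phi> x + 0 * \<phi> x) \<in> test_functions A" for t by (rule test_functions_linear_combination[OF \<phi> \<phi>])
   show "\<eta> (fst z) *\<^sub>R cov \<phi> (snd z) = cov (\<lambda>x. \<eta> (fst z) * \<phi> x + 0 * \<phi> x) (snd z)" for z
    unfolding cov_linear_combination[OF C1 C1] by simp
   show "integrable T (\<lambda>t. \<eta> t * u t)"
   proof (rule Bochner_Integration.integrable_bound)
    show "integrable T (\<lambda>t. b * u t)" using u(2) unfolding integrable_T by simp
    show "(\<lambda>t. \<eta> t * u t) \<in> borel_measurable T" using borel_T[OF \<eta>] borel_T[OF u(1)] by simp
    show "AE t in T. norm (\<eta> t * u t) <= norm (b * u t)"
    proof (rule AE_I2)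
     fix t assume "t \<in> space T"
     then have "\<bar>\<eta> t\<bar> <= \<bar>b\<bar>" using b[of t] by simp
     then show "norm (\<eta> t * u t) <= norm (b * u t)" by (simp add: abs_mult mult_right_mono)
    qed
   qed
   show "\<sigma> * (LINT t:{0..1}|lborel. \<eta> t * u t) = \<sigma> * (LINT t|T. \<eta> t * u t)" by (simp only: integral_T)
   have "AE t in T. 0 < t \<and> t < 1 --> ((\<lambda>s. LINT x|\<mu> s. \<phi> x) has_real_derivative u t) (at t)"
    unfolding AE_T using D by eventually_elim blast
   then show "AE t in T. ((\<lambda>s. LINT x|\<mu> s. \<eta> t * \<phi> x + 0 * \<phi> x) has_real_derivative \<eta> t * u t) (at t)"
    using AE_T_interior
   proof eventually_elim
    case (elim t)
    then have "((\<lambda>s. LINT x|\<mu> s. \<phi> x) has_real_derivative u t) (at t)" by blast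
    from DERIV_cmult[OF this, of "\<eta> t"] show ?case by simp
   qed
  qed
  ultimately show ?thesis unfolding RR_def by blast
 qed
 \<comment> \<open>The zero test function shows that \<open>RR\<close> is nonempty; the combination
   with coefficients 0 then lies in it.\<close>
 have zero: "((\<lambda>_. 0), 0) \<in> RR"
 proof -
  obtain g a where ga: "(g, a) \<in> RR"
   using basic[OF test_functions_zero, of "\<lambda>_. 0" 0 "\<lambda>_. 0"] by (auto simp: set_integrable_def)
  show ?thesis using lin[OF ga ga, of 0 0] by simp
 qed
 obtain v where v: "v \<in> borel_measurable (T \<Otimes>\<^sub>M borel)"
  "!!h a. (h, a) \<in> RR ==> integrable joint (\<lambda>z. h z \<bullet> v z)"
  "!!h a. (h, a) \<in> RR ==> a = (LINT z|joint. h z \<bullet> v z)"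
  "AE t in T. (\<integral>\<^sup>+ x. ennreal (G x (v (t, x)) powr p) \<partial>\<mu> t) <= ennreal (m t powr p)"
 proof (rule D.representation)
  show "((\<lambda>_. 0), 0) \<in> RR" by (rule zero)
  show "(h, a) \<in> RR ==> h \<in> D.bounded_fields" for h a unfolding RR_def by blast
  show "((\<lambda>z. g z + h z), a + b) \<in> RR" if gh: "(g, a) \<in> RR" "(h, b) \<in> RR" for g a h b
   using lin[OF gh, of 1 1] by simp
  show "((\<lambda>z. c *\<^sub>R g z), c * a) \<in> RR" if gh: "(g, a) \<in> RR" for g a c
   using lin[OF gh gh, of c 0] by simp
  show "a <= D.dual_norm h" if ha: "(h, a) \<in> RR" for h a
  proof -
   obtain \<psi> w where ad: "adm h a \<psi> w" and h: "h \<in> D.bounded_fields" using ha unfolding RR_def by blast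
   obtain K where K: "h \<in> borel_measurable (T \<Otimes>\<^sub>M borel)" "!!t x. t \<in> space T ==> norm (h (t, x)) <= K"
    by (rule D.bounded_fieldsE[OF h]) (rule that, assumption+)
   have \<psi>: "\<psi> t \<in> test_functions A" for t using ad unfolding adm_def by blast
   have hc: "h (t, x) = cov (\<psi> t) x" for t x using ad unfolding adm_def by simp
   have w: "integrable T w" "a = (LINT t|T. \<sigma> * w t)" using ad unfolding adm_def by simp_all
   have Dw: "AE t in T. ((\<lambda>s. LINT x|\<mu> s. \<psi> t x) has_real_derivative w t) (at t)" using ad unfolding adm_def by blast
   have spT: "AE t in T. 0 < t \<and> t < 1 --> speed_at_most \<sigma> t (m t)" unfolding AE_T using sp by eventually_elim blast
   show ?thesis unfolding w(2) D.dual_norm_def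
   proof (rule integral_mono_AE)
    show "integrable T (\<lambda>t. \<sigma> * w t)" using w(1) by simp
    show "integrable T (\<lambda>t. m t * Lnorm q (\<mu> t) (\<lambda>x. D.polar x (h (t, x))))" by (rule D.dual_norm_summand_integrable[OF h])
    show "AE t in T. \<sigma> * w t <= m t * Lnorm q (\<mu> t) (\<lambda>x. D.polar x (h (t, x)))"
     using Dw spT AE_T_interior
    proof eventually_elim
     case (elim t)
     then have t: "0 < t" "t < 1" "t \<in> space T" by simp_all
     have s: "sets (\<mu> t) = sets borel" using probs[of t] t unfolding borel_probs_def by simp
     show ?case
     proof (rule derivative_estimate[OF \<psi>[of t] t(1,2) _ m(2)])
      show "speed_at_most \<sigma> t (m t)" using elim t by blast
      show "((\<lambda>s. LINT x|\<mu> s. \<psi> t x) has_real_derivative w t) (at t)" using elim by blast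
      show "(\<lambda>x. D.polar x (h (t, x))) \<in> borel_measurable borel"
       using D.polar_section[OF K(1) t(3)] measurable_cong_sets[OF s refl] by blast
      show "0 <= D.polar x (h (t, x))" for x by (rule D.polar_nonneg)
      show "D.polar x (h (t, x)) <= K" for x by (rule order_trans[OF D.polar_le_norm K(2)[OF t(3)]])
      show "slope_le (\<psi> t) x (D.polar x (h (t, x)))" for x
       by (rule slope_cov[OF test_C1[OF \<psi>]]) (use D.polar_pairing[of "h (t, x)" _ x] hc[of t x] in simp)
     qed
    qed
   qed
  qed
 qed (rule that, assumption+)
 show thesis
 proof (rule that[OF v(1) _ v(4)])
  show "velocity_field \<sigma> v" unfolding velocity_field_def
  proof (intro ballI allI impI)
   fix \<phi> :: "'a => real" and \<eta> u :: "real => real" and b :: real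
   assume a: "\<phi> \<in> test_functions A" "\<eta> \<in> borel_measurable borel" "u \<in> borel_measurable borel"
    "\<forall>t\<in>{0..1}. \<bar>\<eta> t\<bar> <= b" "set_integrable lborel {0..1} u"
    "AE t in lborel. 0 < t \<and> t < 1 --> ((\<lambda>s. LINT x|\<mu> s. \<phi> x) has_real_derivative u t) (at t)"
   have "((\<lambda>z. \<eta> (fst z) *\<^sub>R cov \<phi> (snd z)), \<sigma> * (LINT t:{0..1}|lborel. \<eta> t * u t)) \<in> RR"
    by (rule basic[OF a(1,2) bspec[OF a(4)] a(3,5,6)])
   then show "integrable joint (\<lambda>z. (\<eta> (fst z) *\<^sub>R cov \<phi> (snd z)) \<bullet> v z) \<and>
    \<sigma> * (LINT t:{0..1}|lborel. \<eta> t * u t) = (LINT z|joint. (\<eta> (fst z) *\<^sub>R cov \<phi> (snd z)) \<bullet> v z)"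
    using v(2,3) by blast
  qed
 qed
qed

end

context finsler_curve_cells
begin

text \<open>\<open>N\<close> is the identity or \<open>tneg\<close> and undoes the sign in the
  field: \<open>V\<close> is the frame vector of \<sigma> v, so that \<sigma> \<sigma> = 1 yields
  the continuity equation, while the Finsler norm of \<open>N (V z)\<close> is that of v. The L^p
  bound comes from m <= f and the p-integrability of f.\<close>

lemma field_exists:
 assumes \<sigma>: "\<sigma> = 1 \<or> \<sigma> = - 1"
  and m: "m \<in> borel_measurable borel" "!!t. 0 <= m t" "!!t. m t <= f t"
  and sp: "AE t in lborel. 0 < t \<and> t < 1 --> speed_at_most \<sigma> t (m t)"
  and N: "!!x y. F (N (frame x (\<sigma> *\<^sub>R y))) = G x y"
 obtains V where "V \<in> vector_fields_along A \<mu>" "continuity_equation A \<mu> V"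
  "(\<integral>\<^sup>+ z. ennreal (F (N (V z)) powr p) \<partial>associated_measure \<mu>) < \<infinity>"
  "AE t in lborel. 0 < t \<and> t < 1 -->
    ennreal_powr (\<integral>\<^sup>+ x. ennreal (F (N (V (t, x))) powr p) \<partial>\<mu> t) (1 / p) <= ennreal (m t)"
proof -
 interpret D: dual_setting T borel \<mu> G J m p q by (rule dual[OF m])
 obtain v where vm: "v \<in> borel_measurable (T \<Otimes>\<^sub>M borel)" and
vf: "velocity_field \<sigma> v"
  and vp: "AE t in T. (\<integral>\<^sup>+ x. ennreal (G x (v (t, x)) powr p) \<partial>\<mu> t) <= ennreal (m t powr p)"
  by (rule velocity_exists[OF \<sigma> m sp]) (rule that, assumption+)
 note v = vf[unfolded velocity_field_def, rule_format]
 define V where "V z = frame (snd z) (\<sigma> *\<^sub>R v z)" for z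
 have FV: "F (N (V z)) = G (snd z) (v z)" for z unfolding V_def by (rule N)
 have Gm: "(\<lambda>z. ennreal (G (snd z) (v z) powr p)) \<in> borel_measurable (T \<Otimes>\<^sub>M borel)"
  using D.G_comp_meas[OF vm] by measurable
 show thesis
 proof (rule that)
  have "(\<lambda>z. \<sigma> *\<^sub>R v z) \<in> borel_measurable (T \<Otimes>\<^sub>M borel)" using vm by measurable
  then have "V \<in> T \<Otimes>\<^sub>M borel \<rightarrow>\<^sub>M tangent_borel A" unfolding V_def[abs_def] by (rule frame_measurable[OF measurable_snd])
  then have "V \<in> time_space_borel \<rightarrow>\<^sub>M tangent_borel A" using measurable_cong_sets[OF time_space_sets refl] by blast
  moreover have "AE (t, x) in associated_measure \<mu>. V (t, x) \<in> tangent_space A x"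
   by (rule AE_I2) (simp add: V_def frame_tangent case_prod_beta')
  ultimately show "V \<in> vector_fields_along A \<mu>" unfolding vector_fields_along_def by blast
  have "(\<integral>\<^sup>+ z. ennreal (F (N (V z)) powr p) \<partial>associated_measure \<mu>) = (\<integral>\<^sup>+ t. \<integral>\<^sup>+ x. ennreal (G x (v (t, x)) powr p) \<partial>\<mu> t \<partial>T)"
   unfolding associated_measure_joint FV by (subst nn_integral_joint[OF Gm]) simp
  also have "\<dots> <= (\<integral>\<^sup>+ t. ennreal (f t powr p) \<partial>T)"
  proof (rule nn_integral_mono_AE)
   show "AE t in T. (\<integral>\<^sup>+ x. ennreal (G x (v (t, x)) powr p) \<partial>\<mu> t) <= ennreal (f t powr p)" using vp
   proof eventually_elim
    case (elim t)
    have "m t powr p <= f t powr p" by (rule powr_mono2) (use p m in auto)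
    then show ?case by (intro order_trans[OF elim] ennreal_leI)
   qed
  qed
  also have "\<dots> < \<infinity>" unfolding nn_integral_T by (rule f_pint)
  finally show "(\<integral>\<^sup>+ z. ennreal (F (N (V z)) powr p) \<partial>associated_measure \<mu>) < \<infinity>" .
  have "AE t in lborel. t \<in> {0..1} --> (\<integral>\<^sup>+ x. ennreal (G x (v (t, x)) powr p) \<partial>\<mu> t) <= ennreal (m t powr p)"
   using vp unfolding AE_T .
  then show "AE t in lborel. 0 < t \<and> t < 1 -->
    ennreal_powr (\<integral>\<^sup>+ x. ennreal (F (N (V (t, x))) powr p) \<partial>\<mu> t) (1 / p) <= ennreal (m t)"
  proof (eventually_elim, intro impI)
   fix t :: real
   assume H: "t \<in> {0..1} --> (\<integral>\<^sup>+ x. ennreal (G x (v (t, x)) powr p) \<partial>\<mu> t) <= ennreal (m t powr p)" and t: "0 < t \<and> t < 1"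
   define I where "I = (\<integral>\<^sup>+ x. ennreal (F (N (V (t, x))) powr p) \<partial>\<mu> t)"
   have I: "I <= ennreal (m t powr p)" using H t unfolding I_def FV by simp
   then have fin: "I \<noteq> \<infinity>" using le_less_trans[OF I ennreal_less_top] by auto
   have "enn2real I <= m t powr p" using I by (intro enn2real_leI) simp_all
   then have "enn2real I powr (1 / p) <= (m t powr p) powr (1 / p)" using p by (intro powr_mono2) auto
   also have "\<dots> = m t" using p m(2)[of t] by (simp add: powr_powr)
   finally show "ennreal_powr I (1 / p) <= ennreal (m t)" unfolding ennreal_powr_def using fin by (simp add: ennreal_leI)
  qed
  show "continuity_equation A \<mu> V" unfolding continuity_equation_def
  proof (intro ballI)
   fix \<phi> assume \<phi>: "\<phi> \<in> test_functions A"
   let ?\<Phi> = "\<lambda>t. LINT x|\<mu> t. \<phi> x"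
   obtain L where L: "0 <= L" and cont: "continuous_on {0..1} ?\<Phi>"
    and inc: "!!s t. 0 <= s ==> s <= t ==> t <= 1 ==> \<bar>?\<Phi> t - ?\<Phi> s\<bar> <= (LINT y:{s..t}|lborel. L * f y)"
    by (rule test_function_curve[OF \<phi>]) (rule that, assumption+)
   have Lb: "(\<lambda>t. L * f t) \<in> borel_measurable borel" by measurable
   have L0: "0 <= L * f t" for t using L f0[of t] by simp
   have Li: "set_integrable lborel {0..1} (\<lambda>t. L * f t)" using f_int by simp
   obtain u where u: "u \<in> borel_measurable borel" "set_integrable lborel {0..1} u"
    and Du: "AE t in lborel. 0 < t \<and> t < 1 --> (?\<Phi> has_real_derivative u t) (at t)"
    by (rule absolutely_continuous_real_derivative[OF Lb L0 Li inc]) (assumption | (rule that; assumption))+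
   define g where "g z = cov \<phi> (snd z) \<bullet> v z" for z
   have pg: "pairing A (V (t, x)) \<phi> = \<sigma> * g (t, x)" for t x
    unfolding V_def g_def by (simp add: pairing_frame[OF test_C1[OF \<phi>]])
   have "integrable joint (\<lambda>z. ((\<lambda>_. 1 :: real) (fst z) *\<^sub>R cov \<phi> (snd z)) \<bullet> v z)"
    by (rule conjunct1[OF v[OF \<phi> _ u(1) _ u(2) Du, of "\<lambda>_. 1" 1]]) simp_all
   then have gi: "integrable joint g" unfolding g_def[abs_def] by simp
   note gj = integral_joint[OF gi]
   show "(AE t in lborel. 0 < t \<and> t < 1 --> integrable (\<mu> t) (\<lambda>x. pairing A (V (t, x)) \<phi>)) \<and>
    (\<forall>a b. 0 < a \<and> b < 1 --> set_integrable lborel {a..b} ?\<Phi>) \<and>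
    (\<forall>a b. 0 < a \<and> b < 1 --> set_integrable lborel {a..b} (\<lambda>t. LINT x|\<mu> t. pairing A (V (t, x)) \<phi>)) \<and>
    (\<forall>\<eta> :: real => real. smooth_on UNIV \<eta> \<and> (\<exists>a b. 0 < a \<and> b < 1 \<and> {t. \<eta> t \<noteq> 0} \<subseteq> {a..b}) -->
     - (LINT t:{0<..<1}|lborel. deriv \<eta> t * ?\<Phi> t) =
     (LINT t:{0<..<1}|lborel. \<eta> t * (LINT x|\<mu> t. pairing A (V (t, x)) \<phi>)))"
   proof (intro conjI allI impI)
    have "AE t in lborel. t \<in> {0..1} --> integrable (\<mu> t) (\<lambda>x. g (t, x))" using gj(1) unfolding AE_T .
    then show "AE t in lborel. 0 < t \<and> t < 1 --> integrable (\<mu> t) (\<lambda>x. pairing A (V (t, x)) \<phi>)"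
     unfolding pg by eventually_elim simp
   next
    fix a b :: real assume "0 < a \<and> b < 1"
    then have ab: "{a..b} \<subseteq> {0..1}" by auto
    show "set_integrable lborel {a..b} ?\<Phi>"
     by (rule borel_integrable_atLeastAtMost') (rule continuous_on_subset[OF cont ab])
    have "set_integrable lborel {0..1} (\<lambda>t. LINT x|\<mu> t. g (t, x))" using gj(2) unfolding integrable_T .
    then have "set_integrable lborel {a..b} (\<lambda>t. LINT x|\<mu> t. g (t, x))" by (rule set_integrable_subset) (use ab in simp_all)
    then show "set_integrable lborel {a..b} (\<lambda>t. LINT x|\<mu> t. pairing A (V (t, x)) \<phi>)" unfolding pg by simp
   next
    fix \<eta> :: "real => real"
    assume a: "smooth_on UNIV \<eta> \<and> (\<exists>a b. 0 < a \<and> b < 1 \<and> {t. \<eta> t \<noteq> 0} \<subseteq> {a..b})"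
    then obtain a b where ab: "0 < a" "b < 1" "{t. \<eta> t \<noteq> 0} \<subseteq> {a..b}" by blast
    have sm: "smooth_on UNIV \<eta>" using a by blast
    have \<eta>0: "\<eta> 0 = 0" "\<eta> 1 = 0" using ab by auto
    have \<eta>b: "\<eta> \<in> borel_measurable borel" by (rule borel_measurable_continuous_onI[OF smooth_real(2)[OF sm]])
    have "bounded (\<eta> ` {0..1})"
     by (intro compact_imp_bounded compact_continuous_image continuous_on_subset[OF smooth_real(2)[OF sm]] compact_Icc subset_UNIV)
    then obtain k where "\<forall>y\<in>\<eta> ` {0..1}. \<bar>y\<bar> <= k" unfolding bounded_real by blast
    then have k: "\<bar>\<eta> t\<bar> <= k" if "t \<in> {0..1}" for t using that by blast
    note vk = v[OF \<phi> \<eta>b u(1) k u(2) Du]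
    have \<sigma>2: "\<sigma> * \<sigma> = 1" using \<sigma> by auto
    have "- (LINT t:{0<..<1}|lborel. deriv \<eta> t * ?\<Phi> t) = (LINT t:{0..1}|lborel. \<eta> t * u t)"
     unfolding set_integral_Ioo_Icc by (rule integration_by_parts[OF Lb L0 Li inc cont u Du sm \<eta>0])
    also have "\<dots> = \<sigma> * (\<sigma> * (LINT t:{0..1}|lborel. \<eta> t * u t))" using \<sigma>2 by (simp add: mult.assoc[symmetric])
    also have "\<dots> = \<sigma> * (LINT z|joint. (\<eta> (fst z) *\<^sub>R cov \<phi> (snd z)) \<bullet> v z)" using conjunct2[OF vk] by (simp only:)
    also have "\<dots> = \<sigma> * (LINT t|T. LINT x|\<mu> t. \<eta> t * g (t, x))"
     using integral_joint(3)[OF conjunct1[OF vk]] by (simp add: g_def)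
    also have "\<dots> = (LINT t|T. \<eta> t * (LINT x|\<mu> t. \<sigma> * g (t, x)))" by (simp add: mult_ac)
    also have "\<dots> = (LINT t:{0<..<1}|lborel. \<eta> t * (LINT x|\<mu> t. pairing A (V (t, x)) \<phi>))"
     unfolding set_integral_Ioo_Icc integral_T pg ..
    finally show "- (LINT t:{0<..<1}|lborel. deriv \<eta> t * ?\<Phi> t) =
     (LINT t:{0<..<1}|lborel. \<eta> t * (LINT x|\<mu> t. pairing A (V (t, x)) \<phi>))" .
   qed
  qed
 qed
qed

lemma both_fields:
 "\<exists>vp vm. vp \<in> Lp_fields_plus A F p \<mu> \<and> vm \<in> Lp_fields_minus A F p \<mu> \<and>
  continuity_equation A \<mu> vp \<and> continuity_equation A \<mu> vm \<and>
  (AE t in lborel. 0 < t \<and> t < 1 -->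
    Lp_norm_plus F p (\<mu> t) (\<lambda>x. vp (t, x)) <= metric_deriv_plus A F p \<mu> t \<and>
    Lp_norm_minus F p (\<mu> t) (\<lambda>x. vm (t, x)) <= metric_deriv_minus A F p \<mu> t)"
proof -
 have N1: "F ((\<lambda>w. w) (frame x (1 *\<^sub>R y))) = G x y" for x y by (simp add: F_frame)
 have N2: "F (tneg (frame x (- 1 *\<^sub>R y))) = G x y" for x y by (simp add: tneg_frame F_frame)
 obtain m1 where m1: "m1 \<in> borel_measurable borel" "!!t. 0 <= m1 t" "!!t. m1 t <= f t"
  and d1: "AE t in lborel. 0 < t \<and> t < 1 --> metric_deriv_plus A F p \<mu> t = ennreal (m1 t)"
  and s1: "AE t in lborel. 0 < t \<and> t < 1 --> speed_at_most 1 t (m1 t)"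
  by (rule metric_speeds[of 1 "metric_deriv_plus A F p \<mu>"], simp) (rule that, assumption+)
 obtain m2 where m2: "m2 \<in> borel_measurable borel" "!!t. 0 <= m2 t" "!!t. m2 t <= f t"
  and d2: "AE t in lborel. 0 < t \<and> t < 1 --> metric_deriv_minus A F p \<mu> t = ennreal (m2 t)"
  and s2: "AE t in lborel. 0 < t \<and> t < 1 --> speed_at_most (- 1) t (m2 t)"
  by (rule metric_speeds[of "- 1" "metric_deriv_minus A F p \<mu>"], simp) (rule that, assumption+)
 obtain V1 where V1: "V1 \<in> vector_fields_along A \<mu>" "continuity_equation A \<mu> V1"
  "(\<integral>\<^sup>+ z. ennreal (F (V1 z) powr p) \<partial>associated_measure \<mu>) < \<infinity>"
  and n1: "AE t in lborel. 0 < t \<and> t < 1 -->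
    ennreal_powr (\<integral>\<^sup>+ x. ennreal (F (V1 (t, x)) powr p) \<partial>\<mu> t) (1 / p) <= ennreal (m1 t)"
  by (rule field_exists[OF disjI1[OF refl] m1 s1 N1]) (rule that, assumption+)
 obtain V2 where V2: "V2 \<in> vector_fields_along A \<mu>" "continuity_equation A \<mu> V2"
  "(\<integral>\<^sup>+ z. ennreal (F (tneg (V2 z)) powr p) \<partial>associated_measure \<mu>) < \<infinity>"
  and n2: "AE t in lborel. 0 < t \<and> t < 1 -->
    ennreal_powr (\<integral>\<^sup>+ x. ennreal (F (tneg (V2 (t, x))) powr p) \<partial>\<mu> t) (1 / p) <= ennreal (m2 t)"
  by (rule field_exists[OF disjI2[OF refl] m2 s2 N2]) (rule that, assumption+)
 have "AE t in lborel. 0 < t \<and> t < 1 -->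
    Lp_norm_plus F p (\<mu> t) (\<lambda>x. V1 (t, x)) <= metric_deriv_plus A F p \<mu> t \<and>
    Lp_norm_minus F p (\<mu> t) (\<lambda>x. V2 (t, x)) <= metric_deriv_minus A F p \<mu> t"
  unfolding Lp_norm_plus_def Lp_norm_minus_def using d1 d2 n1 n2 by eventually_elim simp
 moreover have "V1 \<in> Lp_fields_plus A F p \<mu>" "V2 \<in> Lp_fields_minus A F p \<mu>"
  unfolding Lp_fields_plus_def Lp_fields_minus_def using V1(1,3) V2(1,3) by simp_all
 ultimately show ?thesis using V1(2) V2(2) by blast
qed

end

theorem theorem4p15:
  fixes A :: "('a::{t2_space, second_countable_topology}, 'n::finite) chart set"
    and F :: "('a, 'n) tvec \<Rightarrow> real"
    and p :: real
    and star :: 'a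
    and \<mu> :: "real \<Rightarrow> 'a measure"
  assumes "finsler_manifold A F"
    and "forward_complete A F"
    and "1 < p"
    and "\<mu> \<in> AC_curves A F p star"
  shows "\<exists>vp vm. vp \<in> Lp_fields_plus A F p \<mu> \<and> vm \<in> Lp_fields_minus A F p \<mu> \<and>
    continuity_equation A \<mu> vp \<and> continuity_equation A \<mu> vm \<and>
    (AE t in lborel. 0 < t \<and> t < 1 \<longrightarrow>
       Lp_norm_plus F p (\<mu> t) (\<lambda>x. vp (t, x)) \<le> metric_deriv_plus A F p \<mu> t \<and>
       Lp_norm_minus F p (\<mu> t) (\<lambda>x. vm (t, x)) \<le> metric_deriv_minus A F p \<mu> t)"
proof -
 interpret finsler A F by (rule finsler.intro) (rule assms)
 obtain f where f: "f \<in> borel_measurable borel" "!!t. 0 <= f t" "set_integrable lborel {0..1} f"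
  "(\<integral>\<^sup>+ t\<in>{0..1}. ennreal (f t powr p) \<partial>lborel) < \<infinity>"
  "!!s t. 0 <= s ==> s <= t ==> t <= 1 ==> W p (\<mu> s) (\<mu> t) <= ennreal (LINT y:{s..t}|lborel. f y)"
  "!!s t. 0 <= s ==> s <= t ==> t <= 1 ==> W p (\<mu> t) (\<mu> s) <= ennreal (LINT y:{s..t}|lborel. f y)"
  by (rule AC_bound[OF assms(4,3)]) (rule that, assumption+)
 have probs: "\<mu> t \<in> borel_probs" if "t \<in> {0..1}" for t
  using assms(4) that unfolding AC_curves_def wasserstein_space_def by blast
 have 1: "finsler_curve A F p \<mu> f"
  by (rule finsler_curve.intro[OF finsler_axioms], rule finsler_curve_axioms.intro)
   (assumption | rule assms(3) probs f)+
 obtain C B r R where 2: "finsler_cells A F C B r R" using finsler_cells_exist by blast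
 interpret finsler_curve_cells A F p \<mu> f C B r R by (rule finsler_curve_cells.intro[OF 1 2])
 show ?thesis by (rule both_fields)
qed

end
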